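(* Let $T=1$ and let $g,\delta\colon\mathbb{R}\to\mathbb{R}$ be such that $g,\delta,g',\delta',g'',\delta''$ are Lipschitz continuous functions. Suppose additionally that $g$ is increasing (in the weak sense, i.e. non-decreasing) and not constant. Let $u$ be the unique weakly regular Markovian decoupling field on $[0,1]$ for the FBSDE (A). Then (a version of) the weak derivative $\frac{\mathrm{d}}{\mathrm{d}x^{(1)}}u$ is $\mathbb{R}\setminus\{0\}$-valued on $[0,1)\times\mathbb{R}^2$ and Lipschitz continuous in the first two components $(s,x^{(1)})$ on compact subsets of $[0,1)\times\mathbb{R}^2$.
   Context: Setting: $(\Omega,\mathcal{F},(\mathcal{F}_t)_{t\in[0,1]},\mathbb{P})$ is a complete filtered probability space, $W$ a one-dimensional Brownian motion on $[0,1]$ independent of $\mathcal{F}_0$, $\mathcal{F}_0$ contains all null sets and $\mathcal{F}_t=\sigma(\mathcal{F}_0,(W_s)_{s\in[0,t]})$. FBSDE (A): for $t\in[0,1]$ and $(x^{(1)},x^{(2)})\in\mathbb{R}^2$, $$X^{(1)}_s=x^{(1)}+\int_t^s1\,\mathrm{d}W_r,\quad X^{(2)}_s=x^{(2)}+\int_t^sZ_r^2\,\mathrm{d}r,\quad Y_s=g(X^{(1)}_1)-\delta(X^{(2)}_1)-\int_s^1Z_r\,\mathrm{d}W_r,\quad s\in[t,1].$$ A Markovian decoupling field for (A) on $[0,1]$ is a function $u\colon[0,1]\times\Omega\times\mathbb{R}^2\to\mathbb{R}$ with $u(1,\cdot,x)=g(x^{(1)})-\delta(x^{(2)})$ a.e.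 such that for all $0\le t_1\le t_2\le 1$ and every $\mathcal{F}_{t_1}$-measurable $\mathbb{R}^2$-valued initial value $(X^{(1)}_{t_1},X^{(2)}_{t_1})$ there are progressively measurable $X^{(1)},X^{(2)},Y,Z$ on $[t_1,t_2]$ with $\|Z\|_\infty<\infty$, $X^{(1)}_s=X^{(1)}_{t_1}+W_s-W_{t_1}$, $X^{(2)}_s=X^{(2)}_{t_1}+\int_{t_1}^sZ_r^2\,\mathrm{d}r$, $Y_s=Y_{t_2}-\int_s^{t_2}Z_r\,\mathrm{d}W_r$ and $Y_s=u(s,X^{(1)}_s,X^{(2)}_s)$ a.s. for all $s\in[t_1,t_2]$. It is weakly regular if $\sup_s\|u(s,\cdot,0)\|_\infty<\infty$ and it is Lipschitz continuous in $x$ uniformly in $(s,\omega)$ (up to modification). Decoupling fields are identified with their modifications. For Lipschitz $g,\delta$ there is exactly one weakly regular Markovian decoupling field $u$ on $[0,1]$, and it is deterministic and continuous, i.e. a continuous function $u(s,x^{(1)},x^{(2)})$. *)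

theory Defs
  imports "HOL-Probability.Probability"
begin

section \<open>The filtered probability space\<close>

text \<open>Only the values of \<open>F\<close> and \<open>W\<close> at times in \<open>[0,1]\<close> matter. Path continuity and
  \<open>W\<^sub>0 = 0\<close> are required almost surely. The assumption \<open>F_generated\<close> concerns the sets of
  \<open>F t\<close> only, because the measure carried by \<open>F t\<close> plays no role.\<close>

locale brownian_basis = prob_space M + complete_measure M for M :: "'a measure" +
  fixes F :: "real \<Rightarrow> 'a measure" and W :: "real \<Rightarrow> 'a \<Rightarrow> real"
  assumes F0_sub: "subalgebra M (F 0)"
    and F0_null: "null_sets M \<subseteq> sets (F 0)"
    and F_space: "\<And>t. t \<in> {0..1} \<Longrightarrow> space (F t) = space M"
    and F_generated: "\<And>t. t \<in> {0..1} \<Longrightarrow> sets (F t) =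
      sigma_sets (space M)
        (sets (F 0) \<union> (\<Union>s\<in>{0..t}. {W s -` A \<inter> space M | A. A \<in> sets borel}))"
    and W_measurable: "\<And>t. t \<in> {0..1} \<Longrightarrow> W t \<in> borel_measurable M"
    and W_zero: "AE \<omega> in M. W 0 \<omega> = 0"
    and W_continuous: "AE \<omega> in M. continuous_on {0..1} (\<lambda>t. W t \<omega>)"
    and W_normal: "\<And>s t. 0 \<le> s \<Longrightarrow> s < t \<Longrightarrow> t \<le> 1 \<Longrightarrow>
      distributed M lborel (\<lambda>\<omega>. W t \<omega> - W s \<omega>) (\<lambda>x. ennreal (normal_density 0 (sqrt (t - s)) x))"
    and W_indep_increments: "\<And>(n::nat) t. (\<And>i. i \<le> n \<Longrightarrow> t i \<in> {0..1}) \<Longrightarrow>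
      (\<And>i. i < n \<Longrightarrow> t i \<le> t (Suc i)) \<Longrightarrow>
      indep_vars (\<lambda>_. borel) (\<lambda>i \<omega>. W (t (Suc i)) \<omega> - W (t i) \<omega>) {..<n}"
    and W_indep_F0: "indep_set (sets (F 0))
      (sigma_sets (space M) (\<Union>s\<in>{0..1}. {W s -` A \<inter> space M | A. A \<in> sets borel}))"

definition progressively_measurable ::
    "(real \<Rightarrow> 'a measure) \<Rightarrow> real \<Rightarrow> real \<Rightarrow> (real \<Rightarrow> 'a \<Rightarrow> real) \<Rightarrow> bool" where
  "progressively_measurable F a b X \<longleftrightarrow>
    (\<forall>t\<in>{a..b}. (\<lambda>(r, \<omega>). X r \<omega>) \<in> borel_measurable (restrict_space borel {a..t} \<Otimes>\<^sub>M F t))"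

definition essentially_bounded ::
    "'a measure \<Rightarrow> real \<Rightarrow> real \<Rightarrow> (real \<Rightarrow> 'a \<Rightarrow> real) \<Rightarrow> bool" where
  "essentially_bounded M a b Z \<longleftrightarrow>
    (\<exists>C. AE (r, \<omega>) in restrict_space lborel {a..b} \<Otimes>\<^sub>M M. \<bar>Z r \<omega>\<bar> \<le> C)"


section \<open>The It\^o integral of square-integrable integrands\<close>

text \<open>A simple integrand on \<open>[a,b]\<close> is \<open>\<Sum>i<n. \<xi> i \<cdot> 1_(t i, t (i+1)]\<close> with a partition
  \<open>a = t 0 \<le> \<dots> \<le> t n = b\<close> and bounded \<open>F (t i)\<close>-measurable \<open>\<xi> i\<close>.\<close>

definition simple_integrand ::
    "(real \<Rightarrow> 'a measure) \<Rightarrow> real \<Rightarrow> real \<Rightarrow> nat \<Rightarrow> (nat \<Rightarrow> real) \<Rightarrow> (nat \<Rightarrow> 'a \<Rightarrow> real) \<Rightarrow> bool" where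
  "simple_integrand F a b n t \<xi> \<longleftrightarrow>
    t 0 = a \<and> t n = b \<and> (\<forall>i<n. t i \<le> t (Suc i)) \<and>
    (\<forall>i<n. \<xi> i \<in> borel_measurable (F (t i)) \<and> (\<exists>C. \<forall>\<omega>\<in>space (F (t i)). \<bar>\<xi> i \<omega>\<bar> \<le> C))"

definition simple_value ::
    "nat \<Rightarrow> (nat \<Rightarrow> real) \<Rightarrow> (nat \<Rightarrow> 'a \<Rightarrow> real) \<Rightarrow> real \<Rightarrow> 'a \<Rightarrow> real" where
  "simple_value n t \<xi> r \<omega> = (\<Sum>i<n. \<xi> i \<omega> * indicator {t i<..t (Suc i)} r)"

definition simple_integral ::
    "(real \<Rightarrow> 'a \<Rightarrow> real) \<Rightarrow> nat \<Rightarrow> (nat \<Rightarrow> real) \<Rightarrow> (nat \<Rightarrow> 'a \<Rightarrow> real) \<Rightarrow> 'a \<Rightarrow> real" where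
  "simple_integral W n t \<xi> \<omega> = (\<Sum>i<n. \<xi> i \<omega> * (W (t (Suc i)) \<omega> - W (t i) \<omega>))"

text \<open>\<open>has_ito_integral M F W a b Z J\<close>: the random variable \<open>J\<close> is a version of
  \<open>\<integral>\<^sub>a\<^sup>b Z\<^sub>r dW\<^sub>r\<close>, i.e. the \<open>L\<^sup>2(P)\<close>-limit of the integrals of simple integrands that converge to
  \<open>Z\<close> in \<open>L\<^sup>2(dr \<otimes> P)\<close>.\<close>

definition has_ito_integral ::
    "'a measure \<Rightarrow> (real \<Rightarrow> 'a measure) \<Rightarrow> (real \<Rightarrow> 'a \<Rightarrow> real) \<Rightarrow> real \<Rightarrow> real \<Rightarrow>
      (real \<Rightarrow> 'a \<Rightarrow> real) \<Rightarrow> ('a \<Rightarrow> real) \<Rightarrow> bool" where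
  "has_ito_integral M F W a b Z J \<longleftrightarrow>
    J \<in> borel_measurable M \<and>
    (\<exists>n t \<xi>. (\<forall>k::nat. simple_integrand F a b (n k) (t k) (\<xi> k)) \<and>
      (\<lambda>k. \<integral>\<^sup>+\<omega>. (\<integral>\<^sup>+r\<in>{a..b}. ennreal ((simple_value (n k) (t k) (\<xi> k) r \<omega> - Z r \<omega>)\<^sup>2) \<partial>lborel) \<partial>M)
        \<longlonglongrightarrow> 0 \<and>
      (\<lambda>k. \<integral>\<^sup>+\<omega>. ennreal ((simple_integral W (n k) (t k) (\<xi> k) \<omega> - J \<omega>)\<^sup>2) \<partial>M) \<longlonglongrightarrow> 0)"


section \<open>Markovian decoupling fields\<close>

text \<open>A random field is a function \<open>u\<close> of \<open>s\<close>, \<open>\<omega>\<close> and \<open>x = (x\<^sup>(\<^sup>1\<^sup>), x\<^sup>(\<^sup>2\<^sup>))\<close>.\<close>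

definition markovian_decoupling_field ::
    "'a measure \<Rightarrow> (real \<Rightarrow> 'a measure) \<Rightarrow> (real \<Rightarrow> 'a \<Rightarrow> real) \<Rightarrow> (real \<Rightarrow> real) \<Rightarrow> (real \<Rightarrow> real) \<Rightarrow>
      (real \<Rightarrow> 'a \<Rightarrow> real \<times> real \<Rightarrow> real) \<Rightarrow> bool" where
  "markovian_decoupling_field M F W g \<delta> u \<longleftrightarrow>
    (\<forall>x. AE \<omega> in M. u 1 \<omega> x = g (fst x) - \<delta> (snd x)) \<and>
    (\<forall>t1 t2 \<eta>. 0 \<le> t1 \<longrightarrow> t1 \<le> t2 \<longrightarrow> t2 \<le> 1 \<longrightarrow> \<eta> \<in> borel_measurable (F t1) \<longrightarrow>
      (\<exists>X1 X2 Y Z.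
        progressively_measurable F t1 t2 X1 \<and> progressively_measurable F t1 t2 X2 \<and>
        progressively_measurable F t1 t2 Y \<and> progressively_measurable F t1 t2 Z \<and>
        essentially_bounded M t1 t2 Z \<and>
        (\<forall>s\<in>{t1..t2}.
          (AE \<omega> in M. X1 s \<omega> = fst (\<eta> \<omega>) + (W s \<omega> - W t1 \<omega>)) \<and>
          (AE \<omega> in M. X2 s \<omega> = snd (\<eta> \<omega>) + (LINT r:{t1..s}|lborel. (Z r \<omega>)\<^sup>2)) \<and>
          (\<exists>J. has_ito_integral M F W s t2 Z J \<and> (AE \<omega> in M. Y s \<omega> = Y t2 \<omega> - J \<omega>)) \<and>
          (AE \<omega> in M. Y s \<omega> = u s \<omega> (X1 s \<omega>, X2 s \<omega>)))))"

text \<open>A modification of a field may differ from it, for each time \<open>s\<close>, on a null set of \<open>\<omega>\<close> that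
  does not depend on \<open>x\<close>. Being Lipschitz in \<open>x\<close> uniformly in \<open>(s, \<omega>)\<close> up to modification thus
  means: for each \<open>s\<close>, almost surely, with one constant \<open>L\<close>.\<close>

definition weakly_regular :: "'a measure \<Rightarrow> (real \<Rightarrow> 'a \<Rightarrow> real \<times> real \<Rightarrow> real) \<Rightarrow> bool" where
  "weakly_regular M u \<longleftrightarrow>
    (\<exists>C. \<forall>s\<in>{0..1}. AE \<omega> in M. \<bar>u s \<omega> (0, 0)\<bar> \<le> C) \<and>
    (\<exists>L. \<forall>s\<in>{0..1}. AE \<omega> in M. L-lipschitz_on UNIV (u s \<omega>))"


section \<open>Weak partial derivatives\<close>

primrec C_k :: "nat \<Rightarrow> ('a::euclidean_space \<Rightarrow> real) \<Rightarrow> bool" where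
  "C_k 0 f \<longleftrightarrow> continuous_on UNIV f"
| "C_k (Suc k) f \<longleftrightarrow>
    f differentiable_on UNIV \<and> (\<forall>i\<in>Basis. C_k k (\<lambda>x. frechet_derivative f (at x) i))"

definition test_function :: "('a::euclidean_space \<Rightarrow> real) \<Rightarrow> bool" where
  "test_function \<phi> \<longleftrightarrow> (\<forall>k. C_k k \<phi>) \<and> compact (closure {x. \<phi> x \<noteq> 0})"

text \<open>\<open>v\<close> is (a version of) the weak derivative of \<open>f\<close> in the direction of the basis vector \<open>i\<close>.
  Functions are locally integrable for the Lebesgue measure.\<close>

definition has_weak_partial ::
    "('a::euclidean_space \<Rightarrow> real) \<Rightarrow> 'a \<Rightarrow> ('a \<Rightarrow> real) \<Rightarrow> bool" where
  "has_weak_partial f i v \<longleftrightarrow>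
    (\<forall>K. compact K \<longrightarrow> f absolutely_integrable_on K \<and> v absolutely_integrable_on K) \<and>
    (\<forall>\<phi>. test_function \<phi> \<longrightarrow>
      (LINT x|lebesgue. f x * frechet_derivative \<phi> (at x) i) = - (LINT x|lebesgue. v x * \<phi> x))"

end

theory Submission
  imports Defs
begin

text \<open>The field \<open>u\<close> should solve \<open>\<partial>\<^sub>t u + u\<^sub>1\<^sub>1 / 2 + u\<^sub>2 u\<^sub>1\<^sup>2 = 0\<close>. Replacing the Brownian motion
  by a random walk with steps \<open>\<plusminus>\<epsilon>\<close>, \<open>\<epsilon>\<^sup>2 = 1 / n\<close>, turns the FBSDE into a backward recursion in which
  the gradient \<open>(p, q)\<close> and the second derivatives \<open>a, b, c\<close> of the value function are propagated by
  averages under a tilted two-point law. Hence \<open>p, q\<close> stay bounded by their terminal bound, and the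
  second derivatives are bounded, uniformly in \<open>n\<close>, with the help of the weight
  \<open>2 L\<^sup>2 + 1 - p\<^sup>2 - q\<^sup>2\<close>; their Lipschitz constants then satisfy a linear recursion. An energy estimate
  for the difference of the martingale parts shows that the scheme converges to every weakly regular
  decoupling field, so \<open>u\<close> inherits a derivative \<open>u\<^sub>1\<close> that is Lipschitz in space and time. It is
  positive because a square root of a lower bound for \<open>p\<close> evolves like a random walk average,
  up to a factor bounded away from \<open>0\<close>, and the walk reaches the region where \<open>g' > 0\<close>.\<close>

section \<open>Gradients and Lipschitz functions on the plane\<close>

text \<open>The obstacle is the quadratic generator: differentiating
  \<open>u\<^sub>2 u\<^sub>1\<^sup>2\<close> twice produces products of second derivatives, and a
  bound of Riccati type could blow up before time 0. The only favourable term is the variance of the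
  gradient, and the weight is there to bring it in; it lies between \<open>1\<close> and
  \<open>2 L\<^sup>2 + 1\<close>, since \<open>p\<^sup>2 + q\<^sup>2 \<le> 2 L\<^sup>2\<close>. The
  scheme is implicit in the second coordinate because the chain rule then gives the new gradient as
  an exact two-point average of the old one, with no remainder that would spoil the maximum
  principle. As \<open>g''\<close> and \<open>\<delta>''\<close> are merely Lipschitz, third
  derivatives are never formed; Lipschitz constants of the Hessian take their place. On the
  stochastic side \<open>Z\<close> comes with an unspecified bound, while comparing
  \<open>Z\<^sup>2\<close> with \<open>p\<^sup>2\<close> over all steps needs a uniform one. Hence
  \<open>|Z|\<close> is first bounded by the Lipschitz constant of the field, by an argument over
  short intervals that uses no differentiability of \<open>u\<close>. The derivative found in the
  limit is classical in the first coordinate and continuous, so it is also a weak one.\<close>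

type_synonym field2 = "real \<times> real \<Rightarrow> real"

definition grad2 :: "field2 \<Rightarrow> field2 \<Rightarrow> field2 \<Rightarrow> bool" where
  "grad2 F F1 F2 \<longleftrightarrow> (\<forall>x. (F has_derivative (\<lambda>v. F1 x * fst v + F2 x * snd v)) (at x))"

lemma grad2D: "grad2 F F1 F2 \<Longrightarrow> (F has_derivative (\<lambda>v. F1 x * fst v + F2 x * snd v)) (at x)"
  unfolding grad2_def by blast

lemma grad2_eqI: "grad2 F F1 F2 \<Longrightarrow> (\<And>x. F x = G x) \<Longrightarrow> (\<And>x. F1 x = G1 x) \<Longrightarrow> (\<And>x. F2 x = G2 x) \<Longrightarrow> grad2 G G1 G2"
  by (metis ext)

lemma grad2_const: "grad2 (\<lambda>x. k) (\<lambda>x. 0) (\<lambda>x. 0)"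
  by (simp add: grad2_def)

lemma grad2_add:
  "grad2 F F1 F2 \<Longrightarrow> grad2 G G1 G2 \<Longrightarrow>
    grad2 (\<lambda>x. F x + G x) (\<lambda>x. F1 x + G1 x) (\<lambda>x. F2 x + G2 x)"
  unfolding grad2_def
  by (auto intro!: derivative_eq_intros ext simp: algebra_simps)

lemma grad2_diff:
  "grad2 F F1 F2 \<Longrightarrow> grad2 G G1 G2 \<Longrightarrow>
    grad2 (\<lambda>x. F x - G x) (\<lambda>x. F1 x - G1 x) (\<lambda>x. F2 x - G2 x)"
  unfolding grad2_def
  by (auto intro!: derivative_eq_intros ext simp: algebra_simps)

lemma grad2_mult:
  "grad2 F F1 F2 \<Longrightarrow> grad2 G G1 G2 \<Longrightarrow>
    grad2 (\<lambda>x. F x * G x) (\<lambda>x. F1 x * G x + F x * G1 x) (\<lambda>x. F2 x * G x + F x * G2 x)"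
  unfolding grad2_def
  by (auto intro!: derivative_eq_intros ext simp: algebra_simps)

lemma grad2_cmult:
  "grad2 F F1 F2 \<Longrightarrow> grad2 (\<lambda>x. k * F x) (\<lambda>x. k * F1 x) (\<lambda>x. k * F2 x)"
  using grad2_mult[OF grad2_const[of k], of F F1 F2] by simp

lemma grad2_inverse:
  assumes "grad2 F F1 F2" "\<And>x. F x \<noteq> 0"
  shows "grad2 (\<lambda>x. 1 / F x) (\<lambda>x. - F1 x / (F x)\<^sup>2) (\<lambda>x. - F2 x / (F x)\<^sup>2)"
  unfolding grad2_def
proof
  fix x
  show "((\<lambda>x. 1 / F x) has_derivative (\<lambda>v. - F1 x / (F x)\<^sup>2 * fst v + - F2 x / (F x)\<^sup>2 * snd v)) (at x)"
    by (rule derivative_eq_intros grad2D[OF assms(1), where x=x] refl)+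
      (use assms(2)[of x] in \<open>simp_all add: field_simps power2_eq_square\<close>)
qed

lemma grad2_shift:
  assumes "grad2 F F1 F2"
  shows "grad2 (\<lambda>x. F (fst x + k, snd x)) (\<lambda>x. F1 (fst x + k, snd x)) (\<lambda>x. F2 (fst x + k, snd x))"
  unfolding grad2_def
proof
  fix x :: "real \<times> real"
  have "((\<lambda>x. (fst x + k, snd x)) has_derivative (\<lambda>v. (fst v, snd v))) (at x)"
    by (auto intro!: derivative_eq_intros)
  from has_derivative_compose[OF this grad2D[OF assms]]
  show "((\<lambda>x. F (fst x + k, snd x)) has_derivative
      (\<lambda>v. F1 (fst x + k, snd x) * fst v + F2 (fst x + k, snd x) * snd v)) (at x)"
    by simp
qed

lemma grad2_deriv1:
  assumes "grad2 F F1 F2"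
  shows "((\<lambda>t. F (t, y)) has_real_derivative F1 (t, y)) (at t)"
proof -
  have "((\<lambda>t. (t, y)) has_derivative (\<lambda>v. (v, 0))) (at t)"
    by (auto intro!: derivative_eq_intros)
  from has_derivative_compose[OF this grad2D[OF assms]]
  show ?thesis by (simp add: has_field_derivative_def)
qed

lemma grad2_deriv2:
  assumes "grad2 F F1 F2"
  shows "((\<lambda>t. F (x, t)) has_real_derivative F2 (x, t)) (at t)"
proof -
  have "((\<lambda>t. (x, t)) has_derivative (\<lambda>v. (0, v))) (at t)"
    by (auto intro!: derivative_eq_intros)
  from has_derivative_compose[OF this grad2D[OF assms]]
  show ?thesis by (simp add: has_field_derivative_def)
qed

lemma real_deriv_bound:
  fixes f :: "real \<Rightarrow> real"
  assumes "\<And>t. (f has_real_derivative f' t) (at t)" "\<And>t. \<bar>f' t\<bar> \<le> B"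
  shows "\<bar>f x - f y\<bar> \<le> B * \<bar>x - y\<bar>"
  using field_differentiable_bound[of UNIV f f' B x y] assms by (auto intro: has_field_derivative_at_within)

text \<open>The l1 distance splits along the axes: a common bound on both partial derivatives is
  then itself a Lipschitz constant, without a loss in each step of the recursion.\<close>

definition lip2 :: "real \<Rightarrow> field2 \<Rightarrow> bool" where
  "lip2 C F \<longleftrightarrow> (\<forall>x y. \<bar>F x - F y\<bar> \<le> C * (\<bar>fst x - fst y\<bar> + \<bar>snd x - snd y\<bar>))"

lemma lip2D: "lip2 C F \<Longrightarrow> \<bar>F x - F y\<bar> \<le> C * (\<bar>fst x - fst y\<bar> + \<bar>snd x - snd y\<bar>)"
  unfolding lip2_def by blast

lemma grad2_lip2:
  assumes "grad2 F F1 F2" "\<And>x. \<bar>F1 x\<bar> \<le> B" "\<And>x. \<bar>F2 x\<bar> \<le> B"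
  shows "lip2 B F"
  unfolding lip2_def
proof (intro allI)
  fix x y :: "real \<times> real"
  obtain x1 x2 y1 y2 where xy: "x = (x1, x2)" "y = (y1, y2)" by (metis surj_pair)
  have "\<bar>F (x1, x2) - F (y1, x2)\<bar> \<le> B * \<bar>x1 - y1\<bar>"
    by (rule real_deriv_bound[OF grad2_deriv1[OF assms(1)] assms(2)])
  moreover have "\<bar>F (y1, x2) - F (y1, y2)\<bar> \<le> B * \<bar>x2 - y2\<bar>"
    by (rule real_deriv_bound[OF grad2_deriv2[OF assms(1)] assms(3)])
  ultimately show "\<bar>F x - F y\<bar> \<le> B * (\<bar>fst x - fst y\<bar> + \<bar>snd x - snd y\<bar>)"
    unfolding xy by (simp add: distrib_left)
qed

lemma lip2_mono: "lip2 C F \<Longrightarrow> C \<le> D \<Longrightarrow> lip2 D F"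
  unfolding lip2_def by (meson abs_ge_zero add_nonneg_nonneg mult_right_mono order_trans)

lemma lip2_add: "lip2 C F \<Longrightarrow> lip2 D G \<Longrightarrow> lip2 (C + D) (\<lambda>x. F x + G x)"
  unfolding lip2_def
proof (intro allI)
  fix x y assume *: "\<forall>x y. \<bar>F x - F y\<bar> \<le> C * (\<bar>fst x - fst y\<bar> + \<bar>snd x - snd y\<bar>)"
    "\<forall>x y. \<bar>G x - G y\<bar> \<le> D * (\<bar>fst x - fst y\<bar> + \<bar>snd x - snd y\<bar>)"
  show "\<bar>F x + G x - (F y + G y)\<bar> \<le> (C + D) * (\<bar>fst x - fst y\<bar> + \<bar>snd x - snd y\<bar>)"
    unfolding distrib_right[of C D] using *[rule_format, of x y] by linarith
qed

lemma lip2_mult: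
  assumes "lip2 C F" "lip2 D G" "\<And>x. \<bar>F x\<bar> \<le> A" "\<And>x. \<bar>G x\<bar> \<le> B"
  shows "lip2 (A * D + B * C) (\<lambda>x. F x * G x)"
  unfolding lip2_def
proof (intro allI)
  fix x y :: "real \<times> real"
  let ?d = "\<bar>fst x - fst y\<bar> + \<bar>snd x - snd y\<bar>"
  have e: "F x * G x - F y * G y = F x * (G x - G y) + G y * (F x - F y)"
    by (simp add: algebra_simps)
  have "\<bar>F x * (G x - G y)\<bar> \<le> A * (D * ?d)"
    unfolding abs_mult using assms(3)[of x] lip2D[OF assms(2), of x y]
    by (intro mult_mono) auto
  moreover have "\<bar>G y * (F x - F y)\<bar> \<le> B * (C * ?d)"
    unfolding abs_mult using assms(4)[of y] lip2D[OF assms(1), of x y]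
    by (intro mult_mono) auto
  ultimately show "\<bar>F x * G x - F y * G y\<bar> \<le> (A * D + B * C) * ?d"
    unfolding e distrib_right[of "A * D"] mult.assoc by linarith
qed

section \<open>One step of the implicit binomial scheme\<close>

text \<open>The new value at \<open>x\<close> is the average of \<open>f\<close> over \<open>y\<^sub>1 \<plusminus> \<epsilon>\<close>, where \<open>y = \<Phi> x\<close> solves the implicit
  equation \<open>y\<^sub>1 = x\<^sub>1\<close>, \<open>y\<^sub>2 = x\<^sub>2 + \<epsilon>\<^sup>2 (z y)\<^sup>2\<close> of the forward component. Thus \<open>\<Phi>\<close> inverts \<open>\<Psi>\<close>, and \<open>\<kappa>\<close> is the
  Jacobian determinant of \<open>\<Psi>\<close>. With these definitions \<open>P \<circ> \<Phi>\<close>, \<open>Q \<circ> \<Phi>\<close> is the gradient of the new value and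
  \<open>A \<circ> \<Phi>\<close>, \<open>B \<circ> \<Phi>\<close>, \<open>C \<circ> \<Phi>\<close> are its second derivatives; \<open>tilt\<close> is the expectation under the weights
  \<open>(1 \<plusminus> \<theta>) / 2\<close>.\<close>

locale binomial_step =
  fixes f p q a b c :: field2 and \<epsilon> L :: real
  assumes gf: "grad2 f p q" and gp: "grad2 p a b" and gq: "grad2 q b c"
    and pL: "\<And>x. \<bar>p x\<bar> \<le> L" and qL: "\<And>x. \<bar>q x\<bar> \<le> L"
    and eps: "0 < \<epsilon>" and L1: "1 \<le> L" and small: "8 * \<epsilon> * L\<^sup>2 \<le> 1"
begin

definition avg :: "field2 \<Rightarrow> real \<times> real \<Rightarrow> real" where "avg F x = (F (fst x + \<epsilon>, snd x) + F (fst x - \<epsilon>, snd x)) / 2"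
definition dif :: "field2 \<Rightarrow> real \<times> real \<Rightarrow> real" where "dif F x = (F (fst x + \<epsilon>, snd x) - F (fst x - \<epsilon>, snd x)) / (2 * \<epsilon>)"

definition "z = dif f"
definition "\<kappa> x = 1 - 2 * \<epsilon>\<^sup>2 * z x * dif q x"
definition "Q x = avg q x / \<kappa> x"
definition "tilt F x = avg F x + 2 * \<epsilon>\<^sup>2 * z x * Q x * dif F x"
definition "P = tilt p"
definition "Q1 x = (tilt b x + 2 * \<epsilon>\<^sup>2 * Q x * dif p x * dif q x) / \<kappa> x"
definition "C x = (tilt c x + 2 * \<epsilon>\<^sup>2 * Q x * (dif q x)\<^sup>2) / (\<kappa> x)\<^sup>2"
definition "B x = Q1 x + 2 * \<epsilon>\<^sup>2 * z x * dif p x * C x"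
definition "A x = tilt a x + 2 * \<epsilon>\<^sup>2 * Q x * (dif p x)\<^sup>2 + 2 * \<epsilon>\<^sup>2 * z x * dif p x * (Q1 x + B x)"
definition "\<theta> x = 2 * \<epsilon> * z x * Q x"
definition "\<Psi> x = (fst x, snd x - \<epsilon>\<^sup>2 * (z x)\<^sup>2)" for x :: "real \<times> real"

lemma eps_le: "\<epsilon> * L\<^sup>2 \<le> 1/8" "\<epsilon> \<le> 1/8"
proof -
  show "\<epsilon> * L\<^sup>2 \<le> 1/8" using small by simp
  have "\<epsilon> * 1 \<le> \<epsilon> * L\<^sup>2" using eps L1 by (intro mult_left_mono) (auto simp: one_le_power)
  then show "\<epsilon> \<le> 1/8" using small by simp
qed

lemma grad2_avg: "grad2 F F1 F2 \<Longrightarrow> grad2 (avg F) (avg F1) (avg F2)"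
  by (rule grad2_eqI[OF grad2_cmult[OF grad2_add[OF grad2_shift[of F F1 F2 \<epsilon>] grad2_shift[of F F1 F2 "-\<epsilon>"]], of "1/2"]])
     (auto simp: avg_def)

lemma grad2_dif: "grad2 F F1 F2 \<Longrightarrow> grad2 (dif F) (dif F1) (dif F2)"
  by (rule grad2_eqI[OF grad2_cmult[OF grad2_diff[OF grad2_shift[of F F1 F2 \<epsilon>] grad2_shift[of F F1 F2 "-\<epsilon>"]], of "1/(2*\<epsilon>)"]])
     (auto simp: dif_def)

lemma grad2_z: "grad2 z (dif p) (dif q)"
  unfolding z_def by (rule grad2_dif[OF gf])

lemma dif_bound:
  assumes "grad2 F F1 F2" "\<And>x. \<bar>F1 x\<bar> \<le> M" shows "\<bar>dif F x\<bar> \<le> M"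
proof -
  have "\<bar>F (fst x + \<epsilon>, snd x) - F (fst x - \<epsilon>, snd x)\<bar> \<le> M * \<bar>(fst x + \<epsilon>) - (fst x - \<epsilon>)\<bar>"
    by (rule real_deriv_bound[OF grad2_deriv1[OF assms(1)] assms(2)])
  also have "\<dots> = M * (2 * \<epsilon>)" using eps by simp
  finally show ?thesis unfolding dif_def using eps by (simp add: abs_divide pos_divide_le_eq)
qed

lemma dif_bound': assumes "\<And>x. \<bar>F x\<bar> \<le> M" shows "\<bar>dif F x\<bar> \<le> M / \<epsilon>"
proof -
  have "\<bar>F (fst x + \<epsilon>, snd x) - F (fst x - \<epsilon>, snd x)\<bar> \<le> 2 * M"
    using assms[of "(fst x + \<epsilon>, snd x)"] assms[of "(fst x - \<epsilon>, snd x)"] by linarith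
  then show ?thesis unfolding dif_def using eps
    by (simp add: abs_divide pos_divide_le_eq) 
qed

lemma avg_bound: assumes "\<And>x. \<bar>F x\<bar> \<le> M" shows "\<bar>avg F x\<bar> \<le> M"
  using assms[of "(fst x + \<epsilon>, snd x)"] assms[of "(fst x - \<epsilon>, snd x)"] unfolding avg_def abs_le_iff by (auto simp: field_simps)

lemma z_bound: "\<bar>z x\<bar> \<le> L"
  unfolding z_def by (rule dif_bound[OF gf pL])

lemma eps_dif_bound: "\<epsilon> * \<bar>dif p x\<bar> \<le> L" "\<epsilon> * \<bar>dif q x\<bar> \<le> L"
  using dif_bound'[OF pL, where x=x] dif_bound'[OF qL, where x=x] eps by (auto simp: field_simps)

lemma kap_dev: "\<bar>\<kappa> x - 1\<bar> \<le> 2 * \<epsilon>\<^sup>2 * L * \<bar>dif q x\<bar>"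
proof -
  have "\<bar>\<kappa> x - 1\<bar> = 2 * \<epsilon>\<^sup>2 * (\<bar>z x\<bar> * \<bar>dif q x\<bar>)" by (simp add: \<kappa>_def abs_mult)
  also have "\<dots> \<le> 2 * \<epsilon>\<^sup>2 * (L * \<bar>dif q x\<bar>)"
    using z_bound by (intro mult_left_mono mult_right_mono) auto
  finally show ?thesis by simp
qed

text \<open>The product \<open>\<epsilon> |dif q|\<close> is half a difference of two values of
  \<open>q\<close>, hence at most \<open>L\<close> whatever the second derivatives do. So
  \<open>8 \<epsilon> L\<^sup>2 \<le> 1\<close> alone keeps \<open>\<Psi>\<close>
  invertible.\<close>

lemma kap_bounds: "\<bar>\<kappa> x - 1\<bar> \<le> 1/4" "3/4 \<le> \<kappa> x" "\<kappa> x \<le> 5/4" "0 < \<kappa> x"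
proof -
  have "2 * \<epsilon>\<^sup>2 * L * \<bar>dif q x\<bar> = 2 * \<epsilon> * L * (\<epsilon> * \<bar>dif q x\<bar>)" by (simp add: power2_eq_square)
  also have "\<dots> \<le> 2 * \<epsilon> * L * L" using eps_dif_bound(2) eps L1 by (intro mult_left_mono) auto
  also have "\<dots> \<le> 1/4" using small by (simp add: power2_eq_square)
  finally show "\<bar>\<kappa> x - 1\<bar> \<le> 1/4" using kap_dev[of x] by linarith
  then show "3/4 \<le> \<kappa> x" "\<kappa> x \<le> 5/4" "0 < \<kappa> x" by linarith+
qed

lemma kap_nz [simp]: "\<kappa> x \<noteq> 0" using kap_bounds(4)[of x] by simp

lemma theta_tilt: "tilt F x = (1 + \<theta> x) / 2 * F (fst x + \<epsilon>, snd x) + (1 - \<theta> x) / 2 * F (fst x - \<epsilon>, snd x)"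
proof -
  have "\<epsilon> * dif F x = (F (fst x + \<epsilon>, snd x) - F (fst x - \<epsilon>, snd x)) / 2"
    using eps by (simp add: dif_def)
  then have "2 * \<epsilon>\<^sup>2 * z x * Q x * dif F x = \<theta> x * ((F (fst x + \<epsilon>, snd x) - F (fst x - \<epsilon>, snd x)) / 2)"
    by (simp add: \<theta>_def power2_eq_square)
  then show ?thesis unfolding tilt_def avg_def by (simp add: algebra_simps add_divide_distrib diff_divide_distrib)
qed

text \<open>\<open>Q\<close> solves the linear equation
  \<open>Q = avg q + 2 \<epsilon>\<^sup>2 z (dif q) Q\<close>, whose right-hand side is the tilted
  average with \<open>\<theta>\<close> built from this same \<open>Q\<close>. The division by
  \<open>\<kappa>\<close> is thus absorbed into an average, which is what the maximum principle
  needs.\<close>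

lemma Q_tilt: "Q x = tilt q x"
proof -
  have "Q x * \<kappa> x = avg q x" by (simp add: Q_def)
  then show ?thesis by (simp add: tilt_def \<kappa>_def algebra_simps)
qed

text \<open>This breaks a circle: \<open>|Q| \<le> L\<close> requires \<open>tilt\<close> to be an
  average, which requires \<open>|\<theta>| \<le> 1\<close>. The crude bound
  \<open>|Q| \<le> 2 L\<close>, from \<open>\<kappa> \<ge> 3/4\<close>, is enough to start;
  \<open>Q_bound\<close> and \<open>theta_eps\<close> sharpen it afterwards.\<close>

lemma theta_bound: "\<bar>\<theta> x\<bar> \<le> 1/2"
proof -
  have "\<bar>Q x\<bar> \<le> L / (3/4)"
    unfolding Q_def abs_divide using avg_bound[OF qL, where x=x] kap_bounds[of x] L1
    by (intro frac_le) auto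
  then have "\<bar>Q x\<bar> \<le> 2 * L" using L1 by simp
  then have "\<bar>z x\<bar> * \<bar>Q x\<bar> \<le> L * (2 * L)"
    using z_bound[of x] L1 by (intro mult_mono) simp_all
  from mult_left_mono[OF this, of "2 * \<epsilon>"]
  have "\<bar>\<theta> x\<bar> \<le> 2 * \<epsilon> * (L * (2 * L))"
    using eps by (simp add: \<theta>_def abs_mult)
  then show ?thesis using small by (simp add: power2_eq_square)
qed

lemma tilt_bound: assumes "\<And>x. \<bar>F x\<bar> \<le> M" shows "\<bar>tilt F x\<bar> \<le> M"
proof -
  have "\<bar>(1 + \<theta> x) / 2 * F (fst x + \<epsilon>, snd x)\<bar> \<le> (1 + \<theta> x) / 2 * M"
    unfolding abs_mult using assms theta_bound[of x] by (intro mult_mono) auto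
  moreover have "\<bar>(1 - \<theta> x) / 2 * F (fst x - \<epsilon>, snd x)\<bar> \<le> (1 - \<theta> x) / 2 * M"
    unfolding abs_mult using assms theta_bound[of x] by (intro mult_mono) auto
  ultimately have "\<bar>tilt F x\<bar> \<le> (1 + \<theta> x) / 2 * M + (1 - \<theta> x) / 2 * M"
    unfolding theta_tilt by linarith
  also have "\<dots> = M" by (simp add: field_simps)
  finally show ?thesis .
qed

lemma Q_bound: "\<bar>Q x\<bar> \<le> L" unfolding Q_tilt by (rule tilt_bound[OF qL])
lemma P_bound: "\<bar>P x\<bar> \<le> L" unfolding P_def by (rule tilt_bound[OF pL])

lemma theta_eps: "\<bar>\<theta> x\<bar> \<le> 2 * \<epsilon> * L\<^sup>2"
proof -
  have "\<bar>z x\<bar> * \<bar>Q x\<bar> \<le> L * L"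
    using z_bound[of x] Q_bound[of x] L1 by (intro mult_mono) simp_all
  from mult_left_mono[OF this, of "2 * \<epsilon>"]
  have "\<bar>\<theta> x\<bar> \<le> 2 * \<epsilon> * (L * L)"
    using eps by (simp add: \<theta>_def abs_mult)
  then show ?thesis by (simp add: power2_eq_square)
qed

lemma grad2_kap: "grad2 \<kappa> (\<lambda>x. - 2 * \<epsilon>\<^sup>2 * (dif p x * dif q x + z x * dif b x))
    (\<lambda>x. - 2 * \<epsilon>\<^sup>2 * ((dif q x)\<^sup>2 + z x * dif c x))"
proof -
  have "grad2 (\<lambda>x. 1 - 2 * \<epsilon>\<^sup>2 * (z x * dif q x)) (\<lambda>x. 0 - 2 * \<epsilon>\<^sup>2 * (dif p x * dif q x + z x * dif b x))
      (\<lambda>x. 0 - 2 * \<epsilon>\<^sup>2 * (dif q x * dif q x + z x * dif c x))"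
    by (intro grad2_diff grad2_const grad2_cmult grad2_mult grad2_z grad2_dif gq)
  then show ?thesis
    by (rule grad2_eqI) (simp_all add: \<kappa>_def power2_eq_square)
qed


section \<open>The implicit map \<open>\<Phi>\<close> and the derivatives of the new value\<close>

definition "R x = \<epsilon>\<^sup>2 * (z x)\<^sup>2"

lemma grad2_R: "grad2 R (\<lambda>x. 2 * \<epsilon>\<^sup>2 * z x * dif p x) (\<lambda>x. 2 * \<epsilon>\<^sup>2 * z x * dif q x)"
proof -
  have "grad2 (\<lambda>x. \<epsilon>\<^sup>2 * (z x * z x)) (\<lambda>x. \<epsilon>\<^sup>2 * (dif p x * z x + z x * dif p x))
     (\<lambda>x. \<epsilon>\<^sup>2 * (dif q x * z x + z x * dif q x))"
    by (intro grad2_cmult grad2_mult grad2_z)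
  then show ?thesis
    by (rule grad2_eqI) (simp_all add: R_def power2_eq_square)
qed

lemma lip2_R:
  assumes "\<And>x. \<bar>dif p x\<bar> \<le> M" "\<And>x. \<bar>dif q x\<bar> \<le> M"
  shows "lip2 (2 * \<epsilon>\<^sup>2 * L * M) R"
proof (rule grad2_lip2[OF grad2_R])
  have *: "\<bar>2 * \<epsilon>\<^sup>2 * z x * d\<bar> \<le> 2 * \<epsilon>\<^sup>2 * L * M" if "\<bar>d\<bar> \<le> M" for x d
  proof -
    have "\<bar>z x\<bar> * \<bar>d\<bar> \<le> L * M" using z_bound[of x] that L1 by (intro mult_mono) auto
    from mult_left_mono[OF this, of "2 * \<epsilon>\<^sup>2"] show ?thesis by (simp add: abs_mult mult.assoc)
  qed
  show "\<bar>2 * \<epsilon>\<^sup>2 * z x * dif p x\<bar> \<le> 2 * \<epsilon>\<^sup>2 * L * M" for x by (rule *[OF assms(1)])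
  show "\<bar>2 * \<epsilon>\<^sup>2 * z x * dif q x\<bar> \<le> 2 * \<epsilon>\<^sup>2 * L * M" for x by (rule *[OF assms(2)])
qed

text \<open>Only \<open>\<epsilon> |dif p|, \<epsilon> |dif q| \<le> L\<close> enters, so
  \<open>\<Phi>\<close> exists by Banach's theorem before any bound on second derivatives is known.
  The constant of \<open>lip2_R\<close> is kept for the growth of Lipschitz constants, where the
  excess over 1 must be of order \<open>\<epsilon>\<^sup>2\<close>.\<close>

lemma lip2_R_quarter: "lip2 (1/4) R"
proof -
  have "lip2 (2 * \<epsilon>\<^sup>2 * L * (L / \<epsilon>)) R"
    by (rule lip2_R) (rule dif_bound'[OF pL], rule dif_bound'[OF qL])
  moreover have "2 * \<epsilon>\<^sup>2 * L * (L / \<epsilon>) = 2 * (\<epsilon> * L\<^sup>2)" using eps by (simp add: power2_eq_square)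
  ultimately show ?thesis using eps_le(1) by (auto elim: lip2_mono)
qed

lemma Phi_ex: "\<exists>!t. snd x + R (fst x, t) = t"
proof -
  have "\<forall>s t. dist (snd x + R (fst x, s)) (snd x + R (fst x, t)) \<le> 1/4 * dist s t"
    using lip2D[OF lip2_R_quarter, of "(fst x, s)" "(fst x, t)" for s t] by (simp add: dist_real_def)
  then show ?thesis by (rule banach_fix_type[rotated 2]) simp_all
qed

definition "\<Phi> x = (fst x, THE t. snd x + R (fst x, t) = t)"

lemma Phi_fst [simp]: "fst (\<Phi> x) = fst x" by (simp add: \<Phi>_def)

lemma Phi_snd: "snd (\<Phi> x) = snd x + R (\<Phi> x)"
  using theI'[OF Phi_ex[of x]] by (simp add: \<Phi>_def)

lemma Psi_Phi: "\<Psi> (\<Phi> x) = x"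
  using Phi_snd[of x] by (simp add: \<Psi>_def R_def)

lemma Phi_lip:
  assumes "lip2 r R" "0 \<le> r" "r \<le> 1/2"
  shows "\<bar>fst (\<Phi> x) - fst (\<Phi> y)\<bar> + \<bar>snd (\<Phi> x) - snd (\<Phi> y)\<bar> \<le> (1 + 2 * r) * (\<bar>fst x - fst y\<bar> + \<bar>snd x - snd y\<bar>)"
proof -
  let ?a = "\<bar>fst x - fst y\<bar>" let ?b = "\<bar>snd x - snd y\<bar>" let ?s = "\<bar>snd (\<Phi> x) - snd (\<Phi> y)\<bar>"
  have "?s \<le> ?b + \<bar>R (\<Phi> x) - R (\<Phi> y)\<bar>" using Phi_snd[of x] Phi_snd[of y] by linarith
  also have "\<bar>R (\<Phi> x) - R (\<Phi> y)\<bar> \<le> r * (?a + ?s)" using lip2D[OF assms(1), of "\<Phi> x" "\<Phi> y"] by simp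
  finally have 1: "?s * (1 - r) \<le> ?b + r * ?a" by (simp add: algebra_simps)
  have "?a + ?s = (?a * (1 - r) + ?s * (1 - r)) / (1 - r)" using assms by (simp add: field_simps)
  also have "\<dots> \<le> (?a + ?b) / (1 - r)" using 1 assms by (intro divide_right_mono) (auto simp: algebra_simps)
  also have "\<dots> = (1 / (1 - r)) * (?a + ?b)" by simp
  also have "\<dots> \<le> (1 + 2 * r) * (?a + ?b)"
  proof (rule mult_right_mono)
    have "0 \<le> r * (1 - 2 * r)" using assms by (intro mult_nonneg_nonneg) auto
    then show "1 / (1 - r) \<le> 1 + 2 * r" using assms by (simp add: pos_divide_le_eq algebra_simps)
  qed simp
  finally show ?thesis by simp
qed

lemma Phi_continuous: "continuous (at x) \<Phi>"
proof -
  have "dist (\<Phi> x) (\<Phi> y) \<le> 3 * dist x y" for x y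
  proof -
    have "dist (\<Phi> x) (\<Phi> y) \<le> \<bar>fst (\<Phi> x) - fst (\<Phi> y)\<bar> + \<bar>snd (\<Phi> x) - snd (\<Phi> y)\<bar>"
      unfolding dist_prod_def dist_real_def by (rule sqrt_sum_squares_le_sum_abs[THEN order_trans]) simp
    also have "\<dots> \<le> (1 + 2 * (1/4)) * (\<bar>fst x - fst y\<bar> + \<bar>snd x - snd y\<bar>)"
      by (rule Phi_lip[OF lip2_R_quarter]) auto
    also have "\<dots> \<le> (1 + 2 * (1/4)) * (dist x y + dist x y)"
      using dist_fst_le[of x y] dist_snd_le[of x y] unfolding dist_real_def
      by (intro mult_left_mono add_mono) auto
    finally show ?thesis by simp
  qed
  then have "3-lipschitz_on UNIV \<Phi>" by (intro lipschitz_onI) auto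
  from lipschitz_on_continuous_on[OF this] show ?thesis
    using continuous_on_eq_continuous_at[OF open_UNIV, of \<Phi>] by blast
qed

text \<open>The derivative of \<open>\<Psi>\<close> at \<open>\<Phi> x\<close> is triangular with
  determinant \<open>\<kappa>\<close>, and the claimed map is its explicit inverse. Continuity of
  \<open>\<Phi>\<close>, which the inverse rule asks for, comes from the contraction.\<close>

lemma Phi_deriv:
  "(\<Phi> has_derivative (\<lambda>v. (fst v, 2 * \<epsilon>\<^sup>2 * z (\<Phi> x) * dif p (\<Phi> x) / \<kappa> (\<Phi> x) * fst v + snd v / \<kappa> (\<Phi> x)))) (at x)"
proof (rule has_derivative_inverse_basic)
  let ?y = "\<Phi> x"
  have "(\<Psi> has_derivative (\<lambda>v. (fst v, snd v - (2 * \<epsilon>\<^sup>2 * z ?y * dif p ?y * fst v + 2 * \<epsilon>\<^sup>2 * z ?y * dif q ?y * snd v)))) (at ?y)"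
    unfolding \<Psi>_def[abs_def] R_def[symmetric]
    by (intro derivative_intros grad2D[OF grad2_R])
  also have "(\<lambda>v. (fst v, snd v - (2 * \<epsilon>\<^sup>2 * z ?y * dif p ?y * fst v + 2 * \<epsilon>\<^sup>2 * z ?y * dif q ?y * snd v)))
     = (\<lambda>v. (fst v, \<kappa> ?y * snd v - 2 * \<epsilon>\<^sup>2 * z ?y * dif p ?y * fst v))"
    by (simp add: \<kappa>_def algebra_simps)
  finally show "(\<Psi> has_derivative (\<lambda>v. (fst v, \<kappa> ?y * snd v - 2 * \<epsilon>\<^sup>2 * z ?y * dif p ?y * fst v))) (at ?y)" .
  show "bounded_linear (\<lambda>v. (fst v, 2 * \<epsilon>\<^sup>2 * z ?y * dif p ?y / \<kappa> ?y * fst v + snd v / \<kappa> ?y))"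
    by (intro bounded_linear_intros bounded_linear_Pair bounded_linear_compose[OF bounded_linear_divide])
  show "(\<lambda>v. (fst v, 2 * \<epsilon>\<^sup>2 * z ?y * dif p ?y / \<kappa> ?y * fst v + snd v / \<kappa> ?y)) \<circ>
     (\<lambda>v. (fst v, \<kappa> ?y * snd v - 2 * \<epsilon>\<^sup>2 * z ?y * dif p ?y * fst v)) = id"
    by (rule ext) (simp add: diff_divide_distrib)
  show "continuous (at x) \<Phi>" by (rule Phi_continuous)
  show "open (UNIV :: (real \<times> real) set)" by simp
qed (auto simp: Psi_Phi)

lemma grad2_Phi:
  assumes "grad2 F F1 F2"
  shows "grad2 (\<lambda>x. F (\<Phi> x)) (\<lambda>x. F1 (\<Phi> x) + F2 (\<Phi> x) * (2 * \<epsilon>\<^sup>2 * z (\<Phi> x) * dif p (\<Phi> x) / \<kappa> (\<Phi> x)))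
     (\<lambda>x. F2 (\<Phi> x) / \<kappa> (\<Phi> x))"
  unfolding grad2_def
proof
  fix x
  from has_derivative_compose[OF Phi_deriv[of x] grad2D[OF assms, of "\<Phi> x"]]
  show "((\<lambda>x. F (\<Phi> x)) has_derivative
          (\<lambda>v. (F1 (\<Phi> x) + F2 (\<Phi> x) * (2 * \<epsilon>\<^sup>2 * z (\<Phi> x) * dif p (\<Phi> x) / \<kappa> (\<Phi> x))) * fst v
             + F2 (\<Phi> x) / \<kappa> (\<Phi> x) * snd v)) (at x)"
    by (simp add: algebra_simps)
qed

text \<open>This dictates the form of \<open>Q1\<close> and \<open>C\<close>: the second partial is
  \<open>\<kappa> C\<close>, so that the factor \<open>1 / \<kappa>\<close> from
  \<open>\<Phi>\<close> leaves \<open>C\<close>, and the contribution of \<open>\<Phi>\<close> to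
  the first coordinate turns \<open>Q1\<close> into \<open>B\<close>.\<close>

lemma grad2_Q: "grad2 Q Q1 (\<lambda>x. \<kappa> x * C x)"
proof -
  have "grad2 (\<lambda>x. avg q x * (1 / \<kappa> x))
      (\<lambda>x. avg b x * (1 / \<kappa> x) + avg q x * (- (- 2 * \<epsilon>\<^sup>2 * (dif p x * dif q x + z x * dif b x)) / (\<kappa> x)\<^sup>2))
      (\<lambda>x. avg c x * (1 / \<kappa> x) + avg q x * (- (- 2 * \<epsilon>\<^sup>2 * ((dif q x)\<^sup>2 + z x * dif c x)) / (\<kappa> x)\<^sup>2))"
    by (intro grad2_mult grad2_avg gq grad2_inverse grad2_kap kap_nz)
  then show ?thesis
  proof (rule grad2_eqI)
    fix x
    \<comment> \<open>With \<open>avg q\<close> written as \<open>Q \<kappa>\<close>, the quotient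
      rule regroups into \<open>tilt\<close> terms.\<close>
    have aq: "avg q x = Q x * \<kappa> x" by (simp add: Q_def)
    show "avg q x * (1 / \<kappa> x) = Q x" by (simp add: Q_def)
    show "avg b x * (1 / \<kappa> x) + avg q x * (- (- 2 * \<epsilon>\<^sup>2 * (dif p x * dif q x + z x * dif b x)) / (\<kappa> x)\<^sup>2) = Q1 x"
      unfolding Q1_def tilt_def aq by (simp add: field_simps power2_eq_square)
    show "avg c x * (1 / \<kappa> x) + avg q x * (- (- 2 * \<epsilon>\<^sup>2 * ((dif q x)\<^sup>2 + z x * dif c x)) / (\<kappa> x)\<^sup>2) = \<kappa> x * C x"
      unfolding C_def tilt_def aq by (simp add: field_simps power2_eq_square)
  qed
qed

lemma kap_Q1: "\<kappa> x * Q1 x = tilt b x + 2 * \<epsilon>\<^sup>2 * Q x * dif p x * dif q x"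
  by (simp add: Q1_def)

text \<open>The first partial is \<open>A\<close> minus exactly the term that composition with
  \<open>\<Phi>\<close> adds back. The second is \<open>\<kappa> B\<close> with the same
  \<open>B\<close> that arises from \<open>Q\<close>, so the new mixed derivatives coincide and
  three functions describe the Hessian again.\<close>

lemma grad2_P: "grad2 P (\<lambda>x. A x - 2 * \<epsilon>\<^sup>2 * z x * dif p x * B x) (\<lambda>x. \<kappa> x * B x)"
proof -
  have "grad2 (\<lambda>x. avg p x + 2 * \<epsilon>\<^sup>2 * (z x * dif p x * Q x))
      (\<lambda>x. avg a x + 2 * \<epsilon>\<^sup>2 * ((dif p x * dif p x + z x * dif a x) * Q x + z x * dif p x * Q1 x))
      (\<lambda>x. avg b x + 2 * \<epsilon>\<^sup>2 * ((dif q x * dif p x + z x * dif b x) * Q x + z x * dif p x * (\<kappa> x * C x)))"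
    by (intro grad2_mult grad2_add grad2_cmult grad2_avg grad2_Q grad2_z grad2_dif gp)
  then show ?thesis
  proof (rule grad2_eqI)
    fix x
    show "avg p x + 2 * \<epsilon>\<^sup>2 * (z x * dif p x * Q x) = P x" by (simp add: P_def tilt_def)
    show "avg a x + 2 * \<epsilon>\<^sup>2 * ((dif p x * dif p x + z x * dif a x) * Q x + z x * dif p x * Q1 x)
        = A x - 2 * \<epsilon>\<^sup>2 * z x * dif p x * B x"
      unfolding A_def tilt_def by (simp add: algebra_simps power2_eq_square)
    have "\<kappa> x * B x = \<kappa> x * Q1 x + 2 * \<epsilon>\<^sup>2 * z x * dif p x * (\<kappa> x * C x)"
      unfolding B_def by (simp add: algebra_simps)
    then show "avg b x + 2 * \<epsilon>\<^sup>2 * ((dif q x * dif p x + z x * dif b x) * Q x + z x * dif p x * (\<kappa> x * C x))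
        = \<kappa> x * B x"
      unfolding kap_Q1 tilt_def by (simp add: algebra_simps)
  qed
qed

definition "nf x = avg f (\<Phi> x)"
definition "np x = P (\<Phi> x)"
definition "nq x = Q (\<Phi> x)"
definition "na x = A (\<Phi> x)"
definition "nb x = B (\<Phi> x)"
definition "nc x = C (\<Phi> x)"

lemma grad2_nf: "grad2 nf np nq"
proof (rule grad2_eqI[OF grad2_Phi[OF grad2_avg[OF gf]]])
  fix x
  show "avg p (\<Phi> x) + avg q (\<Phi> x) * (2 * \<epsilon>\<^sup>2 * z (\<Phi> x) * dif p (\<Phi> x) / \<kappa> (\<Phi> x)) = np x"
    by (simp add: np_def P_def tilt_def Q_def)
qed (auto simp: nf_def nq_def Q_def)

lemma grad2_np: "grad2 np na nb"
  by (rule grad2_eqI[OF grad2_Phi[OF grad2_P]]) (simp_all add: np_def na_def nb_def)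

lemma grad2_nq: "grad2 nq nb nc"
  by (rule grad2_eqI[OF grad2_Phi[OF grad2_Q]]) (simp_all add: nq_def nb_def nc_def B_def)

end

section \<open>Weighted bounds on the second derivatives and propagation of positivity\<close>

lemma amgm: "s * t \<le> s\<^sup>2 / 4 + (t::real)\<^sup>2"
  using zero_le_power2[of "s / 2 - t"] by (simp add: power2_diff power_divide)

context binomial_step
begin

lemma tilt_mono: assumes "\<And>x. F x \<le> G x" shows "tilt F x \<le> tilt G x"
  unfolding theta_tilt using assms theta_bound[of x]
  by (intro add_mono mult_left_mono) auto

text \<open>Second moment equals squared mean plus variance: the law with weights
  \<open>(1 \<plusminus> \<theta>) / 2\<close> on two values at distance
  \<open>2 \<epsilon> |dif F|\<close> has variance
  \<open>(1 - \<theta>\<^sup>2) \<epsilon>\<^sup>2 (dif F)\<^sup>2\<close>.\<close>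

lemma tilt_square: "tilt (\<lambda>x. (F x)\<^sup>2) x = (tilt F x)\<^sup>2 + (1 - (\<theta> x)\<^sup>2) * (\<epsilon>\<^sup>2 * (dif F x)\<^sup>2)"
proof -
  have e: "\<epsilon>\<^sup>2 * (dif F x)\<^sup>2 = ((F (fst x + \<epsilon>, snd x) - F (fst x - \<epsilon>, snd x)) / 2)\<^sup>2"
    unfolding power_mult_distrib[symmetric] using eps by (simp add: dif_def)
  show ?thesis unfolding e theta_tilt
    by (simp add: field_simps power2_eq_square)
qed

text \<open>Averaging is monotone, so the old weight may be averaged; its square terms give the new
  weight minus the variances of \<open>p\<close> and \<open>q\<close>. The factor \<open>3/4\<close>
  is \<open>1 - (1/2)\<^sup>2\<close>, from \<open>|\<theta>| \<le> 1/2\<close>.\<close>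

lemma barrier_tilt:
  assumes "\<And>x. \<bar>F x\<bar> \<le> E * (2 * L\<^sup>2 + 1 - (p x)\<^sup>2 - (q x)\<^sup>2)" "0 \<le> E"
  shows "\<bar>tilt F x\<bar> \<le> E * (2 * L\<^sup>2 + 1 - (P x)\<^sup>2 - (Q x)\<^sup>2) - 3/4 * (E * (\<epsilon>\<^sup>2 * ((dif p x)\<^sup>2 + (dif q x)\<^sup>2)))"
proof -
  let ?G = "\<lambda>x. E * (2 * L\<^sup>2 + 1 - (p x)\<^sup>2 - (q x)\<^sup>2)"
  let ?T = "\<epsilon>\<^sup>2 * ((dif p x)\<^sup>2 + (dif q x)\<^sup>2)"
  have "tilt F x \<le> tilt ?G x" using assms(1) by (intro tilt_mono) (simp add: abs_le_iff)
  moreover have "- tilt F x = tilt (\<lambda>x. - F x) x" by (simp add: theta_tilt field_simps)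
  moreover have "tilt (\<lambda>x. - F x) x \<le> tilt ?G x" using assms(1) by (intro tilt_mono) (simp add: abs_le_iff)
  moreover have "tilt ?G x = E * (2 * L\<^sup>2 + 1 - tilt (\<lambda>x. (p x)\<^sup>2) x - tilt (\<lambda>x. (q x)\<^sup>2) x)"
    unfolding theta_tilt by (simp add: field_simps)
  moreover have "\<dots> = E * (2 * L\<^sup>2 + 1 - (P x)\<^sup>2 - (Q x)\<^sup>2) - E * ((1 - (\<theta> x)\<^sup>2) * ?T)"
    unfolding tilt_square P_def Q_tilt by (simp add: algebra_simps)
  moreover have "E * (3/4 * ?T) \<le> E * ((1 - (\<theta> x)\<^sup>2) * ?T)"
  proof (intro mult_left_mono mult_right_mono)
    have "(\<theta> x)\<^sup>2 \<le> (1/2)\<^sup>2" using theta_bound[of x] by (simp add: abs_le_square_iff[symmetric])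
    then show "3/4 \<le> 1 - (\<theta> x)\<^sup>2" by (simp add: power2_eq_square)
  qed (use assms(2) in auto)
  ultimately show ?thesis by simp
qed

text \<open>Each inverse is needed in two forms: linear in \<open>|dif q|\<close> for the main term,
  where the excess is paid by the variance, and the constant \<open>2\<close> for terms that already
  carry \<open>\<epsilon>\<^sup>2\<close>.\<close>

lemma kap_inverse: "1 / \<kappa> x \<le> 1 + 4 * \<epsilon>\<^sup>2 * L * \<bar>dif q x\<bar>" "1 / \<kappa> x \<le> 2"
   "1 / (\<kappa> x)\<^sup>2 \<le> 1 + 8 * \<epsilon>\<^sup>2 * L * \<bar>dif q x\<bar>" "1 / (\<kappa> x)\<^sup>2 \<le> 2"
proof -
  define t where "t = \<bar>\<kappa> x - 1\<bar>"
  have t: "0 \<le> t" "t \<le> 1/4" "t \<le> 2 * \<epsilon>\<^sup>2 * L * \<bar>dif q x\<bar>" "1 - t \<le> \<kappa> x"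
    using kap_bounds(1)[of x] kap_dev[of x] by (auto simp: t_def)
  have 1: "1 / \<kappa> x \<le> 1 / (1 - t)" using t by (intro divide_left_mono) auto
  have "0 \<le> t * (1/4 - t)" using t by (intro mult_nonneg_nonneg) auto
  then have t2: "t * t \<le> t / 4" by (simp add: algebra_simps)
  have 2: "1 / (1 - t) \<le> 1 + 2 * t" using t t2 by (simp add: pos_divide_le_eq algebra_simps)
  show "1 / \<kappa> x \<le> 1 + 4 * \<epsilon>\<^sup>2 * L * \<bar>dif q x\<bar>" "1 / \<kappa> x \<le> 2" using 1 2 t by linarith+
  have "(1 / \<kappa> x)\<^sup>2 \<le> (1 + 4/3 * t)\<^sup>2"
  proof (rule power_mono)
    have "1 / (1 - t) \<le> 1 + 4/3 * t" using t t2 by (simp add: pos_divide_le_eq algebra_simps)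
    then show "1 / \<kappa> x \<le> 1 + 4/3 * t" using 1 by linarith
  qed (use kap_bounds(4)[of x] in simp)
  also have "\<dots> \<le> 1 + 4 * t" using t t2 by (simp add: power2_eq_square algebra_simps)
  finally have 3: "1 / (\<kappa> x)\<^sup>2 \<le> 1 + 4 * t" by (simp add: power_divide)
  then show "1 / (\<kappa> x)\<^sup>2 \<le> 1 + 8 * \<epsilon>\<^sup>2 * L * \<bar>dif q x\<bar>" "1 / (\<kappa> x)\<^sup>2 \<le> 2" using t by linarith+
qed

text \<open>The weight \<open>2 L\<^sup>2 + 1 - p\<^sup>2 - q\<^sup>2\<close> loses the conditional variance of \<open>(p, q)\<close> in
  every step; this absorbs the terms that are quadratic in the second derivatives.\<close>

lemma barrier_step:
  assumes "\<And>x. \<bar>a x\<bar> \<le> E * (2 * L\<^sup>2 + 1 - (p x)\<^sup>2 - (q x)\<^sup>2)"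
    "\<And>x. \<bar>b x\<bar> \<le> E * (2 * L\<^sup>2 + 1 - (p x)\<^sup>2 - (q x)\<^sup>2)"
    "\<And>x. \<bar>c x\<bar> \<le> E * (2 * L\<^sup>2 + 1 - (p x)\<^sup>2 - (q x)\<^sup>2)"
    and E: "32 * L ^ 3 \<le> E"
  defines "lam \<equiv> 196 * (L * (2 * L\<^sup>2 + 1))\<^sup>2"
  shows "\<bar>A x\<bar> \<le> E * (1 + lam * \<epsilon>\<^sup>2) * (2 * L\<^sup>2 + 1 - (P x)\<^sup>2 - (Q x)\<^sup>2)"
    "\<bar>B x\<bar> \<le> E * (1 + lam * \<epsilon>\<^sup>2) * (2 * L\<^sup>2 + 1 - (P x)\<^sup>2 - (Q x)\<^sup>2)"
    "\<bar>C x\<bar> \<le> E * (1 + lam * \<epsilon>\<^sup>2) * (2 * L\<^sup>2 + 1 - (P x)\<^sup>2 - (Q x)\<^sup>2)"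
proof -
  define W where "W = 2 * L\<^sup>2 + 1"
  define h where "h = \<epsilon>\<^sup>2"
  define wt where "wt = 2 * L\<^sup>2 + 1 - (P x)\<^sup>2 - (Q x)\<^sup>2"
  define s where "s = \<bar>dif p x\<bar>"
  define t where "t = \<bar>dif q x\<bar>"
  \<comment> \<open>The common bound on the tilted second derivatives: weight minus dissipation.
    Every excess term below must either fit into \<open>3/4 E h (s\<^sup>2 + t\<^sup>2)\<close> or
    be \<open>h E\<close> times a constant depending on \<open>L\<close> only.\<close>
  define m where "m = E * wt - 3/4 * (E * (h * (s\<^sup>2 + t\<^sup>2)))"
  have L3: "1 \<le> L ^ 3" "L \<le> L ^ 3" "0 \<le> L ^ 3"
    using L1 one_le_power[of L 3] power_increasing[of 1 3 L] by auto
  have E0: "0 \<le> E" "32 * L \<le> E" using E L3 by linarith+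
  have st: "0 \<le> s" "0 \<le> t" "0 \<le> h" by (auto simp: s_def t_def h_def)
  have W1: "1 \<le> W" by (simp add: W_def)
  have EW: "E \<le> E * W" using E0 W1 mult_left_mono[of 1 W E] by simp
  have sq: "(P x)\<^sup>2 \<le> L\<^sup>2" "(Q x)\<^sup>2 \<le> L\<^sup>2"
    using P_bound[of x] Q_bound[of x] L1 by (simp_all add: abs_le_square_iff[symmetric])
  have wt: "1 \<le> wt" "wt \<le> W" using sq zero_le_power2[of "P x"] zero_le_power2[of "Q x"]
    unfolding wt_def W_def by linarith+
  have ta: "\<bar>tilt a x\<bar> \<le> m" and tb: "\<bar>tilt b x\<bar> \<le> m" and tc: "\<bar>tilt c x\<bar> \<le> m"
    using barrier_tilt[OF assms(1) E0(1)] barrier_tilt[OF assms(2) E0(1)] barrier_tilt[OF assms(3) E0(1)]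
    by (simp_all add: m_def wt_def h_def s_def t_def)
  have m0: "0 \<le> m" using ta by linarith
  have "0 \<le> E * (h * (s\<^sup>2 + t\<^sup>2))" using E0 st by simp
  moreover have "E * wt \<le> E * W" using wt E0 by (intro mult_left_mono)
  ultimately have mW: "m \<le> E * W" unfolding m_def by linarith
  have hs: "h * s\<^sup>2 \<le> L\<^sup>2" "h * t\<^sup>2 \<le> L\<^sup>2" "h * (s * t) \<le> L\<^sup>2"
  proof -
    have *: "0 \<le> \<epsilon> * s" "\<epsilon> * s \<le> L" "0 \<le> \<epsilon> * t" "\<epsilon> * t \<le> L"
      using eps_dif_bound[of x] eps st by (auto simp: s_def t_def)
    then have "(\<epsilon> * s) * (\<epsilon> * s) \<le> L * L" "(\<epsilon> * t) * (\<epsilon> * t) \<le> L * L" "(\<epsilon> * s) * (\<epsilon> * t) \<le> L * L"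
      using L1 by (auto intro!: mult_mono)
    then show "h * s\<^sup>2 \<le> L\<^sup>2" "h * t\<^sup>2 \<le> L\<^sup>2" "h * (s * t) \<le> L\<^sup>2"
      by (simp_all add: h_def power2_eq_square mult_ac)
  qed
  have hLs: "2 * h * L * s \<le> 1/4"
  proof -
    have "2 * h * L * s = 2 * \<epsilon> * L * (\<epsilon> * s)" by (simp add: h_def power2_eq_square)
    also have "\<dots> \<le> 2 * \<epsilon> * L * L" using eps_dif_bound(1)[of x] eps L1
      unfolding s_def by (intro mult_left_mono) auto
    finally show ?thesis using small by (simp add: power2_eq_square)
  qed
  have Lh: "L * (h * s\<^sup>2) \<le> L ^ 3" "L * (h * t\<^sup>2) \<le> L ^ 3" "L * (h * (s * t)) \<le> L ^ 3"
    using hs[THEN mult_left_mono, of L] L1 by (auto simp: power3_eq_cube power2_eq_square mult.assoc)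
  \<comment> \<open>The purpose of the lower bound on \<open>E\<close>: the quadratic terms
    \<open>L h s\<^sup>2\<close> and \<open>L h t\<^sup>2\<close>, which carry no factor
    \<open>E\<close>, become a small share of the dissipation.\<close>
  have EVs: "32 * (L * (h * s\<^sup>2)) \<le> E * (h * s\<^sup>2)" "32 * (L * (h * t\<^sup>2)) \<le> E * (h * t\<^sup>2)"
    using E0(2) st mult_right_mono[of "32 * L" E "h * s\<^sup>2"] mult_right_mono[of "32 * L" E "h * t\<^sup>2"] by auto
  have nn: "0 \<le> E * (h * s\<^sup>2)" "0 \<le> E * (h * t\<^sup>2)" "0 \<le> L * (h * s\<^sup>2)" "0 \<le> L * (h * t\<^sup>2)"
    "0 \<le> L * (h * (s * t))"
    using E0 st L1 by simp_all
  have st_le: "2 * (L * (h * (s * t))) \<le> L * (h * s\<^sup>2) + L * (h * t\<^sup>2)"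
  proof -
    have "0 \<le> L * h * (s - t)\<^sup>2" using L1 st by simp
    then show ?thesis by (simp add: power2_eq_square algebra_simps)
  qed
  have zL: "\<bar>z x\<bar> \<le> L" "\<bar>Q x\<bar> \<le> L" by (rule z_bound, rule Q_bound)
  \<comment> \<open>A term linear in \<open>s\<close> or \<open>t\<close> costs a quarter of the
    dissipation plus a zero-order term in which its coefficient appears squared.\<close>
  have young: "h * (E * (k * (L * W) * r)) \<le> E * (h * r\<^sup>2) / 4 + h * (E * (k\<^sup>2 * (L * W)\<^sup>2))" for k r
  proof -
    have "r * (k * (L * W)) \<le> r\<^sup>2 / 4 + (k * (L * W))\<^sup>2" by (rule amgm)
    then have "h * E * (r * (k * (L * W))) \<le> h * E * (r\<^sup>2 / 4 + (k * (L * W))\<^sup>2)"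
      using st E0 by (intro mult_left_mono) auto
    then show ?thesis by (simp add: algebra_simps power_mult_distrib)
  qed
  \<comment> \<open>\<open>196 = 14\<^sup>2\<close> is the largest zero-order coefficient that
    occurs: \<open>8\<^sup>2\<close> for \<open>C\<close>, \<open>4\<^sup>2 + 6\<^sup>2\<close> for
    \<open>B\<close>, \<open>14\<^sup>2\<close> for \<open>A\<close>. As the weight is at least
    \<open>1\<close>, the zero-order term turns into growth of \<open>E\<close>.\<close>
  have fin: "y \<le> E * (1 + lam * \<epsilon>\<^sup>2) * wt" if "y \<le> E * wt + h * (E * (196 * (L * W)\<^sup>2))" for y
  proof -
    have "h * (E * (196 * (L * W)\<^sup>2)) * 1 \<le> h * (E * (196 * (L * W)\<^sup>2)) * wt"
      using wt st E0 by (intro mult_left_mono) auto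
    then show ?thesis using that unfolding lam_def h_def W_def by (simp add: algebra_simps)
  qed
  have mono196: "h * (E * (k * (L * W)\<^sup>2)) \<le> h * (E * (k' * (L * W)\<^sup>2))" if "k \<le> k'" for k k'
    using that st E0 by (intro mult_left_mono mult_right_mono) auto

  have dq2: "(dif q x)\<^sup>2 = t\<^sup>2" "(dif p x)\<^sup>2 = s\<^sup>2" by (auto simp: s_def t_def)
  have "\<bar>tilt c x + 2 * \<epsilon>\<^sup>2 * Q x * (dif q x)\<^sup>2\<bar> \<le> m + 2 * (L * (h * t\<^sup>2))"
  proof -
    have "\<bar>2 * \<epsilon>\<^sup>2 * Q x * (dif q x)\<^sup>2\<bar> \<le> 2 * (L * (h * t\<^sup>2))"
      using mult_right_mono[OF zL(2), of "h * t\<^sup>2"] st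
      by (simp add: abs_mult dq2 h_def mult_ac)
    then show ?thesis using tc by linarith
  qed
  then have "\<bar>C x\<bar> \<le> (m + 2 * (L * (h * t\<^sup>2))) / (\<kappa> x)\<^sup>2"
    unfolding C_def abs_divide by (simp add: divide_right_mono)
  also have "\<dots> = m * (1 / (\<kappa> x)\<^sup>2) + 2 * (L * (h * t\<^sup>2)) * (1 / (\<kappa> x)\<^sup>2)" by (simp add: add_divide_distrib)
  finally have C0: "\<bar>C x\<bar> \<le> m * (1 / (\<kappa> x)\<^sup>2) + 2 * (L * (h * t\<^sup>2)) * (1 / (\<kappa> x)\<^sup>2)" .
  have Ct: "2 * (L * (h * t\<^sup>2)) * (1 / (\<kappa> x)\<^sup>2) \<le> 2 * (L * (h * t\<^sup>2)) * 2"
    using kap_inverse(4)[of x] nn by (intro mult_left_mono) auto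
  have "m * (1 / (\<kappa> x)\<^sup>2) \<le> m * 2" using kap_inverse(4)[of x] m0 by (intro mult_left_mono) auto
  \<comment> \<open>A rough size of \<open>C\<close> is enough for its occurrence in
    \<open>B\<close>, where it is multiplied by \<open>2 \<epsilon>\<^sup>2 z (dif p)\<close>.
    \<open>QW\<close> and \<open>BW\<close> play the same part for \<open>A\<close>; the coefficient
    \<open>14\<close> there is \<open>2 (3 + 4)\<close>.\<close>
  then have CW: "\<bar>C x\<bar> \<le> 3 * (E * W)" using C0 Ct mW Lh E EW L3 by linarith
  have "m * (1 / (\<kappa> x)\<^sup>2) \<le> m * (1 + 8 * h * L * t)"
    using kap_inverse(3)[of x] m0 unfolding h_def t_def by (intro mult_left_mono) auto
  also have "\<dots> = m + m * (8 * h * L * t)" by (simp add: algebra_simps)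
  also have "m * (8 * h * L * t) \<le> E * W * (8 * h * L * t)" using mW st L1 by (intro mult_right_mono) auto
  also have "\<dots> = h * (E * (8 * (L * W) * t))" by (simp add: mult_ac)
  finally have "m * (1 / (\<kappa> x)\<^sup>2) \<le> m + h * (E * (8 * (L * W) * t))" by simp
  then have "\<bar>C x\<bar> \<le> m + E * (h * t\<^sup>2) / 4 + h * (E * (8\<^sup>2 * (L * W)\<^sup>2)) + 4 * (L * (h * t\<^sup>2))"
    using C0 Ct young[of 8 t] by linarith
  also have "\<dots> \<le> E * wt + h * (E * (196 * (L * W)\<^sup>2))"
    using EVs nn mono196[of "8\<^sup>2" 196] unfolding m_def by (simp add: distrib_left)
  finally show "\<bar>C x\<bar> \<le> E * (1 + lam * \<epsilon>\<^sup>2) * (2 * L\<^sup>2 + 1 - (P x)\<^sup>2 - (Q x)\<^sup>2)"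
    unfolding wt_def[symmetric] by (rule fin)

  have "\<bar>tilt b x + 2 * \<epsilon>\<^sup>2 * Q x * dif p x * dif q x\<bar> \<le> m + 2 * (L * (h * (s * t)))"
  proof -
    have "\<bar>2 * \<epsilon>\<^sup>2 * Q x * dif p x * dif q x\<bar> \<le> 2 * (L * (h * (s * t)))"
      using mult_right_mono[OF zL(2), of "h * (s * t)"] st
      by (simp add: abs_mult h_def s_def t_def mult_ac)
    then show ?thesis using tb by linarith
  qed
  then have "\<bar>Q1 x\<bar> \<le> (m + 2 * (L * (h * (s * t)))) / \<kappa> x"
    unfolding Q1_def abs_divide using kap_bounds(4)[of x] by (simp add: divide_right_mono)
  also have "\<dots> = m * (1 / \<kappa> x) + 2 * (L * (h * (s * t))) * (1 / \<kappa> x)" by (simp add: add_divide_distrib)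
  finally have Q0: "\<bar>Q1 x\<bar> \<le> m * (1 / \<kappa> x) + 2 * (L * (h * (s * t))) * (1 / \<kappa> x)" .
  have Qt: "2 * (L * (h * (s * t))) * (1 / \<kappa> x) \<le> 2 * (L * (h * (s * t))) * 2"
    using kap_inverse(2)[of x] nn by (intro mult_left_mono) auto
  have "m * (1 / \<kappa> x) \<le> m * 2" using kap_inverse(2)[of x] m0 by (intro mult_left_mono) auto
  then have QW: "\<bar>Q1 x\<bar> \<le> 3 * (E * W)" using Q0 Qt mW Lh E EW L3 by linarith
  have "m * (1 / \<kappa> x) \<le> m * (1 + 4 * h * L * t)"
    using kap_inverse(1)[of x] m0 unfolding h_def t_def by (intro mult_left_mono) auto
  also have "\<dots> = m + m * (4 * h * L * t)" by (simp add: algebra_simps)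
  also have "m * (4 * h * L * t) \<le> E * W * (4 * h * L * t)" using mW st L1 by (intro mult_right_mono) auto
  also have "\<dots> = h * (E * (4 * (L * W) * t))" by (simp add: mult_ac)
  finally have Q2: "\<bar>Q1 x\<bar> \<le> m + h * (E * (4 * (L * W) * t)) + 4 * (L * (h * (s * t)))"
    using Q0 Qt by linarith
  have zs: "\<bar>2 * \<epsilon>\<^sup>2 * z x * dif p x * y\<bar> \<le> h * (E * (2 * k * (L * W) * s))" "\<bar>2 * \<epsilon>\<^sup>2 * z x * dif p x * y\<bar> \<le> k * (E * W) / 4"
    if "\<bar>y\<bar> \<le> k * (E * W)" for y k
  proof -
    have "\<bar>z x\<bar> * \<bar>y\<bar> \<le> L * (k * (E * W))" using that zL L1 by (intro mult_mono) auto
    from mult_left_mono[OF this, of "2 * h * s"]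
    have 1: "\<bar>2 * \<epsilon>\<^sup>2 * z x * dif p x * y\<bar> \<le> 2 * h * s * (L * (k * (E * W)))"
      using st by (simp add: abs_mult h_def s_def mult_ac)
    then show "\<bar>2 * \<epsilon>\<^sup>2 * z x * dif p x * y\<bar> \<le> h * (E * (2 * k * (L * W) * s))"
      by (simp add: mult_ac)
    have "0 \<le> k * (E * W)" using that by linarith
    from mult_right_mono[OF hLs this] 1
    show "\<bar>2 * \<epsilon>\<^sup>2 * z x * dif p x * y\<bar> \<le> k * (E * W) / 4" by (simp add: mult_ac)
  qed
  have BW: "\<bar>B x\<bar> \<le> 4 * (E * W)"
    using zs(2)[OF CW] QW abs_triangle_ineq[of "Q1 x" "2 * \<epsilon>\<^sup>2 * z x * dif p x * C x"] unfolding B_def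
    using EW E0 by linarith
  have "\<bar>B x\<bar> \<le> \<bar>Q1 x\<bar> + h * (E * (6 * (L * W) * s))"
    using zs(1)[OF CW] abs_triangle_ineq[of "Q1 x" "2 * \<epsilon>\<^sup>2 * z x * dif p x * C x"] unfolding B_def
    by simp
  then have "\<bar>B x\<bar> \<le> m + 4 * (L * (h * (s * t))) + E * (h * t\<^sup>2) / 4 + E * (h * s\<^sup>2) / 4
      + h * (E * (4\<^sup>2 * (L * W)\<^sup>2)) + h * (E * (6\<^sup>2 * (L * W)\<^sup>2))"
    using Q2 young[of 4 t] young[of 6 s] by linarith
  moreover have "h * (E * (4\<^sup>2 * (L * W)\<^sup>2)) + h * (E * (6\<^sup>2 * (L * W)\<^sup>2)) = h * (E * (52 * (L * W)\<^sup>2))"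
    by (simp add: algebra_simps)
  ultimately have B1: "\<bar>B x\<bar> \<le> m + 4 * (L * (h * (s * t))) + E * (h * t\<^sup>2) / 4 + E * (h * s\<^sup>2) / 4
      + h * (E * (52 * (L * W)\<^sup>2))" by linarith
  have "\<bar>B x\<bar> \<le> E * wt + h * (E * (196 * (L * W)\<^sup>2))"
    using B1 EVs nn st_le mono196[of 52 196] unfolding m_def distrib_left by linarith
  then show "\<bar>B x\<bar> \<le> E * (1 + lam * \<epsilon>\<^sup>2) * (2 * L\<^sup>2 + 1 - (P x)\<^sup>2 - (Q x)\<^sup>2)"
    unfolding wt_def[symmetric] by (rule fin)

  have "\<bar>2 * \<epsilon>\<^sup>2 * Q x * (dif p x)\<^sup>2\<bar> \<le> 2 * (L * (h * s\<^sup>2))"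
    using mult_right_mono[OF zL(2), of "h * s\<^sup>2"] st by (simp add: abs_mult dq2 h_def mult_ac)
  moreover have "\<bar>Q1 x + B x\<bar> \<le> 7 * (E * W)" using QW BW by linarith
  note zs(1)[OF this]
  ultimately have "\<bar>A x\<bar> \<le> m + 2 * (L * (h * s\<^sup>2)) + h * (E * (14 * (L * W) * s))"
    using ta unfolding A_def by simp
  then have "\<bar>A x\<bar> \<le> m + 2 * (L * (h * s\<^sup>2)) + E * (h * s\<^sup>2) / 4 + h * (E * (14\<^sup>2 * (L * W)\<^sup>2))"
    using young[of 14 s] by linarith
  then have "\<bar>A x\<bar> \<le> E * wt + h * (E * (196 * (L * W)\<^sup>2))"
    using EVs nn unfolding m_def distrib_left by simp
  then show "\<bar>A x\<bar> \<le> E * (1 + lam * \<epsilon>\<^sup>2) * (2 * L\<^sup>2 + 1 - (P x)\<^sup>2 - (Q x)\<^sup>2)"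
    unfolding wt_def[symmetric] by (rule fin)
qed

text \<open>By Cauchy-Schwarz the tilt costs only the factor \<open>1 - \<theta>\<^sup>2\<close> when the square root of the lower
  bound is averaged.\<close>

lemma positivity_step:
  assumes "\<And>x. k * (N (fst x))\<^sup>2 \<le> p x" "0 \<le> k"
  shows "k * (1 - 4 * L ^ 4 * \<epsilon>\<^sup>2) * ((N (fst x + \<epsilon>) + N (fst x - \<epsilon>)) / 2)\<^sup>2 \<le> np x"
proof -
  let ?y = "\<Phi> x" let ?n = "N (fst x + \<epsilon>)" let ?m = "N (fst x - \<epsilon>)"
  let ?t = "\<theta> ?y"
  have "0 \<le> (((1 + ?t) * ?n - (1 - ?t) * ?m) / 2)\<^sup>2" by simp
  then have 1: "(1 - ?t\<^sup>2) * ((?n + ?m) / 2)\<^sup>2 \<le> (1 + ?t) / 2 * ?n\<^sup>2 + (1 - ?t) / 2 * ?m\<^sup>2"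
    by (simp add: power2_eq_square field_simps)
  have "?t\<^sup>2 \<le> (2 * \<epsilon> * L\<^sup>2)\<^sup>2"
    using theta_eps[of ?y] eps by (intro abs_le_square_iff[THEN iffD1]) auto
  then have "(1 - 4 * L ^ 4 * \<epsilon>\<^sup>2) * ((?n + ?m) / 2)\<^sup>2 \<le> (1 - ?t\<^sup>2) * ((?n + ?m) / 2)\<^sup>2"
    by (intro mult_right_mono) (auto simp: power_mult_distrib mult_ac)
  with 1 have "(1 - 4 * L ^ 4 * \<epsilon>\<^sup>2) * ((?n + ?m) / 2)\<^sup>2 \<le> (1 + ?t) / 2 * ?n\<^sup>2 + (1 - ?t) / 2 * ?m\<^sup>2"
    by linarith
  from mult_left_mono[OF this assms(2)]
  have "k * (1 - 4 * L ^ 4 * \<epsilon>\<^sup>2) * ((?n + ?m) / 2)\<^sup>2 \<le> tilt (\<lambda>x. k * (N (fst x))\<^sup>2) ?y"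
    unfolding theta_tilt by (simp add: algebra_simps)
  also have "\<dots> \<le> tilt p ?y" by (rule tilt_mono[OF assms(1)])
  finally show ?thesis by (simp add: np_def P_def)
qed

end

section \<open>Taylor remainders and bookkeeping of Lipschitz constants\<close>

lemma taylor1:
  assumes "\<And>t. (f has_real_derivative f' t) (at t)" "\<And>s t. \<bar>f' s - f' t\<bar> \<le> B * \<bar>s - t\<bar>"
  shows "\<bar>f (x + k) - f x - k * f' x\<bar> \<le> B * k\<^sup>2"
proof -
  have "\<bar>(f (x + k) - (x + k) * f' x) - (f x - x * f' x)\<bar> \<le> B * \<bar>k\<bar> * \<bar>(x + k) - x\<bar>"
    unfolding real_norm_def[symmetric]
  proof (rule field_differentiable_bound[where S="{x - \<bar>k\<bar>..x + \<bar>k\<bar>}" and f'="\<lambda>t. f' t - f' x"])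
    fix t assume "t \<in> {x - \<bar>k\<bar>..x + \<bar>k\<bar>}"
    then have "\<bar>t - x\<bar> \<le> \<bar>k\<bar>" by auto
    moreover have "0 \<le> B" using assms(2)[of 1 0] by simp
    ultimately have "B * \<bar>t - x\<bar> \<le> B * \<bar>k\<bar>" by (intro mult_left_mono)
    then show "norm (f' t - f' x) \<le> B * norm k" using assms(2)[of t x] by simp
  qed (auto intro!: derivative_eq_intros assms(1)[THEN has_field_derivative_at_within])
  then show ?thesis by (simp add: algebra_simps power2_eq_square abs_mult_self_eq)
qed

lemma taylor2:
  assumes "\<And>t. (f has_real_derivative f' t) (at t)" "\<And>t. (f' has_real_derivative f'' t) (at t)"
    "\<And>s t. \<bar>f'' s - f'' t\<bar> \<le> B * \<bar>s - t\<bar>"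
  shows "\<bar>f (x + k) - f x - k * f' x - k\<^sup>2 / 2 * f'' x\<bar> \<le> B * \<bar>k\<bar> ^ 3"
proof -
  have "\<bar>(f (x + k) - (x + k) * f' x - k\<^sup>2 / 2 * f'' x) - (f x - x * f' x - 0)\<bar> \<le> B * k\<^sup>2 * \<bar>(x + k) - x\<bar>"
    unfolding real_norm_def[symmetric]
  proof (rule field_differentiable_bound[where S="{x - \<bar>k\<bar>..x + \<bar>k\<bar>}" and f'="\<lambda>t. f' t - f' x - (t - x) * f'' x"
       and f="\<lambda>t. f t - t * f' x - (t - x)\<^sup>2 / 2 * f'' x", THEN order_trans[rotated]])
    fix t assume "t \<in> {x - \<bar>k\<bar>..x + \<bar>k\<bar>}"
    then have *: "(t - x)\<^sup>2 \<le> k\<^sup>2" by (intro abs_le_square_iff[THEN iffD1]) auto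
    moreover have "0 \<le> B" using assms(3)[of 1 0] by simp
    ultimately have "B * (t - x)\<^sup>2 \<le> B * k\<^sup>2" by (intro mult_left_mono)
    then show "norm (f' t - f' x - (t - x) * f'' x) \<le> B * k\<^sup>2"
      using taylor1[OF assms(2,3), of x "t - x"] by simp
  qed (auto intro!: derivative_eq_intros assms(1)[THEN has_field_derivative_at_within])
  then show ?thesis by (simp add: algebra_simps power2_eq_square power3_eq_cube)
qed

text \<open>The powers of \<open>K\<close> are generous: it only matters that they depend neither on \<open>\<epsilon>\<close> nor on \<open>\<Lambda>\<close>.\<close>

definition bl :: "real \<Rightarrow> real \<Rightarrow> nat \<Rightarrow> field2 \<Rightarrow> bool" where
  "bl K \<Lambda> m F \<longleftrightarrow> (\<forall>x. \<bar>F x\<bar> \<le> K ^ m) \<and> lip2 (K ^ m * (1 + \<Lambda>)) F"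

lemma blD: "bl K \<Lambda> m F \<Longrightarrow> \<bar>F x\<bar> \<le> K ^ m" "bl K \<Lambda> m F \<Longrightarrow> lip2 (K ^ m * (1 + \<Lambda>)) F"
  unfolding bl_def by blast+

context
  fixes K \<Lambda> :: real
  assumes K: "2 \<le> K" and Lam: "0 \<le> \<Lambda>"
begin

lemma blI:
  assumes "\<And>x. \<bar>F x\<bar> \<le> B" "lip2 D F" "B \<le> K ^ m" "D \<le> K ^ m * (1 + \<Lambda>)"
  shows "bl K \<Lambda> m F"
  unfolding bl_def using assms by (auto intro: order_trans lip2_mono)

lemma bl_le: assumes "bl K \<Lambda> m F" "m \<le> n" shows "bl K \<Lambda> n F"
proof (rule blI)
  show "\<bar>F x\<bar> \<le> K ^ m" for x using assms(1) by (rule blD)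
  show "lip2 (K ^ m * (1 + \<Lambda>)) F" using assms(1) by (rule blD)
  show "K ^ m \<le> K ^ n" using assms(2) K by (intro power_increasing) auto
  then show "K ^ m * (1 + \<Lambda>) \<le> K ^ n * (1 + \<Lambda>)" using Lam by (intro mult_right_mono) auto
qed

lemma bl_const: assumes "\<bar>r\<bar> \<le> K ^ m" shows "bl K \<Lambda> m (\<lambda>x. r)"
  by (rule blI[where B="\<bar>r\<bar>" and D=0]) (use assms K Lam in \<open>auto simp: lip2_def\<close>)

lemma Kpow: "1 \<le> K ^ m" using K by (intro one_le_power) auto

text \<open>The product rule yields two Lipschitz terms of equal size, and the extra factor
  \<open>K \<ge> 2\<close> pays for their sum. What matters is that \<open>1 + \<Lambda>\<close>
  stays to the first power, because the factors themselves are bounded independently of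
  \<open>\<Lambda>\<close>: the Lipschitz constants of the Hessian then obey a linear recursion
  instead of a quadratic one.\<close>

lemma bl_mult: assumes "bl K \<Lambda> m F" "bl K \<Lambda> n G" shows "bl K \<Lambda> (Suc (m + n)) (\<lambda>x. F x * G x)"
proof (rule blI)
  have F: "\<And>x. \<bar>F x\<bar> \<le> K ^ m" "lip2 (K ^ m * (1 + \<Lambda>)) F" by (rule blD[OF assms(1)])+
  have G: "\<And>x. \<bar>G x\<bar> \<le> K ^ n" "lip2 (K ^ n * (1 + \<Lambda>)) G" by (rule blD[OF assms(2)])+
  show "\<bar>F x * G x\<bar> \<le> K ^ m * K ^ n" for x
    unfolding abs_mult using F(1)[of x] G(1)[of x] by (intro mult_mono) (use K in auto)
  show "lip2 (K ^ m * (K ^ n * (1 + \<Lambda>)) + K ^ n * (K ^ m * (1 + \<Lambda>))) (\<lambda>x. F x * G x)"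
    by (rule lip2_mult[OF F(2) G(2) F(1) G(1)])
  have *: "0 \<le> K ^ m * K ^ n" using K by simp
  show "K ^ m * K ^ n \<le> K ^ Suc (m + n)"
    using mult_right_mono[of 1 K "K ^ m * K ^ n"] K * by (simp add: power_add)
  have "2 * (K ^ m * K ^ n * (1 + \<Lambda>)) \<le> K * (K ^ m * K ^ n * (1 + \<Lambda>))"
    using K Lam * by (intro mult_right_mono mult_nonneg_nonneg) auto
  then show "K ^ m * (K ^ n * (1 + \<Lambda>)) + K ^ n * (K ^ m * (1 + \<Lambda>)) \<le> K ^ Suc (m + n) * (1 + \<Lambda>)"
    by (simp add: power_add mult_ac)
qed

lemma bl_add: assumes "bl K \<Lambda> m F" "bl K \<Lambda> n G" shows "bl K \<Lambda> (Suc (m + n)) (\<lambda>x. F x + G x)"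
proof (rule blI)
  have F: "\<And>x. \<bar>F x\<bar> \<le> K ^ m" "lip2 (K ^ m * (1 + \<Lambda>)) F" by (rule blD[OF assms(1)])+
  have G: "\<And>x. \<bar>G x\<bar> \<le> K ^ n" "lip2 (K ^ n * (1 + \<Lambda>)) G" by (rule blD[OF assms(2)])+
  show "\<bar>F x + G x\<bar> \<le> K ^ m + K ^ n" for x
    using F(1)[of x] G(1)[of x] by linarith
  show "lip2 (K ^ m * (1 + \<Lambda>) + K ^ n * (1 + \<Lambda>)) (\<lambda>x. F x + G x)"
    by (rule lip2_add[OF F(2) G(2)])
  have *: "K ^ m \<le> K ^ m * K ^ n" "K ^ n \<le> K ^ m * K ^ n" 
    using Kpow[of m] Kpow[of n] mult_left_mono[of 1 "K ^ n" "K ^ m"] mult_right_mono[of 1 "K ^ m" "K ^ n"] by auto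
  have "2 * (K ^ m * K ^ n) \<le> K * (K ^ m * K ^ n)" using K by (intro mult_right_mono) auto
  then show 1: "K ^ m + K ^ n \<le> K ^ Suc (m + n)" using * by (simp add: power_add)
  from mult_right_mono[OF this, of "1 + \<Lambda>"] Lam
  show "K ^ m * (1 + \<Lambda>) + K ^ n * (1 + \<Lambda>) \<le> K ^ Suc (m + n) * (1 + \<Lambda>)"
    by (simp add: distrib_right)
qed

end

context binomial_step
begin

lemma dif_lip: assumes "lip2 D F" shows "\<bar>dif F x\<bar> \<le> D"
proof -
  have "\<bar>F (fst x + \<epsilon>, snd x) - F (fst x - \<epsilon>, snd x)\<bar> \<le> D * (2 * \<epsilon>)"
    using lip2D[OF assms, of "(fst x + \<epsilon>, snd x)" "(fst x - \<epsilon>, snd x)"] eps by simp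
  then show ?thesis unfolding dif_def using eps by (simp add: abs_divide pos_divide_le_eq)
qed

text \<open>Averaging by itself costs nothing. The weights vary at a rate of order
  \<open>\<epsilon>\<close>, and this variation multiplies a difference of \<open>F\<close> over the
  distance \<open>2 \<epsilon>\<close>; hence the relative cost
  \<open>2 T \<epsilon>\<^sup>2\<close>.\<close>

lemma lip2_tilt:
  assumes "lip2 D F" "lip2 (2 * \<epsilon> * T) \<theta>" "0 \<le> T"
  shows "lip2 ((1 + 2 * T * \<epsilon>\<^sup>2) * D) (tilt F)"
  unfolding lip2_def
proof (intro allI)
  fix x y :: "real \<times> real"
  define d where "d = \<bar>fst x - fst y\<bar> + \<bar>snd x - snd y\<bar>"
  let ?u = "\<lambda>x. F (fst x + \<epsilon>, snd x)" let ?v = "\<lambda>x. F (fst x - \<epsilon>, snd x)"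
  have D0: "0 \<le> D" using lip2D[OF assms(1), of "(1, 0)" "(0, 0)"] by simp
  have e: "tilt F x - tilt F y = (1 + \<theta> x) / 2 * (?u x - ?u y) + (1 - \<theta> x) / 2 * (?v x - ?v y)
     + (\<theta> x - \<theta> y) / 2 * (?u y - ?v y)"
    unfolding theta_tilt by (simp add: field_simps)
  have 1: "\<bar>(1 + \<theta> x) / 2 * (?u x - ?u y)\<bar> \<le> (1 + \<theta> x) / 2 * (D * d)"
    unfolding abs_mult using theta_bound[of x] lip2D[OF assms(1), of "(fst x + \<epsilon>, snd x)" "(fst y + \<epsilon>, snd y)"]
    by (intro mult_mono) (auto simp: d_def)
  have 2: "\<bar>(1 - \<theta> x) / 2 * (?v x - ?v y)\<bar> \<le> (1 - \<theta> x) / 2 * (D * d)"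
    unfolding abs_mult using theta_bound[of x] lip2D[OF assms(1), of "(fst x - \<epsilon>, snd x)" "(fst y - \<epsilon>, snd y)"]
    by (intro mult_mono) (auto simp: d_def)
  have "\<bar>(\<theta> x - \<theta> y) / 2 * (?u y - ?v y)\<bar> \<le> (\<epsilon> * T * d) * (D * (2 * \<epsilon>))"
    unfolding abs_mult using lip2D[OF assms(2), of x y] eps D0 assms(3)
      lip2D[OF assms(1), of "(fst y + \<epsilon>, snd y)" "(fst y - \<epsilon>, snd y)"]
    by (intro mult_mono) (auto simp: d_def)
  moreover have "(\<epsilon> * T * d) * (D * (2 * \<epsilon>)) = 2 * T * \<epsilon>\<^sup>2 * D * d" by (simp add: power2_eq_square)
  moreover have "(1 + \<theta> x) / 2 * (D * d) + (1 - \<theta> x) / 2 * (D * d) = D * d" by (simp add: field_simps)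
  ultimately have "\<bar>tilt F x - tilt F y\<bar> \<le> D * d + 2 * T * \<epsilon>\<^sup>2 * D * d"
    unfolding e using 1 2 by linarith
  then show "\<bar>tilt F x - tilt F y\<bar> \<le> (1 + 2 * T * \<epsilon>\<^sup>2) * D * (\<bar>fst x - fst y\<bar> + \<bar>snd x - snd y\<bar>)"
    unfolding d_def[symmetric] by (simp add: algebra_simps)
qed

context
  fixes K M \<Lambda> :: real
  assumes K: "2 \<le> K" "L \<le> K" "M \<le> K" and Lam: "0 \<le> \<Lambda>"
    and aM: "\<And>x. \<bar>a x\<bar> \<le> M" and bM: "\<And>x. \<bar>b x\<bar> \<le> M" and cM: "\<And>x. \<bar>c x\<bar> \<le> M"
    and al: "lip2 \<Lambda> a" and bla: "lip2 \<Lambda> b" and cl: "lip2 \<Lambda> c"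
begin

lemma difM: "\<bar>dif p x\<bar> \<le> M" "\<bar>dif q x\<bar> \<le> M"
  by (rule dif_bound[OF gp aM], rule dif_bound[OF gq bM])

lemma M0: "0 \<le> M" using aM[of "(0,0)"] by linarith

lemma eps2: "\<epsilon>\<^sup>2 \<le> 1" "0 \<le> \<epsilon>\<^sup>2"
  using eps eps_le(2) by (auto intro: power_le_one)

text \<open>The partial derivatives of \<open>Q\<close> consist of averages of \<open>b\<close>,
  \<open>c\<close> and products of first-order quotients, all bounded through \<open>M\<close> and
  \<open>L\<close>. The constant is therefore free of \<open>\<Lambda>\<close>, and so is that of
  \<open>\<theta>\<close>; otherwise the recursion for \<open>\<Lambda>\<close> would be
  quadratic.\<close>

lemma lip_Q: "lip2 (K ^ 6) Q"
proof (rule grad2_lip2[OF grad2_Q])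
  have K1: "1 \<le> K ^ n" for n using K by (intro one_le_power) auto
  have *: "\<bar>(y + 2 * \<epsilon>\<^sup>2 * Q x * u * v) / \<kappa> x\<bar> \<le> K ^ 6" if "\<bar>y\<bar> \<le> M" "\<bar>u\<bar> \<le> M" "\<bar>v\<bar> \<le> M" for x y u v
  proof -
    have "\<bar>Q x\<bar> * \<bar>u\<bar> * \<bar>v\<bar> \<le> K * K * K"
    proof -
      have "\<bar>Q x\<bar> \<le> K" "\<bar>u\<bar> \<le> K" "\<bar>v\<bar> \<le> K" using Q_bound[of x] that K by linarith+
      then show ?thesis using K by (intro mult_mono) auto
    qed
    then have "\<epsilon>\<^sup>2 * (\<bar>Q x\<bar> * \<bar>u\<bar> * \<bar>v\<bar>) \<le> 1 * (K * K * K)"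
      by (rule mult_mono[OF eps2(1)]) auto
    then have "\<bar>2 * \<epsilon>\<^sup>2 * Q x * u * v\<bar> \<le> 2 * K ^ 3" by (simp add: abs_mult mult_ac power3_eq_cube)
    then have "\<bar>y + 2 * \<epsilon>\<^sup>2 * Q x * u * v\<bar> \<le> K + 2 * K ^ 3" using that K by linarith
    also have "\<dots> \<le> K ^ 5"
    proof -
      have "K * 1 \<le> K * K ^ 2" using K1[of 2] K by (intro mult_left_mono) auto
      then have "K \<le> K ^ 3" by (simp add: power3_eq_cube power2_eq_square)
      moreover have "(2 * 2) * K ^ 3 \<le> (K * K) * K ^ 3" using K by (intro mult_right_mono mult_mono) auto
      moreover have "0 \<le> K ^ 3" "(K * K) * K ^ 3 = K ^ 5" using K by (simp_all add: eval_nat_numeral)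
      ultimately show ?thesis by linarith
    qed
    finally have "\<bar>(y + 2 * \<epsilon>\<^sup>2 * Q x * u * v) / \<kappa> x\<bar> \<le> K ^ 5 * (1 / \<kappa> x)"
      using kap_bounds(4)[of x] by (simp add: abs_divide divide_right_mono)
    also have "\<dots> \<le> K ^ 5 * K" using kap_inverse(2)[of x] K by (intro mult_left_mono) auto
    finally show ?thesis by (simp add: eval_nat_numeral mult_ac)
  qed
  show "\<bar>Q1 x\<bar> \<le> K ^ 6" for x
    unfolding Q1_def by (rule *[OF tilt_bound[OF bM] difM])
  have "\<kappa> x * C x = (tilt c x + 2 * \<epsilon>\<^sup>2 * Q x * dif q x * dif q x) / \<kappa> x" for x
    unfolding C_def by (simp add: power2_eq_square)
  moreover have "\<bar>(tilt c x + 2 * \<epsilon>\<^sup>2 * Q x * dif q x * dif q x) / \<kappa> x\<bar> \<le> K ^ 6" for x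
    by (rule *[OF tilt_bound[OF cM] difM(2) difM(2)])
  ultimately show "\<bar>\<kappa> x * C x\<bar> \<le> K ^ 6" for x by simp
qed

lemma lip_theta: "lip2 (2 * \<epsilon> * K ^ 8) \<theta>"
proof -
  have 1: "lip2 (L * K ^ 6 + L * M) (\<lambda>x. z x * Q x)"
    using lip2_mult[OF grad2_lip2[OF grad2_z difM] lip_Q z_bound Q_bound] by simp
  have "L * K ^ 6 \<le> K * K ^ 6" "L * M \<le> K * K ^ 6"
    using K L1 M0 power_increasing[of 1 6 K] by (auto intro!: mult_mono)
  moreover have "2 * (K * K ^ 6) \<le> K * (K * K ^ 6)" using K by (intro mult_right_mono) auto
  ultimately have "L * K ^ 6 + L * M \<le> K ^ 8" by (simp add: eval_nat_numeral mult_ac)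
  from lip2_mono[OF 1 this] have 2: "lip2 (K ^ 8) (\<lambda>x. z x * Q x)" .
  show ?thesis unfolding lip2_def
  proof (intro allI)
    fix x y :: "real \<times> real"
    have "\<theta> x - \<theta> y = 2 * \<epsilon> * (z x * Q x - z y * Q y)" by (simp add: \<theta>_def algebra_simps)
    then have "\<bar>\<theta> x - \<theta> y\<bar> = 2 * \<epsilon> * \<bar>z x * Q x - z y * Q y\<bar>" using eps by (simp add: abs_mult)
    also have "\<dots> \<le> 2 * \<epsilon> * (K ^ 8 * (\<bar>fst x - fst y\<bar> + \<bar>snd x - snd y\<bar>))"
      using lip2D[OF 2] eps by (intro mult_left_mono) auto
    finally show "\<bar>\<theta> x - \<theta> y\<bar> \<le> 2 * \<epsilon> * K ^ 8 * (\<bar>fst x - fst y\<bar> + \<bar>snd x - snd y\<bar>)" by (simp add: mult.assoc)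
  qed
qed

lemma lip_tilt: "lip2 \<Lambda> F \<Longrightarrow> lip2 ((1 + K ^ 9 * \<epsilon>\<^sup>2) * \<Lambda>) (tilt F)"
proof (erule lip2_mono[OF lip2_tilt[OF _ lip_theta]])
  have "2 * K ^ 8 \<le> K * K ^ 8" using K by (intro mult_right_mono) auto
  then have "2 * K ^ 8 \<le> K ^ 9" by (simp add: eval_nat_numeral)
  then show "(1 + 2 * K ^ 8 * \<epsilon>\<^sup>2) * \<Lambda> \<le> (1 + K ^ 9 * \<epsilon>\<^sup>2) * \<Lambda>"
    using Lam eps2 by (intro mult_right_mono add_mono) auto
qed (use K in auto)

lemmas bls = bl_mult[OF K(1) Lam] bl_add[OF K(1) Lam]
lemmas blw = bl_le[OF K(1) Lam]

text \<open>Writing the inverse determinant as \<open>1 + \<epsilon>\<^sup>2 \<rho>\<close> isolates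
  a remainder of order \<open>\<epsilon>\<^sup>2\<close>. A mere bound on
  \<open>1 / \<kappa>\<close> would multiply the Lipschitz constants by a fixed factor in each of
  the \<open>n\<close> steps.\<close>

definition "\<iota> x = 1 / \<kappa> x"
definition "\<rho> x = 2 * (z x * dif q x) * \<iota> x"

lemma iota_rho: "\<iota> x = 1 + \<epsilon>\<^sup>2 * \<rho> x"
proof -
  have k: "1 - \<epsilon>\<^sup>2 * (2 * (z x * dif q x)) = \<kappa> x" by (simp add: \<kappa>_def)
  have "\<iota> x - \<epsilon>\<^sup>2 * \<rho> x = \<iota> x * (1 - \<epsilon>\<^sup>2 * (2 * (z x * dif q x)))" by (simp add: \<rho>_def algebra_simps)
  also have "\<dots> = 1" unfolding k by (simp add: \<iota>_def)
  finally show ?thesis by simp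
qed

lemma bl_z: "bl K \<Lambda> 1 z"
  by (rule blI[OF K(1) Lam z_bound grad2_lip2[OF grad2_z difM]])
     (use K Lam M0 mult_mono[of M K 1 "1+\<Lambda>"] in auto)

lemma bl_dif: "bl K \<Lambda> 1 (dif p)" "bl K \<Lambda> 1 (dif q)"
proof -
  have *: "1 * \<Lambda> \<le> K ^ 1 * (1 + \<Lambda>)" using K Lam by (intro mult_mono) auto
  show "bl K \<Lambda> 1 (dif p)"
    by (rule blI[OF K(1) Lam difM(1) grad2_lip2[OF grad2_dif[OF gp] dif_lip[OF al] dif_lip[OF bla]]])
       (use K * in auto)
  show "bl K \<Lambda> 1 (dif q)"
    by (rule blI[OF K(1) Lam difM(2) grad2_lip2[OF grad2_dif[OF gq] dif_lip[OF bla] dif_lip[OF cl]]])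
       (use K * in auto)
qed

lemma bl_2: "bl K \<Lambda> 1 (\<lambda>x. 2)" by (rule bl_const[OF K(1) Lam]) (use K in simp)
lemma bl_eps: "bl K \<Lambda> 0 (\<lambda>x. \<epsilon>\<^sup>2)" by (rule bl_const[OF K(1) Lam]) (use eps2 in simp)

lemma bl_D: "bl K \<Lambda> 5 (\<lambda>x. 2 * (z x * dif q x))"
  by (rule blw, (rule bls bl_2 bl_z bl_dif)+) simp

lemma bl_iota: "bl K \<Lambda> 6 \<iota>"
proof (rule blI[OF K(1) Lam])
  show "\<bar>\<iota> x\<bar> \<le> 2" for x using kap_inverse(2)[of x] kap_bounds(4)[of x] by (simp add: \<iota>_def)
  show "2 \<le> K ^ 6" using K power_increasing[of 1 6 K] by simp
  show "lip2 (2 * (K ^ 5 * (1 + \<Lambda>))) \<iota>" unfolding lip2_def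
  proof (intro allI)
    fix x y :: "real \<times> real"
    define d where "d = \<bar>fst x - fst y\<bar> + \<bar>snd x - snd y\<bar>"
    let ?D = "\<lambda>x. 2 * (z x * dif q x)"
    have "\<bar>\<kappa> y - \<kappa> x\<bar> = \<epsilon>\<^sup>2 * \<bar>?D x - ?D y\<bar>"
      unfolding \<kappa>_def using eps2 by (simp add: abs_mult[of "\<epsilon>\<^sup>2", simplified, symmetric] algebra_simps)
    also have "\<dots> \<le> 1 * (K ^ 5 * (1 + \<Lambda>) * d)"
      using bl_D eps2 unfolding bl_def d_def by (intro mult_mono) (auto dest: lip2D)
    finally have 1: "\<bar>\<kappa> y - \<kappa> x\<bar> \<le> K ^ 5 * (1 + \<Lambda>) * d" by simp
    have "\<iota> x - \<iota> y = (\<kappa> y - \<kappa> x) / (\<kappa> x * \<kappa> y)" by (simp add: \<iota>_def field_simps)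
    then have "\<bar>\<iota> x - \<iota> y\<bar> = \<bar>\<kappa> y - \<kappa> x\<bar> / (\<kappa> x * \<kappa> y)"
      using kap_bounds(4)[of x] kap_bounds(4)[of y] by (simp add: abs_mult)
    also have "\<dots> \<le> \<bar>\<kappa> y - \<kappa> x\<bar> / (1/2)"
    proof (rule divide_left_mono)
      have "3/4 * (3/4) \<le> \<kappa> x * \<kappa> y" using kap_bounds[of x] kap_bounds[of y] by (intro mult_mono) auto
      then show "1/2 \<le> \<kappa> x * \<kappa> y" "0 < \<kappa> x * \<kappa> y * (1 / 2)" by simp_all
    qed simp
    also have "\<dots> \<le> 2 * (K ^ 5 * (1 + \<Lambda>) * d)" using 1 by simp
    finally show "\<bar>\<iota> x - \<iota> y\<bar> \<le> 2 * (K ^ 5 * (1 + \<Lambda>)) * (\<bar>fst x - fst y\<bar> + \<bar>snd x - snd y\<bar>)"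
      by (simp add: d_def mult.assoc)
  qed
  have "2 * (K ^ 5 * (1 + \<Lambda>)) \<le> K * (K ^ 5 * (1 + \<Lambda>))" using K Lam by (intro mult_right_mono) auto
  then show "2 * (K ^ 5 * (1 + \<Lambda>)) \<le> K ^ 6 * (1 + \<Lambda>)" by (simp add: eval_nat_numeral mult_ac)
qed

lemma bl_rho: "bl K \<Lambda> 12 \<rho>"
  unfolding \<rho>_def by (rule blw, (rule bl_mult[OF K(1) Lam bl_D bl_iota])) simp

lemma bl_Q: "bl K \<Lambda> 6 Q"
proof (rule blI[OF K(1) Lam Q_bound lip_Q])
  show "L \<le> K ^ 6" using K power_increasing[of 1 6 K] by simp
  show "K ^ 6 \<le> K ^ 6 * (1 + \<Lambda>)" using K Lam mult_left_mono[of 1 "1+\<Lambda>" "K ^ 6"] by simp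
qed

lemma bl_tilt: assumes "\<And>x. \<bar>F x\<bar> \<le> M" "lip2 \<Lambda> F" shows "bl K \<Lambda> 10 (tilt F)"
proof (rule blI[OF K(1) Lam tilt_bound[OF assms(1)] lip_tilt[OF assms(2)]])
  show "M \<le> K ^ 10" using K power_increasing[of 1 10 K] by simp
  have "1 \<le> K ^ 9" using K by (intro one_le_power) auto
  then have "(1 + K ^ 9 * \<epsilon>\<^sup>2) \<le> K ^ 9 + K ^ 9 * 1" using eps2 K by (intro add_mono mult_left_mono) auto
  also have "\<dots> \<le> K * K ^ 9" using mult_right_mono[of 2 K "K ^ 9"] K by simp
  also have "\<dots> = K ^ 10" by (simp add: eval_nat_numeral)
  finally show "(1 + K ^ 9 * \<epsilon>\<^sup>2) * \<Lambda> \<le> K ^ 10 * (1 + \<Lambda>)" using Lam by (intro mult_mono) auto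
qed

text \<open>The remainders of the Hessian recursion once the tilted average is split off. Each
  enters with a factor \<open>\<epsilon>\<^sup>2\<close>, so a bound that is uniform in
  \<open>\<epsilon>\<close> and linear in \<open>1 + \<Lambda>\<close> is all that is asked of
  them.\<close>

definition "XC x = (2 * \<rho> x + \<epsilon>\<^sup>2 * (\<rho> x * \<rho> x)) * tilt c x + 2 * (Q x * (dif q x * dif q x)) * (\<iota> x * \<iota> x)"
definition "XQ x = \<rho> x * tilt b x + 2 * (Q x * (dif p x * dif q x)) * \<iota> x"
definition "XB x = XQ x + 2 * (z x * dif p x) * C x"
definition "XA x = 2 * (Q x * (dif p x * dif p x)) + 2 * (z x * dif p x) * (Q1 x + B x)"

lemma CX: "C x = tilt c x + \<epsilon>\<^sup>2 * XC x"
proof -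
  have "C x = (tilt c x + 2 * \<epsilon>\<^sup>2 * Q x * (dif q x)\<^sup>2) * (\<iota> x * \<iota> x)"
    by (simp add: C_def \<iota>_def power2_eq_square)
  also have "\<dots> = tilt c x * (\<iota> x * \<iota> x) + \<epsilon>\<^sup>2 * (2 * (Q x * (dif q x * dif q x)) * (\<iota> x * \<iota> x))"
    by (simp add: algebra_simps power2_eq_square)
  also have "\<iota> x * \<iota> x = 1 + \<epsilon>\<^sup>2 * (2 * \<rho> x + \<epsilon>\<^sup>2 * (\<rho> x * \<rho> x))"
    unfolding iota_rho by (simp add: algebra_simps)
  finally show ?thesis unfolding XC_def iota_rho by (simp add: algebra_simps)
qed

lemma QX: "Q1 x = tilt b x + \<epsilon>\<^sup>2 * XQ x"
proof -
  have "Q1 x = (tilt b x + 2 * \<epsilon>\<^sup>2 * Q x * dif p x * dif q x) * \<iota> x"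
    by (simp add: Q1_def \<iota>_def)
  also have "\<dots> = tilt b x * \<iota> x + \<epsilon>\<^sup>2 * (2 * (Q x * (dif p x * dif q x)) * \<iota> x)"
    by (simp add: algebra_simps)
  finally show ?thesis unfolding XQ_def iota_rho by (simp add: algebra_simps)
qed

lemma BX: "B x = tilt b x + \<epsilon>\<^sup>2 * XB x"
  unfolding B_def XB_def QX by (simp add: algebra_simps)

lemma AX: "A x = tilt a x + \<epsilon>\<^sup>2 * XA x"
  unfolding A_def XA_def by (simp add: algebra_simps power2_eq_square)

text \<open>The exponents are round upper bounds for those generated by repeated use of the sum and
  product rules; each later remainder contains the earlier ones as factors.\<close>

lemma bl_X: "bl K \<Lambda> 100 XC" "bl K \<Lambda> 100 XQ" "bl K \<Lambda> 220 XB" "bl K \<Lambda> 380 XA"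
proof -
  note all = bls bl_rho bl_2 bl_z bl_dif bl_Q bl_iota bl_eps bl_tilt[OF cM cl] bl_tilt[OF bM bla] bl_tilt[OF aM al]
  show XC: "bl K \<Lambda> 100 XC" unfolding XC_def[abs_def]
    by (rule blw, (rule all)+) simp
  show XQ: "bl K \<Lambda> 100 XQ" unfolding XQ_def[abs_def]
    by (rule blw, (rule all)+) simp
  have C: "bl K \<Lambda> 112 C" unfolding CX[abs_def]
    by (rule blw, (rule all XC)+) simp
  have Q1: "bl K \<Lambda> 112 Q1" unfolding QX[abs_def]
    by (rule blw, (rule all XQ)+) simp
  show XB: "bl K \<Lambda> 220 XB" unfolding XB_def[abs_def]
    by (rule blw, (rule all XQ C)+) simp
  have B: "bl K \<Lambda> 232 B" unfolding BX[abs_def]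
    by (rule blw, (rule all XB)+) simp
  show "bl K \<Lambda> 380 XA" unfolding XA_def[abs_def]
    by (rule blw, (rule all Q1 B)+) simp
qed

context
  assumes small2: "\<epsilon>\<^sup>2 * K ^ 400 \<le> 1"
begin

lemma Kpow2: "k * K ^ m \<le> K ^ n" if "k \<le> K ^ (n - m)" "m \<le> n" for k m n
proof -
  have "k * K ^ m \<le> K ^ (n - m) * K ^ m" using that(1) K by (intro mult_right_mono) auto
  also have "\<dots> = K ^ n" using that(2) by (simp flip: power_add)
  finally show ?thesis .
qed

lemma r_small: "0 \<le> 2 * \<epsilon>\<^sup>2 * L * M" "2 * \<epsilon>\<^sup>2 * L * M \<le> \<epsilon>\<^sup>2 * K ^ 3" "\<epsilon>\<^sup>2 * K ^ 3 \<le> 1/2"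
proof -
  show "0 \<le> 2 * \<epsilon>\<^sup>2 * L * M" using L1 M0 eps2 by simp
  have "L * M \<le> K * K" using K M0 L1 by (intro mult_mono) auto
  then have "2 * (L * M) \<le> 2 * K ^ 2" by (simp add: power2_eq_square)
  also have "\<dots> \<le> K ^ 3" by (rule Kpow2) (use K in auto)
  finally have "\<epsilon>\<^sup>2 * (2 * (L * M)) \<le> \<epsilon>\<^sup>2 * K ^ 3" using eps2 by (intro mult_left_mono) auto
  then show "2 * \<epsilon>\<^sup>2 * L * M \<le> \<epsilon>\<^sup>2 * K ^ 3" by (simp add: mult_ac)
  have "2 * K ^ 3 \<le> K ^ 400"
  proof (rule Kpow2)
    show "2 \<le> K ^ (400 - 3)" using K power_increasing[of 1 397 K] by simp
  qed simp
  then have "\<epsilon>\<^sup>2 * (2 * K ^ 3) \<le> \<epsilon>\<^sup>2 * K ^ 400" using eps2 by (intro mult_left_mono) auto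
  then show "\<epsilon>\<^sup>2 * K ^ 3 \<le> 1/2" using small2 by linarith
qed

text \<open>Growth has three sources, each of relative size \<open>\<epsilon>\<^sup>2\<close>: the
  tilted average, the remainder \<open>X\<close>, and composition with \<open>\<Phi>\<close>. Stated
  for \<open>1 + \<Lambda>\<close> the recursion is purely multiplicative, so \<open>n\<close> steps
  with \<open>\<epsilon>\<^sup>2 = 1 / n\<close> amount to an exponential factor. The exponent
  \<open>400\<close> leaves room above \<open>380\<close> to collect the three factors.\<close>

lemma new_lip:
  assumes X: "bl K \<Lambda> 380 X" and F: "\<And>x. F x = tilt G x + \<epsilon>\<^sup>2 * X x" and G: "lip2 \<Lambda> G"
  shows "lip2 ((1 + \<epsilon>\<^sup>2 * K ^ 400) * (1 + \<Lambda>) - 1) (\<lambda>x. F (\<Phi> x))"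
proof -
  define S where "S = (1 + \<epsilon>\<^sup>2 * K ^ 381) * (1 + \<Lambda>) - 1"
  have eX: "lip2 (\<epsilon>\<^sup>2 * (K ^ 380 * (1 + \<Lambda>))) (\<lambda>x. \<epsilon>\<^sup>2 * X x)" unfolding lip2_def
  proof (intro allI)
    fix x y :: "real \<times> real"
    show "\<bar>\<epsilon>\<^sup>2 * X x - \<epsilon>\<^sup>2 * X y\<bar> \<le> \<epsilon>\<^sup>2 * (K ^ 380 * (1 + \<Lambda>)) * (\<bar>fst x - fst y\<bar> + \<bar>snd x - snd y\<bar>)"
      using mult_left_mono[OF lip2D[OF blD(2)[OF X], of x y] eps2(2)] eps2(2)
      by (simp add: right_diff_distrib[symmetric] abs_mult mult.assoc)
  qed
  have "lip2 ((1 + K ^ 9 * \<epsilon>\<^sup>2) * \<Lambda> + \<epsilon>\<^sup>2 * (K ^ 380 * (1 + \<Lambda>))) F"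
    unfolding F[abs_def] by (rule lip2_add[OF lip_tilt[OF G] eX])
  moreover have "(1 + K ^ 9 * \<epsilon>\<^sup>2) * \<Lambda> + \<epsilon>\<^sup>2 * (K ^ 380 * (1 + \<Lambda>)) \<le> S"
  proof -
    have "K ^ 9 \<le> K ^ 380" using K by (intro power_increasing) auto
    moreover have "2 * K ^ 380 \<le> K ^ 381" by (rule Kpow2) (use K in auto)
    ultimately have "K ^ 9 * \<Lambda> + K ^ 380 * (1 + \<Lambda>) \<le> K ^ 380 * (1 + \<Lambda>) + K ^ 380 * (1 + \<Lambda>)"
      using Lam K by (intro add_mono mult_mono) auto
    also have "\<dots> = (2 * K ^ 380) * (1 + \<Lambda>)" by simp
    also have "\<dots> \<le> K ^ 381 * (1 + \<Lambda>)" using \<open>2 * K ^ 380 \<le> K ^ 381\<close> Lam by (intro mult_right_mono) auto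
    finally have "\<epsilon>\<^sup>2 * (K ^ 9 * \<Lambda> + K ^ 380 * (1 + \<Lambda>)) \<le> \<epsilon>\<^sup>2 * (K ^ 381 * (1 + \<Lambda>))"
      using eps2 by (intro mult_left_mono) auto
    then show ?thesis unfolding S_def by (simp add: algebra_simps)
  qed
  ultimately have FS: "lip2 S F" by (rule lip2_mono)
  have S0: "0 \<le> S" using lip2D[OF FS, of "(1,0)" "(0,0)"] by simp
  have r12: "2 * \<epsilon>\<^sup>2 * L * M \<le> 1/2" using r_small(2,3) by linarith
  have "lip2 ((1 + 2 * (2 * \<epsilon>\<^sup>2 * L * M)) * S) (\<lambda>x. F (\<Phi> x))" unfolding lip2_def
  proof (intro allI)
    fix x y :: "real \<times> real"
    have "\<bar>F (\<Phi> x) - F (\<Phi> y)\<bar> \<le> S * (\<bar>fst (\<Phi> x) - fst (\<Phi> y)\<bar> + \<bar>snd (\<Phi> x) - snd (\<Phi> y)\<bar>)"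
      by (rule lip2D[OF FS])
    also have "\<dots> \<le> S * ((1 + 2 * (2 * \<epsilon>\<^sup>2 * L * M)) * (\<bar>fst x - fst y\<bar> + \<bar>snd x - snd y\<bar>))"
      by (intro mult_left_mono Phi_lip[OF lip2_R[OF difM] r_small(1) r12] S0)
    finally show "\<bar>F (\<Phi> x) - F (\<Phi> y)\<bar> \<le> (1 + 2 * (2 * \<epsilon>\<^sup>2 * L * M)) * S * (\<bar>fst x - fst y\<bar> + \<bar>snd x - snd y\<bar>)"
      by (simp add: mult_ac)
  qed
  moreover have "(1 + 2 * (2 * \<epsilon>\<^sup>2 * L * M)) * S \<le> (1 + \<epsilon>\<^sup>2 * K ^ 400) * (1 + \<Lambda>) - 1"
  proof -
    define u where "u = 2 * (2 * \<epsilon>\<^sup>2 * L * M)"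
    define v where "v = \<epsilon>\<^sup>2 * K ^ 381"
    have u: "0 \<le> u" "u \<le> 2 * (\<epsilon>\<^sup>2 * K ^ 3)" "u \<le> 1" using r_small unfolding u_def by linarith+
    have v: "0 \<le> v" using eps2 K by (simp add: v_def)
    have "(1 + u) * S \<le> (1 + u) * (1 + v) * (1 + \<Lambda>) - 1"
      using u unfolding S_def v_def by (simp add: algebra_simps)
    also have "(1 + u) * (1 + v) \<le> 1 + \<epsilon>\<^sup>2 * K ^ 400"
    proof -
      have "(1 + u) * (1 + v) \<le> 1 + u + 2 * v" using mult_right_mono[OF u(3) v] by (simp add: algebra_simps)
      also have "\<dots> \<le> 1 + \<epsilon>\<^sup>2 * (2 * K ^ 3 + 2 * K ^ 381)" using u unfolding v_def by (simp add: algebra_simps)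
      also have "2 * K ^ 3 + 2 * K ^ 381 \<le> K ^ 400"
      proof -
        have "K ^ 3 \<le> K ^ 381" using K by (intro power_increasing) auto
        moreover have "4 * K ^ 381 \<le> K ^ 400"
          by (rule Kpow2) (use order_trans[OF power_mono[of 2 K 2] power_increasing[of 2 19 K]] K in auto)
        ultimately show ?thesis by linarith
      qed
      finally show ?thesis using eps2 by (simp add: mult_left_mono)
    qed
    finally show ?thesis using Lam unfolding u_def by (simp add: mult_right_mono)
  qed
  ultimately show ?thesis by (rule lip2_mono)
qed

lemma new_lips: "lip2 ((1 + \<epsilon>\<^sup>2 * K ^ 400) * (1 + \<Lambda>) - 1) na"
   "lip2 ((1 + \<epsilon>\<^sup>2 * K ^ 400) * (1 + \<Lambda>) - 1) nb"
   "lip2 ((1 + \<epsilon>\<^sup>2 * K ^ 400) * (1 + \<Lambda>) - 1) nc"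
proof -
  note le = bl_le[OF K(1) Lam, where n=380]
  show "lip2 ((1 + \<epsilon>\<^sup>2 * K ^ 400) * (1 + \<Lambda>) - 1) na"
    unfolding na_def by (rule new_lip[OF bl_X(4) AX al])
  show "lip2 ((1 + \<epsilon>\<^sup>2 * K ^ 400) * (1 + \<Lambda>) - 1) nb"
    unfolding nb_def by (rule new_lip[OF le[OF bl_X(3)] BX bla]) simp
  show "lip2 ((1 + \<epsilon>\<^sup>2 * K ^ 400) * (1 + \<Lambda>) - 1) nc"
    unfolding nc_def by (rule new_lip[OF le[OF bl_X(1)] CX cl]) simp
qed

end

section \<open>Consistency and time regularity of one step\<close>

lemma R_le: "\<bar>R x\<bar> \<le> \<epsilon>\<^sup>2 * L\<^sup>2" "\<bar>snd (\<Phi> x) - snd x\<bar> \<le> \<epsilon>\<^sup>2 * L\<^sup>2"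
proof -
  have "(z x)\<^sup>2 \<le> L\<^sup>2" for x using z_bound[of x] L1 by (simp add: abs_le_square_iff[symmetric])
  then show *: "\<bar>R x\<bar> \<le> \<epsilon>\<^sup>2 * L\<^sup>2" for x unfolding R_def using eps2
    by (simp add: abs_mult mult_left_mono)
  show "\<bar>snd (\<Phi> x) - snd x\<bar> \<le> \<epsilon>\<^sup>2 * L\<^sup>2" using Phi_snd[of x] *[of "\<Phi> x"] by simp
qed

lemma lip2_p: "lip2 M p" and lip2_q: "lip2 M q"
  by (rule grad2_lip2[OF gp aM bM], rule grad2_lip2[OF gq bM cM])

lemma x1_lip: "lip2 D F \<Longrightarrow> \<bar>F (s, y) - F (t, y)\<bar> \<le> D * \<bar>s - t\<bar>"
  using lip2D[of D F "(s, y)" "(t, y)"] by simp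

lemma avg_p: "\<bar>avg p y - p y\<bar> \<le> \<Lambda> * \<epsilon>\<^sup>2"
  using taylor1[of "\<lambda>t. p (t, snd y)" "\<lambda>t. a (t, snd y)", OF grad2_deriv1[OF gp] x1_lip[OF al], of "fst y" \<epsilon>]
    taylor1[of "\<lambda>t. p (t, snd y)" "\<lambda>t. a (t, snd y)", OF grad2_deriv1[OF gp] x1_lip[OF al], of "fst y" "-\<epsilon>"]
  unfolding avg_def by (simp add: abs_le_iff field_simps)

lemma Phi_move: "lip2 D F \<Longrightarrow> \<bar>F (\<Phi> x) - F x\<bar> \<le> D * (\<epsilon>\<^sup>2 * L\<^sup>2)"
proof -
  assume F: "lip2 D F"
  have "0 \<le> D" using lip2D[OF F, of "(1, 0)" "(0, 0)"] by simp
  then have "D * \<bar>snd (\<Phi> x) - snd x\<bar> \<le> D * (\<epsilon>\<^sup>2 * L\<^sup>2)" by (rule mult_left_mono[OF R_le(2)])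
  then show ?thesis using lip2D[OF F, of "\<Phi> x" x] by simp
qed

text \<open>A step lasts \<open>\<epsilon>\<^sup>2\<close>, so this is a Lipschitz bound in time.
  Terms of first order in \<open>\<epsilon>\<close> cancel in the symmetric average, while the tilt
  correction and the shift by \<open>\<Phi>\<close> are of order \<open>\<epsilon>\<^sup>2\<close>
  anyway.\<close>

lemma time_step: "\<bar>np x - p x\<bar> \<le> (\<Lambda> + 3 * L\<^sup>2 * M) * \<epsilon>\<^sup>2"
proof -
  let ?y = "\<Phi> x"
  have "\<bar>z ?y\<bar> * \<bar>Q ?y\<bar> * \<bar>dif p ?y\<bar> \<le> L * L * M"
    using z_bound[of ?y] Q_bound[of ?y] difM(1)[of ?y] L1 by (intro mult_mono) auto
  from mult_left_mono[OF this eps2(2)]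
  have 1: "\<bar>2 * \<epsilon>\<^sup>2 * z ?y * Q ?y * dif p ?y\<bar> \<le> 2 * (\<epsilon>\<^sup>2 * (L * L * M))"
    by (simp add: abs_mult mult_ac)
  have "\<bar>np x - avg p ?y\<bar> \<le> 2 * (\<epsilon>\<^sup>2 * (L * L * M))" using 1 by (simp add: np_def P_def tilt_def)
  then show ?thesis using avg_p[of ?y] Phi_move[OF lip2_p, of x]
    by (simp add: power2_eq_square algebra_simps abs_le_iff)
qed

lemma avg_f: "\<bar>avg f y - f y - \<epsilon>\<^sup>2 * (a y / 2)\<bar> \<le> \<Lambda> * \<epsilon> ^ 3"
  using taylor2[of "\<lambda>t. f (t, snd y)" "\<lambda>t. p (t, snd y)" "\<lambda>t. a (t, snd y)", OF grad2_deriv1[OF gf] grad2_deriv1[OF gp] x1_lip[OF al], of "fst y" \<epsilon>]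
    taylor2[of "\<lambda>t. f (t, snd y)" "\<lambda>t. p (t, snd y)" "\<lambda>t. a (t, snd y)", OF grad2_deriv1[OF gf] grad2_deriv1[OF gp] x1_lip[OF al], of "fst y" "-\<epsilon>"]
    eps
  unfolding avg_def by (simp add: abs_le_iff field_simps)

lemma z_p: "\<bar>z y - p y\<bar> \<le> M * \<epsilon>"
  using taylor1[of "\<lambda>t. f (t, snd y)" "\<lambda>t. p (t, snd y)", OF grad2_deriv1[OF gf] x1_lip[OF lip2_p], of "fst y" \<epsilon>]
    taylor1[of "\<lambda>t. f (t, snd y)" "\<lambda>t. p (t, snd y)", OF grad2_deriv1[OF gf] x1_lip[OF lip2_p], of "fst y" "-\<epsilon>"]
proof -
  assume "\<bar>f (fst y + \<epsilon>, snd y) - f (fst y, snd y) - \<epsilon> * p (fst y, snd y)\<bar> \<le> M * \<epsilon>\<^sup>2"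
    "\<bar>f (fst y + - \<epsilon>, snd y) - f (fst y, snd y) - - \<epsilon> * p (fst y, snd y)\<bar> \<le> M * (- \<epsilon>)\<^sup>2"
  then have "\<bar>(f (fst y + \<epsilon>, snd y) - f (fst y - \<epsilon>, snd y)) - 2 * \<epsilon> * p y\<bar> \<le> 2 * (M * \<epsilon>\<^sup>2)"
    by simp
  moreover have "(f (fst y + \<epsilon>, snd y) - f (fst y - \<epsilon>, snd y)) - 2 * \<epsilon> * p y = 2 * \<epsilon> * (z y - p y)"
  proof -
    have "f (fst y + \<epsilon>, snd y) - f (fst y - \<epsilon>, snd y) = 2 * \<epsilon> * z y" using eps by (simp add: z_def dif_def)
    then show ?thesis by (simp only: right_diff_distrib)
  qed
  ultimately have "2 * \<epsilon> * \<bar>z y - p y\<bar> \<le> 2 * \<epsilon> * (M * \<epsilon>)"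
    using eps by (simp add: abs_mult power2_eq_square mult_ac)
  then show ?thesis using eps by simp
qed

text \<open>Four errors add up: Taylor expansion in the first coordinate, transport of
  \<open>a\<close> along \<open>\<Phi>\<close>, Taylor expansion in the second coordinate, and
  replacement of the quotient \<open>z\<close> by \<open>p\<close>. A merely Lipschitz
  \<open>a\<close> allows order \<open>\<epsilon>\<^sup>3\<close> in the first of them, which is
  enough in the energy estimate.\<close>

lemma consistency:
  "\<bar>nf x - (f x + \<epsilon>\<^sup>2 * (a x / 2 + q x * (p x)\<^sup>2))\<bar> \<le> (\<Lambda> * (1 + L\<^sup>2) + L ^ 4 * M + 2 * L\<^sup>2 * M * (1 + L\<^sup>2)) * \<epsilon> ^ 3"
proof -
  let ?y = "\<Phi> x"
  have e34: "\<epsilon> ^ 4 \<le> \<epsilon> ^ 3" "\<epsilon>\<^sup>2 \<le> \<epsilon>" using eps eps_le(2) power_decreasing[of 3 4 \<epsilon>] power_decreasing[of 1 2 \<epsilon>] by auto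
  have 1: "\<bar>nf x - f ?y - \<epsilon>\<^sup>2 * (a ?y / 2)\<bar> \<le> \<Lambda> * \<epsilon> ^ 3" unfolding nf_def by (rule avg_f)
  have "\<epsilon>\<^sup>2 * (\<bar>a ?y - a x\<bar> / 2) \<le> \<epsilon>\<^sup>2 * (\<Lambda> * (\<epsilon>\<^sup>2 * L\<^sup>2) / 2)"
    using Phi_move[OF al, of x] eps2 by (intro mult_left_mono) auto
  also have "\<dots> = \<Lambda> * L\<^sup>2 / 2 * \<epsilon> ^ 4" by (simp add: eval_nat_numeral)
  also have "\<dots> \<le> \<Lambda> * L\<^sup>2 / 2 * \<epsilon> ^ 3" using e34 Lam by (intro mult_left_mono) auto
  finally have "\<epsilon>\<^sup>2 * (\<bar>a ?y - a x\<bar> / 2) \<le> \<Lambda> * L\<^sup>2 / 2 * \<epsilon> ^ 3" .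
  moreover have "\<bar>\<epsilon>\<^sup>2 * (a ?y / 2) - \<epsilon>\<^sup>2 * (a x / 2)\<bar> = \<epsilon>\<^sup>2 * (\<bar>a ?y - a x\<bar> / 2)"
    using eps2 by (simp add: right_diff_distrib[symmetric] diff_divide_distrib[symmetric] abs_mult)
  ultimately have 2: "\<bar>\<epsilon>\<^sup>2 * (a ?y / 2) - \<epsilon>\<^sup>2 * (a x / 2)\<bar> \<le> \<Lambda> * L\<^sup>2 / 2 * \<epsilon> ^ 3" by simp
  have 3: "\<bar>f ?y - f x - q x * R ?y\<bar> \<le> L ^ 4 * M * \<epsilon> ^ 3"
  proof -
    have l: "\<bar>q (fst x, s) - q (fst x, t)\<bar> \<le> M * \<bar>s - t\<bar>" for s t
      using lip2D[OF lip2_q, of "(fst x, s)" "(fst x, t)"] by simp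
    have "\<bar>f (fst x, snd x + R ?y) - f (fst x, snd x) - R ?y * q (fst x, snd x)\<bar> \<le> M * (R ?y)\<^sup>2"
      by (rule taylor1[OF grad2_deriv2[OF gf] l])
    moreover have "(fst x, snd x + R ?y) = ?y" using Phi_snd[of x] by (simp add: prod_eq_iff)
    ultimately have "\<bar>f ?y - f x - q x * R ?y\<bar> \<le> M * (R ?y)\<^sup>2" by (simp add: mult.commute)
    also have "\<dots> \<le> M * (\<epsilon>\<^sup>2 * L\<^sup>2)\<^sup>2"
      using R_le(1)[of ?y] M0 by (intro mult_left_mono) (auto simp: abs_le_square_iff[symmetric])
    also have "\<dots> = L ^ 4 * M * \<epsilon> ^ 4" by (simp add: power_mult_distrib)
    also have "\<dots> \<le> L ^ 4 * M * \<epsilon> ^ 3" using e34 M0 by (intro mult_left_mono) auto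
    finally show ?thesis .
  qed
  have 4: "\<bar>q x * R ?y - \<epsilon>\<^sup>2 * (q x * (p x)\<^sup>2)\<bar> \<le> 2 * L\<^sup>2 * M * (1 + L\<^sup>2) * \<epsilon> ^ 3"
  proof -
    have "\<bar>p ?y - p x\<bar> \<le> M * (\<epsilon>\<^sup>2 * L\<^sup>2)" by (rule Phi_move[OF lip2_p])
    also have "\<dots> \<le> M * (\<epsilon> * L\<^sup>2)" using e34 M0 by (intro mult_left_mono mult_right_mono) auto
    finally have "\<bar>z ?y - p x\<bar> \<le> M * (1 + L\<^sup>2) * \<epsilon>" using z_p[of ?y] by (simp add: algebra_simps)
    moreover have "\<bar>z ?y + p x\<bar> \<le> 2 * L" using z_bound[of ?y] pL[of x] by linarith
    ultimately have "\<bar>z ?y - p x\<bar> * \<bar>z ?y + p x\<bar> \<le> (M * (1 + L\<^sup>2) * \<epsilon>) * (2 * L)"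
      using L1 M0 eps by (intro mult_mono) auto
    then have "\<bar>q x\<bar> * (\<bar>z ?y - p x\<bar> * \<bar>z ?y + p x\<bar>) \<le> L * ((M * (1 + L\<^sup>2) * \<epsilon>) * (2 * L))"
      by (rule mult_mono[OF qL]) (use L1 in auto)
    from mult_left_mono[OF this eps2(2)]
    have "\<epsilon>\<^sup>2 * (\<bar>q x\<bar> * (\<bar>z ?y - p x\<bar> * \<bar>z ?y + p x\<bar>)) \<le> 2 * L\<^sup>2 * M * (1 + L\<^sup>2) * \<epsilon> ^ 3"
      by (simp add: power2_eq_square power3_eq_cube mult_ac)
    moreover have "q x * R ?y - \<epsilon>\<^sup>2 * (q x * (p x)\<^sup>2) = \<epsilon>\<^sup>2 * (q x * ((z ?y - p x) * (z ?y + p x)))"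
      by (simp add: R_def power2_eq_square algebra_simps)
    ultimately show ?thesis by (simp add: abs_mult)
  qed
  have "\<Lambda> * L\<^sup>2 / 2 * \<epsilon> ^ 3 \<le> \<Lambda> * L\<^sup>2 * \<epsilon> ^ 3" using Lam eps by simp
  moreover have "nf x - (f x + \<epsilon>\<^sup>2 * (a x / 2 + q x * (p x)\<^sup>2)) =
     (nf x - f ?y - \<epsilon>\<^sup>2 * (a ?y / 2)) + (\<epsilon>\<^sup>2 * (a ?y / 2) - \<epsilon>\<^sup>2 * (a x / 2)) + (f ?y - f x - q x * R ?y)
     + (q x * R ?y - \<epsilon>\<^sup>2 * (q x * (p x)\<^sup>2))" by (simp add: algebra_simps)
  ultimately have "\<bar>nf x - (f x + \<epsilon>\<^sup>2 * (a x / 2 + q x * (p x)\<^sup>2))\<bar> \<le>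
    \<Lambda> * \<epsilon> ^ 3 + \<Lambda> * L\<^sup>2 * \<epsilon> ^ 3 + L ^ 4 * M * \<epsilon> ^ 3 + 2 * L\<^sup>2 * M * (1 + L\<^sup>2) * \<epsilon> ^ 3"
    using 1 2 3 4 by linarith
  then show ?thesis by (simp only: distrib_right distrib_left mult_1_right mult_1_left mult.assoc add.assoc)
qed

end
end

section \<open>Uniform bounds along the scheme\<close>

text \<open>A level collects a value function with its first derivatives \<open>p, q\<close> and second derivatives
  \<open>a, b, c\<close>.\<close>

type_synonym level = "field2 \<times> field2 \<times> field2 \<times> field2 \<times> field2 \<times> field2"

definition barrier :: "real \<Rightarrow> real \<Rightarrow> field2 \<Rightarrow> field2 \<Rightarrow> field2 \<Rightarrow> bool" where
  "barrier L E p q F \<longleftrightarrow> (\<forall>x. \<bar>F x\<bar> \<le> E * (2 * L\<^sup>2 + 1 - (p x)\<^sup>2 - (q x)\<^sup>2))"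

fun regular :: "real \<Rightarrow> real \<Rightarrow> real \<Rightarrow> level \<Rightarrow> bool" where
  "regular L E \<Lambda> (f, p, q, a, b, c) \<longleftrightarrow>
    grad2 f p q \<and> grad2 p a b \<and> grad2 q b c \<and> (\<forall>x. \<bar>p x\<bar> \<le> L) \<and> (\<forall>x. \<bar>q x\<bar> \<le> L) \<and>
    barrier L E p q a \<and> barrier L E p q b \<and> barrier L E p q c \<and>
    lip2 \<Lambda> a \<and> lip2 \<Lambda> b \<and> lip2 \<Lambda> c"

text \<open>The first clause is the discrete equation, the second the time increment of the
  derivative. The third stores \<open>positivity_step\<close> as a property of all profiles
  \<open>N\<close>, so that later arguments need neither \<open>\<Phi>\<close> nor
  \<open>\<theta>\<close>.\<close>

fun linked :: "real \<Rightarrow> real \<Rightarrow> real \<Rightarrow> level \<Rightarrow>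
    level \<Rightarrow> bool" where
  "linked L C \<epsilon> (f, p, q, a, b, c) (f', p', q', a', b', c') \<longleftrightarrow>
    (\<forall>x. \<bar>f' x - (f x + \<epsilon>\<^sup>2 * (a x / 2 + q x * (p x)\<^sup>2))\<bar> \<le> C * \<epsilon> ^ 3) \<and>
    (\<forall>x. \<bar>p' x - p x\<bar> \<le> C * \<epsilon>\<^sup>2) \<and>
    (\<forall>k N. 0 \<le> k \<longrightarrow> (\<forall>x. k * (N (fst x))\<^sup>2 \<le> p x) \<longrightarrow>
       (\<forall>x. k * (1 - 4 * L ^ 4 * \<epsilon>\<^sup>2) * ((N (fst x + \<epsilon>) + N (fst x - \<epsilon>)) / 2)\<^sup>2 \<le> p' x))"

lemma barrier_bound:
  assumes "barrier L E p q F" "0 \<le> E"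
  shows "\<bar>F x\<bar> \<le> E * (2 * L\<^sup>2 + 1)"
proof -
  have "E * (2 * L\<^sup>2 + 1 - (p x)\<^sup>2 - (q x)\<^sup>2) \<le> E * (2 * L\<^sup>2 + 1)"
    using assms(2) by (intro mult_left_mono) auto
  then show ?thesis using assms(1) unfolding barrier_def by (metis order_trans)
qed

lemma regular_step:
  fixes L E M K \<Lambda> \<epsilon> C :: real
  defines "lam \<equiv> 196 * (L * (2 * L\<^sup>2 + 1))\<^sup>2"
  assumes D: "regular L E \<Lambda> D" and L: "1 \<le> L" and E: "32 * L ^ 3 \<le> E" "E * (2 * L\<^sup>2 + 1) \<le> M"
    and Lam: "0 \<le> \<Lambda>" and K: "2 \<le> K" "L \<le> K" "M \<le> K"
    and ep: "0 < \<epsilon>" "8 * \<epsilon> * L\<^sup>2 \<le> 1" "\<epsilon>\<^sup>2 * K ^ 400 \<le> 1"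
    and C: "\<Lambda> + 3 * L\<^sup>2 * M \<le> C" "\<Lambda> * (1 + L\<^sup>2) + L ^ 4 * M + 2 * L\<^sup>2 * M * (1 + L\<^sup>2) \<le> C"
  shows "\<exists>D'. regular L (E * (1 + lam * \<epsilon>\<^sup>2)) ((1 + \<epsilon>\<^sup>2 * K ^ 400) * (1 + \<Lambda>) - 1) D' \<and> linked L C \<epsilon> D D'"
proof -
  obtain f p q a b c where D_eq: "D = (f, p, q, a, b, c)" by (metis prod_cases6)
  have g: "grad2 f p q" "grad2 p a b" "grad2 q b c" and pq: "\<And>x. \<bar>p x\<bar> \<le> L" "\<And>x. \<bar>q x\<bar> \<le> L"
    and bar: "barrier L E p q a" "barrier L E p q b" "barrier L E p q c"
    and lip: "lip2 \<Lambda> a" "lip2 \<Lambda> b" "lip2 \<Lambda> c"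
    using D unfolding D_eq regular.simps by blast+
  have E0: "0 \<le> E" using E(1) L one_le_power[of L 3] by linarith
  interpret binomial_step f p q a b c \<epsilon> L
    by unfold_locales (fact g pq L ep)+
  have M: "\<bar>a x\<bar> \<le> M" "\<bar>b x\<bar> \<le> M" "\<bar>c x\<bar> \<le> M" for x
    using bar[THEN barrier_bound, OF E0, of x] E(2) by linarith+
  note bar' = bar[unfolded barrier_def, rule_format]
  have "regular L (E * (1 + lam * \<epsilon>\<^sup>2)) ((1 + \<epsilon>\<^sup>2 * K ^ 400) * (1 + \<Lambda>) - 1) (nf, np, nq, na, nb, nc)"
    unfolding regular.simps
  proof (intro conjI allI)
    show "grad2 nf np nq" "grad2 np na nb" "grad2 nq nb nc"
      by (rule grad2_nf grad2_np grad2_nq)+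
    show "\<bar>np x\<bar> \<le> L" "\<bar>nq x\<bar> \<le> L" for x
      unfolding np_def nq_def by (rule P_bound Q_bound)+
    show "barrier L (E * (1 + lam * \<epsilon>\<^sup>2)) np nq na" "barrier L (E * (1 + lam * \<epsilon>\<^sup>2)) np nq nb"
      "barrier L (E * (1 + lam * \<epsilon>\<^sup>2)) np nq nc"
      unfolding barrier_def na_def nb_def nc_def np_def nq_def lam_def
      by (intro allI barrier_step[OF bar' E(1)])+
    show "lip2 ((1 + \<epsilon>\<^sup>2 * K ^ 400) * (1 + \<Lambda>) - 1) na" "lip2 ((1 + \<epsilon>\<^sup>2 * K ^ 400) * (1 + \<Lambda>) - 1) nb"
      "lip2 ((1 + \<epsilon>\<^sup>2 * K ^ 400) * (1 + \<Lambda>) - 1) nc"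
      by (rule new_lips[OF K Lam M lip ep(3)])+
  qed
  moreover have "linked L C \<epsilon> D (nf, np, nq, na, nb, nc)"
    unfolding D_eq linked.simps
  proof (intro conjI allI impI)
    fix x
    have "(\<Lambda> * (1 + L\<^sup>2) + L ^ 4 * M + 2 * L\<^sup>2 * M * (1 + L\<^sup>2)) * \<epsilon> ^ 3 \<le> C * \<epsilon> ^ 3"
      using C(2) ep(1) by (intro mult_right_mono) auto
    then show "\<bar>nf x - (f x + \<epsilon>\<^sup>2 * (a x / 2 + q x * (p x)\<^sup>2))\<bar> \<le> C * \<epsilon> ^ 3"
      using consistency[OF K Lam M lip, of x] by linarith
    have "(\<Lambda> + 3 * L\<^sup>2 * M) * \<epsilon>\<^sup>2 \<le> C * \<epsilon>\<^sup>2"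
      using C(1) by (intro mult_right_mono) auto
    then show "\<bar>np x - p x\<bar> \<le> C * \<epsilon>\<^sup>2"
      using time_step[OF K Lam M lip, of x] by linarith
  next
    fix k :: real and N :: "real \<Rightarrow> real" and x :: "real \<times> real"
    assume "0 \<le> k" "\<forall>x. k * (N (fst x))\<^sup>2 \<le> p x"
    then show "k * (1 - 4 * L ^ 4 * \<epsilon>\<^sup>2) * ((N (fst x + \<epsilon>) + N (fst x - \<epsilon>)) / 2)\<^sup>2 \<le> np x"
      by (intro positivity_step) blast+
  qed
  ultimately show ?thesis by blast
qed

lemma power_exp_bound:
  assumes "0 \<le> l" "real j * h \<le> 1" "0 \<le> h"
  shows "(1 + l * h) ^ j \<le> exp l"
proof -
  have "(1 + l * h) ^ j \<le> exp (l * h) ^ j"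
    using assms by (intro power_mono) auto
  also have "\<dots> = exp (l * (real j * h))" by (simp add: exp_of_nat_mult[symmetric] mult_ac)
  also have "\<dots> \<le> exp (l * 1)" using assms by (subst exp_le_cancel_iff) (intro mult_left_mono, auto)
  finally show ?thesis by simp
qed

lemma binomial_scheme:
  assumes D0: "regular L E0 \<Lambda>0 D0" and L: "1 \<le> L" and E0: "32 * L ^ 3 \<le> E0" and L0: "0 \<le> \<Lambda>0"
  obtains C n0 where "0 < C"
    "\<And>n. n0 \<le> n \<Longrightarrow> \<exists>S. S 0 = D0 \<and>
       (\<forall>j\<le>n. regular L C C (S j)) \<and> (\<forall>j<n. linked L C (1 / sqrt (real n)) (S j) (S (Suc j)))"
proof -
  \<comment> \<open>The constants are fixed in an order without circularity: the growth rate
    \<open>lam\<close> of the weighted bound depends on \<open>L\<close> only and gives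
    \<open>E1\<close>; this gives the Hessian bound \<open>M\<close>, then \<open>K\<close>, and
    only then the growth rate \<open>N\<close> of the Lipschitz constants. None depends on
    \<open>n\<close>.\<close>
  define lam where "lam = 196 * (L * (2 * L\<^sup>2 + 1))\<^sup>2"
  define E1 where "E1 = E0 * exp lam"
  define M where "M = E1 * (2 * L\<^sup>2 + 1)"
  define K where "K = 2 + L + M"
  define N where "N = K ^ 400"
  define \<Lambda>1 where "\<Lambda>1 = (1 + \<Lambda>0) * exp N"
  define C where "C = 1 + E1 + \<Lambda>1 + \<Lambda>1 + 3 * L\<^sup>2 * M + (\<Lambda>1 * (1 + L\<^sup>2) + L ^ 4 * M + 2 * L\<^sup>2 * M * (1 + L\<^sup>2))"
  have E00: "0 \<le> E0" using E0 L one_le_power[of L 3] by linarith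
  have lam0: "0 \<le> lam" by (simp add: lam_def)
  have E1: "0 \<le> E1" using E00 by (simp add: E1_def)
  have M0: "0 \<le> M" using E1 by (simp add: M_def)
  have K: "2 \<le> K" "L \<le> K" "M \<le> K" using L M0 by (auto simp: K_def)
  have N0: "0 \<le> N" using K by (simp add: N_def)
  have L10: "0 \<le> \<Lambda>1" using L0 by (simp add: \<Lambda>1_def)
  have nn: "0 \<le> 3 * L\<^sup>2 * M" "0 \<le> \<Lambda>1 * (1 + L\<^sup>2)" "0 \<le> L ^ 4 * M" "0 \<le> 2 * L\<^sup>2 * M * (1 + L\<^sup>2)"
    using M0 L10 by simp_all
  have C: "0 < C" "E1 \<le> C" "\<Lambda>1 \<le> C" "\<Lambda>1 + 3 * L\<^sup>2 * M \<le> C"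
    "\<Lambda>1 * (1 + L\<^sup>2) + L ^ 4 * M + 2 * L\<^sup>2 * M * (1 + L\<^sup>2) \<le> C"
    using E1 L10 nn unfolding C_def by linarith+
  \<comment> \<open>The two summands secure \<open>\<epsilon>\<^sup>2 K ^ 400 \<le> 1\<close> and
    \<open>8 \<epsilon> L\<^sup>2 \<le> 1\<close>.\<close>
  define n0 where "n0 = nat \<lceil>N + (8 * L\<^sup>2)\<^sup>2\<rceil> + 1"
  have "\<exists>S. S 0 = D0 \<and> (\<forall>j\<le>n. regular L C C (S j)) \<and> (\<forall>j<n. linked L C (1 / sqrt (real n)) (S j) (S (Suc j)))"
    if n: "n0 \<le> n" for n
  proof -
    define \<epsilon> where "\<epsilon> = 1 / sqrt (real n)"
    have n': "N + (8 * L\<^sup>2)\<^sup>2 \<le> real n" "0 < n" using n unfolding n0_def by linarith+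
    have eps: "0 < \<epsilon>" "\<epsilon>\<^sup>2 = 1 / real n" using n' by (auto simp: \<epsilon>_def power_divide)
    have "\<epsilon>\<^sup>2 * K ^ 400 \<le> 1" using n' unfolding eps(2) N_def[symmetric]
      using order_trans[of N "N + (8 * L\<^sup>2)\<^sup>2" "real n"] by simp
    moreover have "8 * \<epsilon> * L\<^sup>2 \<le> 1"
    proof -
      have "8 * L\<^sup>2 \<le> sqrt (real n)" using n' N0 by (intro real_le_rsqrt) linarith
      then show ?thesis using n' by (simp add: \<epsilon>_def field_simps)
    qed
    ultimately have eps': "8 * \<epsilon> * L\<^sup>2 \<le> 1" "\<epsilon>\<^sup>2 * K ^ 400 \<le> 1" by auto
    \<comment> \<open>The construction carries bounds that grow geometrically with the step index;
      \<open>n \<epsilon>\<^sup>2 = 1\<close> keeps them below \<open>E1\<close> and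
      \<open>\<Lambda>1\<close> up to \<open>j = n\<close>, after which a single \<open>C\<close>
      replaces them.\<close>
    define Ej where "Ej j = E0 * (1 + lam * \<epsilon>\<^sup>2) ^ j" for j
    define Lj where "Lj j = (1 + N * \<epsilon>\<^sup>2) ^ j * (1 + \<Lambda>0) - 1" for j
    have Ej: "E0 \<le> Ej j" "j \<le> n \<Longrightarrow> Ej j \<le> E1" for j
    proof -
      show "E0 \<le> Ej j" unfolding Ej_def using E00 lam0 one_le_power[of "1 + lam * \<epsilon>\<^sup>2" j]
          mult_left_mono[of 1 "(1 + lam * \<epsilon>\<^sup>2) ^ j" E0] by simp
      assume "j \<le> n"
      then have "(1 + lam * \<epsilon>\<^sup>2) ^ j \<le> exp lam"
        using n' lam0 by (intro power_exp_bound) (auto simp: eps(2))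
      then show "Ej j \<le> E1" unfolding Ej_def E1_def using E00 by (intro mult_left_mono)
    qed
    have Lj: "0 \<le> Lj j" "j \<le> n \<Longrightarrow> Lj j \<le> \<Lambda>1" for j
    proof -
      have "1 * 1 \<le> (1 + N * \<epsilon>\<^sup>2) ^ j * (1 + \<Lambda>0)"
        using L0 N0 by (intro mult_mono one_le_power) auto
      then show "0 \<le> Lj j" by (simp add: Lj_def)
      assume "j \<le> n"
      then have "(1 + N * \<epsilon>\<^sup>2) ^ j \<le> exp N"
        using n' N0 by (intro power_exp_bound) (auto simp: eps(2))
      then have "(1 + N * \<epsilon>\<^sup>2) ^ j * (1 + \<Lambda>0) \<le> exp N * (1 + \<Lambda>0)" using L0 by (intro mult_right_mono) auto
      then show "Lj j \<le> \<Lambda>1" unfolding Lj_def \<Lambda>1_def by (simp add: mult_ac)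
    qed
    have "\<exists>S. \<forall>j. ((j = 0 \<longrightarrow> S j = D0) \<and> (j \<le> n \<longrightarrow> regular L (Ej j) (Lj j) (S j))) \<and>
        (j < n \<longrightarrow> linked L C \<epsilon> (S j) (S (Suc j)))"
    proof (rule dependent_nat_choice)
      show "\<exists>D. (0 = 0 \<longrightarrow> D = D0) \<and> (0 \<le> n \<longrightarrow> regular L (Ej 0) (Lj 0) D)"
        using D0 by (auto simp: Ej_def Lj_def)
      fix D j assume IH: "(j = 0 \<longrightarrow> D = D0) \<and> (j \<le> n \<longrightarrow> regular L (Ej j) (Lj j) D)"
      show "\<exists>D'. ((Suc j = 0 \<longrightarrow> D' = D0) \<and> (Suc j \<le> n \<longrightarrow> regular L (Ej (Suc j)) (Lj (Suc j)) D')) \<and>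
          (j < n \<longrightarrow> linked L C \<epsilon> D D')"
      proof (cases "j < n")
        case True
        have j: "j \<le> n" using True by simp
        have "\<exists>D'. regular L (Ej j * (1 + lam * \<epsilon>\<^sup>2)) ((1 + \<epsilon>\<^sup>2 * K ^ 400) * (1 + Lj j) - 1) D' \<and> linked L C \<epsilon> D D'"
          unfolding lam_def
        proof (rule regular_step[where M=M and K=K])
          show "regular L (Ej j) (Lj j) D" using IH j by blast
          show "32 * L ^ 3 \<le> Ej j" using E0 Ej(1)[of j] by linarith
          show "Ej j * (2 * L\<^sup>2 + 1) \<le> M" unfolding M_def using Ej(2)[OF j] by (intro mult_right_mono) auto
          have le: "Lj j \<le> \<Lambda>1" by (rule Lj(2)[OF j])
          show "Lj j + 3 * L\<^sup>2 * M \<le> C" using le C by linarith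
          have "Lj j * (1 + L\<^sup>2) \<le> \<Lambda>1 * (1 + L\<^sup>2)" using le by (intro mult_right_mono) auto
          then show "Lj j * (1 + L\<^sup>2) + L ^ 4 * M + 2 * L\<^sup>2 * M * (1 + L\<^sup>2) \<le> C" using C(5) by linarith
        qed (fact L Lj(1) K eps eps')+
        moreover have "Ej j * (1 + lam * \<epsilon>\<^sup>2) = Ej (Suc j)" by (simp add: Ej_def)
        moreover have "(1 + \<epsilon>\<^sup>2 * K ^ 400) * (1 + Lj j) - 1 = Lj (Suc j)" by (simp add: Lj_def N_def mult_ac)
        ultimately show ?thesis by (metis nat.distinct(1))
      qed auto
    qed
    then obtain S where S: "\<And>j. j = 0 \<longrightarrow> S j = D0" "\<And>j. j \<le> n \<longrightarrow> regular L (Ej j) (Lj j) (S j)"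
      "\<And>j. j < n \<longrightarrow> linked L C \<epsilon> (S j) (S (Suc j))" by metis
    have "regular L C C (S j)" if "j \<le> n" for j
    proof -
      obtain f p q a b c where S_eq: "S j = (f, p, q, a, b, c)" by (metis prod_cases6)
      have G: "regular L (Ej j) (Lj j) (S j)" using S(2) that by blast
      have le: "Ej j \<le> C" "Lj j \<le> C" using Ej(2)[OF that] Lj(2)[OF that] C by linarith+
      have pq: "(p x)\<^sup>2 \<le> L\<^sup>2" "(q x)\<^sup>2 \<le> L\<^sup>2" for x
      proof -
        have "\<bar>p x\<bar> \<le> L" "\<bar>q x\<bar> \<le> L" using G unfolding S_eq regular.simps by blast+
        then show "(p x)\<^sup>2 \<le> L\<^sup>2" "(q x)\<^sup>2 \<le> L\<^sup>2" using L by (auto intro!: abs_le_square_iff[THEN iffD1])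
      qed
      have bm: "barrier L C p q F" if "barrier L (Ej j) p q F" for F
        unfolding barrier_def
      proof
        fix x
        have "0 \<le> 2 * L\<^sup>2 + 1 - (p x)\<^sup>2 - (q x)\<^sup>2" using pq[of x] by linarith
        then have "Ej j * (2 * L\<^sup>2 + 1 - (p x)\<^sup>2 - (q x)\<^sup>2) \<le> C * (2 * L\<^sup>2 + 1 - (p x)\<^sup>2 - (q x)\<^sup>2)"
          using le by (intro mult_right_mono)
        then show "\<bar>F x\<bar> \<le> C * (2 * L\<^sup>2 + 1 - (p x)\<^sup>2 - (q x)\<^sup>2)"
          using that unfolding barrier_def by (meson order_trans)
      qed
      show ?thesis using G bm lip2_mono[OF _ le(2)] unfolding S_eq regular.simps by blast
    qed
    then show ?thesis using S(1,3) unfolding \<epsilon>_def by blast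
  qed
  with C(1) show ?thesis by (rule that)
qed

section \<open>Lower bounds for random walk averages\<close>

fun walk :: "real \<Rightarrow> (real \<Rightarrow> real) \<Rightarrow> nat \<Rightarrow> real \<Rightarrow> real" where
  "walk \<epsilon> \<phi> 0 x = \<phi> x"
| "walk \<epsilon> \<phi> (Suc j) x = (walk \<epsilon> \<phi> j (x + \<epsilon>) + walk \<epsilon> \<phi> j (x - \<epsilon>)) / 2"

lemma walk_nonneg: "(\<And>x. 0 \<le> \<phi> x) \<Longrightarrow> 0 \<le> walk \<epsilon> \<phi> j x"
  by (induction j arbitrary: x) auto

lemma one_minus_ge_exp: "0 \<le> y \<Longrightarrow> y \<le> 1/2 \<Longrightarrow> exp (- 2 * y) \<le> 1 - (y::real)"
proof -
  assume y: "0 \<le> y" "y \<le> 1/2"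
  have "0 \<le> y * (1 - 2 * y)" using y by simp
  then have "1 \<le> (1 - y) * (1 + 2 * y)" by (simp add: algebra_simps)
  also have "\<dots> \<le> (1 - y) * exp (2 * y)"
    using exp_ge_add_one_self[of "2 * y"] y by (intro mult_left_mono) auto
  finally have "exp (- (2 * y)) * 1 \<le> exp (- (2 * y)) * ((1 - y) * exp (2 * y))"
    by (intro mult_left_mono) auto
  also have "\<dots> = (1 - y) * (exp (- (2 * y)) * exp (2 * y))" by (simp only: mult_ac)
  also have "exp (- (2 * y)) * exp (2 * y) = 1" by (simp only: exp_add[symmetric]) simp
  finally show ?thesis by simp
qed

lemma one_minus_power_ge:
  assumes "0 \<le> l" "l / real n \<le> 1/2" "j \<le> n" "0 < n"
  shows "exp (- 2 * l) \<le> (1 - l / real n) ^ j"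
proof -
  have "real j * (l / real n) \<le> real n * (l / real n)" using assms by (intro mult_right_mono) auto
  also have "\<dots> = l" using assms by simp
  finally have "- 2 * l \<le> real j * (- 2 * (l / real n))" by (simp only: mult.left_commute[of "real j"])
  then have "exp (- 2 * l) \<le> exp (real j * (- 2 * (l / real n)))" by (simp only: exp_le_cancel_iff)
  also have "\<dots> = exp (- 2 * (l / real n)) ^ j" by (rule exp_of_nat_mult)
  also have "\<dots> \<le> (1 - l / real n) ^ j"
    by (rule power_mono[OF one_minus_ge_exp]) (use assms in auto)
  finally show ?thesis .
qed

lemma cos_ge_one_minus_square: "1 - x\<^sup>2 / 2 \<le> cos (x::real)"
proof -
  have "\<bar>sin (x / 2)\<bar> \<le> \<bar>x / 2\<bar>" by (rule abs_sin_x_le_abs_x)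
  then have "(sin (x / 2))\<^sup>2 \<le> (x / 2)\<^sup>2" by (rule abs_le_square_iff[THEN iffD1])
  moreover have "cos x = 1 - 2 * (sin (x / 2))\<^sup>2" using cos_double_sin[of "x / 2"] by simp
  ultimately show ?thesis unfolding power_divide by simp
qed

text \<open>\<open>cos (k (x - x0))\<close> is an eigenfunction of the two-point average with
  eigenvalue \<open>cos (k \<epsilon>)\<close>; it is positive inside radius \<open>R\<close> and
  nonpositive from \<open>R\<close> to \<open>3 R\<close>. One step from inside reaches at most
  radius \<open>2 R\<close>, and in the outer ring the trivial bound \<open>0\<close> suffices, so
  the induction closes.\<close>

lemma walk_ge_inner:
  assumes \<phi>: "\<And>x. 0 \<le> \<phi> x" "\<And>x. \<bar>x - x0\<bar> \<le> R \<Longrightarrow> m \<le> \<phi> x" and m: "0 < m"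
    and k: "0 < k" "k * R = pi / 2" and eps: "0 < \<epsilon>" "\<epsilon> \<le> R"
  shows "\<bar>x - x0\<bar> \<le> 3 * R \<Longrightarrow> m * cos (k * \<epsilon>) ^ j * cos (k * (x - x0)) \<le> walk \<epsilon> \<phi> j x"
proof (induction j arbitrary: x)
  have ke: "0 \<le> cos (k * \<epsilon>)"
  proof (rule cos_ge_zero)
    have "0 \<le> k * \<epsilon>" using eps k by simp
    then show "- (pi / 2) \<le> k * \<epsilon>" using pi_ge_zero by linarith
    show "k * \<epsilon> \<le> pi / 2" using mult_left_mono[OF eps(2), of k] k by simp
  qed
  have outer: "cos (k * (x - x0)) \<le> 0" if "R \<le> \<bar>x - x0\<bar>" "\<bar>x - x0\<bar> \<le> 3 * R" for x
  proof -
    define y where "y = k * \<bar>x - x0\<bar>"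
    have "cos (k * (x - x0)) = cos \<bar>k * (x - x0)\<bar>" by (rule cos_abs_real[symmetric])
    also have "\<bar>k * (x - x0)\<bar> = y" using k by (simp add: abs_mult y_def)
    also have "cos y = - cos (y - pi)" by (simp add: cos_diff)
    finally have 1: "cos (k * (x - x0)) = - cos (y - pi)" .
    have "k * R \<le> y" unfolding y_def using that k by (intro mult_left_mono) auto
    moreover have "y \<le> k * (3 * R)" unfolding y_def using that k by (intro mult_left_mono) auto
    moreover have "k * (3 * R) = 3 * (pi / 2)" unfolding k(2)[symmetric] by simp
    ultimately have "0 \<le> cos (y - pi)" using k by (intro cos_ge_zero) linarith+
    then show ?thesis using 1 by simp
  qed
  {
    case 0
    show ?case
    proof (cases "\<bar>x - x0\<bar> \<le> R")
      case True
      have "m * cos (k * (x - x0)) \<le> m * 1" using m by (intro mult_left_mono) auto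
      then show ?thesis using \<phi>(2)[OF True] by simp
    next
      case False
      then have "m * cos (k * (x - x0)) \<le> 0"
        by (intro mult_nonneg_nonpos outer less_imp_le[OF m]) (use 0 in linarith)+
      then show ?thesis using \<phi>(1)[of x] by simp
    qed
  next
    case (Suc j)
    show ?case
    proof (cases "\<bar>x - x0\<bar> \<le> R")
      case True
      let ?c = "m * cos (k * \<epsilon>) ^ j"
      have 1: "?c * cos (k * (x + \<epsilon> - x0)) \<le> walk \<epsilon> \<phi> j (x + \<epsilon>)"
        by (rule Suc.IH) (use True eps in linarith)
      have 2: "?c * cos (k * (x - \<epsilon> - x0)) \<le> walk \<epsilon> \<phi> j (x - \<epsilon>)"
        by (rule Suc.IH) (use True eps in linarith)
      have e: "k * (x + \<epsilon> - x0) = k * (x - x0) + k * \<epsilon>" "k * (x - \<epsilon> - x0) = k * (x - x0) - k * \<epsilon>"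
        by (simp_all add: algebra_simps)
      have "?c * cos (k * (x + \<epsilon> - x0)) + ?c * cos (k * (x - \<epsilon> - x0))
          = 2 * (m * cos (k * \<epsilon>) ^ Suc j * cos (k * (x - x0)))"
        unfolding e cos_add cos_diff by (simp add: algebra_simps)
      then show ?thesis using 1 2 by simp
    next
      case False
      then have "m * cos (k * \<epsilon>) ^ Suc j * cos (k * (x - x0)) \<le> 0"
        by (intro mult_nonneg_nonpos outer mult_nonneg_nonneg zero_le_power ke less_imp_le[OF m])
           (use Suc.prems in linarith)+
      then show ?thesis using walk_nonneg[of \<phi> \<epsilon> "Suc j" x, OF \<phi>(1)] by linarith
    qed
  }
qed

text \<open>Outside a neighbourhood of \<open>x0\<close>, an exponential front travelling at speed \<open>\<mu> / 4\<close> is a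
  subsolution, so mass that sits near \<open>x0\<close> reaches every point.\<close>

lemma walk_ge_outer:
  assumes inner: "\<And>i x. i \<le> n \<Longrightarrow> \<bar>x - x0\<bar> \<le> r \<Longrightarrow> c * exp (\<mu> * (r + \<mu> / 4)) \<le> walk \<epsilon> \<phi> i x"
    and \<phi>: "\<And>x. 0 \<le> \<phi> x" and c: "0 < c" and r: "\<epsilon> \<le> r" and mu: "0 < \<mu>"
    and eps: "0 < \<epsilon>" "\<epsilon>\<^sup>2 * real n \<le> 1" "\<mu> * \<epsilon> \<le> 1"
  shows "j \<le> n \<Longrightarrow> c * (exp (- \<mu> * (\<bar>x - x0\<bar> - r - \<mu> / 4 * (\<epsilon>\<^sup>2 * real j))) - 1) \<le> walk \<epsilon> \<phi> j x"
proof (induction j arbitrary: x)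
  have ins: "c * (exp (- \<mu> * (\<bar>x - x0\<bar> - r - \<mu> / 4 * (\<epsilon>\<^sup>2 * real j))) - 1) \<le> walk \<epsilon> \<phi> j x"
    if "j \<le> n" "\<bar>x - x0\<bar> \<le> r" for x j
  proof -
    have "\<epsilon>\<^sup>2 * real j \<le> \<epsilon>\<^sup>2 * real n" using that by (intro mult_left_mono) auto
    then have "\<epsilon>\<^sup>2 * real j \<le> 1" using eps(2) by linarith
    then have "\<mu> / 4 * (\<epsilon>\<^sup>2 * real j) \<le> \<mu> / 4 * 1" using mu by (intro mult_left_mono) auto
    then have "- \<mu> * (\<bar>x - x0\<bar> - r - \<mu> / 4 * (\<epsilon>\<^sup>2 * real j)) \<le> \<mu> * (r + \<mu> / 4)"
    proof -
      have "- (\<bar>x - x0\<bar> - r - \<mu> / 4 * (\<epsilon>\<^sup>2 * real j)) \<le> r + \<mu> / 4"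
        using \<open>\<mu> / 4 * (\<epsilon>\<^sup>2 * real j) \<le> \<mu> / 4 * 1\<close> abs_ge_zero[of "x - x0"] by linarith
      from mult_left_mono[OF this, of \<mu>] show ?thesis using mu by (simp only: mult_minus_left mult_minus_right less_imp_le)
    qed
    then have "exp (- \<mu> * (\<bar>x - x0\<bar> - r - \<mu> / 4 * (\<epsilon>\<^sup>2 * real j))) \<le> exp (\<mu> * (r + \<mu> / 4))"
      by (simp only: exp_le_cancel_iff)
    then have "c * (exp (- \<mu> * (\<bar>x - x0\<bar> - r - \<mu> / 4 * (\<epsilon>\<^sup>2 * real j))) - 1) \<le> c * exp (\<mu> * (r + \<mu> / 4))"
      by (intro mult_left_mono[OF _ less_imp_le[OF c]]) linarith
    then show ?thesis using inner[OF that] by linarith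
  qed
  {
    case 0
    show ?case
    proof (cases "\<bar>x - x0\<bar> \<le> r")
      case True then show ?thesis using ins[of 0 x] by simp
    next
      case False
      \<comment> \<open>The subtracted \<open>1\<close> makes the claimed bound nonpositive outside
        the neighbourhood at time zero, where nothing but \<open>0 \<le> \<phi>\<close> is
        known.\<close>
      have "exp (- \<mu> * (\<bar>x - x0\<bar> - r)) \<le> 1" using False mu by simp
      then have "c * (exp (- \<mu> * (\<bar>x - x0\<bar> - r)) - 1) \<le> 0" using c by (intro mult_nonneg_nonpos) auto
      then show ?thesis using \<phi>[of x] by simp
    qed
  next
    case (Suc j)
    show ?case
    proof (cases "\<bar>x - x0\<bar> \<le> r")
      case True then show ?thesis using ins[OF Suc.prems True] by simp
    next
      case False
      define X where "X = \<bar>x - x0\<bar>"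
      define T where "T = \<mu> / 4 * (\<epsilon>\<^sup>2 * real j)"
      define e where "e s = exp (- \<mu> * (s - r - T))" for s
      have j: "j \<le> n" using Suc.prems by simp
      have 1: "c * (e \<bar>x + \<epsilon> - x0\<bar> - 1) \<le> walk \<epsilon> \<phi> j (x + \<epsilon>)" "c * (e \<bar>x - \<epsilon> - x0\<bar> - 1) \<le> walk \<epsilon> \<phi> j (x - \<epsilon>)"
        unfolding e_def T_def using Suc.IH[OF j] by blast+
      \<comment> \<open>Both neighbours lie on the same side of \<open>x0\<close>, since
        \<open>\<epsilon> \<le> r < |x - x0|\<close>, so the kink of the modulus is never
        met.\<close>
      have "e \<bar>x + \<epsilon> - x0\<bar> + e \<bar>x - \<epsilon> - x0\<bar> = e (X + \<epsilon>) + e (X - \<epsilon>)"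
      proof (cases "x \<le> x0")
        case True
        then have "\<bar>x + \<epsilon> - x0\<bar> = X - \<epsilon>" "\<bar>x - \<epsilon> - x0\<bar> = X + \<epsilon>"
          using False r eps unfolding X_def by linarith+
        then show ?thesis by simp
      next
        case c: False
        then have "\<bar>x + \<epsilon> - x0\<bar> = X + \<epsilon>" "\<bar>x - \<epsilon> - x0\<bar> = X - \<epsilon>"
          using False r eps unfolding X_def by linarith+
        then show ?thesis by simp
      qed
      also have "\<dots> = 2 * (e X * cosh (\<mu> * \<epsilon>))"
      proof -
        have "- \<mu> * (X + \<epsilon> - r - T) = - \<mu> * (X - r - T) + - (\<mu> * \<epsilon>)"
             "- \<mu> * (X - \<epsilon> - r - T) = - \<mu> * (X - r - T) + \<mu> * \<epsilon>" by (simp_all add: algebra_simps)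
        then show ?thesis unfolding e_def cosh_def by (simp only: exp_add) (simp add: field_simps)
      qed
      finally have 2: "e \<bar>x + \<epsilon> - x0\<bar> + e \<bar>x - \<epsilon> - x0\<bar> = 2 * (e X * cosh (\<mu> * \<epsilon>))" .
      define y where "y = \<mu> * \<epsilon>"
      have y: "0 \<le> y" "y \<le> 1" using mu eps by (auto simp: y_def)
      \<comment> \<open>One time step multiplies the front by \<open>exp (y\<^sup>2 / 4)\<close>,
        the average in space by \<open>cosh y\<close>, with
        \<open>y = \<mu> \<epsilon> \<le> 1\<close>. The speed \<open>\<mu> / 4\<close>, half of the
        limiting value \<open>\<mu> / 2\<close>, leaves room for the quadratic term of the
        exponential.\<close>
      have "exp (y\<^sup>2 / 4) \<le> 1 + y\<^sup>2 / 4 + (y\<^sup>2 / 4)\<^sup>2"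
        using y power_le_one[of y 2] by (intro exp_bound) simp_all
      also have "\<dots> \<le> 1 + y\<^sup>2 / 2"
      proof -
        have "(y\<^sup>2 / 4) * (y\<^sup>2 / 4) \<le> 1 * (y\<^sup>2 / 4)"
          using power_le_one[OF y, of 2] by (intro mult_right_mono) simp_all
        then show ?thesis unfolding power2_eq_square[of "y\<^sup>2 / 4"] by linarith
      qed
      also have "\<dots> \<le> cosh y"
      proof -
        have "1 + y\<^sup>2 / 2 \<le> cosh y"
        proof -
          have s: "y / 2 \<le> sinh (y / 2)"
          proof -
            have d: "((\<lambda>t. sinh t - t) has_real_derivative cosh t - 1) (at t)" for t :: real
              by (auto intro!: derivative_eq_intros)
            have "sinh 0 - (0::real) \<le> sinh (y / 2) - y / 2"
              by (rule DERIV_nonneg_imp_nondecreasing[where f="\<lambda>t. sinh t - t"])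
                 (use d y cosh_real_ge_1 in \<open>force intro: exI[of _ "cosh t - 1" for t]\<close>)+
            then show ?thesis by simp
          qed
          have "(y / 2)\<^sup>2 \<le> (sinh (y / 2))\<^sup>2" using s y by (intro power_mono) auto
          moreover have "cosh y = 1 + 2 * (sinh (y / 2))\<^sup>2"
          proof -
            have "cosh y = (cosh (y / 2))\<^sup>2 + (sinh (y / 2))\<^sup>2" using cosh_double[of "y / 2"] by simp
            then show ?thesis unfolding cosh_square_eq by simp
          qed
          ultimately show ?thesis unfolding power_divide by simp
        qed
        then show ?thesis .
      qed
      finally have 3: "exp (y\<^sup>2 / 4) \<le> cosh (\<mu> * \<epsilon>)" by (simp add: y_def)
      have "exp (- \<mu> * (X - r - \<mu> / 4 * (\<epsilon>\<^sup>2 * real (Suc j)))) = e X * exp (y\<^sup>2 / 4)"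
        unfolding e_def T_def y_def exp_add[symmetric]
        by (intro arg_cong[where f=exp]) (simp add: algebra_simps power2_eq_square)
      also have "\<dots> \<le> e X * cosh (\<mu> * \<epsilon>)" using 3 by (intro mult_left_mono) (auto simp: e_def)
      finally have "c * (exp (- \<mu> * (X - r - \<mu> / 4 * (\<epsilon>\<^sup>2 * real (Suc j)))) - 1) \<le> c * (e X * cosh (\<mu> * \<epsilon>) - 1)"
        using c by (intro mult_left_mono) auto
      also have "\<dots> = (c * (e \<bar>x + \<epsilon> - x0\<bar> - 1) + c * (e \<bar>x - \<epsilon> - x0\<bar> - 1)) / 2"
      proof -
        have "c * (e X * cosh (\<mu> * \<epsilon>) - 1) = (c * (2 * (e X * cosh (\<mu> * \<epsilon>))) - 2 * c) / 2"
          by (simp add: right_diff_distrib)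
        also have "\<dots> = (c * (e \<bar>x + \<epsilon> - x0\<bar> - 1) + c * (e \<bar>x - \<epsilon> - x0\<bar> - 1)) / 2"
          unfolding 2[symmetric] by (simp add: right_diff_distrib distrib_left)
        finally show ?thesis .
      qed
      also have "\<dots> \<le> walk \<epsilon> \<phi> (Suc j) x" using 1 by simp
      finally show ?thesis unfolding X_def .
    qed
  }
qed

lemma walk_lower_bound:
  assumes \<phi>: "\<And>x. 0 \<le> \<phi> x" "\<And>x. \<bar>x - x0\<bar> \<le> R \<Longrightarrow> m \<le> \<phi> x" and R: "0 < R" and m: "0 < m"
    and \<sigma>: "0 < \<sigma>"
  obtains c n0 where "0 < c"
    "\<And>n j. n0 \<le> n \<Longrightarrow> j \<le> n \<Longrightarrow> \<sigma> \<le> real j / real n \<Longrightarrow> c \<le> walk (1 / sqrt (real n)) \<phi> j x"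
proof -
  define k where "k = pi / (2 * R)"
  define r where "r = R / 2"
  \<comment> \<open>On radius \<open>r = R / 2\<close> the angle is at most \<open>pi / 4\<close>,
    so the cosine exceeds \<open>1/2\<close>, and the eigenvalue factor after at most
    \<open>n\<close> steps is at least \<open>exp (- k\<^sup>2)\<close>.\<close>
  define m1 where "m1 = m * exp (- (k\<^sup>2)) / 2"
  \<comment> \<open>At speed \<open>\<mu> / 4\<close> the front has passed \<open>x\<close> by at
    least one unit at time \<open>\<sigma>\<close>, so the lower bound there is at least
    \<open>c (exp \<mu> - 1)\<close>. The constant \<open>c\<close> below is scaled so that up to
    time 1 the front does not exceed \<open>m1\<close> near \<open>x0\<close>.\<close>
  define \<mu> where "\<mu> = 4 * (\<bar>x - x0\<bar> + 1) / \<sigma>"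
  define c where "c = m1 * exp (- (\<mu> * (r + \<mu> / 4)))"
  define b where "b = c * (exp \<mu> - 1)"
  have mu: "0 < \<mu>" unfolding \<mu>_def using \<sigma> by (intro divide_pos_pos mult_pos_pos add_nonneg_pos) auto
  have k: "0 < k" using R by (simp add: k_def)
  have m1: "0 < m1" using m by (simp add: m1_def)
  have c: "0 < c" using m1 by (simp add: c_def)
  have b: "0 < b" using c mu by (simp add: b_def)
  define n0 where "n0 = nat \<lceil>k\<^sup>2 + \<mu>\<^sup>2 + (1 / r)\<^sup>2\<rceil> + 1"
  have "b \<le> walk (1 / sqrt (real n)) \<phi> j x" if n: "n0 \<le> n" "j \<le> n" "\<sigma> \<le> real j / real n" for n j
  proof -
    define \<epsilon> where "\<epsilon> = 1 / sqrt (real n)"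
    have n': "k\<^sup>2 + \<mu>\<^sup>2 + (1 / r)\<^sup>2 \<le> real n" "0 < n" using n unfolding n0_def by linarith+
    have r0: "0 < r" using R by (simp add: r_def)
    have n'': "k\<^sup>2 \<le> real n" "\<mu>\<^sup>2 \<le> real n" "(1 / r)\<^sup>2 \<le> real n"
      using n' zero_le_power2[of k] zero_le_power2[of \<mu>] zero_le_power2[of "1 / r"] by linarith+
    have sq: "\<mu> \<le> sqrt (real n)" "1 / r \<le> sqrt (real n)"
      using n'' by (intro real_le_rsqrt; simp)+
    have eps: "0 < \<epsilon>" "\<epsilon>\<^sup>2 = 1 / real n" using n' by (auto simp: \<epsilon>_def power_divide)
    have eps3: "\<epsilon> \<le> r" using sq(2) n' r0 by (simp add: \<epsilon>_def pos_divide_le_eq mult.commute)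
    have eps4: "\<mu> * \<epsilon> \<le> 1" using sq(1) n' by (simp add: \<epsilon>_def)
    have inner: "m1 \<le> walk \<epsilon> \<phi> i y" if "i \<le> n" "\<bar>y - x0\<bar> \<le> r" for i y
    proof -
      have "m * cos (k * \<epsilon>) ^ i * cos (k * (y - x0)) \<le> walk \<epsilon> \<phi> i y"
        by (rule walk_ge_inner[OF \<phi> m k _ eps(1)]) (use eps3 that R in \<open>auto simp: r_def k_def\<close>)
      moreover have "exp (- (k\<^sup>2)) \<le> cos (k * \<epsilon>) ^ i"
      proof -
        have "exp (- 2 * (k\<^sup>2 / 2)) \<le> (1 - k\<^sup>2 / 2 / real n) ^ i"
          using n' n'' that by (intro one_minus_power_ge) (auto simp: field_simps)
        also have "\<dots> \<le> cos (k * \<epsilon>) ^ i"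
        proof (rule power_mono)
          show "1 - k\<^sup>2 / 2 / real n \<le> cos (k * \<epsilon>)"
            using cos_ge_one_minus_square[of "k * \<epsilon>"] by (simp add: power_mult_distrib eps(2))
          show "0 \<le> 1 - k\<^sup>2 / 2 / real n" using n'' n' by (simp add: field_simps)
        qed
        finally show ?thesis by simp
      qed
      moreover have "1/2 \<le> cos (k * (y - x0))"
      proof -
        have "1/2 = cos (pi / 3)" by (simp add: cos_60)
        also have "\<dots> \<le> cos \<bar>k * (y - x0)\<bar>"
        proof (rule cos_monotone_0_pi_le)
          have "\<bar>k * (y - x0)\<bar> = k * \<bar>y - x0\<bar>" using k by (simp add: abs_mult)
          also have "\<dots> \<le> k * r" using k that by (intro mult_left_mono) auto
          also have "\<dots> = pi / 4" using R by (simp add: k_def r_def)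
          also have "\<dots> \<le> pi / 3" by simp
          finally show "\<bar>k * (y - x0)\<bar> \<le> pi / 3" .
        qed auto
        finally show ?thesis by simp
      qed
      moreover have "m * exp (- (k\<^sup>2)) * (1/2) \<le> m * cos (k * \<epsilon>) ^ i * cos (k * (y - x0))"
        if "exp (- (k\<^sup>2)) \<le> cos (k * \<epsilon>) ^ i" "1/2 \<le> cos (k * (y - x0))"
      proof (rule mult_mono)
        show "m * exp (- (k\<^sup>2)) \<le> m * cos (k * \<epsilon>) ^ i" using that(1) m by (intro mult_left_mono) simp_all
        have "0 \<le> cos (k * \<epsilon>) ^ i" using that(1) exp_ge_zero order_trans by blast
        then show "0 \<le> m * cos (k * \<epsilon>) ^ i" using m by simp
      qed (use that in simp_all)
      ultimately show ?thesis unfolding m1_def by linarith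
    qed
    have "c * exp (\<mu> * (r + \<mu> / 4)) = m1" by (simp add: c_def mult.assoc exp_add[symmetric])
    then have 1: "c * (exp (- \<mu> * (\<bar>x - x0\<bar> - r - \<mu> / 4 * (\<epsilon>\<^sup>2 * real j))) - 1) \<le> walk \<epsilon> \<phi> j x"
      using n' by (intro walk_ge_outer[OF _ \<phi>(1) c eps3 mu eps(1) _ eps4 n(2)]) (auto simp: eps(2) inner)
    have "\<mu> / 4 * \<sigma> \<le> \<mu> / 4 * (\<epsilon>\<^sup>2 * real j)" using n mu by (intro mult_left_mono) (auto simp: eps(2))
    moreover have "\<mu> / 4 * \<sigma> = \<bar>x - x0\<bar> + 1" using \<sigma> by (simp add: \<mu>_def)
    ultimately have "1 \<le> - (\<bar>x - x0\<bar> - r - \<mu> / 4 * (\<epsilon>\<^sup>2 * real j))" using r0 by linarith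
    from mult_left_mono[OF this, of \<mu>] have "\<mu> \<le> - \<mu> * (\<bar>x - x0\<bar> - r - \<mu> / 4 * (\<epsilon>\<^sup>2 * real j))"
      using mu by (simp only: mult_minus_left mult_minus_right mult_1_right less_imp_le)
    then have "b \<le> c * (exp (- \<mu> * (\<bar>x - x0\<bar> - r - \<mu> / 4 * (\<epsilon>\<^sup>2 * real j))) - 1)"
      unfolding b_def using c by (intro mult_left_mono) auto
    then show ?thesis using 1 unfolding \<epsilon>_def by linarith
  qed
  then show ?thesis by (rule that[OF b])
qed

section \<open>Brownian increments and Ito integrals\<close>

context brownian_basis
begin

lemma F_subalgebra: assumes "t \<in> {0..1}" shows "subalgebra M (F t)"
proof -
  have "sets (F t) \<subseteq> sets M"
    unfolding F_generated[of t, OF assms]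
  proof (rule sets.sigma_sets_subset, intro Un_least UN_least subsetI)
    fix A assume "A \<in> sets (F 0)" then show "A \<in> sets M" using F0_sub by (auto simp: subalgebra_def)
  next
    fix s A assume "s \<in> {0..t}" "A \<in> {W s -` B \<inter> space M |B. B \<in> sets borel}"
    then show "A \<in> sets M" using assms W_measurable[of s] by (auto intro: measurable_sets)
  qed
  then show ?thesis using F_space[OF assms] by (simp add: subalgebra_def)
qed

lemma F_mono: assumes "0 \<le> s" "s \<le> t" "t \<le> 1" shows "subalgebra (F t) (F s)"
proof -
  have "sets (F s) \<subseteq> sets (F t)"
  proof -
    have st: "s \<in> {0..1}" "t \<in> {0..1}" using assms by auto
    show ?thesis unfolding F_generated[OF st(1)] F_generated[OF st(2)]
      by (rule sigma_sets_mono', rule Un_mono[OF order_refl UN_mono]) (use assms in auto)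
  qed
  then show ?thesis using assms by (simp add: subalgebra_def F_space)
qed

lemma F_mono_measurable: "f \<in> measurable (F s) N \<Longrightarrow> 0 \<le> s \<Longrightarrow> s \<le> t \<Longrightarrow> t \<le> 1 \<Longrightarrow> f \<in> measurable (F t) N"
  by (rule measurable_from_subalg[OF F_mono])

lemma F_measurable: "f \<in> measurable (F s) N \<Longrightarrow> 0 \<le> s \<Longrightarrow> s \<le> 1 \<Longrightarrow> f \<in> measurable M N"
  by (rule measurable_from_subalg[OF F_subalgebra]) auto

lemma W_adapted: assumes "0 \<le> s" "s \<le> t" "t \<le> 1" shows "W s \<in> borel_measurable (F t)"
proof (rule measurableI)
  fix A :: "real set" assume "A \<in> sets borel"
  then have "W s -` A \<inter> space M \<in> sets (F s)"
  proof -
    have s: "s \<in> {0..1}" using assms by auto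
    show ?thesis unfolding F_generated[OF s]
      by (rule sigma_sets.Basic, rule UnI2, rule UN_I[of s]) (use \<open>A \<in> sets borel\<close> assms in auto)
  qed
  then show "W s -` A \<inter> space (F t) \<in> sets (F t)"
    using F_mono[OF assms] assms by (auto simp: F_space subalgebra_def)
qed auto

text \<open>An intersection-stable generator of the history of \<open>W\<close> up to
  \<open>s\<close>; restricting to finitely many times makes independence a statement about finitely
  many increments.\<close>

definition cylinders :: "real \<Rightarrow> 'a set set" where
  "cylinders s = {{\<omega> \<in> space M. \<forall>v\<in>J. W v \<omega> \<in> B v} | J B.
      finite J \<and> J \<subseteq> {0..s} \<and> (\<forall>v. B v \<in> sets borel)}"

lemma cylinders_Int: assumes "A \<in> cylinders s" "A' \<in> cylinders s" shows "A \<inter> A' \<in> cylinders s"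
proof -
  obtain J B J' B' where A: "A = {\<omega> \<in> space M. \<forall>v\<in>J. W v \<omega> \<in> B v}" "finite J" "J \<subseteq> {0..s}" "\<And>v. B v \<in> sets borel"
    and A': "A' = {\<omega> \<in> space M. \<forall>v\<in>J'. W v \<omega> \<in> B' v}" "finite J'" "J' \<subseteq> {0..s}" "\<And>v. B' v \<in> sets borel"
    using assms unfolding cylinders_def by blast
  define B2 where "B2 v = (if v \<in> J then B v else UNIV) \<inter> (if v \<in> J' then B' v else UNIV)" for v
  have "A \<inter> A' = {\<omega> \<in> space M. \<forall>v\<in>J \<union> J'. W v \<omega> \<in> B2 v}" unfolding A A' B2_def by auto
  moreover have "B2 v \<in> sets borel" for v using A(4) A'(4) by (auto simp: B2_def)
  moreover have "finite (J \<union> J')" "J \<union> J' \<subseteq> {0..s}" using A A' by simp_all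
  ultimately show ?thesis unfolding cylinders_def
    by (intro CollectI exI[of _ "J \<union> J'"] exI[of _ B2] conjI allI)
qed

lemma sorted_wrt_nth_Suc: "sorted xs \<Longrightarrow> Suc i < length xs \<Longrightarrow> xs ! i \<le> xs ! Suc i"
  by (simp add: sorted_nth_mono)

lemma cylinder_sets: assumes "A \<in> cylinders s" "s \<le> 1" shows "A \<in> sets M"
proof -
  obtain J B where A: "A = {\<omega> \<in> space M. \<forall>v\<in>J. W v \<omega> \<in> B v}" "finite J" "J \<subseteq> {0..s}" "\<And>v. B v \<in> sets borel"
    using assms unfolding cylinders_def by blast
  have "{\<omega> \<in> space M. W v \<omega> \<in> B v} \<in> sets M" if "v \<in> J" for v
    using measurable_sets[OF W_measurable A(4), of v v] that A(3) assms(2)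
    by (auto simp: vimage_def Int_def conj_commute)
  then show ?thesis unfolding A(1) by (intro sets.sets_Collect_finite_All A(2))
qed

text \<open>With the times of the cylinder sorted, each \<open>W v\<close> is a partial sum of
  increments, because \<open>W 0 = 0\<close> almost surely. The cylinder is thus, up to a null set,
  an event of the increments before \<open>s\<close>, and this block is independent of the last
  increment.\<close>

lemma prob_cylinder_increment:
  assumes A: "A \<in> cylinders s" and st: "0 \<le> s" "s \<le> r" "r \<le> 1" and D: "D \<in> sets borel"
  shows "prob (A \<inter> ((\<lambda>\<omega>. W r \<omega> - W s \<omega>) -` D \<inter> space M)) =
    prob A * prob ((\<lambda>\<omega>. W r \<omega> - W s \<omega>) -` D \<inter> space M)"
proof -
  obtain J B where A_eq: "A = {\<omega> \<in> space M. \<forall>v\<in>J. W v \<omega> \<in> B v}" and J: "finite J" "J \<subseteq> {0..s}"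
    and B: "\<And>v. B v \<in> sets borel"
    using A unfolding cylinders_def by blast
  \<comment> \<open>The leading \<open>0\<close> starts the telescoping sums; the final
    \<open>s, r\<close> make index \<open>k\<close> the increment from \<open>s\<close> to
    \<open>r\<close>. Repeated times are harmless, as the list need only be weakly
    increasing.\<close>
  define ts where "ts = 0 # sorted_list_of_set J @ [s, r]"
  define t where "t i = ts ! i" for i
  define k where "k = Suc (card J)"
  have len: "length ts = k + 2" using J by (simp add: ts_def k_def)
  have set: "set ts = insert 0 (J \<union> {s, r})" using J by (auto simp: ts_def)
  have sorted: "sorted ts" unfolding ts_def using J st by (auto simp: sorted_append)
  have t: "t i \<in> {0..1}" if "i \<le> Suc k" for i
  proof -
    have "t i \<in> set ts" unfolding t_def using that len by (intro nth_mem) auto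
    then show ?thesis unfolding set using J st by auto
  qed
  have t_mono: "t i \<le> t (Suc i)" if "i < Suc k" for i
    unfolding t_def using that len by (intro sorted_wrt_nth_Suc[OF sorted]) auto
  have t0: "t 0 = 0" by (simp add: t_def ts_def)
  have tk: "t k = s" "t (Suc k) = r"
  proof -
    have "length (0 # sorted_list_of_set J) = k" using J by (simp add: k_def)
    then have "((0 # sorted_list_of_set J) @ [s, r]) ! k = s" "((0 # sorted_list_of_set J) @ [s, r]) ! (Suc k) = r"
      by (auto simp: nth_append)
    then show "t k = s" "t (Suc k) = r" by (auto simp: t_def ts_def)
  qed
  define X where "X i \<omega> = W (t (Suc i)) \<omega> - W (t i) \<omega>" for i \<omega>
  have ind: "indep_vars (\<lambda>_. borel) X {..<Suc k}"
    unfolding X_def[abs_def] by (rule W_indep_increments) (use t t_mono in auto)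
  have "\<exists>i\<le>k. t i = v" if "v \<in> J" for v
  proof -
    have "v \<in> set (0 # sorted_list_of_set J)" using that J by auto
    then obtain i where "i < length (0 # sorted_list_of_set J)" "(0 # sorted_list_of_set J) ! i = v"
      unfolding in_set_conv_nth by blast
    then show ?thesis using J by (intro exI[of _ i]) (auto simp: t_def ts_def k_def nth_append nth_Cons split: nat.split)
  qed
  then obtain ix where ix: "\<And>v. v \<in> J \<Longrightarrow> ix v \<le> k" "\<And>v. v \<in> J \<Longrightarrow> t (ix v) = v" by metis
  define G where "G = {x \<in> space (PiM {..<k} (\<lambda>_. borel :: real measure)). \<forall>v\<in>J. (\<Sum>i<ix v. x i) \<in> B v}"
  have G: "G \<in> sets (PiM {..<k} (\<lambda>_. borel))"
  proof -
    have "{x \<in> space (PiM {..<k} (\<lambda>_. borel :: real measure)). (\<Sum>i<ix v. x i) \<in> B v} \<in> sets (PiM {..<k} (\<lambda>_. borel))"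
      if "v \<in> J" for v
    proof -
      have "(\<lambda>x. \<Sum>i<ix v. x i) \<in> borel_measurable (PiM {..<k} (\<lambda>_. borel :: real measure))"
        using ix(1)[OF that] by (intro borel_measurable_sum measurable_component_singleton) auto
      from measurable_sets[OF this B[of v]] show ?thesis by (auto simp: vimage_def Int_def conj_commute)
    qed
    then show ?thesis unfolding G_def by (intro sets.sets_Collect_finite_All J(1))
  qed
  define H where "H = {x \<in> space (PiM {k} (\<lambda>_. borel :: real measure)). x k \<in> D}"
  have H: "H \<in> sets (PiM {k} (\<lambda>_. borel))"
  proof -
    have "(\<lambda>x. x k) \<in> borel_measurable (PiM {k} (\<lambda>_. borel :: real measure))"
      by (intro measurable_component_singleton) auto
    from measurable_sets[OF this D] show ?thesis unfolding H_def by (auto simp: vimage_def Int_def conj_commute)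
  qed
  let ?Y = "\<lambda>\<omega>. restrict (\<lambda>i. X i \<omega>) {..<k}" let ?V = "\<lambda>\<omega>. restrict (\<lambda>i. X i \<omega>) {k}"
  have iv: "indep_var (PiM {..<k} (\<lambda>_. borel)) ?Y (PiM {k} (\<lambda>_. borel)) ?V"
    by (rule indep_var_restrict[OF ind]) auto
  have Ym: "?Y \<in> measurable M (PiM {..<k} (\<lambda>_. borel))" and Vm: "?V \<in> measurable M (PiM {k} (\<lambda>_. borel))"
    using iv unfolding indep_var_eq by auto
  have Veq: "?V -` H \<inter> space M = (\<lambda>\<omega>. W r \<omega> - W s \<omega>) -` D \<inter> space M"
    unfolding H_def by (auto simp: X_def tk space_PiM)
  have sum: "(\<Sum>i<ix v. ?Y \<omega> i) = W v \<omega> - W 0 \<omega>" if "v \<in> J" for v \<omega>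
  proof -
    have "(\<Sum>i<ix v. ?Y \<omega> i) = (\<Sum>i<ix v. X i \<omega>)" using ix(1)[OF that] by (intro sum.cong) auto
    also have "\<dots> = W (t (ix v)) \<omega> - W (t 0) \<omega>" unfolding X_def by (rule sum_lessThan_telescope)
    finally show ?thesis using ix(2)[OF that] t0 by simp
  qed
  have YA: "AE \<omega> in M. \<omega> \<in> ?Y -` G \<inter> space M \<longleftrightarrow> \<omega> \<in> A"
    using W_zero
  proof eventually_elim
    case (elim \<omega>)
    have "?Y \<omega> \<in> G \<longleftrightarrow> (\<forall>v\<in>J. W v \<omega> \<in> B v)"
      unfolding G_def using sum[of _ \<omega>] elim by (auto simp: space_PiM)
    then show ?case unfolding A_eq by auto
  qed
  have Am: "A \<in> sets M" by (rule cylinder_sets[OF A]) (use st in auto)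
  have pA: "prob A = prob (?Y -` G \<inter> space M)"
    by (rule finite_measure_eq_AE) (use YA Am measurable_sets[OF Ym G] in auto)
  have Dm: "?V -` H \<inter> space M \<in> sets M" by (rule measurable_sets[OF Vm H])
  have "prob (A \<inter> (?V -` H \<inter> space M)) = prob ((\<lambda>x. (?Y x, ?V x)) -` (G \<times> H) \<inter> space M)"
  proof (rule finite_measure_eq_AE)
    show "AE x in M. (x \<in> A \<inter> (?V -` H \<inter> space M)) = (x \<in> (\<lambda>x. (?Y x, ?V x)) -` (G \<times> H) \<inter> space M)"
      using YA by eventually_elim auto
    have "(\<lambda>x. (?Y x, ?V x)) -` (G \<times> H) \<inter> space M = (?Y -` G \<inter> space M) \<inter> (?V -` H \<inter> space M)" by auto
    then show "(\<lambda>x. (?Y x, ?V x)) -` (G \<times> H) \<inter> space M \<in> events"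
      using measurable_sets[OF Ym G] Dm by auto
  qed (use Am Dm in auto)
  also have "\<dots> = prob (?Y -` G \<inter> space M) * prob (?V -` H \<inter> space M)" by (rule indep_varD[OF iv G H])
  finally show ?thesis unfolding Veq pA .
qed

definition W_sigma :: "'a measure" where
  "W_sigma = sigma (space M) (\<Union>s\<in>{0..1}. {W s -` A \<inter> space M | A. A \<in> sets borel})"

lemma space_W_sigma: "space W_sigma = space M"
  unfolding W_sigma_def by (rule space_measure_of) blast

lemma sets_W_sigma:
  "sets W_sigma = sigma_sets (space M) (\<Union>s\<in>{0..1}. {W s -` A \<inter> space M | A. A \<in> sets borel})"
  unfolding W_sigma_def by (rule sets_measure_of) blast

lemma W_sigma_measurable: assumes "v \<in> {0..1}" shows "W v \<in> borel_measurable W_sigma"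
proof (rule measurableI)
  fix A :: "real set" assume "A \<in> sets borel"
  then show "W v -` A \<inter> space W_sigma \<in> sets W_sigma"
    unfolding space_W_sigma sets_W_sigma using assms by (intro sigma_sets.Basic UN_I[of v]) auto
qed simp

text \<open>Independence of \<open>F 0\<close> and \<open>W\<close> is used twice: it splits off the
  \<open>F 0\<close> event from the joint event, and after the increment has been factored out it
  reattaches that event to the cylinder.\<close>

lemma prob_F0_cylinder_increment:
  assumes A0: "A0 \<in> sets (F 0)" and A: "A \<in> cylinders s" and st: "0 \<le> s" "s \<le> r" "r \<le> 1"
    and B: "B \<in> sets borel"
  defines "D \<equiv> (\<lambda>\<omega>. W r \<omega> - W s \<omega>) -` B \<inter> space M"
  shows "prob (A0 \<inter> A \<inter> D) = prob (A0 \<inter> A) * prob D"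
proof -
  have indep: "prob (A0 \<inter> S) = prob A0 * prob S" if "S \<in> sets W_sigma" for S
    using indep_setD[OF W_indep_F0 A0] that unfolding sets_W_sigma .
  have AS: "A \<in> sets W_sigma"
  proof -
    obtain J B where A: "A = {\<omega> \<in> space M. \<forall>v\<in>J. W v \<omega> \<in> B v}" "finite J" "J \<subseteq> {0..s}" "\<And>v. B v \<in> sets borel"
      using A unfolding cylinders_def by blast
    have "{\<omega> \<in> space W_sigma. W v \<omega> \<in> B v} \<in> sets W_sigma" if "v \<in> J" for v
    proof -
      have "v \<in> {0..1}" using that A(3) st by auto
      from measurable_sets[OF W_sigma_measurable[OF this] A(4)[of v]]
      show ?thesis by (simp add: vimage_def Int_def conj_commute)
    qed
    then show ?thesis unfolding A(1) space_W_sigma[symmetric] by (intro sets.sets_Collect_finite_All A(2))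
  qed
  have DS: "D \<in> sets W_sigma"
  proof -
    have "(\<lambda>\<omega>. W r \<omega> - W s \<omega>) \<in> borel_measurable W_sigma"
      by (intro borel_measurable_diff W_sigma_measurable) (use st in simp_all)
    from measurable_sets[OF this B] show ?thesis unfolding D_def space_W_sigma .
  qed
  have "prob (A0 \<inter> A \<inter> D) = prob A0 * prob (A \<inter> D)"
    unfolding Int_assoc by (rule indep[OF sets.Int[OF AS DS]])
  also have "prob (A \<inter> D) = prob A * prob D" unfolding D_def by (rule prob_cylinder_increment[OF A st B])
  also have "prob A0 * (prob A * prob D) = prob (A0 \<inter> A) * prob D" unfolding indep[OF AS] by (rule mult.assoc[symmetric])
  finally show ?thesis .
qed

text \<open>Intersections of \<open>F 0\<close> events with cylinders generate \<open>F s\<close>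
  and are stable under intersection, so independence extends from them to \<open>F s\<close>. In
  what follows, conditioning on \<open>F s\<close> is expressed through weights
  \<open>\<zeta>\<close> measurable for \<open>F s\<close>.\<close>

lemma indep_increment:
  assumes \<zeta>: "\<zeta> \<in> borel_measurable (F s)" and st: "0 \<le> s" "s \<le> r" "r \<le> 1"
  shows "indep_var borel \<zeta> borel (\<lambda>\<omega>. W r \<omega> - W s \<omega>)"
proof -
  let ?D = "\<lambda>\<omega>. W r \<omega> - W s \<omega>"
  define E where "E = {A0 \<inter> A | A0 A. A0 \<in> sets (F 0) \<and> A \<in> cylinders s}"
  define V where "V = {?D -` B \<inter> space M | B. B \<in> sets borel}"
  have Dm: "?D \<in> borel_measurable M" using W_measurable[of r] W_measurable[of s] st by auto
  have top: "space M \<in> cylinders s" unfolding cylinders_def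
    by (rule CollectI, rule exI[of _ "{}"], rule exI[of _ "\<lambda>_. UNIV"]) auto
  have sp0: "space (F 0) = space M" using F_space[of 0] by simp
  have "Int_stable E"
  proof (rule Int_stableI)
    fix a b assume "a \<in> E" "b \<in> E"
    then obtain A0 A B0 B where o: "a = A0 \<inter> A" "A0 \<in> sets (F 0)" "A \<in> cylinders s"
      and o2: "b = B0 \<inter> B" "B0 \<in> sets (F 0)" "B \<in> cylinders s"
      unfolding E_def by (elim CollectE exE conjE)
    have "a \<inter> b = (A0 \<inter> B0) \<inter> (A \<inter> B)" unfolding o(1) o2(1) by auto
    moreover have "A0 \<inter> B0 \<in> sets (F 0)" using o(2) o2(2) by auto
    moreover have "A \<inter> B \<in> cylinders s" by (rule cylinders_Int[OF o(3) o2(3)])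
    ultimately show "a \<inter> b \<in> E" unfolding E_def by blast
  qed
  moreover have "Int_stable V"
  proof (rule Int_stableI)
    fix a b assume "a \<in> V" "b \<in> V"
    then obtain A B where o: "a = ?D -` A \<inter> space M" "A \<in> sets borel" "b = ?D -` B \<inter> space M" "B \<in> sets borel"
      unfolding V_def by (elim CollectE exE conjE)
    have "a \<inter> b = ?D -` (A \<inter> B) \<inter> space M" "A \<inter> B \<in> sets borel" using o by auto
    then show "a \<inter> b \<in> V" unfolding V_def by blast
  qed
  moreover have "indep_set E V"
  proof (rule indep_setI)
    show "E \<subseteq> events"
    proof
      fix a assume "a \<in> E"
      then obtain A0 A where o: "a = A0 \<inter> A" "A0 \<in> sets (F 0)" "A \<in> cylinders s"
        unfolding E_def by (elim CollectE exE conjE)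
      have "A0 \<in> events" using F0_sub o(2) unfolding subalgebra_def by blast
      moreover have "A \<in> events" by (rule cylinder_sets[OF o(3)]) (use st in simp)
      ultimately show "a \<in> events" unfolding o(1) by (rule sets.Int)
    qed
    show "V \<subseteq> events" unfolding V_def using measurable_sets[OF Dm] by blast
    fix a b assume "a \<in> E" "b \<in> V"
    then obtain A0 A B where ab: "a = A0 \<inter> A" "b = ?D -` B \<inter> space M" "A0 \<in> sets (F 0)" "A \<in> cylinders s" "B \<in> sets borel"
      unfolding E_def V_def by (elim CollectE exE conjE)
    show "prob (a \<inter> b) = prob a * prob b"
      unfolding ab(1,2) by (rule prob_F0_cylinder_increment[OF ab(3,4) st ab(5)])
  qed
  ultimately have "indep_set (sigma_sets (space M) E) (sigma_sets (space M) V)" by (intro indep_set_sigma_sets)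
  moreover have "sets (F s) \<subseteq> sigma_sets (space M) E"
  proof -
    have "sets (F 0) \<subseteq> E"
    proof
      fix A assume A: "A \<in> sets (F 0)"
      then have "A = A \<inter> space M" using sets.sets_into_space[OF A] sp0 by auto
      then show "A \<in> E" unfolding E_def using A top by blast
    qed
    moreover have "W v -` B \<inter> space M \<in> E" if "v \<in> {0..s}" "B \<in> sets borel" for v B
    proof -
      have "W v -` B \<inter> space M \<in> cylinders s" unfolding cylinders_def
        by (rule CollectI, rule exI[of _ "{v}"], rule exI[of _ "\<lambda>_. B"]) (use that in auto)
      moreover have "space M \<in> sets (F 0)" using sets.top[of "F 0"] sp0 by simp
      moreover have "W v -` B \<inter> space M = space M \<inter> (W v -` B \<inter> space M)" by auto
      ultimately show ?thesis unfolding E_def by blast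
    qed
    ultimately have "sets (F 0) \<union> (\<Union>v\<in>{0..s}. {W v -` A \<inter> space M | A. A \<in> sets borel}) \<subseteq> E" by blast
    moreover have "s \<in> {0..1}" using st by auto
    ultimately show ?thesis unfolding F_generated[OF \<open>s \<in> {0..1}\<close>] by (intro sigma_sets_mono')
  qed
  moreover have "sigma_sets (space M) {\<zeta> -` A \<inter> space M | A. A \<in> sets borel} \<subseteq> sets (F s)"
  proof -
    have "space (F s) = space M" using F_space[of s] st by auto
    then have "{\<zeta> -` A \<inter> space M | A. A \<in> sets borel} \<subseteq> sets (F s)" using measurable_sets[OF \<zeta>] by auto
    from sets.sigma_sets_subset[OF this] show ?thesis using \<open>space (F s) = space M\<close> by simp
  qed
  ultimately have "indep_set (sigma_sets (space M) {\<zeta> -` A \<inter> space M | A. A \<in> sets borel}) (sigma_sets (space M) V)"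
    unfolding indep_set_def by (elim indep_sets_mono_sets) (auto split: bool.split)
  then show ?thesis unfolding indep_var_eq V_def using Dm F_measurable[OF \<zeta>] st by auto
qed

lemma increment_moments:
  assumes st: "0 \<le> s" "s \<le> r" "r \<le> 1"
  shows "integrable M (\<lambda>\<omega>. (W r \<omega> - W s \<omega>) ^ k)" "expectation (\<lambda>\<omega>. W r \<omega> - W s \<omega>) = 0"
    "expectation (\<lambda>\<omega>. (W r \<omega> - W s \<omega>)\<^sup>2) = r - s" "expectation (\<lambda>\<omega>. (W r \<omega> - W s \<omega>) ^ 4) = 3 * (r - s)\<^sup>2"
proof -
  have *: "integrable M (\<lambda>\<omega>. (W r \<omega> - W s \<omega>) ^ k) \<and> expectation (\<lambda>\<omega>. W r \<omega> - W s \<omega>) = 0 \<and>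
    expectation (\<lambda>\<omega>. (W r \<omega> - W s \<omega>)\<^sup>2) = r - s \<and> expectation (\<lambda>\<omega>. (W r \<omega> - W s \<omega>) ^ 4) = 3 * (r - s)\<^sup>2"
  proof (cases "s = r")
    case False
    then have sr: "s < r" using st by simp
    have D: "distributed M lborel (\<lambda>\<omega>. W r \<omega> - W s \<omega>) (\<lambda>x. ennreal (normal_density 0 (sqrt (r - s)) x))"
      by (rule W_normal) (use sr st in auto)
    have pos: "0 < sqrt (r - s)" using sr by simp
    have i: "integrable M (\<lambda>\<omega>. (W r \<omega> - W s \<omega>) ^ k)"
      using distributed_integrable[OF D, of "\<lambda>x. x ^ k"] integrable_normal_moment[OF pos, of 0 k] by simp
    have e: "expectation (\<lambda>\<omega>. (W r \<omega> - W s \<omega>) ^ m) = (\<integral>x. normal_density 0 (sqrt (r - s)) x * (x - 0) ^ m \<partial>lborel)" for m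
      using distributed_integral[OF D, of "\<lambda>x. x ^ m"] by simp
    have "expectation (\<lambda>\<omega>. W r \<omega> - W s \<omega>) = 0"
      using e[of 1] integral_normal_moment_odd[OF pos, of 0 0] by simp
    moreover have "expectation (\<lambda>\<omega>. (W r \<omega> - W s \<omega>)\<^sup>2) = r - s"
      using e[of 2] integral_normal_moment_even[OF pos, of 0 1] sr by simp
    moreover have "expectation (\<lambda>\<omega>. (W r \<omega> - W s \<omega>) ^ 4) = 3 * (r - s)\<^sup>2"
      using e[of 4] integral_normal_moment_even[OF pos, of 0 2] sr
      by (simp add: fact_numeral power2_eq_square)
    ultimately show ?thesis using i by simp
  qed (simp add: power_0_left)
  then show "integrable M (\<lambda>\<omega>. (W r \<omega> - W s \<omega>) ^ k)" "expectation (\<lambda>\<omega>. W r \<omega> - W s \<omega>) = 0"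
    "expectation (\<lambda>\<omega>. (W r \<omega> - W s \<omega>)\<^sup>2) = r - s" "expectation (\<lambda>\<omega>. (W r \<omega> - W s \<omega>) ^ 4) = 3 * (r - s)\<^sup>2"
    by blast+
qed

lemma increment_product:
  assumes st: "0 \<le> s" "s \<le> r" "r \<le> 1" and \<zeta>: "\<zeta> \<in> borel_measurable (F s)" "integrable M \<zeta>"
  shows "integrable M (\<lambda>\<omega>. \<zeta> \<omega> * (W r \<omega> - W s \<omega>))" "expectation (\<lambda>\<omega>. \<zeta> \<omega> * (W r \<omega> - W s \<omega>)) = 0"
    "integrable M (\<lambda>\<omega>. \<zeta> \<omega> * (W r \<omega> - W s \<omega>)\<^sup>2)"
    "expectation (\<lambda>\<omega>. \<zeta> \<omega> * (W r \<omega> - W s \<omega>)\<^sup>2) = expectation \<zeta> * (r - s)"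
proof -
  have i1: "indep_var borel \<zeta> borel (\<lambda>\<omega>. W r \<omega> - W s \<omega>)" by (rule indep_increment[OF \<zeta>(1) st])
  have i2: "indep_var borel \<zeta> borel (\<lambda>\<omega>. (W r \<omega> - W s \<omega>)\<^sup>2)"
    using indep_var_compose[OF i1, of "\<lambda>x. x" borel "\<lambda>x. x\<^sup>2" borel] by (simp add: comp_def)
  note m = increment_moments[OF st]
  have m1: "integrable M (\<lambda>\<omega>. W r \<omega> - W s \<omega>)" using m(1)[of 1] by simp
  show "integrable M (\<lambda>\<omega>. \<zeta> \<omega> * (W r \<omega> - W s \<omega>))" by (rule indep_var_integrable[OF i1 \<zeta>(2) m1])
  show "expectation (\<lambda>\<omega>. \<zeta> \<omega> * (W r \<omega> - W s \<omega>)) = 0"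
    using indep_var_lebesgue_integral[OF i1 \<zeta>(2) m1] m(2) by simp
  show "integrable M (\<lambda>\<omega>. \<zeta> \<omega> * (W r \<omega> - W s \<omega>)\<^sup>2)" by (rule indep_var_integrable[OF i2 \<zeta>(2) m(1)])
  show "expectation (\<lambda>\<omega>. \<zeta> \<omega> * (W r \<omega> - W s \<omega>)\<^sup>2) = expectation \<zeta> * (r - s)"
    using indep_var_lebesgue_integral[OF i2 \<zeta>(2) m(1)] m(3) by simp
qed

end

section \<open>Square-integrable functions and their limits\<close>

lemma integrable_mult_squares:
  fixes f g :: "'a \<Rightarrow> real"
  assumes "f \<in> borel_measurable N" "g \<in> borel_measurable N" "integrable N (\<lambda>x. (f x)\<^sup>2)" "integrable N (\<lambda>x. (g x)\<^sup>2)"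
  shows "integrable N (\<lambda>x. f x * g x)"
proof (rule Bochner_Integration.integrable_bound)
  show "integrable N (\<lambda>x. (f x)\<^sup>2 + (g x)\<^sup>2)" using assms by auto
  show "AE x in N. norm (f x * g x) \<le> norm ((f x)\<^sup>2 + (g x)\<^sup>2)"
  proof (rule AE_I2)
    fix x
    have "0 \<le> (\<bar>f x\<bar> - \<bar>g x\<bar>)\<^sup>2" by simp
    then have "2 * (\<bar>f x\<bar> * \<bar>g x\<bar>) \<le> (f x)\<^sup>2 + (g x)\<^sup>2" by (simp add: power2_diff)
    moreover have "0 \<le> \<bar>f x\<bar> * \<bar>g x\<bar>" by simp
    ultimately show "norm (f x * g x) \<le> norm ((f x)\<^sup>2 + (g x)\<^sup>2)" unfolding real_norm_def abs_mult by linarith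
  qed
qed (use assms in simp)

lemma integrable_square_add:
  fixes f g :: "'a \<Rightarrow> real"
  assumes "f \<in> borel_measurable N" "g \<in> borel_measurable N" "integrable N (\<lambda>x. (f x)\<^sup>2)" "integrable N (\<lambda>x. (g x)\<^sup>2)"
  shows "integrable N (\<lambda>x. (f x + g x)\<^sup>2)" "integrable N (\<lambda>x. (f x - g x)\<^sup>2)"
  unfolding power2_sum power2_diff using integrable_mult_squares[OF assms] assms(3,4) by (auto simp: mult.assoc)

lemma integrable_bounded_mult:
  fixes f h :: "'a \<Rightarrow> real"
  assumes "integrable N f" "h \<in> borel_measurable N" "\<And>x. x \<in> space N \<Longrightarrow> \<bar>h x\<bar> \<le> B"
  shows "integrable N (\<lambda>x. h x * f x)"
proof (rule Bochner_Integration.integrable_bound)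
  show "integrable N (\<lambda>x. B * f x)" using assms(1) by simp
  show "AE x in N. norm (h x * f x) \<le> norm (B * f x)"
  proof (rule AE_I2)
    fix x assume "x \<in> space N"
    then have "\<bar>h x\<bar> \<le> \<bar>B\<bar>" using assms(3)[of x] by linarith
    then show "norm (h x * f x) \<le> norm (B * f x)" by (simp add: abs_mult mult_right_mono)
  qed
  show "(\<lambda>x. h x * f x) \<in> borel_measurable N" using assms(1,2) borel_measurable_integrable by auto
qed

text \<open>What the definition of the Ito integral provides, in abstract form: nonnegative
  integrals of squared differences tend to 0. It is applied on \<open>M\<close> to the integrals and
  on the product space to the integrands.\<close>

locale L2_limit =
  fixes N :: "'b measure" and f :: "nat \<Rightarrow> 'b \<Rightarrow> real" and g :: "'b \<Rightarrow> real"
  assumes fm: "\<And>k. f k \<in> borel_measurable N" and gm: "g \<in> borel_measurable N"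
    and fi: "\<And>k. integrable N (\<lambda>x. (f k x)\<^sup>2)"
    and lim: "(\<lambda>k. \<integral>\<^sup>+x. ennreal ((f k x - g x)\<^sup>2) \<partial>N) \<longlonglongrightarrow> 0"
begin

lemma limit_square_integrable: "integrable N (\<lambda>x. (g x)\<^sup>2)"
proof -
  have "eventually (\<lambda>k. (\<integral>\<^sup>+x. ennreal ((f k x - g x)\<^sup>2) \<partial>N) < 1) sequentially"
    using lim by (rule order_tendstoD) simp
  then obtain k where "(\<integral>\<^sup>+x. ennreal ((f k x - g x)\<^sup>2) \<partial>N) < 1" by (auto simp: eventually_sequentially)
  then have fin: "(\<integral>\<^sup>+x. ennreal ((f k x - g x)\<^sup>2) \<partial>N) < \<infinity>" by (rule order_less_trans) simp
  have i: "integrable N (\<lambda>x. (f k x - g x)\<^sup>2)"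
    by (rule integrableI_nonneg) (use fm gm fin in auto)
  have "integrable N (\<lambda>x. (f k x - (f k x - g x))\<^sup>2)"
    by (rule integrable_square_add(2)[OF fm _ fi i]) (use fm gm in auto)
  then show ?thesis by simp
qed

lemma diff_integrable: "integrable N (\<lambda>x. (f k x - g x)\<^sup>2)"
  by (rule integrable_square_add(2)[OF fm gm fi limit_square_integrable])

lemma diff_tendsto: "(\<lambda>k. \<integral>x. (f k x - g x)\<^sup>2 \<partial>N) \<longlonglongrightarrow> 0"
proof -
  have "(\<lambda>k. enn2real (\<integral>\<^sup>+x. ennreal ((f k x - g x)\<^sup>2) \<partial>N)) \<longlonglongrightarrow> enn2real 0"
    by (rule tendsto_enn2real) (use lim in auto)
  moreover have "enn2real (\<integral>\<^sup>+x. ennreal ((f k x - g x)\<^sup>2) \<partial>N) = (\<integral>x. (f k x - g x)\<^sup>2 \<partial>N)" for k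
    by (rule integral_eq_nn_integral[symmetric]) (use fm gm in auto)
  ultimately show ?thesis by simp
qed

lemma inner_tendsto:
  assumes hm: "h \<in> borel_measurable N" and hi: "integrable N (\<lambda>x. (h x)\<^sup>2)"
  shows "(\<lambda>k. \<integral>x. h x * f k x \<partial>N) \<longlonglongrightarrow> (\<integral>x. h x * g x \<partial>N)"
proof (rule LIMSEQ_I)
  fix e :: real assume e: "0 < e"
  define H where "H = (\<integral>x. (h x)\<^sup>2 \<partial>N)"
  \<comment> \<open>Young's inequality with parameter \<open>\<eta>\<close> stands in for
    Cauchy-Schwarz: \<open>\<eta>\<close> makes the part with \<open>h\<^sup>2\<close> smaller than
    \<open>e / 2\<close>, and convergence makes the other part at most \<open>e / 2\<close>.\<close>
  define \<eta> where "\<eta> = e / (2 * (H + 1))"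
  have H: "0 \<le> H" by (simp add: H_def)
  have \<eta>: "0 < \<eta>" "\<eta> * H < e / 2" using e H by (auto simp: \<eta>_def field_simps)
  have "0 < 2 * \<eta> * e" using \<eta> e by simp
  from LIMSEQ_D[OF diff_tendsto this]
  obtain K where K: "\<And>k. k \<ge> K \<Longrightarrow> norm ((\<integral>x. (f k x - g x)\<^sup>2 \<partial>N) - 0) < 2 * \<eta> * e" by blast
  have "norm ((\<integral>x. h x * f k x \<partial>N) - (\<integral>x. h x * g x \<partial>N)) < e" if k: "k \<ge> K" for k
  proof -
    let ?d = "\<lambda>x. f k x - g x"
    have i: "integrable N (\<lambda>x. h x * f k x)" "integrable N (\<lambda>x. h x * g x)" "integrable N (\<lambda>x. h x * ?d x)"
      by (rule integrable_mult_squares[OF hm]; use fm gm hi fi limit_square_integrable diff_integrable in simp)+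
    have pw: "\<bar>h x * ?d x\<bar> \<le> \<eta> * (h x)\<^sup>2 + (?d x)\<^sup>2 / (4 * \<eta>)" for x
    proof -
      have "0 \<le> (2 * \<eta> * \<bar>h x\<bar> - \<bar>?d x\<bar>)\<^sup>2" by simp
      then have "4 * \<eta> * (\<bar>h x\<bar> * \<bar>?d x\<bar>) \<le> 4 * \<eta> * (\<eta> * (h x)\<^sup>2) + (?d x)\<^sup>2"
        by (simp add: power2_diff power_mult_distrib algebra_simps power2_eq_square)
      then have "\<bar>h x\<bar> * \<bar>?d x\<bar> \<le> (4 * \<eta> * (\<eta> * (h x)\<^sup>2) + (?d x)\<^sup>2) / (4 * \<eta>)"
        using \<eta> by (simp only: pos_le_divide_eq mult.commute[of "\<bar>h x\<bar> * \<bar>?d x\<bar>"])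
      then show ?thesis using \<eta> by (simp only: abs_mult add_divide_distrib) simp
    qed
    have "(\<integral>x. h x * f k x \<partial>N) - (\<integral>x. h x * g x \<partial>N) = (\<integral>x. h x * ?d x \<partial>N)"
      using i by (simp add: right_diff_distrib)
    then have "norm ((\<integral>x. h x * f k x \<partial>N) - (\<integral>x. h x * g x \<partial>N)) \<le> (\<integral>x. norm (h x * ?d x) \<partial>N)"
      by simp
    also have "\<dots> \<le> (\<integral>x. \<eta> * (h x)\<^sup>2 + (?d x)\<^sup>2 / (4 * \<eta>) \<partial>N)"
      by (rule integral_mono) (use i(3) hi diff_integrable pw in auto)
    also have "\<dots> = \<eta> * H + (\<integral>x. (?d x)\<^sup>2 \<partial>N) / (4 * \<eta>)"
      using hi diff_integrable by (simp add: H_def)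
    also have "(\<integral>x. (?d x)\<^sup>2 \<partial>N) / (4 * \<eta>) \<le> (2 * \<eta> * e) / (4 * \<eta>)"
      using K[OF k] \<eta> by (intro divide_right_mono) auto
    also have "(2 * \<eta> * e) / (4 * \<eta>) = e / 2" using \<eta> by simp
    finally show ?thesis using \<eta>(2) by linarith
  qed
  then show "\<exists>K. \<forall>k\<ge>K. norm ((\<integral>x. h x * f k x \<partial>N) - (\<integral>x. h x * g x \<partial>N)) < e" by blast
qed

text \<open>In \<open>h (f k)\<^sup>2 = h (f k - g)\<^sup>2 + 2 (h g) (f k) - h g\<^sup>2\<close>
  the first term vanishes in the limit because \<open>h\<close> is bounded, and the second is an
  inner product with the fixed function \<open>h g\<close>.\<close>

lemma square_tendsto:
  assumes hm: "h \<in> borel_measurable N" and hB: "\<And>x. x \<in> space N \<Longrightarrow> \<bar>h x\<bar> \<le> B"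
  shows "(\<lambda>k. \<integral>x. h x * (f k x)\<^sup>2 \<partial>N) \<longlonglongrightarrow> (\<integral>x. h x * (g x)\<^sup>2 \<partial>N)"
proof -
  have hg: "(\<lambda>x. h x * g x) \<in> borel_measurable N" using hm gm by simp
  have hgi: "integrable N (\<lambda>x. (h x * g x)\<^sup>2)"
    unfolding power_mult_distrib
  proof (rule integrable_bounded_mult[OF limit_square_integrable, where B="B\<^sup>2"])
    show "\<bar>(h x)\<^sup>2\<bar> \<le> B\<^sup>2" if "x \<in> space N" for x
      using hB[OF that] by (simp add: abs_le_square_iff[symmetric])
  qed (use hm in simp)
  have 1: "(\<lambda>k. (\<integral>x. h x * (f k x - g x)\<^sup>2 \<partial>N)) \<longlonglongrightarrow> 0"
  proof (rule Lim_null_comparison)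
    show "\<forall>\<^sub>F k in sequentially. norm (\<integral>x. h x * (f k x - g x)\<^sup>2 \<partial>N) \<le> \<bar>B\<bar> * (\<integral>x. (f k x - g x)\<^sup>2 \<partial>N)"
    proof (intro always_eventually allI)
      fix k
      have "norm (\<integral>x. h x * (f k x - g x)\<^sup>2 \<partial>N) \<le> (\<integral>x. norm (h x * (f k x - g x)\<^sup>2) \<partial>N)"
        by simp
      also have "\<dots> \<le> (\<integral>x. \<bar>B\<bar> * (f k x - g x)\<^sup>2 \<partial>N)"
      proof (rule integral_mono)
        show "integrable N (\<lambda>x. norm (h x * (f k x - g x)\<^sup>2))"
          using integrable_bounded_mult[OF diff_integrable hm hB] by (rule integrable_norm)
        show "norm (h x * (f k x - g x)\<^sup>2) \<le> \<bar>B\<bar> * (f k x - g x)\<^sup>2" if "x \<in> space N" for x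
          using hB[OF that] by (simp add: abs_mult mult_right_mono)
      qed (use diff_integrable in simp)
      finally show "norm (\<integral>x. h x * (f k x - g x)\<^sup>2 \<partial>N) \<le> \<bar>B\<bar> * (\<integral>x. (f k x - g x)\<^sup>2 \<partial>N)" by simp
    qed
    show "(\<lambda>k. \<bar>B\<bar> * (\<integral>x. (f k x - g x)\<^sup>2 \<partial>N)) \<longlonglongrightarrow> 0"
      using tendsto_mult_left[OF diff_tendsto, of "\<bar>B\<bar>"] by simp
  qed
  have 2: "(\<lambda>k. \<integral>x. (h x * g x) * f k x \<partial>N) \<longlonglongrightarrow> (\<integral>x. (h x * g x) * g x \<partial>N)"
    by (rule inner_tendsto[OF hg hgi])
  have "(\<integral>x. h x * (f k x)\<^sup>2 \<partial>N) = (\<integral>x. h x * (f k x - g x)\<^sup>2 \<partial>N) + 2 * (\<integral>x. (h x * g x) * f k x \<partial>N) - (\<integral>x. (h x * g x) * g x \<partial>N)" for k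
  proof -
    have i: "integrable N (\<lambda>x. h x * (f k x - g x)\<^sup>2)" "integrable N (\<lambda>x. (h x * g x) * f k x)" "integrable N (\<lambda>x. (h x * g x) * g x)"
      using integrable_bounded_mult[OF diff_integrable hm hB] integrable_mult_squares[OF hg fm hgi fi] integrable_mult_squares[OF hg gm hgi limit_square_integrable]
      by auto
    have "(\<integral>x. h x * (f k x)\<^sup>2 \<partial>N) = (\<integral>x. (h x * (f k x - g x)\<^sup>2 + 2 * ((h x * g x) * f k x)) - (h x * g x) * g x \<partial>N)"
      by (rule Bochner_Integration.integral_cong) (auto simp: power2_diff algebra_simps power2_eq_square)
    also have "\<dots> = (\<integral>x. h x * (f k x - g x)\<^sup>2 + 2 * ((h x * g x) * f k x) \<partial>N) - (\<integral>x. (h x * g x) * g x \<partial>N)"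
      by (rule Bochner_Integration.integral_diff) (use i in simp_all)
    also have "(\<integral>x. h x * (f k x - g x)\<^sup>2 + 2 * ((h x * g x) * f k x) \<partial>N) =
        (\<integral>x. h x * (f k x - g x)\<^sup>2 \<partial>N) + (\<integral>x. 2 * ((h x * g x) * f k x) \<partial>N)"
      by (rule Bochner_Integration.integral_add) (use i in simp_all)
    finally show ?thesis by simp
  qed
  moreover have "(\<lambda>k. (\<integral>x. h x * (f k x - g x)\<^sup>2 \<partial>N) + 2 * (\<integral>x. (h x * g x) * f k x \<partial>N) - (\<integral>x. (h x * g x) * g x \<partial>N))
     \<longlonglongrightarrow> 0 + 2 * (\<integral>x. (h x * g x) * g x \<partial>N) - (\<integral>x. (h x * g x) * g x \<partial>N)"
    by (intro tendsto_intros 1 2)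
  ultimately show ?thesis by (simp add: power2_eq_square mult.assoc)
qed

end

section \<open>Simple integrands and the weighted Ito isometry\<close>

context pair_sigma_finite
begin

lemma product_integrable:
  fixes f k :: "_ \<Rightarrow> real"
  assumes "integrable M1 f" "integrable M2 k"
  shows "integrable (M1 \<Otimes>\<^sub>M M2) (\<lambda>(x, y). f x * k y)" "(\<integral>(x, y). f x * k y \<partial>(M1 \<Otimes>\<^sub>M M2)) = (\<integral>x. f x \<partial>M1) * (\<integral>y. k y \<partial>M2)"
proof -
  have m: "f \<in> borel_measurable M1" "k \<in> borel_measurable M2" using assms by auto
  show i: "integrable (M1 \<Otimes>\<^sub>M M2) (\<lambda>(x, y). f x * k y)"
  proof (rule Fubini_integrable)
    show "(\<lambda>(x, y). f x * k y) \<in> borel_measurable (M1 \<Otimes>\<^sub>M M2)" using m by measurable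
    show "integrable M1 (\<lambda>x. \<integral>y. norm (case (x, y) of (x, y) \<Rightarrow> f x * k y) \<partial>M2)"
      using assms by (simp add: abs_mult)
  qed (use assms in simp)
  show "(\<integral>(x, y). f x * k y \<partial>(M1 \<Otimes>\<^sub>M M2)) = (\<integral>x. f x \<partial>M1) * (\<integral>y. k y \<partial>M2)"
    using integral_fst'[OF i] by simp
qed

end

text \<open>Monotone partition times make the intervals disjoint, so all cross terms vanish.\<close>

lemma simple_value_square:
  assumes "\<forall>i<n. t i \<le> t (Suc i)"
  shows "(simple_value n t \<xi> r \<omega>)\<^sup>2 = (\<Sum>i<n. indicator {t i<..t (Suc i)} r * (\<xi> i \<omega>)\<^sup>2)"
  using assms
proof (induction n)
  case (Suc n)
  have IH: "(simple_value n t \<xi> r \<omega>)\<^sup>2 = (\<Sum>i<n. indicator {t i<..t (Suc i)} r * (\<xi> i \<omega>)\<^sup>2)"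
    using Suc by auto
  have le: "t (Suc i) \<le> t n" if "i < n" for i
    using that Suc.prems
  proof (induction n)
    case (Suc m)
    then show ?case by (cases "i = m") (auto intro: order_trans)
  qed simp
  have zero: "simple_value n t \<xi> r \<omega> * indicator {t n<..t (Suc n)} r = 0"
  proof (cases "r \<in> {t n<..t (Suc n)}")
    case True
    then have "simple_value n t \<xi> r \<omega> = 0" unfolding simple_value_def using le by (intro sum.neutral) (force simp: indicator_def)
    then show ?thesis by simp
  qed simp
  have s: "simple_value (Suc n) t \<xi> r \<omega> = simple_value n t \<xi> r \<omega> + \<xi> n \<omega> * indicator {t n<..t (Suc n)} r"
    by (simp add: simple_value_def)
  have "(simple_value (Suc n) t \<xi> r \<omega>)\<^sup>2 = (simple_value n t \<xi> r \<omega>)\<^sup>2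
      + 2 * \<xi> n \<omega> * (simple_value n t \<xi> r \<omega> * indicator {t n<..t (Suc n)} r)
      + (\<xi> n \<omega>)\<^sup>2 * (indicator {t n<..t (Suc n)} r)\<^sup>2"
    unfolding s by (simp add: power2_sum power_mult_distrib)
  also have "\<dots> = (simple_value n t \<xi> r \<omega>)\<^sup>2 + indicator {t n<..t (Suc n)} r * (\<xi> n \<omega>)\<^sup>2"
    unfolding zero by (simp add: indicator_def)
  finally show ?case unfolding IH by simp
qed (simp add: simple_value_def)

lemma integrable_indicator_Ioc: "integrable lborel (indicator {a<..b::real} :: real \<Rightarrow> real)"
  "a \<le> b \<Longrightarrow> (\<integral>r. indicator {a<..b} r \<partial>lborel) = b - a"
  by (cases "a \<le> b") (auto intro!: integrable_real_indicator)

locale brownian_simple = brownian_basis +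
  fixes a b :: real and n :: nat and t :: "nat \<Rightarrow> real" and \<xi> :: "nat \<Rightarrow> 'a \<Rightarrow> real"
  assumes si: "simple_integrand F a b n t \<xi>" and ab: "0 \<le> a" "b \<le> 1"
begin

lemma t_Suc: "i < n \<Longrightarrow> t i \<le> t (Suc i)" using si by (simp add: simple_integrand_def)

lemma t_mono: "j \<le> n \<Longrightarrow> i \<le> j \<Longrightarrow> t i \<le> t j"
proof (induction j)
  case (Suc j)
  then show ?case using t_Suc[of j] by (cases "i = Suc j") (auto intro: order_trans)
qed simp

lemma t_ends: "t 0 = a" "t n = b" using si by (auto simp: simple_integrand_def)

lemma t_bounds: "i \<le> n \<Longrightarrow> a \<le> t i" "i \<le> n \<Longrightarrow> t i \<le> b" "i \<le> n \<Longrightarrow> 0 \<le> t i" "i \<le> n \<Longrightarrow> t i \<le> 1"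
  using t_mono[of i 0] t_mono[of n i] t_ends ab by auto

lemma xi_F: "i < n \<Longrightarrow> \<xi> i \<in> borel_measurable (F (t i))" using si by (simp add: simple_integrand_def)

lemma xi_M: "i < n \<Longrightarrow> \<xi> i \<in> borel_measurable M"
  using F_measurable[OF xi_F] t_bounds[of i] by auto

lemma xi_bound: assumes "i < n" shows "\<exists>C. \<forall>\<omega>\<in>space M. \<bar>\<xi> i \<omega>\<bar> \<le> C"
proof -
  have "\<exists>C. \<forall>\<omega>\<in>space (F (t i)). \<bar>\<xi> i \<omega>\<bar> \<le> C" using si assms by (auto simp: simple_integrand_def)
  moreover have "space (F (t i)) = space M" using F_space[of "t i"] t_bounds[of i] assms by auto
  ultimately show ?thesis by simp
qed

definition "S k \<omega> = (\<Sum>i<k. \<xi> i \<omega> * (W (t (Suc i)) \<omega> - W (t i) \<omega>))"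

lemma S_Suc: "S (Suc k) \<omega> = S k \<omega> + \<xi> k \<omega> * (W (t (Suc k)) \<omega> - W (t k) \<omega>)"
  by (simp add: S_def)

lemma S_F: "k \<le> n \<Longrightarrow> S k \<in> borel_measurable (F (t k))"
proof -
  assume k: "k \<le> n"
  have "(\<lambda>\<omega>. \<Sum>i<k. \<xi> i \<omega> * (W (t (Suc i)) \<omega> - W (t i) \<omega>)) \<in> borel_measurable (F (t k))"
  proof (intro borel_measurable_sum borel_measurable_times borel_measurable_diff)
    fix i assume "i \<in> {..<k}"
    then have i: "i < k" "i < n" using k by auto
    have le: "t (Suc i) \<le> t k" "t i \<le> t k" using i k by (auto intro!: t_mono)
    have b: "0 \<le> t i" "0 \<le> t (Suc i)" "t k \<le> 1" using i k t_bounds by auto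
    show "\<xi> i \<in> borel_measurable (F (t k))" by (rule F_mono_measurable[OF xi_F[OF i(2)] b(1) le(2) b(3)])
    show "W (t (Suc i)) \<in> borel_measurable (F (t k))" by (rule W_adapted[OF b(2) le(1) b(3)])
    show "W (t i) \<in> borel_measurable (F (t k))" by (rule W_adapted[OF b(1) le(2) b(3)])
  qed
  then show ?thesis by (simp add: S_def[abs_def])
qed

lemma S_M: "k \<le> n \<Longrightarrow> S k \<in> borel_measurable M"
  using F_measurable[OF S_F] t_bounds[of k] by auto

lemma xi_dW_square: assumes "k < n" shows "integrable M (\<lambda>\<omega>. (\<xi> k \<omega> * (W (t (Suc k)) \<omega> - W (t k) \<omega>))\<^sup>2)"
proof -
  obtain C where C: "\<And>\<omega>. \<omega> \<in> space M \<Longrightarrow> \<bar>\<xi> k \<omega>\<bar> \<le> C" using xi_bound[OF assms] by blast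
  show ?thesis unfolding power_mult_distrib
  proof (rule integrable_bounded_mult[where B="C\<^sup>2"])
    show "integrable M (\<lambda>\<omega>. (W (t (Suc k)) \<omega> - W (t k) \<omega>)\<^sup>2)"
      using assms by (intro increment_moments t_bounds t_Suc) auto
    show "\<bar>(\<xi> k \<omega>)\<^sup>2\<bar> \<le> C\<^sup>2" if "\<omega> \<in> space M" for \<omega>
      using C[OF that] by (simp add: abs_le_square_iff[symmetric])
  qed (use xi_M[OF assms] in simp)
qed

lemma S_square: "k \<le> n \<Longrightarrow> integrable M (\<lambda>\<omega>. (S k \<omega>)\<^sup>2)"
proof (induction k)
  case (Suc k)
  have W: "W (t k) \<in> borel_measurable M" "W (t (Suc k)) \<in> borel_measurable M"
    using Suc.prems t_bounds by (auto intro!: W_measurable)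
  show ?case unfolding S_Suc
    by (rule integrable_square_add(1)) (use Suc S_M xi_M xi_dW_square W in auto)
qed (simp add: S_def)

lemma S_inner_zero:
  assumes \<zeta>: "\<zeta> \<in> borel_measurable (F a)" "integrable M (\<lambda>\<omega>. (\<zeta> \<omega>)\<^sup>2)"
  shows "k \<le> n \<Longrightarrow> expectation (\<lambda>\<omega>. \<zeta> \<omega> * S k \<omega>) = 0"
proof (induction k)
  case (Suc k)
  have k: "k < n" using Suc.prems by simp
  have \<zeta>M: "\<zeta> \<in> borel_measurable M" using F_measurable[OF \<zeta>(1)] ab t_bounds[of 0] t_ends by auto
  have \<zeta>i: "integrable M \<zeta>" by (rule square_integrable_imp_integrable[OF \<zeta>M \<zeta>(2)])
  have \<zeta>k: "\<zeta> \<in> borel_measurable (F (t k))"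
    by (rule F_mono_measurable[OF \<zeta>(1) ab(1)]) (use t_bounds[of k] k in auto)
  obtain C where C: "\<And>\<omega>. \<omega> \<in> space M \<Longrightarrow> \<bar>\<xi> k \<omega>\<bar> \<le> C" using xi_bound[OF k] by blast
  have p: "(\<lambda>\<omega>. \<xi> k \<omega> * \<zeta> \<omega>) \<in> borel_measurable (F (t k))" using \<zeta>k xi_F[OF k] by simp
  have pi: "integrable M (\<lambda>\<omega>. \<xi> k \<omega> * \<zeta> \<omega>)" by (rule integrable_bounded_mult[OF \<zeta>i xi_M[OF k] C])
  have i1: "integrable M (\<lambda>\<omega>. \<zeta> \<omega> * S k \<omega>)"
    by (rule integrable_mult_squares[OF \<zeta>M S_M \<zeta>(2) S_square]) (use k in auto)
  have ip: "integrable M (\<lambda>\<omega>. (\<xi> k \<omega> * \<zeta> \<omega>) * (W (t (Suc k)) \<omega> - W (t k) \<omega>))"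
    "expectation (\<lambda>\<omega>. (\<xi> k \<omega> * \<zeta> \<omega>) * (W (t (Suc k)) \<omega> - W (t k) \<omega>)) = 0"
    by (rule increment_product[OF _ _ _ p pi]; use k t_bounds t_Suc in simp)+
  have "expectation (\<lambda>\<omega>. \<zeta> \<omega> * S (Suc k) \<omega>) =
      expectation (\<lambda>\<omega>. \<zeta> \<omega> * S k \<omega> + (\<xi> k \<omega> * \<zeta> \<omega>) * (W (t (Suc k)) \<omega> - W (t k) \<omega>))"
    unfolding S_Suc by (rule Bochner_Integration.integral_cong) (auto simp: algebra_simps)
  also have "\<dots> = 0" using i1 ip Suc k by simp
  finally show ?case .
qed (simp add: S_def)

text \<open>Bounded \<open>F a\<close> weights express the isometry conditionally on
  \<open>F a\<close>. In the induction the cross term vanishes, since \<open>\<zeta>\<close>,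
  \<open>\<xi> k\<close> and \<open>S k\<close> are all measurable for \<open>F (t k)\<close> while
  the increment comes later; the squared increment contributes its variance.\<close>

lemma S_square_expectation:
  assumes \<zeta>: "\<zeta> \<in> borel_measurable (F a)" "\<And>\<omega>. \<omega> \<in> space M \<Longrightarrow> \<bar>\<zeta> \<omega>\<bar> \<le> B"
  shows "k \<le> n \<Longrightarrow> expectation (\<lambda>\<omega>. \<zeta> \<omega> * (S k \<omega>)\<^sup>2) =
    (\<Sum>i<k. expectation (\<lambda>\<omega>. \<zeta> \<omega> * (\<xi> i \<omega>)\<^sup>2) * (t (Suc i) - t i))"
proof (induction k)
  case (Suc k)
  have k: "k < n" using Suc.prems by simp
  let ?D = "\<lambda>\<omega>. W (t (Suc k)) \<omega> - W (t k) \<omega>"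
  have \<zeta>M: "\<zeta> \<in> borel_measurable M" using F_measurable[OF \<zeta>(1)] ab t_bounds[of 0] t_ends by auto
  have \<zeta>k: "\<zeta> \<in> borel_measurable (F (t k))"
    by (rule F_mono_measurable[OF \<zeta>(1) ab(1)]) (use t_bounds[of k] k in auto)
  obtain C where C: "\<And>\<omega>. \<omega> \<in> space M \<Longrightarrow> \<bar>\<xi> k \<omega>\<bar> \<le> C" using xi_bound[OF k] by blast
  have Si: "integrable M (S k)"
    by (rule square_integrable_imp_integrable[OF S_M S_square]) (use k in auto)
  have p: "(\<lambda>\<omega>. \<zeta> \<omega> * (\<xi> k \<omega> * S k \<omega>)) \<in> borel_measurable (F (t k))"
    using \<zeta>k xi_F[OF k] S_F[of k] k by simp
  have pi: "integrable M (\<lambda>\<omega>. \<zeta> \<omega> * (\<xi> k \<omega> * S k \<omega>))"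
    by (rule integrable_bounded_mult[OF integrable_bounded_mult[OF Si xi_M[OF k] C] \<zeta>M \<zeta>(2)])
  have q: "(\<lambda>\<omega>. \<zeta> \<omega> * (\<xi> k \<omega>)\<^sup>2) \<in> borel_measurable (F (t k))" using \<zeta>k xi_F[OF k] by simp
  have qi: "integrable M (\<lambda>\<omega>. \<zeta> \<omega> * (\<xi> k \<omega>)\<^sup>2)"
  proof (rule integrable_bounded_mult[OF _ \<zeta>M \<zeta>(2)])
    have "integrable M (\<lambda>\<omega>. (\<xi> k \<omega>)\<^sup>2 * 1)"
    proof (rule integrable_bounded_mult[where B="C\<^sup>2"])
      show "\<bar>(\<xi> k \<omega>)\<^sup>2\<bar> \<le> C\<^sup>2" if "\<omega> \<in> space M" for \<omega>
        using C[OF that] by (simp add: abs_le_square_iff[symmetric])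
    qed (use xi_M[OF k] in auto)
    then show "integrable M (\<lambda>\<omega>. (\<xi> k \<omega>)\<^sup>2)" by simp
  qed
  have i1: "integrable M (\<lambda>\<omega>. \<zeta> \<omega> * (S k \<omega>)\<^sup>2)"
    by (rule integrable_bounded_mult[OF S_square \<zeta>M \<zeta>(2)]) (use k in auto)
  have ip: "integrable M (\<lambda>\<omega>. (\<zeta> \<omega> * (\<xi> k \<omega> * S k \<omega>)) * ?D \<omega>)"
    "expectation (\<lambda>\<omega>. (\<zeta> \<omega> * (\<xi> k \<omega> * S k \<omega>)) * ?D \<omega>) = 0"
    by (rule increment_product[OF _ _ _ p pi]; use k t_bounds t_Suc in simp)+
  have iq: "integrable M (\<lambda>\<omega>. (\<zeta> \<omega> * (\<xi> k \<omega>)\<^sup>2) * (?D \<omega>)\<^sup>2)"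
    "expectation (\<lambda>\<omega>. (\<zeta> \<omega> * (\<xi> k \<omega>)\<^sup>2) * (?D \<omega>)\<^sup>2) = expectation (\<lambda>\<omega>. \<zeta> \<omega> * (\<xi> k \<omega>)\<^sup>2) * (t (Suc k) - t k)"
    by (rule increment_product[OF _ _ _ q qi]; use k t_bounds t_Suc in simp)+
  have "expectation (\<lambda>\<omega>. \<zeta> \<omega> * (S (Suc k) \<omega>)\<^sup>2) =
      expectation (\<lambda>\<omega>. (\<zeta> \<omega> * (S k \<omega>)\<^sup>2 + 2 * ((\<zeta> \<omega> * (\<xi> k \<omega> * S k \<omega>)) * ?D \<omega>)) + (\<zeta> \<omega> * (\<xi> k \<omega>)\<^sup>2) * (?D \<omega>)\<^sup>2)"
    unfolding S_Suc by (rule Bochner_Integration.integral_cong) (auto simp: algebra_simps power2_eq_square)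
  also have "\<dots> = expectation (\<lambda>\<omega>. \<zeta> \<omega> * (S k \<omega>)\<^sup>2 + 2 * ((\<zeta> \<omega> * (\<xi> k \<omega> * S k \<omega>)) * ?D \<omega>))
      + expectation (\<lambda>\<omega>. (\<zeta> \<omega> * (\<xi> k \<omega>)\<^sup>2) * (?D \<omega>)\<^sup>2)"
    by (rule Bochner_Integration.integral_add) (use i1 ip iq in simp_all)
  also have "expectation (\<lambda>\<omega>. \<zeta> \<omega> * (S k \<omega>)\<^sup>2 + 2 * ((\<zeta> \<omega> * (\<xi> k \<omega> * S k \<omega>)) * ?D \<omega>))
     = expectation (\<lambda>\<omega>. \<zeta> \<omega> * (S k \<omega>)\<^sup>2) + expectation (\<lambda>\<omega>. 2 * ((\<zeta> \<omega> * (\<xi> k \<omega> * S k \<omega>)) * ?D \<omega>))"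
    by (rule Bochner_Integration.integral_add) (use i1 ip in simp_all)
  also have "expectation (\<lambda>\<omega>. 2 * ((\<zeta> \<omega> * (\<xi> k \<omega> * S k \<omega>)) * ?D \<omega>)) = 0"
    using ip by (simp only: integral_mult_right_zero mult_zero_right)
  finally show ?case using Suc.IH k iq(2) by simp
qed (simp add: S_def)

lemma simple_integral_S: "simple_integral W n t \<xi> = S n"
  by (rule ext) (simp add: simple_integral_def S_def)

end

context brownian_basis
begin

sublocale LM: pair_sigma_finite lborel M by unfold_locales

abbreviation LM :: "(real \<times> 'a) measure" where "LM \<equiv> lborel \<Otimes>\<^sub>M M"

end

context brownian_simple
begin

lemma simple_value_measurable: "(\<lambda>(r, \<omega>). simple_value n t \<xi> r \<omega>) \<in> borel_measurable LM"
  unfolding simple_value_def split_beta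
proof (intro borel_measurable_sum borel_measurable_times)
  fix i assume "i \<in> {..<n}"
  then have "\<xi> i \<in> borel_measurable M" using xi_M by simp
  then show "(\<lambda>x. \<xi> i (snd x)) \<in> borel_measurable LM" by measurable
  show "(\<lambda>x. indicator {t i<..t (Suc i)} (fst x)) \<in> borel_measurable LM" by measurable
qed

lemma simple_value_integral:
  assumes \<zeta>: "\<zeta> \<in> borel_measurable M" "\<And>\<omega>. \<omega> \<in> space M \<Longrightarrow> \<bar>\<zeta> \<omega>\<bar> \<le> B"
  shows "integrable LM (\<lambda>(r, \<omega>). \<zeta> \<omega> * (simple_value n t \<xi> r \<omega>)\<^sup>2)"
    "(\<integral>(r, \<omega>). \<zeta> \<omega> * (simple_value n t \<xi> r \<omega>)\<^sup>2 \<partial>LM) = (\<Sum>i<n. expectation (\<lambda>\<omega>. \<zeta> \<omega> * (\<xi> i \<omega>)\<^sup>2) * (t (Suc i) - t i))"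
proof -
  have mono: "\<forall>i<n. t i \<le> t (Suc i)" using t_Suc by simp
  have e: "(\<lambda>(r, \<omega>). \<zeta> \<omega> * (simple_value n t \<xi> r \<omega>)\<^sup>2) =
      (\<lambda>x. \<Sum>i<n. (\<lambda>(r, \<omega>). indicator {t i<..t (Suc i)} r * (\<zeta> \<omega> * (\<xi> i \<omega>)\<^sup>2)) x)"
    unfolding simple_value_square[OF mono] split_beta sum_distrib_left by (simp only: mult.left_commute)
  have i: "integrable M (\<lambda>\<omega>. \<zeta> \<omega> * (\<xi> i \<omega>)\<^sup>2)" if i: "i < n" for i
  proof (rule integrable_bounded_mult[OF _ \<zeta>])
    obtain C where C: "\<And>\<omega>. \<omega> \<in> space M \<Longrightarrow> \<bar>\<xi> i \<omega>\<bar> \<le> C" using xi_bound[OF i] by blast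
    have "integrable M (\<lambda>\<omega>. (\<xi> i \<omega>)\<^sup>2 * 1)"
    proof (rule integrable_bounded_mult[where B="C\<^sup>2"])
      show "\<bar>(\<xi> i \<omega>)\<^sup>2\<bar> \<le> C\<^sup>2" if "\<omega> \<in> space M" for \<omega>
        using C[OF that] by (simp add: abs_le_square_iff[symmetric])
    qed (use xi_M[OF i] in auto)
    then show "integrable M (\<lambda>\<omega>. (\<xi> i \<omega>)\<^sup>2)" by simp
  qed
  note p = LM.product_integrable[OF integrable_indicator_Ioc(1) i]
  show "integrable LM (\<lambda>(r, \<omega>). \<zeta> \<omega> * (simple_value n t \<xi> r \<omega>)\<^sup>2)"
    unfolding e by (intro Bochner_Integration.integrable_sum) (use p(1) in simp)
  have "(\<integral>(r, \<omega>). \<zeta> \<omega> * (simple_value n t \<xi> r \<omega>)\<^sup>2 \<partial>LM) =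
      (\<Sum>i<n. \<integral>x. (\<lambda>(r, \<omega>). indicator {t i<..t (Suc i)} r * (\<zeta> \<omega> * (\<xi> i \<omega>)\<^sup>2)) x \<partial>LM)"
    unfolding e by (intro Bochner_Integration.integral_sum) (use p(1) in simp)
  also have "\<dots> = (\<Sum>i<n. expectation (\<lambda>\<omega>. \<zeta> \<omega> * (\<xi> i \<omega>)\<^sup>2) * (t (Suc i) - t i))"
  proof (rule sum.cong[OF refl])
    fix i assume "i \<in> {..<n}"
    then have "i < n" by simp
    then show "(\<integral>x. (\<lambda>(r, \<omega>). indicator {t i<..t (Suc i)} r * (\<zeta> \<omega> * (\<xi> i \<omega>)\<^sup>2)) x \<partial>LM)
       = expectation (\<lambda>\<omega>. \<zeta> \<omega> * (\<xi> i \<omega>)\<^sup>2) * (t (Suc i) - t i)"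
      using p(2)[of i "t i" "t (Suc i)"] integrable_indicator_Ioc(2)[OF t_Suc] by simp
  qed
  finally show "(\<integral>(r, \<omega>). \<zeta> \<omega> * (simple_value n t \<xi> r \<omega>)\<^sup>2 \<partial>LM) = (\<Sum>i<n. expectation (\<lambda>\<omega>. \<zeta> \<omega> * (\<xi> i \<omega>)\<^sup>2) * (t (Suc i) - t i))" .
qed

lemma simple_value_outside: assumes "r \<notin> {a..b}" shows "simple_value n t \<xi> r \<omega> = 0"
  unfolding simple_value_def
proof (rule sum.neutral, rule ballI)
  fix i assume "i \<in> {..<n}"
  then have "a \<le> t i" "t (Suc i) \<le> b" using t_bounds(1)[of i] t_bounds(2)[of "Suc i"] by auto
  then show "\<xi> i \<omega> * indicator {t i<..t (Suc i)} r = 0" using assms by (auto simp: indicator_def)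
qed

end

text \<open>Exchanging the integrals over time and \<open>\<omega>\<close> needs joint
  measurability, which the definition of the integral does not supply for \<open>Z\<close>;
  \<open>Zc\<close> is a jointly measurable function that agrees with it on
  \<open>[a, b]\<close>.\<close>

locale brownian_ito = brownian_basis +
  fixes a b :: real and Z Zc :: "real \<Rightarrow> 'a \<Rightarrow> real" and J :: "'a \<Rightarrow> real"
  assumes ito: "has_ito_integral M F W a b Z J" and ab: "0 \<le> a" "b \<le> 1"
    and Zc: "(\<lambda>(r, \<omega>). Zc r \<omega>) \<in> borel_measurable (lborel \<Otimes>\<^sub>M M)"
    and Z_Zc: "\<And>r \<omega>. r \<in> {a..b} \<Longrightarrow> \<omega> \<in> space M \<Longrightarrow> Z r \<omega> = Zc r \<omega>"
begin

definition "ZI = (\<lambda>(r, \<omega>). indicator {a..b} r * Zc r \<omega>)"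

lemma ZI_measurable: "ZI \<in> borel_measurable LM"
proof -
  have "(\<lambda>x. indicator {a..b} (fst x) * (\<lambda>(r, \<omega>). Zc r \<omega>) x) \<in> borel_measurable LM"
    by (intro borel_measurable_times Zc) measurable
  then show ?thesis by (simp add: ZI_def split_beta)
qed

text \<open>Both limits of the definition become instances of \<open>L2_limit\<close>. For the
  integrands, the iterated integral is one over the product space, because simple values and
  \<open>ZI\<close> both vanish outside \<open>[a, b]\<close>.\<close>

lemma approximation:
  "\<exists>n t \<xi>. (\<forall>k. simple_integrand F a b (n k) (t k) (\<xi> k)) \<and>
    L2_limit M (\<lambda>k. simple_integral W (n k) (t k) (\<xi> k)) J \<and>
    L2_limit LM (\<lambda>k (r, \<omega>). simple_value (n k) (t k) (\<xi> k) r \<omega>) ZI"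
proof -
  obtain n t \<xi> where J: "J \<in> borel_measurable M" and si: "\<And>k. simple_integrand F a b (n k) (t k) (\<xi> k)"
    and l1: "(\<lambda>k. \<integral>\<^sup>+\<omega>. (\<integral>\<^sup>+r\<in>{a..b}. ennreal ((simple_value (n k) (t k) (\<xi> k) r \<omega> - Z r \<omega>)\<^sup>2) \<partial>lborel) \<partial>M) \<longlonglongrightarrow> 0"
    and l2: "(\<lambda>k. \<integral>\<^sup>+\<omega>. ennreal ((simple_integral W (n k) (t k) (\<xi> k) \<omega> - J \<omega>)\<^sup>2) \<partial>M) \<longlonglongrightarrow> 0"
    using ito unfolding has_ito_integral_def by blast
  have bs: "brownian_simple M F W a b (n k) (t k) (\<xi> k)" for k
    by unfold_locales (use si ab in auto)
  have "L2_limit M (\<lambda>k. simple_integral W (n k) (t k) (\<xi> k)) J"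
  proof
    fix k
    interpret brownian_simple M F W a b "n k" "t k" "\<xi> k" by (rule bs)
    show "simple_integral W (n k) (t k) (\<xi> k) \<in> borel_measurable M"
      "integrable M (\<lambda>x. (simple_integral W (n k) (t k) (\<xi> k) x)\<^sup>2)"
      unfolding simple_integral_S by (rule S_M S_square; simp)+
  qed (use J l2 in auto)
  moreover have "L2_limit LM (\<lambda>k (r, \<omega>). simple_value (n k) (t k) (\<xi> k) r \<omega>) ZI"
  proof
    fix k
    interpret brownian_simple M F W a b "n k" "t k" "\<xi> k" by (rule bs)
    show "(\<lambda>(r, \<omega>). simple_value (n k) (t k) (\<xi> k) r \<omega>) \<in> borel_measurable LM" by (rule simple_value_measurable)
    show "integrable LM (\<lambda>x. (case x of (r, \<omega>) \<Rightarrow> simple_value (n k) (t k) (\<xi> k) r \<omega>)\<^sup>2)"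
    proof -
      have "integrable LM (\<lambda>(r, \<omega>). 1 * (simple_value (n k) (t k) (\<xi> k) r \<omega>)\<^sup>2)"
        by (rule simple_value_integral(1)[where B=1]) auto
      then show ?thesis by (simp add: case_prod_beta')
    qed
  next
    have "(\<integral>\<^sup>+x. ennreal (((case x of (r, \<omega>) \<Rightarrow> simple_value (n k) (t k) (\<xi> k) r \<omega>) - ZI x)\<^sup>2) \<partial>LM)
       = (\<integral>\<^sup>+\<omega>. (\<integral>\<^sup>+r\<in>{a..b}. ennreal ((simple_value (n k) (t k) (\<xi> k) r \<omega> - Z r \<omega>)\<^sup>2) \<partial>lborel) \<partial>M)" for k
    proof -
      interpret brownian_simple M F W a b "n k" "t k" "\<xi> k" by (rule bs)
      have m: "(\<lambda>x. ennreal (((case x of (r, \<omega>) \<Rightarrow> simple_value (n k) (t k) (\<xi> k) r \<omega>) - ZI x)\<^sup>2)) \<in> borel_measurable LM"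
        using simple_value_measurable ZI_measurable by measurable
      have "(\<integral>\<^sup>+x. ennreal (((case x of (r, \<omega>) \<Rightarrow> simple_value (n k) (t k) (\<xi> k) r \<omega>) - ZI x)\<^sup>2) \<partial>LM) =
        (\<integral>\<^sup>+\<omega>. \<integral>\<^sup>+r. ennreal ((simple_value (n k) (t k) (\<xi> k) r \<omega> - ZI (r, \<omega>))\<^sup>2) \<partial>lborel \<partial>M)"
        using LM.nn_integral_snd[OF m] by simp
      also have "\<dots> = (\<integral>\<^sup>+\<omega>. (\<integral>\<^sup>+r\<in>{a..b}. ennreal ((simple_value (n k) (t k) (\<xi> k) r \<omega> - Z r \<omega>)\<^sup>2) \<partial>lborel) \<partial>M)"
      proof (intro nn_integral_cong)
        fix \<omega> r assume "\<omega> \<in> space M"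
        then show "ennreal ((simple_value (n k) (t k) (\<xi> k) r \<omega> - ZI (r, \<omega>))\<^sup>2) =
            ennreal ((simple_value (n k) (t k) (\<xi> k) r \<omega> - Z r \<omega>)\<^sup>2) * indicator {a..b} r"
          using simple_value_outside[of r \<omega>] Z_Zc[of r \<omega>] by (cases "r \<in> {a..b}") (auto simp: ZI_def)
      qed
      finally show ?thesis .
    qed
    then show "(\<lambda>k. \<integral>\<^sup>+x. ennreal (((case x of (r, \<omega>) \<Rightarrow> simple_value (n k) (t k) (\<xi> k) r \<omega>) - ZI x)\<^sup>2) \<partial>LM) \<longlonglongrightarrow> 0"
      using l1 by simp
  qed (rule ZI_measurable)
  ultimately show ?thesis using si by blast
qed

lemma J_measurable: "J \<in> borel_measurable M" using ito by (simp add: has_ito_integral_def)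

lemma J_square: "integrable M (\<lambda>\<omega>. (J \<omega>)\<^sup>2)"
  using approximation L2_limit.limit_square_integrable[of M _ J] by blast

lemma ZI_square: "integrable LM (\<lambda>x. (ZI x)\<^sup>2)"
  using approximation L2_limit.limit_square_integrable[of LM _ ZI] by blast

lemma J_inner_zero:
  assumes \<zeta>: "\<zeta> \<in> borel_measurable (F a)" "integrable M (\<lambda>\<omega>. (\<zeta> \<omega>)\<^sup>2)" and "a \<le> b"
  shows "expectation (\<lambda>\<omega>. \<zeta> \<omega> * J \<omega>) = 0"
proof -
  obtain n t \<xi> where si: "\<And>k. simple_integrand F a b (n k) (t k) (\<xi> k)"
    and l: "L2_limit M (\<lambda>k. simple_integral W (n k) (t k) (\<xi> k)) J" using approximation by blast
  have "\<zeta> \<in> borel_measurable M" using F_measurable[OF \<zeta>(1)] ab assms(3) by auto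
  from L2_limit.inner_tendsto[OF l this \<zeta>(2)]
  have "(\<lambda>k. expectation (\<lambda>x. \<zeta> x * simple_integral W (n k) (t k) (\<xi> k) x)) \<longlonglongrightarrow> expectation (\<lambda>x. \<zeta> x * J x)" .
  moreover have "expectation (\<lambda>x. \<zeta> x * simple_integral W (n k) (t k) (\<xi> k) x) = 0" for k
  proof -
    interpret brownian_simple M F W a b "n k" "t k" "\<xi> k" by unfold_locales (use si ab in auto)
    show ?thesis unfolding simple_integral_S by (rule S_inner_zero[OF \<zeta>]) simp
  qed
  ultimately have "(\<lambda>k. 0) \<longlonglongrightarrow> expectation (\<lambda>x. \<zeta> x * J x)" by simp
  from LIMSEQ_unique[OF this tendsto_const] show ?thesis .
qed

lemma J_isometry:
  assumes \<zeta>: "\<zeta> \<in> borel_measurable (F a)" "\<And>\<omega>. \<omega> \<in> space M \<Longrightarrow> \<bar>\<zeta> \<omega>\<bar> \<le> B" and "a \<le> b"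
  shows "expectation (\<lambda>\<omega>. \<zeta> \<omega> * (J \<omega>)\<^sup>2) = (\<integral>x. \<zeta> (snd x) * (ZI x)\<^sup>2 \<partial>LM)"
proof -
  obtain n t \<xi> where si: "\<And>k. simple_integrand F a b (n k) (t k) (\<xi> k)"
    and l: "L2_limit M (\<lambda>k. simple_integral W (n k) (t k) (\<xi> k)) J"
      "L2_limit LM (\<lambda>k (r, \<omega>). simple_value (n k) (t k) (\<xi> k) r \<omega>) ZI" using approximation by blast
  have \<zeta>M: "\<zeta> \<in> borel_measurable M" using F_measurable[OF \<zeta>(1)] ab assms(3) by auto
  have 1: "(\<lambda>k. expectation (\<lambda>x. \<zeta> x * (simple_integral W (n k) (t k) (\<xi> k) x)\<^sup>2)) \<longlonglongrightarrow> expectation (\<lambda>x. \<zeta> x * (J x)\<^sup>2)"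
    by (rule L2_limit.square_tendsto[OF l(1) \<zeta>M \<zeta>(2)])
  have 2: "(\<lambda>k. \<integral>x. \<zeta> (snd x) * (case x of (r, \<omega>) \<Rightarrow> simple_value (n k) (t k) (\<xi> k) r \<omega>)\<^sup>2 \<partial>LM)
     \<longlonglongrightarrow> (\<integral>x. \<zeta> (snd x) * (ZI x)\<^sup>2 \<partial>LM)"
    by (rule L2_limit.square_tendsto[OF l(2)]) (use \<zeta>M \<zeta>(2) in \<open>auto simp: space_pair_measure\<close>)
  have 3: "expectation (\<lambda>x. \<zeta> x * (simple_integral W (n k) (t k) (\<xi> k) x)\<^sup>2) =
      (\<integral>x. \<zeta> (snd x) * (case x of (r, \<omega>) \<Rightarrow> simple_value (n k) (t k) (\<xi> k) r \<omega>)\<^sup>2 \<partial>LM)" for k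
  proof -
    interpret brownian_simple M F W a b "n k" "t k" "\<xi> k" by unfold_locales (use si ab in auto)
    have "expectation (\<lambda>x. \<zeta> x * (simple_integral W (n k) (t k) (\<xi> k) x)\<^sup>2) =
        (\<integral>(r, \<omega>). \<zeta> \<omega> * (simple_value (n k) (t k) (\<xi> k) r \<omega>)\<^sup>2 \<partial>LM)"
      unfolding simple_integral_S
    proof (rule trans)
      show "expectation (\<lambda>x. \<zeta> x * (S (n k) x)\<^sup>2) = (\<Sum>i<n k. expectation (\<lambda>\<omega>. \<zeta> \<omega> * (\<xi> k i \<omega>)\<^sup>2) * (t k (Suc i) - t k i))"
        by (rule S_square_expectation[OF \<zeta>]) simp_all
      show "\<dots> = (\<integral>(r, \<omega>). \<zeta> \<omega> * (simple_value (n k) (t k) (\<xi> k) r \<omega>)\<^sup>2 \<partial>LM)"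
        by (rule simple_value_integral(2)[OF \<zeta>M \<zeta>(2), symmetric])
    qed
    then show ?thesis by (simp add: case_prod_beta')
  qed
  show ?thesis by (rule LIMSEQ_unique[OF 1 2[folded 3]])
qed

end

section \<open>The bound on Z\<close>

text \<open>Outside \<open>[t1, t2]\<close> the process \<open>Z\<close> is arbitrary; \<open>Zc\<close> below freezes it there to make it jointly
  measurable.\<close>

locale decoupled = brownian_basis +
  fixes t1 t2 x1 x2 L :: real and u :: "real \<Rightarrow> real \<times> real \<Rightarrow> real"
    and X1 X2 Y Z :: "real \<Rightarrow> 'a \<Rightarrow> real"
  assumes t12: "0 \<le> t1" "t1 \<le> t2" "t2 \<le> 1"
    and pX1: "progressively_measurable F t1 t2 X1" and pX2: "progressively_measurable F t1 t2 X2"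
    and pY: "progressively_measurable F t1 t2 Y" and pZ: "progressively_measurable F t1 t2 Z"
    and Z_bounded: "essentially_bounded M t1 t2 Z"
    and X1_eq: "\<And>s. s \<in> {t1..t2} \<Longrightarrow> AE \<omega> in M. X1 s \<omega> = x1 + (W s \<omega> - W t1 \<omega>)"
    and X2_eq: "\<And>s. s \<in> {t1..t2} \<Longrightarrow> AE \<omega> in M. X2 s \<omega> = x2 + (LINT r:{t1..s}|lborel. (Z r \<omega>)\<^sup>2)"
    and Y_eq: "\<And>s. s \<in> {t1..t2} \<Longrightarrow> \<exists>J. has_ito_integral M F W s t2 Z J \<and> (AE \<omega> in M. Y s \<omega> = Y t2 \<omega> - J \<omega>)"
    and Y_u: "\<And>s. s \<in> {t1..t2} \<Longrightarrow> AE \<omega> in M. Y s \<omega> = u s (X1 s \<omega>, X2 s \<omega>)"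
    and u_lip: "\<And>s. s \<in> {0..1} \<Longrightarrow> L-lipschitz_on UNIV (u s)"
begin

lemma L0: "0 \<le> L" using lipschitz_on_nonneg[OF u_lip[of 0]] by simp

lemma u_diff: assumes "s \<in> {0..1}" shows "\<bar>u s (a, b) - u s (c, d)\<bar> \<le> L * (\<bar>a - c\<bar> + \<bar>b - d\<bar>)"
proof -
  have "\<bar>u s (a, b) - u s (c, d)\<bar> \<le> L * dist (a, b) (c, d)"
    using lipschitz_onD[OF u_lip[OF assms], of "(a, b)" "(c, d)"] by (simp add: dist_real_def)
  also have "\<dots> \<le> L * (\<bar>a - c\<bar> + \<bar>b - d\<bar>)"
    using sqrt_sum_squares_le_sum_abs[of "a - c" "b - d"] L0
    by (intro mult_left_mono) (auto simp: dist_prod_def dist_real_def)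
  finally show ?thesis .
qed

lemma u_measurable: assumes "s \<in> {0..1}" shows "u s \<in> borel_measurable borel"
  using lipschitz_on_continuous_on[OF u_lip[OF assms]] by (intro borel_measurable_continuous_onI)

lemma prog_measurable:
  assumes "progressively_measurable F t1 t2 V" "s \<in> {t1..t2}" shows "V s \<in> borel_measurable (F s)"
proof -
  have 1: "(\<lambda>(r, \<omega>). V r \<omega>) \<in> borel_measurable (restrict_space borel {t1..s} \<Otimes>\<^sub>M F s)"
    using assms unfolding progressively_measurable_def by blast
  have 2: "(\<lambda>\<omega>. (s, \<omega>)) \<in> measurable (F s) (restrict_space borel {t1..s} \<Otimes>\<^sub>M F s)"
    using assms(2) by (intro measurable_Pair measurable_const measurable_ident) (auto simp: space_restrict_space)
  show ?thesis using measurable_compose[OF 2 1] by simp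
qed

lemma prog_measurable_M: "progressively_measurable F t1 t2 V \<Longrightarrow> s \<in> {t1..t2} \<Longrightarrow> V s \<in> borel_measurable M"
  by (rule F_measurable[OF prog_measurable]) (use t12 in auto)

definition "Zc r \<omega> = Z (max t1 (min t2 r)) \<omega>"

lemma Zc_Z: "r \<in> {t1..t2} \<Longrightarrow> Zc r \<omega> = Z r \<omega>"
  by (simp add: Zc_def min_absorb2 max_absorb2)

lemma Zc_measurable: "(\<lambda>(r, \<omega>). Zc r \<omega>) \<in> borel_measurable LM"
proof -
  have "(\<lambda>(r, \<omega>). Z r \<omega>) \<in> borel_measurable (restrict_space borel {t1..t2} \<Otimes>\<^sub>M F t2)"
    using pZ t12 unfolding progressively_measurable_def by auto
  moreover have "(\<lambda>x. (max t1 (min t2 (fst x)), snd x)) \<in> measurable LM (restrict_space borel {t1..t2} \<Otimes>\<^sub>M F t2)"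
  proof (rule measurable_Pair)
    show "(\<lambda>x. max t1 (min t2 (fst x))) \<in> measurable LM (restrict_space borel {t1..t2})"
      by (rule measurable_restrict_space2) (use t12 in \<open>auto simp: space_pair_measure\<close>)
    have 1: "(\<lambda>\<omega>. \<omega>) \<in> measurable M (F t2)"
    proof (rule measurableI)
      have sub: "space (F t2) = space M" "sets (F t2) \<subseteq> sets M"
        using F_subalgebra[of t2] t12 by (simp_all add: subalgebra_def)
      show "\<omega> \<in> space (F t2)" if "\<omega> \<in> space M" for \<omega> using that sub(1) by simp
      fix A assume A: "A \<in> sets (F t2)"
      then have "A \<subseteq> space M" "A \<in> sets M" using sets.sets_into_space[OF A] sub by auto
      then show "(\<lambda>\<omega>. \<omega>) -` A \<inter> space M \<in> sets M" by (simp add: Int_absorb2)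
    qed
    show "(\<lambda>x. snd x) \<in> measurable LM (F t2)" by (rule measurable_compose[OF measurable_snd 1])
  qed
  ultimately have "(\<lambda>x. (\<lambda>(r, \<omega>). Z r \<omega>) (max t1 (min t2 (fst x)), snd x)) \<in> borel_measurable LM"
    by (rule measurable_compose[rotated])
  then show ?thesis by (simp add: Zc_def split_beta)
qed

lemma Zc_section: "\<omega> \<in> space M \<Longrightarrow> (\<lambda>r. Zc r \<omega>) \<in> borel_measurable lborel"
  using measurable_compose[OF measurable_Pair2' Zc_measurable, of \<omega>] by simp

text \<open>This \<open>C\<close> may depend on the solution and the interval. It serves for
  integrability and for remainders that vanish under refinement of the interval; the uniform bound
  is \<open>Z_bound\<close>.\<close>

lemma Zc_bounded: "\<exists>C\<ge>0. AE x in LM. fst x \<in> {t1..t2} \<longrightarrow> \<bar>Zc (fst x) (snd x)\<bar> \<le> C"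
proof -
  obtain C where C: "AE (r, \<omega>) in restrict_space lborel {t1..t2} \<Otimes>\<^sub>M M. \<bar>Z r \<omega>\<bar> \<le> C"
    using Z_bounded unfolding essentially_bounded_def by blast
  interpret R: finite_measure "restrict_space lborel {t1..t2}"
    by (rule finite_measureI) (use t12 in \<open>simp add: emeasure_restrict_space space_restrict_space\<close>)
  interpret RM: pair_sigma_finite "restrict_space lborel {t1..t2}" M by unfold_locales
  have "AE r in restrict_space lborel {t1..t2}. AE \<omega> in M. \<bar>Z r \<omega>\<bar> \<le> C"
    using RM.AE_pair[OF C] by simp
  then have "AE r in lborel. r \<in> {t1..t2} \<longrightarrow> (AE \<omega> in M. \<bar>Z r \<omega>\<bar> \<le> C)"
    by (subst (asm) AE_restrict_space_iff) auto
  then have ae: "AE r in lborel. AE \<omega> in M. r \<in> {t1..t2} \<longrightarrow> \<bar>Zc r \<omega>\<bar> \<le> \<bar>C\<bar>"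
  proof eventually_elim
    case (elim r)
    show ?case
    proof (cases "r \<in> {t1..t2}")
      case True
      then have "AE \<omega> in M. \<bar>Z r \<omega>\<bar> \<le> C" using elim by blast
      then show ?thesis by eventually_elim (use Zc_Z[OF True] in auto)
    qed auto
  qed
  have m: "{x \<in> space LM. fst x \<in> {t1..t2} \<longrightarrow> \<bar>(\<lambda>(r, \<omega>). Zc r \<omega>) x\<bar> \<le> \<bar>C\<bar>} \<in> sets LM"
    using Zc_measurable by measurable
  have "AE x in LM. fst x \<in> {t1..t2} \<longrightarrow> \<bar>(\<lambda>(r, \<omega>). Zc r \<omega>) x\<bar> \<le> \<bar>C\<bar>"
    by (rule LM.AE_pair_measure[OF m]) (use ae in simp)
  then have "AE x in LM. fst x \<in> {t1..t2} \<longrightarrow> \<bar>Zc (fst x) (snd x)\<bar> \<le> \<bar>C\<bar>"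
    by (simp add: split_beta)
  then show ?thesis by (intro exI[of _ "\<bar>C\<bar>"]) simp
qed

text \<open>Half-open intervals make this exactly additive in the interval; the endpoint by which it
  differs from the integral in the forward equation is a null set.\<close>

definition "QV s r \<omega> = (\<integral>v. indicator {s..<r} v * (Zc v \<omega>)\<^sup>2 \<partial>lborel)"

lemma AE_neq: "AE v in lborel. v \<noteq> (c::real)" by (rule AE_lborel_singleton)

lemma QV_set_integral:
  assumes "t1 \<le> s" "s \<le> t2" "\<omega> \<in> space M"
  shows "(LINT r:{t1..s}|lborel. (Z r \<omega>)\<^sup>2) = QV t1 s \<omega>"
proof -
  have "(LINT r:{t1..s}|lborel. (Z r \<omega>)\<^sup>2) = (\<integral>v. indicator {t1..s} v * (Zc v \<omega>)\<^sup>2 \<partial>lborel)"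
    unfolding set_lebesgue_integral_def
    by (rule Bochner_Integration.integral_cong) (use assms Zc_Z in \<open>auto simp: indicator_def\<close>)
  also have "\<dots> = QV t1 s \<omega>" unfolding QV_def
  proof (rule integral_cong_AE)
    show "AE v in lborel. indicator {t1..s} v * (Zc v \<omega>)\<^sup>2 = indicator {t1..<s} v * (Zc v \<omega>)\<^sup>2"
      using AE_neq[of s] by eventually_elim (auto simp: indicator_def)
  qed (use Zc_section[OF assms(3)] in simp_all)
  finally show ?thesis .
qed

lemma QV_props:
  assumes C: "AE x in LM. fst x \<in> {t1..t2} \<longrightarrow> \<bar>Zc (fst x) (snd x)\<bar> \<le> C" and "0 \<le> C"
  shows "AE \<omega> in M. \<forall>s r. t1 \<le> s \<longrightarrow> s \<le> r \<longrightarrow> r \<le> t2 \<longrightarrow>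
     QV t1 r \<omega> = QV t1 s \<omega> + QV s r \<omega> \<and> 0 \<le> QV s r \<omega> \<and> QV s r \<omega> \<le> C\<^sup>2 * (r - s)"
proof -
  have m: "{x \<in> space LM. fst x \<in> {t1..t2} \<longrightarrow> \<bar>(\<lambda>(r, \<omega>). Zc r \<omega>) x\<bar> \<le> C} \<in> sets LM"
    using Zc_measurable by measurable
  have m': "{x \<in> space LM. fst x \<in> {t1..t2} \<longrightarrow> \<bar>Zc (fst x) (snd x)\<bar> \<le> C} \<in> sets LM"
    using m by (simp add: split_beta)
  have "AE r in lborel. AE \<omega> in M. r \<in> {t1..t2} \<longrightarrow> \<bar>Zc r \<omega>\<bar> \<le> C"
    using LM.AE_pair[OF C] by simp
  then have "AE \<omega> in M. AE r in lborel. r \<in> {t1..t2} \<longrightarrow> \<bar>Zc r \<omega>\<bar> \<le> C"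
    by (subst (asm) LM.AE_commute[OF m'])
  then show ?thesis
  proof (rule AE_mp, intro AE_I2 impI allI)
    fix \<omega> s r assume \<omega>: "\<omega> \<in> space M" and ae: "AE r in lborel. r \<in> {t1..t2} \<longrightarrow> \<bar>Zc r \<omega>\<bar> \<le> C"
      and sr: "t1 \<le> s" "s \<le> r" "r \<le> t2"
    have i: "integrable lborel (\<lambda>v. indicator {a..<b} v * (Zc v \<omega>)\<^sup>2)" if "t1 \<le> a" "b \<le> t2" for a b
    proof (rule Bochner_Integration.integrable_bound)
      show "integrable lborel (\<lambda>v. indicator {a..<b} v * C\<^sup>2)"
        by (cases "a \<le> b") (auto intro!: integrable_real_indicator integrable_mult_left)
      show "AE v in lborel. norm (indicator {a..<b} v * (Zc v \<omega>)\<^sup>2) \<le> norm (indicator {a..<b} v * C\<^sup>2)"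
        using ae
      proof eventually_elim
        case (elim v)
        show ?case
        proof (cases "v \<in> {a..<b}")
          case True
          then have "\<bar>Zc v \<omega>\<bar> \<le> C" using elim that by auto
          then have "(Zc v \<omega>)\<^sup>2 \<le> C\<^sup>2" using assms(2) by (simp add: abs_le_square_iff[symmetric])
          then show ?thesis using True by simp
        qed simp
      qed
    qed (use Zc_section[OF \<omega>] in simp)
    have "QV t1 r \<omega> = (\<integral>v. indicator {t1..<s} v * (Zc v \<omega>)\<^sup>2 + indicator {s..<r} v * (Zc v \<omega>)\<^sup>2 \<partial>lborel)"
      unfolding QV_def by (rule Bochner_Integration.integral_cong) (use sr in \<open>auto simp: indicator_def\<close>)
    also have "\<dots> = QV t1 s \<omega> + QV s r \<omega>"
      unfolding QV_def by (rule Bochner_Integration.integral_add; rule i) (use sr in auto)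
    finally have 1: "QV t1 r \<omega> = QV t1 s \<omega> + QV s r \<omega>" .
    have 2: "0 \<le> QV s r \<omega>" unfolding QV_def by (rule Bochner_Integration.integral_nonneg) simp
    have "QV s r \<omega> \<le> (\<integral>v. indicator {s..<r} v * C\<^sup>2 \<partial>lborel)" unfolding QV_def
    proof (rule integral_mono_AE)
      show "integrable lborel (\<lambda>v. indicator {s..<r} v * (Zc v \<omega>)\<^sup>2)" by (rule i) (use sr in auto)
      show "integrable lborel (\<lambda>v. indicator {s..<r} v * C\<^sup>2)"
        using sr by (auto intro!: integrable_real_indicator integrable_mult_left)
      show "AE v in lborel. indicator {s..<r} v * (Zc v \<omega>)\<^sup>2 \<le> indicator {s..<r} v * C\<^sup>2"
        using ae
      proof eventually_elim
        case (elim v)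
        show ?case
        proof (cases "v \<in> {s..<r}")
          case True
          then have "\<bar>Zc v \<omega>\<bar> \<le> C" using elim sr by auto
          then have "(Zc v \<omega>)\<^sup>2 \<le> C\<^sup>2" using assms(2) by (simp add: abs_le_square_iff[symmetric])
          then show ?thesis using True by simp
        qed simp
      qed
    qed
    also have "\<dots> = C\<^sup>2 * (r - s)" using sr by simp
    finally show "QV t1 r \<omega> = QV t1 s \<omega> + QV s r \<omega> \<and> 0 \<le> QV s r \<omega> \<and> QV s r \<omega> \<le> C\<^sup>2 * (r - s)"
      using 1 2 by blast
  qed
qed

lemma X2_QV: assumes "s \<in> {t1..t2}" shows "AE \<omega> in M. X2 s \<omega> = x2 + QV t1 s \<omega>"
  using X2_eq[OF assms] AE_space
proof eventually_elim
  case (elim \<omega>)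
  then show ?case using QV_set_integral[of s \<omega>] assms by simp
qed

lemma Y_square: assumes "s \<in> {t1..t2}" shows "integrable M (\<lambda>\<omega>. (Y s \<omega>)\<^sup>2)"
   "r \<in> {0..1} \<Longrightarrow> integrable M (\<lambda>\<omega>. (u r (X1 s \<omega>, X2 s \<omega>))\<^sup>2)"
proof -
  have s01: "s \<in> {0..1}" using assms t12 by auto
  obtain C where C: "0 \<le> C" "AE x in LM. fst x \<in> {t1..t2} \<longrightarrow> \<bar>Zc (fst x) (snd x)\<bar> \<le> C"
    using Zc_bounded by blast
  show u: "integrable M (\<lambda>\<omega>. (u r (X1 s \<omega>, X2 s \<omega>))\<^sup>2)" if r: "r \<in> {0..1}" for r
  proof (rule Bochner_Integration.integrable_bound)
    define c where "c = \<bar>u r (x1, x2)\<bar> + L * (C\<^sup>2 * (s - t1))"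
    show "integrable M (\<lambda>\<omega>. 2 * c\<^sup>2 + 2 * L\<^sup>2 * (W s \<omega> - W t1 \<omega>)\<^sup>2)"
      using increment_moments(1)[of t1 s 2] assms t12 by auto
    have "(\<lambda>\<omega>. u r (X1 s \<omega>, X2 s \<omega>)) \<in> borel_measurable M"
    proof (rule measurable_compose[OF _ u_measurable[OF r]])
      show "(\<lambda>\<omega>. (X1 s \<omega>, X2 s \<omega>)) \<in> borel_measurable M"
        using prog_measurable_M[OF pX1 assms] prog_measurable_M[OF pX2 assms] by (rule borel_measurable_Pair)
    qed
    then show "(\<lambda>\<omega>. (u r (X1 s \<omega>, X2 s \<omega>))\<^sup>2) \<in> borel_measurable M" by simp
    show "AE \<omega> in M. norm ((u r (X1 s \<omega>, X2 s \<omega>))\<^sup>2) \<le> norm (2 * c\<^sup>2 + 2 * L\<^sup>2 * (W s \<omega> - W t1 \<omega>)\<^sup>2)"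
      using X1_eq[OF assms] X2_QV[OF assms] QV_props[OF C(2,1)]
    proof eventually_elim
      case (elim \<omega>)
      have q: "0 \<le> QV t1 s \<omega>" "QV t1 s \<omega> \<le> C\<^sup>2 * (s - t1)" using elim(3) assms by auto
      let ?w = "W s \<omega> - W t1 \<omega>" let ?U = "u r (X1 s \<omega>, X2 s \<omega>)"
      have "\<bar>?U - u r (x1, x2)\<bar> \<le> L * (\<bar>?w\<bar> + QV t1 s \<omega>)"
        using u_diff[OF r, of "X1 s \<omega>" "X2 s \<omega>" x1 x2] elim q by simp
      also have "\<dots> \<le> L * (\<bar>?w\<bar> + C\<^sup>2 * (s - t1))" using q L0 by (intro mult_left_mono) auto
      finally have "\<bar>?U\<bar> \<le> c + L * \<bar>?w\<bar>" unfolding c_def by (simp add: distrib_left)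
      then have "?U\<^sup>2 \<le> (c + L * \<bar>?w\<bar>)\<^sup>2" by (intro abs_le_square_iff[THEN iffD1]) linarith
      also have "\<dots> \<le> 2 * c\<^sup>2 + 2 * L\<^sup>2 * ?w\<^sup>2"
      proof -
        have "0 \<le> (c - L * \<bar>?w\<bar>)\<^sup>2" by simp
        then show ?thesis by (simp add: power2_sum power2_diff power_mult_distrib)
      qed
      finally show ?case by simp
    qed
  qed
  show "integrable M (\<lambda>\<omega>. (Y s \<omega>)\<^sup>2)"
  proof (rule integrable_cong_AE_imp[OF u[OF s01]])
    show "(\<lambda>\<omega>. (Y s \<omega>)\<^sup>2) \<in> borel_measurable M" using prog_measurable_M[OF pY assms] by simp
    show "AE \<omega> in M. (u s (X1 s \<omega>, X2 s \<omega>))\<^sup>2 = (Y s \<omega>)\<^sup>2"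
      using Y_u[OF assms] by eventually_elim simp
  qed
qed

text \<open>The expectation of \<open>\<zeta>\<close> times the quadratic variation of
  \<open>Y\<close> from \<open>s\<close> to \<open>r\<close>, written over the product space to
  match the isometry.\<close>

definition "V s r \<zeta> = (\<integral>x. \<zeta> (snd x) * (indicator {s..<r} (fst x) * (Zc (fst x) (snd x))\<^sup>2) \<partial>LM)"

lemma Zc_square_integrable:
  assumes "A \<subseteq> {t1..t2}" "A \<in> sets borel" "\<zeta> \<in> borel_measurable M" "\<And>\<omega>. \<omega> \<in> space M \<Longrightarrow> \<bar>\<zeta> \<omega>\<bar> \<le> B"
  shows "integrable LM (\<lambda>x. \<zeta> (snd x) * (indicator A (fst x) * (Zc (fst x) (snd x))\<^sup>2))"
proof (rule integrable_bounded_mult)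
  obtain C where C: "0 \<le> C" "AE x in LM. fst x \<in> {t1..t2} \<longrightarrow> \<bar>Zc (fst x) (snd x)\<bar> \<le> C"
    using Zc_bounded by blast
  have Zm: "(\<lambda>x. Zc (fst x) (snd x)) \<in> borel_measurable LM" using Zc_measurable by (simp add: split_beta)
  show "integrable LM (\<lambda>x. indicator A (fst x) * (Zc (fst x) (snd x))\<^sup>2)"
  proof (rule Bochner_Integration.integrable_bound)
    have "integrable lborel (indicator {t1..t2} :: real \<Rightarrow> real)" using t12 by (auto intro!: integrable_real_indicator)
    moreover have "integrable M (\<lambda>_. C\<^sup>2)" by simp
    ultimately have "integrable LM (\<lambda>(r, \<omega>). indicator {t1..t2} r * C\<^sup>2)" by (rule LM.product_integrable)
    then show "integrable LM (\<lambda>x. indicator {t1..t2} (fst x) * C\<^sup>2)" unfolding case_prod_beta' .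
    show "(\<lambda>x. indicator A (fst x) * (Zc (fst x) (snd x))\<^sup>2) \<in> borel_measurable LM"
      using Zm assms(2) by measurable
    show "AE x in LM. norm (indicator A (fst x) * (Zc (fst x) (snd x))\<^sup>2) \<le> norm (indicator {t1..t2} (fst x) * C\<^sup>2 :: real)"
      using C(2)
    proof eventually_elim
      case (elim x)
      show ?case
      proof (cases "fst x \<in> A")
        case True
        then have "\<bar>Zc (fst x) (snd x)\<bar> \<le> C" "fst x \<in> {t1..t2}" using elim assms(1) by auto
        then show ?thesis using True C(1) by (simp add: abs_le_square_iff[symmetric])
      qed simp
    qed
  qed
  show "(\<lambda>x. \<zeta> (snd x)) \<in> borel_measurable LM" using assms(3) by measurable
  show "\<bar>\<zeta> (snd x)\<bar> \<le> B" if "x \<in> space LM" for x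
    using that assms(4) by (auto simp: space_pair_measure)
qed

lemma V_add:
  assumes "t1 \<le> s" "s \<le> r" "r \<le> v" "v \<le> t2" "\<zeta> \<in> borel_measurable M" "\<And>\<omega>. \<omega> \<in> space M \<Longrightarrow> \<bar>\<zeta> \<omega>\<bar> \<le> B"
  shows "V s v \<zeta> = V s r \<zeta> + V r v \<zeta>"
proof -
  have "V s v \<zeta> = (\<integral>x. \<zeta> (snd x) * (indicator {s..<r} (fst x) * (Zc (fst x) (snd x))\<^sup>2)
      + \<zeta> (snd x) * (indicator {r..<v} (fst x) * (Zc (fst x) (snd x))\<^sup>2) \<partial>LM)"
    unfolding V_def by (rule Bochner_Integration.integral_cong) (use assms in \<open>auto simp: indicator_def\<close>)
  also have "\<dots> = V s r \<zeta> + V r v \<zeta>" unfolding V_def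
    by (rule Bochner_Integration.integral_add; rule Zc_square_integrable[OF _ _ assms(5,6)]) (use assms in auto)
  finally show ?thesis .
qed

lemma brownian_ito_Z: assumes "s \<in> {t1..t2}" "has_ito_integral M F W s t2 Z J" shows "brownian_ito M F W s t2 Z Zc J"
  by unfold_locales (use assms t12 Zc_measurable Zc_Z in auto)


text \<open>By the isometry, \<open>V\<close> is the weighted mean square of
  \<open>Y r - Y s\<close>. As \<open>Y s\<close> is the best prediction of \<open>Y r\<close> given
  \<open>F s\<close>, replacing it by \<open>u r (X1 s, X2 s)\<close> can only enlarge this. What
  remains is a difference of \<open>u r\<close> at two states, at most
  \<open>L (|W r - W s| + C\<^sup>2 (r - s))\<close>: the Brownian part has the right constant
  \<open>L\<^sup>2\<close>, and the rest is of higher order in \<open>r - s\<close>.\<close>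

lemma V_crude:
  assumes C: "AE x in LM. fst x \<in> {t1..t2} \<longrightarrow> \<bar>Zc (fst x) (snd x)\<bar> \<le> C" "0 \<le> C"
    and sr: "t1 \<le> s" "s \<le> r" "r \<le> t2"
    and \<zeta>: "\<zeta> \<in> borel_measurable (F s)" "\<And>\<omega>. \<omega> \<in> space M \<Longrightarrow> 0 \<le> \<zeta> \<omega>" "\<And>\<omega>. \<omega> \<in> space M \<Longrightarrow> \<zeta> \<omega> \<le> B"
  shows "V s r \<zeta> \<le> L\<^sup>2 * expectation \<zeta> * ((r - s) * (1 + (1 + 2 * C ^ 4) * sqrt (r - s)))"
proof -
  have s: "s \<in> {t1..t2}" and r: "r \<in> {t1..t2}" and s01: "0 \<le> s" "s \<le> 1" and r01: "0 \<le> r" "r \<le> 1" "r \<in> {0..1}"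
    using sr t12 by auto
  have \<zeta>b: "\<And>\<omega>. \<omega> \<in> space M \<Longrightarrow> \<bar>\<zeta> \<omega>\<bar> \<le> B" using \<zeta>(2,3) by force
  have \<zeta>M: "\<zeta> \<in> borel_measurable M" by (rule F_measurable[OF \<zeta>(1) s01])
  have \<zeta>r: "\<zeta> \<in> borel_measurable (F r)" by (rule F_mono_measurable[OF \<zeta>(1) s01(1) sr(2) r01(2)])
  have \<zeta>i: "integrable M \<zeta>" using integrable_bounded_mult[OF integrable_const[of 1] \<zeta>M \<zeta>b] by simp
  obtain Js where Js: "has_ito_integral M F W s t2 Z Js" "AE \<omega> in M. Y s \<omega> = Y t2 \<omega> - Js \<omega>" using Y_eq[OF s] by blast
  obtain Jr where Jr: "has_ito_integral M F W r t2 Z Jr" "AE \<omega> in M. Y r \<omega> = Y t2 \<omega> - Jr \<omega>" using Y_eq[OF r] by blast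
  interpret S: brownian_ito M F W s t2 Z Zc Js by (rule brownian_ito_Z[OF s Js(1)])
  interpret R: brownian_ito M F W r t2 Z Zc Jr by (rule brownian_ito_Z[OF r Jr(1)])
  define D where "D \<omega> = Y r \<omega> - Y s \<omega>" for \<omega>
  define c where "c \<omega> = u r (X1 s \<omega>, X2 s \<omega>)" for \<omega>
  define G where "G \<omega> = Y s \<omega> - c \<omega>" for \<omega>
  have YsF: "Y s \<in> borel_measurable (F s)" by (rule prog_measurable[OF pY s])
  have YrF: "Y r \<in> borel_measurable (F r)" by (rule prog_measurable[OF pY r])
  have YsFr: "Y s \<in> borel_measurable (F r)" by (rule F_mono_measurable[OF YsF s01(1) sr(2) r01(2)])
  have cF: "c \<in> borel_measurable (F s)" unfolding c_def[abs_def]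
    by (rule measurable_compose[OF borel_measurable_Pair[OF prog_measurable[OF pX1 s] prog_measurable[OF pX2 s]] u_measurable[OF r01(3)]])
  have GF: "G \<in> borel_measurable (F s)" unfolding G_def[abs_def] using YsF cF by simp
  have DF: "D \<in> borel_measurable (F r)" unfolding D_def[abs_def] using YrF YsFr by simp
  have DM: "D \<in> borel_measurable M" by (rule F_measurable[OF DF r01(1,2)])
  have GM: "G \<in> borel_measurable M" by (rule F_measurable[OF GF s01])
  have YM: "Y s \<in> borel_measurable M" "Y r \<in> borel_measurable M" "c \<in> borel_measurable M"
    using prog_measurable_M[OF pY] s r F_measurable[OF cF s01] by auto
  have c2: "integrable M (\<lambda>\<omega>. (c \<omega>)\<^sup>2)" unfolding c_def by (rule Y_square(2)[OF s r01(3)])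
  have D2: "integrable M (\<lambda>\<omega>. (D \<omega>)\<^sup>2)" unfolding D_def
    by (rule integrable_square_add(2)[OF YM(2,1) Y_square(1)[OF r] Y_square(1)[OF s]])
  have G2: "integrable M (\<lambda>\<omega>. (G \<omega>)\<^sup>2)" unfolding G_def
    by (rule integrable_square_add(2)[OF YM(1,3) Y_square(1)[OF s] c2])
  have DJ: "AE \<omega> in M. Js \<omega> = D \<omega> + Jr \<omega>" using Js(2) Jr(2) by eventually_elim (simp add: D_def)
  have mult2: "integrable M (\<lambda>\<omega>. (\<zeta> \<omega> * H \<omega>)\<^sup>2)" if "integrable M (\<lambda>\<omega>. (H \<omega>)\<^sup>2)" for H
  proof -
    have "\<bar>(\<zeta> \<omega>)\<^sup>2\<bar> \<le> B\<^sup>2" if "\<omega> \<in> space M" for \<omega>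
      using \<zeta>b[OF that] by (simp add: abs_le_square_iff[symmetric])
    then show ?thesis unfolding power_mult_distrib
      by (intro integrable_bounded_mult[OF that]) (use \<zeta>M in auto)
  qed
  have D\<zeta>: "expectation (\<lambda>\<omega>. (\<zeta> \<omega> * D \<omega>) * Jr \<omega>) = 0"
    by (rule R.J_inner_zero) (use \<zeta>r DF mult2[OF D2] sr in auto)
  have i\<zeta>: "integrable M (\<lambda>\<omega>. \<zeta> \<omega> * H \<omega>)" if "integrable M H" for H
    by (rule integrable_bounded_mult[OF that \<zeta>M \<zeta>b])

  have "V s r \<zeta> + expectation (\<lambda>\<omega>. \<zeta> \<omega> * (Jr \<omega>)\<^sup>2) = expectation (\<lambda>\<omega>. \<zeta> \<omega> * (Js \<omega>)\<^sup>2)"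
  proof -
    have e: "(\<integral>x. \<zeta> (snd x) * ((\<lambda>(v, \<omega>). indicator {q..t2} v * Zc v \<omega>) x)\<^sup>2 \<partial>LM)
       = (\<integral>x. \<zeta> (snd x) * (indicator {q..t2} (fst x) * (Zc (fst x) (snd x))\<^sup>2) \<partial>LM)" for q
      by (rule Bochner_Integration.integral_cong) (auto simp: indicator_def)
    have "expectation (\<lambda>\<omega>. \<zeta> \<omega> * (Jr \<omega>)\<^sup>2) = (\<integral>x. \<zeta> (snd x) * (indicator {r..t2} (fst x) * (Zc (fst x) (snd x))\<^sup>2) \<partial>LM)"
      using R.J_isometry[OF \<zeta>r \<zeta>b sr(3)] unfolding R.ZI_def e .
    moreover have "expectation (\<lambda>\<omega>. \<zeta> \<omega> * (Js \<omega>)\<^sup>2) = (\<integral>x. \<zeta> (snd x) * (indicator {s..t2} (fst x) * (Zc (fst x) (snd x))\<^sup>2) \<partial>LM)"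
      using S.J_isometry[OF \<zeta>(1) \<zeta>b] sr unfolding S.ZI_def e by simp
    moreover have "(\<integral>x. \<zeta> (snd x) * (indicator {s..t2} (fst x) * (Zc (fst x) (snd x))\<^sup>2) \<partial>LM) =
       (\<integral>x. \<zeta> (snd x) * (indicator {s..<r} (fst x) * (Zc (fst x) (snd x))\<^sup>2)
         + \<zeta> (snd x) * (indicator {r..t2} (fst x) * (Zc (fst x) (snd x))\<^sup>2) \<partial>LM)"
      by (rule Bochner_Integration.integral_cong) (use sr in \<open>auto simp: indicator_def\<close>)
    moreover have "\<dots> = V s r \<zeta> + (\<integral>x. \<zeta> (snd x) * (indicator {r..t2} (fst x) * (Zc (fst x) (snd x))\<^sup>2) \<partial>LM)"
      unfolding V_def by (rule Bochner_Integration.integral_add; rule Zc_square_integrable[OF _ _ \<zeta>M \<zeta>b]) (use sr in auto)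
    ultimately show ?thesis by simp
  qed
  moreover have "expectation (\<lambda>\<omega>. \<zeta> \<omega> * (Js \<omega>)\<^sup>2) = expectation (\<lambda>\<omega>. \<zeta> \<omega> * (D \<omega>)\<^sup>2) + expectation (\<lambda>\<omega>. \<zeta> \<omega> * (Jr \<omega>)\<^sup>2)"
  proof -
    have i: "integrable M (\<lambda>\<omega>. \<zeta> \<omega> * (D \<omega>)\<^sup>2)" "integrable M (\<lambda>\<omega>. (\<zeta> \<omega> * D \<omega>) * Jr \<omega>)" "integrable M (\<lambda>\<omega>. \<zeta> \<omega> * (Jr \<omega>)\<^sup>2)"
      using i\<zeta>[OF D2] i\<zeta>[OF R.J_square] i\<zeta>[OF integrable_mult_squares[OF DM R.J_measurable D2 R.J_square]]
      by (auto simp: mult.assoc)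
    have "expectation (\<lambda>\<omega>. \<zeta> \<omega> * (Js \<omega>)\<^sup>2) =
       expectation (\<lambda>\<omega>. (\<zeta> \<omega> * (D \<omega>)\<^sup>2 + 2 * ((\<zeta> \<omega> * D \<omega>) * Jr \<omega>)) + \<zeta> \<omega> * (Jr \<omega>)\<^sup>2)"
    proof (rule integral_cong_AE)
      show "AE \<omega> in M. \<zeta> \<omega> * (Js \<omega>)\<^sup>2 = (\<zeta> \<omega> * (D \<omega>)\<^sup>2 + 2 * ((\<zeta> \<omega> * D \<omega>) * Jr \<omega>)) + \<zeta> \<omega> * (Jr \<omega>)\<^sup>2"
        using DJ by eventually_elim (simp add: power2_sum algebra_simps)
    qed (use \<zeta>M DM R.J_measurable S.J_measurable in simp_all)
    also have "\<dots> = expectation (\<lambda>\<omega>. \<zeta> \<omega> * (D \<omega>)\<^sup>2 + 2 * ((\<zeta> \<omega> * D \<omega>) * Jr \<omega>)) + expectation (\<lambda>\<omega>. \<zeta> \<omega> * (Jr \<omega>)\<^sup>2)"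
      by (rule Bochner_Integration.integral_add) (use i in simp_all)
    also have "expectation (\<lambda>\<omega>. \<zeta> \<omega> * (D \<omega>)\<^sup>2 + 2 * ((\<zeta> \<omega> * D \<omega>) * Jr \<omega>)) =
       expectation (\<lambda>\<omega>. \<zeta> \<omega> * (D \<omega>)\<^sup>2) + expectation (\<lambda>\<omega>. 2 * ((\<zeta> \<omega> * D \<omega>) * Jr \<omega>))"
      by (rule Bochner_Integration.integral_add) (use i in simp_all)
    also have "expectation (\<lambda>\<omega>. 2 * ((\<zeta> \<omega> * D \<omega>) * Jr \<omega>)) = 0"
      using D\<zeta> by (simp only: integral_mult_right_zero mult_zero_right)
    finally show ?thesis by simp
  qed
  ultimately have VD: "V s r \<zeta> = expectation (\<lambda>\<omega>. \<zeta> \<omega> * (D \<omega>)\<^sup>2)" by linarith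

  \<comment> \<open>The \<open>F s\<close>-measurable \<open>G\<close> is orthogonal to the
    martingale increment \<open>D\<close>, so the mean square of \<open>D + G = Y r - c\<close>
    dominates that of \<open>D\<close>.\<close>
  have GD: "expectation (\<lambda>\<omega>. (\<zeta> \<omega> * G \<omega>) * D \<omega>) = 0"
  proof -
    have g1: "expectation (\<lambda>\<omega>. (\<zeta> \<omega> * G \<omega>) * Js \<omega>) = 0"
      by (rule S.J_inner_zero) (use \<zeta>(1) GF mult2[OF G2] sr in auto)
    have "G \<in> borel_measurable (F r)" by (rule F_mono_measurable[OF GF s01(1) sr(2) r01(2)])
    then have g2: "expectation (\<lambda>\<omega>. (\<zeta> \<omega> * G \<omega>) * Jr \<omega>) = 0"
      by (intro R.J_inner_zero) (use \<zeta>r mult2[OF G2] sr in auto)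
    have i: "integrable M (\<lambda>\<omega>. (\<zeta> \<omega> * G \<omega>) * Js \<omega>)" "integrable M (\<lambda>\<omega>. (\<zeta> \<omega> * G \<omega>) * Jr \<omega>)"
      using i\<zeta>[OF integrable_mult_squares[OF GM S.J_measurable G2 S.J_square]]
        i\<zeta>[OF integrable_mult_squares[OF GM R.J_measurable G2 R.J_square]] by (auto simp: mult.assoc)
    have "expectation (\<lambda>\<omega>. (\<zeta> \<omega> * G \<omega>) * D \<omega>) = expectation (\<lambda>\<omega>. (\<zeta> \<omega> * G \<omega>) * Js \<omega> - (\<zeta> \<omega> * G \<omega>) * Jr \<omega>)"
    proof (rule integral_cong_AE)
      show "AE \<omega> in M. (\<zeta> \<omega> * G \<omega>) * D \<omega> = (\<zeta> \<omega> * G \<omega>) * Js \<omega> - (\<zeta> \<omega> * G \<omega>) * Jr \<omega>"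
        using DJ by eventually_elim (simp add: algebra_simps)
    qed (use \<zeta>M DM GM R.J_measurable S.J_measurable in simp_all)
    also have "\<dots> = 0" using g1 g2 Bochner_Integration.integral_diff[OF i] by simp
    finally show ?thesis .
  qed
  have "expectation (\<lambda>\<omega>. \<zeta> \<omega> * (D \<omega>)\<^sup>2) \<le> expectation (\<lambda>\<omega>. \<zeta> \<omega> * (D \<omega> + G \<omega>)\<^sup>2)"
  proof -
    have i: "integrable M (\<lambda>\<omega>. \<zeta> \<omega> * (D \<omega>)\<^sup>2)" "integrable M (\<lambda>\<omega>. (\<zeta> \<omega> * G \<omega>) * D \<omega>)" "integrable M (\<lambda>\<omega>. \<zeta> \<omega> * (D \<omega> + G \<omega>)\<^sup>2)"
      using i\<zeta>[OF D2] i\<zeta>[OF integrable_mult_squares[OF GM DM G2 D2]] i\<zeta>[OF integrable_square_add(1)[OF DM GM D2 G2]]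
      by (auto simp: mult.assoc)
    have "expectation (\<lambda>\<omega>. \<zeta> \<omega> * (D \<omega>)\<^sup>2) = expectation (\<lambda>\<omega>. \<zeta> \<omega> * (D \<omega>)\<^sup>2 + 2 * ((\<zeta> \<omega> * G \<omega>) * D \<omega>))"
      using i GD by simp
    also have "\<dots> \<le> expectation (\<lambda>\<omega>. \<zeta> \<omega> * (D \<omega> + G \<omega>)\<^sup>2)"
    proof (rule integral_mono)
      show "integrable M (\<lambda>\<omega>. \<zeta> \<omega> * (D \<omega>)\<^sup>2 + 2 * ((\<zeta> \<omega> * G \<omega>) * D \<omega>))" using i by auto
      fix \<omega> assume "\<omega> \<in> space M"
      then have "0 \<le> \<zeta> \<omega> * (G \<omega>)\<^sup>2" using \<zeta>(2) by simp
      then show "\<zeta> \<omega> * (D \<omega>)\<^sup>2 + 2 * ((\<zeta> \<omega> * G \<omega>) * D \<omega>) \<le> \<zeta> \<omega> * (D \<omega> + G \<omega>)\<^sup>2"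
        by (simp add: power2_sum algebra_simps)
    qed (rule i)
    finally show ?thesis .
  qed
  also have "\<dots> \<le> L\<^sup>2 * expectation \<zeta> * ((r - s) * (1 + (1 + 2 * C ^ 4) * sqrt (r - s)))"
  proof -
    define d where "d = r - s"
    \<comment> \<open>Young's inequality with parameter \<open>sqrt (r - s)\<close>: the squared
      Brownian part keeps a factor \<open>1 + e\<close> tending to 1, and the drift part costs
      \<open>(d + e) d C ^ 4\<close>, of order \<open>d e\<close>.\<close>
    define e where "e = sqrt d"
    have e: "0 \<le> e" "e \<le> 1" "d = e\<^sup>2" using sr t12 by (auto simp: e_def d_def)
    have rearrange: "a * (b * (c * w + k)) = b * c * (a * w) + b * k * a" for a b c w k :: real
      by (simp add: distrib_left)
    have "AE \<omega> in M. \<zeta> \<omega> * (D \<omega> + G \<omega>)\<^sup>2 \<le>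
        L\<^sup>2 * (1 + e) * (\<zeta> \<omega> * (W r \<omega> - W s \<omega>)\<^sup>2) + L\<^sup>2 * ((d + e) * d * C ^ 4) * \<zeta> \<omega>"
      using Y_u[OF r] X1_eq[OF s] X1_eq[OF r] X2_QV[OF s] X2_QV[OF r] QV_props[OF C] AE_space
    proof eventually_elim
      case (elim \<omega>)
      let ?w = "W r \<omega> - W s \<omega>"
      have q: "QV t1 r \<omega> = QV t1 s \<omega> + QV s r \<omega>" "0 \<le> QV s r \<omega>" "QV s r \<omega> \<le> C\<^sup>2 * d"
        using elim(6)[rule_format, OF sr] unfolding d_def by blast+
      have "\<bar>D \<omega> + G \<omega>\<bar> = \<bar>u r (X1 r \<omega>, X2 r \<omega>) - u r (X1 s \<omega>, X2 s \<omega>)\<bar>"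
        using elim(1) by (simp add: D_def G_def c_def)
      also have "\<dots> \<le> L * (\<bar>X1 r \<omega> - X1 s \<omega>\<bar> + \<bar>X2 r \<omega> - X2 s \<omega>\<bar>)" by (rule u_diff[OF r01(3)])
      also have "\<dots> = L * (\<bar>?w\<bar> + QV s r \<omega>)" using elim(2-5) q by simp
      also have "\<dots> \<le> L * (\<bar>?w\<bar> + C\<^sup>2 * d)" using q L0 by (intro mult_left_mono) auto
      finally have "(D \<omega> + G \<omega>)\<^sup>2 \<le> (L * (\<bar>?w\<bar> + C\<^sup>2 * d))\<^sup>2"
        by (intro abs_le_square_iff[THEN iffD1]) linarith
      also have "\<dots> = L\<^sup>2 * (\<bar>?w\<bar> + C\<^sup>2 * d)\<^sup>2" by (rule power_mult_distrib)
      also have "\<dots> \<le> L\<^sup>2 * ((1 + e) * ?w\<^sup>2 + (d + e) * d * C ^ 4)"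
      proof (rule mult_left_mono)
        define A where "A = C\<^sup>2"
        define y where "y = \<bar>?w\<bar>"
        have C4: "C ^ 4 = A\<^sup>2" and y2: "?w\<^sup>2 = y\<^sup>2" by (simp_all add: A_def y_def)
        have "0 \<le> e * (y - A * e)\<^sup>2" using e by simp
        also have "\<dots> = e * y\<^sup>2 - 2 * (y * (A * e\<^sup>2)) + e * e\<^sup>2 * A\<^sup>2"
          by (simp add: algebra_simps power2_eq_square)
        finally have "2 * (y * (A * e\<^sup>2)) \<le> e * y\<^sup>2 + e * e\<^sup>2 * A\<^sup>2" by linarith
        moreover have "(y + A * e\<^sup>2)\<^sup>2 = y\<^sup>2 + 2 * (y * (A * e\<^sup>2)) + e\<^sup>2 * e\<^sup>2 * A\<^sup>2"
          by (simp add: algebra_simps power2_eq_square)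
        moreover have "(1 + e) * y\<^sup>2 + (e\<^sup>2 + e) * e\<^sup>2 * A\<^sup>2 = y\<^sup>2 + e * y\<^sup>2 + e\<^sup>2 * e\<^sup>2 * A\<^sup>2 + e * e\<^sup>2 * A\<^sup>2"
          by (simp add: algebra_simps)
        ultimately show "(\<bar>?w\<bar> + C\<^sup>2 * d)\<^sup>2 \<le> (1 + e) * ?w\<^sup>2 + (d + e) * d * C ^ 4"
          unfolding C4 y2 A_def[symmetric] y_def[symmetric] e(3) by linarith
      qed simp
      finally have "(D \<omega> + G \<omega>)\<^sup>2 \<le> L\<^sup>2 * ((1 + e) * ?w\<^sup>2 + (d + e) * d * C ^ 4)" .
      from mult_left_mono[OF this \<zeta>(2)[OF elim(7)]]
      have "\<zeta> \<omega> * (D \<omega> + G \<omega>)\<^sup>2 \<le> \<zeta> \<omega> * (L\<^sup>2 * ((1 + e) * ?w\<^sup>2 + (d + e) * d * C ^ 4))" .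
      then show ?case by (rule order_trans[OF _ eq_refl[OF rearrange]])
    qed
    moreover have ip: "integrable M (\<lambda>\<omega>. \<zeta> \<omega> * (W r \<omega> - W s \<omega>)\<^sup>2)"
      "expectation (\<lambda>\<omega>. \<zeta> \<omega> * (W r \<omega> - W s \<omega>)\<^sup>2) = expectation \<zeta> * d"
      unfolding d_def by (rule increment_product[OF s01(1) sr(2) r01(2) \<zeta>(1) \<zeta>i])+
    moreover have "integrable M (\<lambda>\<omega>. L\<^sup>2 * (1 + e) * (\<zeta> \<omega> * (W r \<omega> - W s \<omega>)\<^sup>2) + L\<^sup>2 * ((d + e) * d * C ^ 4) * \<zeta> \<omega>)"
      using ip \<zeta>i by simp
    ultimately have "expectation (\<lambda>\<omega>. \<zeta> \<omega> * (D \<omega> + G \<omega>)\<^sup>2) \<le>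
        expectation (\<lambda>\<omega>. L\<^sup>2 * (1 + e) * (\<zeta> \<omega> * (W r \<omega> - W s \<omega>)\<^sup>2) + L\<^sup>2 * ((d + e) * d * C ^ 4) * \<zeta> \<omega>)"
      using i\<zeta>[OF integrable_square_add(1)[OF DM GM D2 G2]] by (intro integral_mono_AE) simp_all
    also have "\<dots> = L\<^sup>2 * (1 + e) * (expectation \<zeta> * d) + L\<^sup>2 * ((d + e) * d * C ^ 4) * expectation \<zeta>"
      using ip \<zeta>i by simp
    also have "\<dots> = L\<^sup>2 * expectation \<zeta> * (d * (1 + e + (d + e) * C ^ 4))" by (simp add: algebra_simps)
    also have "\<dots> \<le> L\<^sup>2 * expectation \<zeta> * (d * (1 + (1 + 2 * C ^ 4) * e))"
    proof (intro mult_left_mono mult_nonneg_nonneg)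
      have "d \<le> e" using e mult_left_mono[of e 1 e] by (simp add: power2_eq_square)
      then have "(d + e) * C ^ 4 \<le> (e + e) * C ^ 4" by (intro mult_right_mono) auto
      then show "1 + e + (d + e) * C ^ 4 \<le> 1 + (1 + 2 * C ^ 4) * e" by (simp add: algebra_simps)
      show "0 \<le> expectation \<zeta>" using \<zeta>(2) by (intro Bochner_Integration.integral_nonneg) auto
      show "0 \<le> d" using e by simp
    qed simp
    finally show ?thesis unfolding d_def e_def .
  qed
  finally show ?thesis unfolding VD .
qed

text \<open>Cut the interval into \<open>m\<close> equal pieces: the leading terms add up exactly,
  while the excess carries a factor \<open>sqrt ((r - s) / m)\<close> and disappears as
  \<open>m\<close> grows. This removes the unspecified \<open>C\<close>.\<close>

lemma V_bound:
  assumes sr: "t1 \<le> s" "s \<le> r" "r \<le> t2"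
    and \<zeta>: "\<zeta> \<in> borel_measurable (F s)" "\<And>\<omega>. \<omega> \<in> space M \<Longrightarrow> 0 \<le> \<zeta> \<omega>" "\<And>\<omega>. \<omega> \<in> space M \<Longrightarrow> \<zeta> \<omega> \<le> B"
  shows "V s r \<zeta> \<le> L\<^sup>2 * expectation \<zeta> * (r - s)"
proof -
  obtain C where C: "0 \<le> C" "AE x in LM. fst x \<in> {t1..t2} \<longrightarrow> \<bar>Zc (fst x) (snd x)\<bar> \<le> C"
    using Zc_bounded by blast
  define K where "K = 1 + 2 * C ^ 4"
  have \<zeta>b: "\<And>\<omega>. \<omega> \<in> space M \<Longrightarrow> \<bar>\<zeta> \<omega>\<bar> \<le> B" using \<zeta>(2,3) by force
  have \<zeta>M: "\<zeta> \<in> borel_measurable M" by (rule F_measurable[OF \<zeta>(1)]) (use sr t12 in auto)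
  have main: "V s r \<zeta> \<le> L\<^sup>2 * expectation \<zeta> * ((r - s) * (1 + K * sqrt ((r - s) / real m)))" if m: "0 < m" for m
  proof -
    define d where "d = (r - s) / real m"
    have d: "0 \<le> d" "real m * d = r - s" using sr m by (auto simp: d_def)
    have step: "i \<le> m \<Longrightarrow> V s (s + real i * d) \<zeta> \<le> real i * (L\<^sup>2 * expectation \<zeta> * (d * (1 + K * sqrt d)))" for i
    proof (induction i)
      case 0
      then show ?case by (simp add: V_def)
    next
      case (Suc i)
      let ?a = "s + real i * d" let ?b = "s + real (Suc i) * d"
      have "real (Suc i) * d \<le> real m * d" using Suc.prems d by (intro mult_right_mono) auto
      moreover have "0 \<le> real i * d" "real (Suc i) * d = real i * d + d" using d by (simp_all add: distrib_right)
      ultimately have le: "s \<le> ?a" "?a \<le> ?b" "?b \<le> t2" "t1 \<le> ?a" using d sr by linarith+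
      have "V s ?b \<zeta> = V s ?a \<zeta> + V ?a ?b \<zeta>" by (rule V_add[OF sr(1) le(1-3) \<zeta>M \<zeta>b])
      also have "V ?a ?b \<zeta> \<le> L\<^sup>2 * expectation \<zeta> * ((?b - ?a) * (1 + (1 + 2 * C ^ 4) * sqrt (?b - ?a)))"
      proof (rule V_crude[OF C(2,1) le(4,2,3) _ \<zeta>(2,3)])
        show "\<zeta> \<in> borel_measurable (F ?a)"
          by (rule F_mono_measurable[OF \<zeta>(1)]) (use le sr t12 in auto)
      qed
      also have "?b - ?a = d" by (simp add: distrib_right)
      finally show ?case using Suc unfolding K_def by (simp add: distrib_right)
    qed
    have "real m * (L\<^sup>2 * expectation \<zeta> * (d * (1 + K * sqrt d))) = L\<^sup>2 * expectation \<zeta> * ((real m * d) * (1 + K * sqrt d))"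
      by (simp only: mult_ac)
    also have "\<dots> = L\<^sup>2 * expectation \<zeta> * ((r - s) * (1 + K * sqrt d))" by (simp only: d(2))
    finally have e: "real m * (L\<^sup>2 * expectation \<zeta> * (d * (1 + K * sqrt d))) = L\<^sup>2 * expectation \<zeta> * ((r - s) * (1 + K * sqrt d))" .
    have "s + real m * d = r" using d(2) by simp
    with step[of m] have "V s r \<zeta> \<le> real m * (L\<^sup>2 * expectation \<zeta> * (d * (1 + K * sqrt d)))" by simp
    from this[unfolded e] show ?thesis unfolding d_def .
  qed
  have "(\<lambda>m. L\<^sup>2 * expectation \<zeta> * ((r - s) * (1 + K * sqrt ((r - s) / real m)))) \<longlonglongrightarrow>
      L\<^sup>2 * expectation \<zeta> * ((r - s) * (1 + K * sqrt 0))"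
    by (intro tendsto_intros lim_const_over_n)
  moreover have "\<forall>\<^sub>F m in sequentially. V s r \<zeta> \<le> L\<^sup>2 * expectation \<zeta> * ((r - s) * (1 + K * sqrt ((r - s) / real m)))"
    using eventually_gt_at_top[of 0] by eventually_elim (rule main)
  ultimately have "V s r \<zeta> \<le> L\<^sup>2 * expectation \<zeta> * ((r - s) * (1 + K * sqrt 0))"
    by (intro tendsto_lowerbound[OF _ _ sequentially_bot])
  then show ?thesis by simp
qed

end

text \<open>At each \<open>r\<close> at most one summand is active, and \<open>\<psi> 0 = 0\<close>
  covers those \<open>r\<close> at which none is.\<close>

lemma simple_value_comp:
  assumes "\<forall>i<n. t i \<le> t (Suc i)" "\<psi> 0 = (0::real)"
  shows "\<psi> (simple_value n t \<xi> r \<omega>) = simple_value n t (\<lambda>i \<omega>. \<psi> (\<xi> i \<omega>)) r \<omega>"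
  using assms(1)
proof (induction n)
  case (Suc n)
  have IH: "\<psi> (simple_value n t \<xi> r \<omega>) = simple_value n t (\<lambda>i \<omega>. \<psi> (\<xi> i \<omega>)) r \<omega>"
    using Suc by auto
  have le: "t (Suc i) \<le> t n" if "i < n" for i
    using that Suc.prems
  proof (induction n)
    case (Suc m)
    then show ?case by (cases "i = m") (auto intro: order_trans)
  qed simp
  have s: "simple_value (Suc n) t \<nu> r \<omega> = simple_value n t \<nu> r \<omega> + \<nu> n \<omega> * indicator {t n<..t (Suc n)} r" for \<nu>
    by (simp add: simple_value_def)
  show ?case
  proof (cases "r \<in> {t n<..t (Suc n)}")
    case True
    then have "simple_value n t \<nu> r \<omega> = 0" for \<nu> unfolding simple_value_def using le by (intro sum.neutral) (force simp: indicator_def)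
    then show ?thesis unfolding s using True by simp
  next
    case False
    then show ?thesis unfolding s using IH by simp
  qed
qed (simp add: simple_value_def assms(2))

context decoupled
begin

definition "G x = indicator {t1..t2} (fst x) * ((Zc (fst x) (snd x))\<^sup>2 - L\<^sup>2)"

lemma Zc_measurable': "(\<lambda>x. Zc (fst x) (snd x)) \<in> borel_measurable LM"
  using Zc_measurable by (simp add: split_beta)

lemma G_measurable: "G \<in> borel_measurable LM"
  unfolding G_def[abs_def] using Zc_measurable' by measurable

lemma G_square: "integrable LM (\<lambda>x. (G x)\<^sup>2)"
proof -
  obtain C where C: "0 \<le> C" "AE x in LM. fst x \<in> {t1..t2} \<longrightarrow> \<bar>Zc (fst x) (snd x)\<bar> \<le> C"
    using Zc_bounded by blast
  show ?thesis
  proof (rule Bochner_Integration.integrable_bound)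
    have "integrable lborel (indicator {t1..t2} :: real \<Rightarrow> real)" using t12 by (auto intro!: integrable_real_indicator)
    moreover have "integrable M (\<lambda>_. (C\<^sup>2 + L\<^sup>2)\<^sup>2)" by simp
    ultimately have "integrable LM (\<lambda>(r, \<omega>). indicator {t1..t2} r * (C\<^sup>2 + L\<^sup>2)\<^sup>2)" by (rule LM.product_integrable)
    then show "integrable LM (\<lambda>x. indicator {t1..t2} (fst x) * (C\<^sup>2 + L\<^sup>2)\<^sup>2)" unfolding case_prod_beta' .
    show "(\<lambda>x. (G x)\<^sup>2) \<in> borel_measurable LM" using G_measurable by simp
    show "AE x in LM. norm ((G x)\<^sup>2) \<le> norm (indicator {t1..t2} (fst x) * (C\<^sup>2 + L\<^sup>2)\<^sup>2 :: real)"
      using C(2)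
    proof eventually_elim
      case (elim x)
      show ?case
      proof (cases "fst x \<in> {t1..t2}")
        case True
        then have "\<bar>Zc (fst x) (snd x)\<bar> \<le> \<bar>C\<bar>" using elim C(1) by auto
        then have "(Zc (fst x) (snd x))\<^sup>2 \<le> C\<^sup>2" by (simp only: abs_le_square_iff)
        then have "\<bar>(Zc (fst x) (snd x))\<^sup>2 - L\<^sup>2\<bar> \<le> C\<^sup>2 + L\<^sup>2"
          using zero_le_power2[of L] zero_le_power2[of "Zc (fst x) (snd x)"] unfolding abs_le_iff by linarith
        then have "((Zc (fst x) (snd x))\<^sup>2 - L\<^sup>2)\<^sup>2 \<le> (C\<^sup>2 + L\<^sup>2)\<^sup>2"
          by (intro abs_le_square_iff[THEN iffD1]) simp
        then show ?thesis using True by (simp add: G_def)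
      qed (simp add: G_def)
    qed
  qed
qed

text \<open>By \<open>V_bound\<close> the weight \<open>Z\<^sup>2 - L\<^sup>2\<close> is nonpositive on nonnegative predictable functions; testing it
  against \<open>min 1 (max 0 (\<bar>Z\<bar> - L))\<close> yields \<open>\<bar>Z\<bar> \<le> L\<close>.\<close>

lemma simple_G_nonpos:
  assumes si: "simple_integrand F t1 t2 n t \<xi>" and \<xi>: "\<And>i \<omega>. 0 \<le> \<xi> i \<omega>" "\<And>i \<omega>. \<xi> i \<omega> \<le> 1"
  shows "(\<integral>x. G x * (case x of (r, \<omega>) \<Rightarrow> simple_value n t \<xi> r \<omega>) \<partial>LM) \<le> 0"
proof -
  interpret brownian_simple M F W t1 t2 n t \<xi> by unfold_locales (use si t12 in auto)
  \<comment> \<open>Simple integrands live on left-open intervals and \<open>V\<close> on right-open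
    ones; they differ only at the partition times, a null set.\<close>
  let ?I = "\<lambda>i x. \<xi> i (snd x) * (indicator {t i..<t (Suc i)} (fst x) * (Zc (fst x) (snd x))\<^sup>2)"
  let ?H = "\<lambda>i x. L\<^sup>2 * (indicator {t i<..t (Suc i)} (fst x) * \<xi> i (snd x))"
  have xb: "\<And>i \<omega>. \<bar>\<xi> i \<omega>\<bar> \<le> 1" using \<xi> by (simp add: abs_le_iff order_trans[OF _ \<xi>(1)])
  have AEneq: "AE x in LM. fst x \<noteq> c" for c
  proof -
    have "{x \<in> space LM. fst x \<noteq> c} \<in> sets LM" by measurable
    moreover have "AE r in lborel. AE \<omega> in M. fst (r, \<omega>) \<noteq> c" using AE_neq[of c] by eventually_elim simp
    ultimately show ?thesis by (rule LM.AE_pair_measure)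
  qed
  have iI: "integrable LM (?I i)" if "i < n" for i
    by (rule Zc_square_integrable[OF _ _ xi_M[OF that] xb]) (use t_bounds[of i] t_bounds[of "Suc i"] that in auto)
  have iH: "integrable LM (?H i)" "(\<integral>x. ?H i x \<partial>LM) = L\<^sup>2 * expectation (\<xi> i) * (t (Suc i) - t i)" if "i < n" for i
  proof -
    have i: "integrable M (\<xi> i)" using integrable_bounded_mult[OF integrable_const[of 1] xi_M[OF that] xb] by simp
    note p = LM.product_integrable[OF integrable_indicator_Ioc(1)[of "t i" "t (Suc i)"] i, unfolded case_prod_beta']
    show "integrable LM (?H i)" using p(1) by simp
    show "(\<integral>x. ?H i x \<partial>LM) = L\<^sup>2 * expectation (\<xi> i) * (t (Suc i) - t i)"
      using p(2) integrable_indicator_Ioc(2)[OF t_Suc[OF that]] by simp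
  qed
  have "AE x in LM. G x * (case x of (r, \<omega>) \<Rightarrow> simple_value n t \<xi> r \<omega>) = (\<Sum>i<n. ?I i x - ?H i x)"
  proof -
    have "AE x in LM. \<forall>i\<in>{..n}. fst x \<noteq> t i" by (rule AE_finite_allI) (use AEneq in auto)
    then show ?thesis
    proof eventually_elim
      case (elim x)
      have "G x * (\<xi> i (snd x) * indicator {t i<..t (Suc i)} (fst x)) = ?I i x - ?H i x" if "i < n" for i
      proof (cases "fst x \<in> {t i<..t (Suc i)}")
        case True
        moreover have "fst x \<noteq> t (Suc i)" using elim that by auto
        ultimately have "fst x \<in> {t i..<t (Suc i)}" "fst x \<in> {t1..t2}"
          using t_bounds(1)[of i] t_bounds(2)[of "Suc i"] that by auto
        then show ?thesis using True by (simp add: G_def algebra_simps)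
      next
        case False
        moreover have "fst x \<noteq> t i" using elim that by auto
        ultimately have "fst x \<notin> {t i..<t (Suc i)}" by auto
        then show ?thesis using False by simp
      qed
      then show ?case unfolding split_beta simple_value_def sum_distrib_left by (intro sum.cong) auto
    qed
  qed
  moreover have "(\<lambda>x. G x * (case x of (r, \<omega>) \<Rightarrow> simple_value n t \<xi> r \<omega>)) \<in> borel_measurable LM"
    using G_measurable simple_value_measurable by (rule borel_measurable_times)
  moreover have "(\<lambda>x. \<Sum>i<n. ?I i x - ?H i x) \<in> borel_measurable LM"
    by (intro borel_measurable_sum borel_measurable_diff borel_measurable_integrable iI iH) auto
  ultimately have "(\<integral>x. G x * (case x of (r, \<omega>) \<Rightarrow> simple_value n t \<xi> r \<omega>) \<partial>LM) = (\<integral>x. (\<Sum>i<n. ?I i x - ?H i x) \<partial>LM)"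
    by (intro integral_cong_AE)
  also have "\<dots> = (\<Sum>i<n. \<integral>x. ?I i x - ?H i x \<partial>LM)"
    by (rule Bochner_Integration.integral_sum) (intro Bochner_Integration.integrable_diff iI iH; simp)
  also have "\<dots> \<le> 0"
  proof (rule sum_nonpos)
    fix i assume "i \<in> {..<n}"
    then have i: "i < n" by simp
    have "(\<integral>x. ?I i x - ?H i x \<partial>LM) = V (t i) (t (Suc i)) (\<xi> i) - L\<^sup>2 * expectation (\<xi> i) * (t (Suc i) - t i)"
      unfolding Bochner_Integration.integral_diff[OF iI[OF i] iH(1)[OF i]] iH(2)[OF i] V_def by simp
    also have "V (t i) (t (Suc i)) (\<xi> i) \<le> L\<^sup>2 * expectation (\<xi> i) * (t (Suc i) - t i)"
      by (rule V_bound[where B=1]) (use t_bounds[of i] t_bounds[of "Suc i"] t_Suc[OF i] xi_F[OF i] \<xi> i in auto)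
    finally show "(\<integral>x. ?I i x - ?H i x \<partial>LM) \<le> 0" by simp
  qed
  finally show ?thesis .
qed

lemma Z_bound: "AE x in LM. fst x \<in> {t1..t2} \<longrightarrow> \<bar>Zc (fst x) (snd x)\<bar> \<le> L"
proof -
  \<comment> \<open>Being 1-Lipschitz with \<open>\<psi> 0 = 0\<close>, it preserves L2 convergence
    and maps simple integrands to simple integrands; values in \<open>[0, 1]\<close> make their
    coefficients admissible weights; and it is positive exactly where
    \<open>|z| > L\<close>.\<close>
  define \<psi> :: "real \<Rightarrow> real" where "\<psi> z = min 1 (max 0 (\<bar>z\<bar> - L))" for z
  have \<psi>0: "\<psi> 0 = 0" using L0 by (simp add: \<psi>_def)
  have \<psi>m: "\<psi> \<in> borel_measurable borel" unfolding \<psi>_def[abs_def] by measurable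
  have \<psi>b: "0 \<le> \<psi> z" "\<psi> z \<le> 1" "\<bar>\<psi> z - \<psi> w\<bar> \<le> \<bar>z - w\<bar>" for z w unfolding \<psi>_def by linarith+
  have t1: "t1 \<in> {t1..t2}" using t12 by auto
  obtain J where J: "has_ito_integral M F W t1 t2 Z J" using Y_eq[OF t1] by blast
  interpret I: brownian_ito M F W t1 t2 Z Zc J by (rule brownian_ito_Z[OF t1 J])
  obtain n t \<xi> where si: "\<And>k. simple_integrand F t1 t2 (n k) (t k) (\<xi> k)"
    and l: "L2_limit LM (\<lambda>k (r, \<omega>). simple_value (n k) (t k) (\<xi> k) r \<omega>) I.ZI"
    using I.approximation by blast
  interpret L2_limit LM "\<lambda>k (r, \<omega>). simple_value (n k) (t k) (\<xi> k) r \<omega>" I.ZI by (rule l)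
  interpret P: L2_limit LM "\<lambda>k x. \<psi> (case x of (r, \<omega>) \<Rightarrow> simple_value (n k) (t k) (\<xi> k) r \<omega>)" "\<lambda>x. \<psi> (I.ZI x)"
  proof
    show m: "(\<lambda>x. \<psi> (case x of (r, \<omega>) \<Rightarrow> simple_value (n k) (t k) (\<xi> k) r \<omega>)) \<in> borel_measurable LM" for k
      by (rule measurable_compose[OF fm \<psi>m])
    show m2: "(\<lambda>x. \<psi> (I.ZI x)) \<in> borel_measurable LM"
      by (rule measurable_compose[OF gm \<psi>m])
    have sq: "(\<psi> z - \<psi> w)\<^sup>2 \<le> (z - w)\<^sup>2" for z w
      using \<psi>b(3)[of z w] by (rule abs_le_square_iff[THEN iffD1])
    show "integrable LM (\<lambda>x. (\<psi> (case x of (r, \<omega>) \<Rightarrow> simple_value (n k) (t k) (\<xi> k) r \<omega>))\<^sup>2)" for k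
    proof (rule Bochner_Integration.integrable_bound[OF fi[of k]])
      show "(\<lambda>x. (\<psi> (case x of (r, \<omega>) \<Rightarrow> simple_value (n k) (t k) (\<xi> k) r \<omega>))\<^sup>2) \<in> borel_measurable LM"
        using m[of k] by simp
      show "AE x in LM. norm ((\<psi> (case x of (r, \<omega>) \<Rightarrow> simple_value (n k) (t k) (\<xi> k) r \<omega>))\<^sup>2)
         \<le> norm ((case x of (r, \<omega>) \<Rightarrow> simple_value (n k) (t k) (\<xi> k) r \<omega>)\<^sup>2)"
        by (rule AE_I2) (use sq[of _ 0] \<psi>0 in simp)
    qed
    show "(\<lambda>k. \<integral>\<^sup>+x. ennreal ((\<psi> (case x of (r, \<omega>) \<Rightarrow> simple_value (n k) (t k) (\<xi> k) r \<omega>) - \<psi> (I.ZI x))\<^sup>2) \<partial>LM) \<longlonglongrightarrow> 0"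
    proof (rule tendsto_sandwich[OF _ _ tendsto_const lim])
      show "\<forall>\<^sub>F k in sequentially. (\<integral>\<^sup>+x. ennreal ((\<psi> (case x of (r, \<omega>) \<Rightarrow> simple_value (n k) (t k) (\<xi> k) r \<omega>) - \<psi> (I.ZI x))\<^sup>2) \<partial>LM)
        \<le> (\<integral>\<^sup>+x. ennreal (((case x of (r, \<omega>) \<Rightarrow> simple_value (n k) (t k) (\<xi> k) r \<omega>) - I.ZI x)\<^sup>2) \<partial>LM)"
        by (intro always_eventually allI nn_integral_mono ennreal_leI sq)
    qed simp
  qed
  have "(\<integral>x. G x * \<psi> (I.ZI x) \<partial>LM) \<le> 0"
  proof (rule LIMSEQ_le_const2[OF P.inner_tendsto[OF G_measurable G_square]], intro exI allI impI)
    fix k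
    interpret S: brownian_simple M F W t1 t2 "n k" "t k" "\<xi> k" by unfold_locales (use si t12 in auto)
    have "\<psi> (case x of (r, \<omega>) \<Rightarrow> simple_value (n k) (t k) (\<xi> k) r \<omega>) =
       (case x of (r, \<omega>) \<Rightarrow> simple_value (n k) (t k) (\<lambda>i \<omega>. \<psi> (\<xi> k i \<omega>)) r \<omega>)" for x
      unfolding split_beta by (rule simple_value_comp[where \<psi>=\<psi>]) (use S.t_Suc \<psi>0 in auto)
    moreover have "simple_integrand F t1 t2 (n k) (t k) (\<lambda>i \<omega>. \<psi> (\<xi> k i \<omega>))"
    proof -
      have "(\<lambda>\<omega>. \<psi> (\<xi> k i \<omega>)) \<in> borel_measurable (F (t k i))" if "i < n k" for i
        by (rule measurable_compose[OF S.xi_F[OF that] \<psi>m])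
      moreover have "\<exists>C. \<forall>\<omega>\<in>space (F (t k i)). \<bar>\<psi> (\<xi> k i \<omega>)\<bar> \<le> C" for i
        by (rule exI[of _ 1]) (use \<psi>b in auto)
      ultimately show ?thesis using S.t_ends S.t_Suc unfolding simple_integrand_def by blast
    qed
    ultimately show "(\<integral>x. G x * \<psi> (case x of (r, \<omega>) \<Rightarrow> simple_value (n k) (t k) (\<xi> k) r \<omega>) \<partial>LM) \<le> 0"
      using simple_G_nonpos[of "n k" "t k" "\<lambda>i \<omega>. \<psi> (\<xi> k i \<omega>)"] \<psi>b by simp
  qed
  moreover have "0 \<le> G x * \<psi> (I.ZI x)" for x
  proof (cases "fst x \<in> {t1..t2}")
    case True
    then have z: "I.ZI x = Zc (fst x) (snd x)" by (simp add: I.ZI_def split_beta)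
    show ?thesis
    proof (cases "\<bar>Zc (fst x) (snd x)\<bar> \<le> L")
      case True
      then show ?thesis unfolding z by (simp add: \<psi>_def)
    next
      case False
      then have "\<bar>L\<bar> \<le> \<bar>Zc (fst x) (snd x)\<bar>" using L0 by simp
      then have "L\<^sup>2 \<le> (Zc (fst x) (snd x))\<^sup>2" by (simp only: abs_le_square_iff)
      then show ?thesis using \<psi>b(1) by (simp add: G_def)
    qed
  qed (simp add: G_def)
  moreover have i: "integrable LM (\<lambda>x. G x * \<psi> (I.ZI x))"
    by (rule integrable_mult_squares[OF G_measurable P.gm G_square P.limit_square_integrable])
  ultimately have "AE x in LM. G x * \<psi> (I.ZI x) = 0"
    using integral_nonneg_eq_0_iff_AE[OF i] Bochner_Integration.integral_nonneg[of LM "\<lambda>x. G x * \<psi> (I.ZI x)"] by force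
  then show ?thesis
  proof eventually_elim
    case (elim x)
    show ?case
    proof (rule impI, rule ccontr)
      assume x: "fst x \<in> {t1..t2}" and n: "\<not> \<bar>Zc (fst x) (snd x)\<bar> \<le> L"
      have z: "I.ZI x = Zc (fst x) (snd x)" using x by (simp add: I.ZI_def split_beta)
      have "L\<^sup>2 < (Zc (fst x) (snd x))\<^sup>2" using power_strict_mono[of L "\<bar>Zc (fst x) (snd x)\<bar>" 2] n L0 by simp
      moreover have "0 < \<psi> (I.ZI x)" unfolding z \<psi>_def using n by simp
      ultimately have "0 < G x * \<psi> (I.ZI x)" using x by (simp add: G_def)
      then show False using elim by simp
    qed
  qed
qed

end

section \<open>Comparison of one scheme step with the decoupling field\<close>

lemma sum_indicator_partition:
  fixes t :: "nat \<Rightarrow> real"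
  assumes "\<forall>i<n. t i \<le> t (Suc i)"
  shows "(\<Sum>i<n. indicator {t i<..t (Suc i)} r) = (indicator {t 0<..t n} r :: real)" "t 0 \<le> t n"
proof -
  have "(\<Sum>i<n. indicator {t i<..t (Suc i)} r) = (indicator {t 0<..t n} r :: real) \<and> t 0 \<le> t n"
    using assms
  proof (induction n)
    case (Suc n)
    then have IH: "(\<Sum>i<n. indicator {t i<..t (Suc i)} r) = (indicator {t 0<..t n} r :: real)" "t 0 \<le> t n" by auto
    have le: "t n \<le> t (Suc n)" using Suc.prems by simp
    have "(\<Sum>i<Suc n. indicator {t i<..t (Suc i)} r) = (indicator {t 0<..t n} r + indicator {t n<..t (Suc n)} r :: real)"
      by (simp only: sum.lessThan_Suc IH(1))
    also have "\<dots> = indicator {t 0<..t (Suc n)} r" using le IH(2) by (auto simp: indicator_def)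
    finally show ?case using le IH(2) by simp
  qed simp
  then show "(\<Sum>i<n. indicator {t i<..t (Suc i)} r) = (indicator {t 0<..t n} r :: real)" "t 0 \<le> t n" by auto
qed

context brownian_basis
begin

text \<open>Subtracting \<open>c\<close> from every coefficient subtracts \<open>c\<close> on
  \<open>(a, b]\<close>, and the point \<open>a\<close> is null. The isometry thereby becomes
  available for \<open>Z - p\<close>, the quantity that the energy estimate controls.\<close>

lemma has_ito_integral_diff_const:
  assumes ito: "has_ito_integral M F W a b Z J" and ab: "0 \<le> a" "a \<le> b" "b \<le> 1"
  shows "has_ito_integral M F W a b (\<lambda>r \<omega>. Z r \<omega> - c) (\<lambda>\<omega>. J \<omega> - c * (W b \<omega> - W a \<omega>))"
proof -
  obtain n t \<xi> where J: "J \<in> borel_measurable M" and si: "\<And>k. simple_integrand F a b (n k) (t k) (\<xi> k)"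
    and l1: "(\<lambda>k. \<integral>\<^sup>+\<omega>. (\<integral>\<^sup>+r\<in>{a..b}. ennreal ((simple_value (n k) (t k) (\<xi> k) r \<omega> - Z r \<omega>)\<^sup>2) \<partial>lborel) \<partial>M) \<longlonglongrightarrow> 0"
    and l2: "(\<lambda>k. \<integral>\<^sup>+\<omega>. ennreal ((simple_integral W (n k) (t k) (\<xi> k) \<omega> - J \<omega>)\<^sup>2) \<partial>M) \<longlonglongrightarrow> 0"
    using ito unfolding has_ito_integral_def by blast
  define \<eta> where "\<eta> k i \<omega> = \<xi> k i \<omega> - c" for k i \<omega>
  have mono: "\<forall>i<n k. t k i \<le> t k (Suc i)" and ends: "t k 0 = a" "t k (n k) = b" for k
    using si[of k] by (auto simp: simple_integrand_def)
  have 1: "simple_integrand F a b (n k) (t k) (\<eta> k)" for k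
  proof -
    have "\<eta> k i \<in> borel_measurable (F (t k i)) \<and> (\<exists>C. \<forall>\<omega>\<in>space (F (t k i)). \<bar>\<eta> k i \<omega>\<bar> \<le> C)" if i: "i < n k" for i
    proof -
      have m: "\<xi> k i \<in> borel_measurable (F (t k i))" using si[of k] i by (simp add: simple_integrand_def)
      obtain C where C: "\<forall>\<omega>\<in>space (F (t k i)). \<bar>\<xi> k i \<omega>\<bar> \<le> C" using si[of k] i unfolding simple_integrand_def by blast
      have "\<forall>\<omega>\<in>space (F (t k i)). \<bar>\<eta> k i \<omega>\<bar> \<le> C + \<bar>c\<bar>"
      proof
        fix \<omega> assume "\<omega> \<in> space (F (t k i))"
        then have "\<bar>\<xi> k i \<omega>\<bar> \<le> C" using C by blast
        then show "\<bar>\<eta> k i \<omega>\<bar> \<le> C + \<bar>c\<bar>" unfolding \<eta>_def by linarith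
      qed
      then show ?thesis using m unfolding \<eta>_def[abs_def] by auto
    qed
    then show ?thesis using mono[of k] ends[of k] unfolding simple_integrand_def by blast
  qed
  have 2: "simple_integral W (n k) (t k) (\<eta> k) \<omega> = simple_integral W (n k) (t k) (\<xi> k) \<omega> - c * (W b \<omega> - W a \<omega>)" for k \<omega>
  proof -
    have "simple_integral W (n k) (t k) (\<eta> k) \<omega> = simple_integral W (n k) (t k) (\<xi> k) \<omega> - c * (\<Sum>i<n k. W (t k (Suc i)) \<omega> - W (t k i) \<omega>)"
      by (simp add: simple_integral_def \<eta>_def left_diff_distrib sum_subtractf sum_distrib_left[symmetric])
    also have "(\<Sum>i<n k. W (t k (Suc i)) \<omega> - W (t k i) \<omega>) = W b \<omega> - W a \<omega>"
      using sum_lessThan_telescope[of "\<lambda>i. W (t k i) \<omega>" "n k"] ends[of k] by simp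
    finally show ?thesis .
  qed
  have 3: "simple_value (n k) (t k) (\<eta> k) r \<omega> = simple_value (n k) (t k) (\<xi> k) r \<omega> - c * indicator {a<..b} r" for k r \<omega>
  proof -
    have "simple_value (n k) (t k) (\<eta> k) r \<omega> = simple_value (n k) (t k) (\<xi> k) r \<omega> - c * (\<Sum>i<n k. indicator {t k i<..t k (Suc i)} r)"
      by (simp only: simple_value_def \<eta>_def left_diff_distrib sum_subtractf sum_distrib_left)
    then show ?thesis using sum_indicator_partition(1)[OF mono[of k], of r] ends[of k] by simp
  qed
  have e1: "(\<integral>\<^sup>+r\<in>{a..b}. ennreal ((simple_value (n k) (t k) (\<eta> k) r \<omega> - (Z r \<omega> - c))\<^sup>2) \<partial>lborel)
     = (\<integral>\<^sup>+r\<in>{a..b}. ennreal ((simple_value (n k) (t k) (\<xi> k) r \<omega> - Z r \<omega>)\<^sup>2) \<partial>lborel)" for k \<omega>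
  proof (rule nn_integral_cong_AE)
    show "AE r in lborel. ennreal ((simple_value (n k) (t k) (\<eta> k) r \<omega> - (Z r \<omega> - c))\<^sup>2) * indicator {a..b} r =
      ennreal ((simple_value (n k) (t k) (\<xi> k) r \<omega> - Z r \<omega>)\<^sup>2) * indicator {a..b} r"
      using AE_lborel_singleton[of a] by eventually_elim (auto simp: 3 indicator_def)
  qed
  have e2: "simple_integral W (n k) (t k) (\<eta> k) \<omega> - (J \<omega> - c * (W b \<omega> - W a \<omega>)) = simple_integral W (n k) (t k) (\<xi> k) \<omega> - J \<omega>" for k \<omega>
    unfolding 2 by simp
  have m: "(\<lambda>\<omega>. J \<omega> - c * (W b \<omega> - W a \<omega>)) \<in> borel_measurable M"
    using J W_measurable[of a] W_measurable[of b] ab by auto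
  show ?thesis unfolding has_ito_integral_def
    using m 1 l1[folded e1] l2[folded e2] by blast
qed

end

context decoupled
begin

lemma QV_expectation: "integrable M (QV t1 t2)" "expectation (QV t1 t2) = (\<integral>x. indicator {t1..<t2} (fst x) * (Zc (fst x) (snd x))\<^sup>2 \<partial>LM)"
proof -
  have "integrable LM (\<lambda>x. 1 * (indicator {t1..<t2} (fst x) * (Zc (fst x) (snd x))\<^sup>2))"
    by (rule Zc_square_integrable[where B=1]) auto
  then have i: "integrable LM (case_prod (\<lambda>r \<omega>. indicator {t1..<t2} r * (Zc r \<omega>)\<^sup>2))"
    by (simp add: case_prod_beta')
  show "integrable M (QV t1 t2)" using LM.integrable_snd[OF i] by (simp add: QV_def[abs_def])
  show "expectation (QV t1 t2) = (\<integral>x. indicator {t1..<t2} (fst x) * (Zc (fst x) (snd x))\<^sup>2 \<partial>LM)"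
    using LM.integral_snd[OF i] by (simp add: QV_def[abs_def] case_prod_beta')
qed

text \<open>Comparison of one step of an approximation with value \<open>nf\<close> at \<open>(x1, x2)\<close> with the field
  \<open>u\<close>: the error \<open>D\<close> before the step satisfies \<open>D' = D - K + S\<close> with the martingale
  increment \<open>K = \<integral>(Z - p) dW\<close>, whose variance absorbs the error made in the quadratic variation.\<close>

lemma one_step:
  fixes f :: field2 and nf p q aa e R :: real
  defines "h \<equiv> t2 - t1"
  assumes T1: "\<And>k l. \<bar>f (x1 + k, x2 + l) - f (x1, x2) - p * k - aa / 2 * k\<^sup>2 - q * l\<bar> \<le> R * (\<bar>k\<bar> ^ 3 + \<bar>k\<bar> * \<bar>l\<bar> + l\<^sup>2)"
    and T2: "\<And>k l. \<bar>f (x1 + k, x2 + l) - f (x1, x2) - p * k\<bar> \<le> R * (k\<^sup>2 + \<bar>l\<bar>)"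
    and R: "\<bar>p\<bar> \<le> R" "\<bar>q\<bar> \<le> R" "\<bar>aa\<bar> \<le> R" "L \<le> R" "1 \<le> R"
    and cons: "\<bar>nf - (f (x1, x2) + h * (aa / 2 + q * p\<^sup>2))\<bar> \<le> R * (h * sqrt h)"
    and close: "\<And>y. \<bar>f y - u t2 y\<bar> \<le> e"
  shows "(nf - u t1 (x1, x2))\<^sup>2 * (1 - 44 * R ^ 8 * h) \<le> e\<^sup>2 + 44 * R ^ 8 * h\<^sup>2"
proof -
  define D where "D = nf - u t1 (x1, x2)"
  have h: "0 \<le> h" "h \<le> 1" using t12 by (auto simp: h_def)
  have R0: "0 \<le> R" using R by simp
  have Rm: "R ^ i \<le> R ^ j" if "i \<le> j" for i j using R that by (intro power_increasing) auto
  have t1: "t1 \<in> {t1..t2}" and t2: "t2 \<in> {t1..t2}" and t01: "0 \<le> t1" "t1 \<le> t2" "t2 \<le> 1" using t12 by auto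
  obtain J where J: "has_ito_integral M F W t1 t2 Z J" "AE \<omega> in M. Y t1 \<omega> = Y t2 \<omega> - J \<omega>" using Y_eq[OF t1] by blast
  define w where "w \<omega> = W t2 \<omega> - W t1 \<omega>" for \<omega>
  define K where "K \<omega> = J \<omega> - p * w \<omega>" for \<omega>
  interpret I: brownian_ito M F W t1 t2 "\<lambda>r \<omega>. Z r \<omega> - p" "\<lambda>r \<omega>. Zc r \<omega> - p" K
  proof
    show "has_ito_integral M F W t1 t2 (\<lambda>r \<omega>. Z r \<omega> - p) K"
      unfolding K_def[abs_def] w_def by (rule has_ito_integral_diff_const[OF J(1) t01])
    show "(\<lambda>(r, \<omega>). Zc r \<omega> - p) \<in> borel_measurable LM"
      unfolding case_prod_beta' using Zc_measurable' by simp
  qed (use t12 Zc_Z in auto)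
  have K2: "integrable M (\<lambda>\<omega>. (K \<omega>)\<^sup>2)" by (rule I.J_square)
  have K1: "integrable M K" by (rule square_integrable_imp_integrable[OF I.J_measurable K2])
  have EK: "expectation K = 0" using I.J_inner_zero[of "\<lambda>_. 1"] t12 by simp
  define Q where "Q = (\<integral>x. indicator {t1..<t2} (fst x) * (Zc (fst x) (snd x) - p)\<^sup>2 \<partial>LM)"
  have AEneq: "AE x in LM. fst x \<noteq> t2"
  proof -
    have "{x \<in> space LM. fst x \<noteq> t2} \<in> sets LM" by measurable
    moreover have "AE r in lborel. AE \<omega> in M. fst (r, \<omega>) \<noteq> t2" using AE_neq[of t2] by eventually_elim simp
    ultimately show ?thesis by (rule LM.AE_pair_measure)
  qed
  have Qm: "(\<lambda>x. indicator {t1..<t2} (fst x) * (Zc (fst x) (snd x) - p)\<^sup>2) \<in> borel_measurable LM"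
    using Zc_measurable' by measurable
  have AEeq: "AE x in LM. (I.ZI x)\<^sup>2 = indicator {t1..<t2} (fst x) * (Zc (fst x) (snd x) - p)\<^sup>2"
    using AEneq by eventually_elim (auto simp: I.ZI_def split_beta indicator_def)
  have ZIm: "(\<lambda>x. (I.ZI x)\<^sup>2) \<in> borel_measurable LM" using I.ZI_measurable by simp
  have EK2: "expectation (\<lambda>\<omega>. (K \<omega>)\<^sup>2) = Q"
    using I.J_isometry[of "\<lambda>_. 1" 1] t12 integral_cong_AE[OF ZIm Qm AEeq] by (simp add: Q_def)
  have Qi: "integrable LM (\<lambda>x. indicator {t1..<t2} (fst x) * (Zc (fst x) (snd x) - p)\<^sup>2)"
    by (rule integrable_cong_AE_imp[OF I.ZI_square Qm]) (use AEeq in eventually_elim, simp)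
  note mom = increment_moments[OF t01, folded w_def h_def]
  \<comment> \<open>Factor \<open>Z\<^sup>2 - p\<^sup>2 = (Z + p) (Z - p)\<close>;
    \<open>Z_bound\<close> gives \<open>|Z + p| \<le> 2 R\<close>. Half of the energy
    \<open>Q\<close> of \<open>Z - p\<close> and a multiple of \<open>D\<^sup>2 h\<close> then
    dominate the error in the quadratic variation.\<close>
  have QD: "- (Q / 2) - 8 * R ^ 4 * D\<^sup>2 * h \<le> 2 * D * q * (expectation (QV t1 t2) - h * p\<^sup>2)"
  proof -
    have ind: "integrable LM (\<lambda>x. indicator {t1..<t2} (fst x) * k)" "(\<integral>x. indicator {t1..<t2} (fst x) * k \<partial>LM) = h * k" for k :: real
    proof -
      have 1: "integrable lborel (indicator {t1..<t2} :: real \<Rightarrow> real)" using t12 by (auto intro!: integrable_real_indicator)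
      have 2: "integrable M (\<lambda>_. k)" by simp
      note LM.product_integrable[OF 1 2, unfolded case_prod_beta']
      then show "integrable LM (\<lambda>x. indicator {t1..<t2} (fst x) * k)" "(\<integral>x. indicator {t1..<t2} (fst x) * k \<partial>LM) = h * k"
        using t12 prob_space by (simp_all add: h_def)
    qed
    have iZ: "integrable LM (\<lambda>x. indicator {t1..<t2} (fst x) * (Zc (fst x) (snd x))\<^sup>2)"
      using Zc_square_integrable[of "{t1..<t2}" "\<lambda>_. 1" 1] by (simp add: subset_iff)
    have "- (Q / 2) - 8 * R ^ 4 * D\<^sup>2 * h =
      (\<integral>x. (- 1 / 2) * (indicator {t1..<t2} (fst x) * (Zc (fst x) (snd x) - p)\<^sup>2) - indicator {t1..<t2} (fst x) * (8 * R ^ 4 * D\<^sup>2) \<partial>LM)"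
      using Qi ind by (subst Bochner_Integration.integral_diff) (auto simp: Q_def)
    also have "\<dots> \<le> (\<integral>x. (2 * D * q) * (indicator {t1..<t2} (fst x) * (Zc (fst x) (snd x))\<^sup>2 - indicator {t1..<t2} (fst x) * p\<^sup>2) \<partial>LM)"
    proof (rule integral_mono_AE)
      show "integrable LM (\<lambda>x. (- 1 / 2) * (indicator {t1..<t2} (fst x) * (Zc (fst x) (snd x) - p)\<^sup>2) - indicator {t1..<t2} (fst x) * (8 * R ^ 4 * D\<^sup>2))"
        using Qi ind by (intro Bochner_Integration.integrable_diff integrable_mult_right) auto
      show "integrable LM (\<lambda>x. (2 * D * q) * (indicator {t1..<t2} (fst x) * (Zc (fst x) (snd x))\<^sup>2 - indicator {t1..<t2} (fst x) * p\<^sup>2))"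
        using iZ ind by (intro Bochner_Integration.integrable_diff integrable_mult_right) auto
      show "AE x in LM. (- 1 / 2) * (indicator {t1..<t2} (fst x) * (Zc (fst x) (snd x) - p)\<^sup>2) - indicator {t1..<t2} (fst x) * (8 * R ^ 4 * D\<^sup>2)
         \<le> (2 * D * q) * (indicator {t1..<t2} (fst x) * (Zc (fst x) (snd x))\<^sup>2 - indicator {t1..<t2} (fst x) * p\<^sup>2)"
        using Z_bound
      proof eventually_elim
        case (elim x)
        let ?z = "Zc (fst x) (snd x)"
        show ?case
        proof (cases "fst x \<in> {t1..<t2}")
          case True
          then have zb: "\<bar>?z\<bar> \<le> R" using elim R(4) by auto
          have "\<bar>?z + p\<bar> \<le> 2 * R" using zb R(1) by linarith
          then have "\<bar>q\<bar> * \<bar>?z + p\<bar> \<le> R * (2 * R)" using R R0 by (intro mult_mono) auto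
          then have "(2 * \<bar>D\<bar>) * (\<bar>q\<bar> * \<bar>?z + p\<bar>) * \<bar>?z - p\<bar> \<le> (2 * \<bar>D\<bar>) * (R * (2 * R)) * \<bar>?z - p\<bar>"
            by (intro mult_right_mono mult_left_mono) auto
          also have "\<dots> = 4 * (R\<^sup>2 * \<bar>D\<bar> * \<bar>?z - p\<bar>)" by (simp add: power2_eq_square)
          also have "\<dots> \<le> (?z - p)\<^sup>2 / 2 + 8 * R ^ 4 * D\<^sup>2"
          proof -
            have "0 \<le> (\<bar>?z - p\<bar> - 4 * (R\<^sup>2 * \<bar>D\<bar>))\<^sup>2" by simp
            also have "\<dots> = (?z - p)\<^sup>2 + 16 * (R ^ 4 * D\<^sup>2) - 8 * (R\<^sup>2 * \<bar>D\<bar> * \<bar>?z - p\<bar>)"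
              unfolding power2_diff[of "\<bar>?z - p\<bar>"] by (simp add: power_mult_distrib)
            finally show ?thesis by linarith
          qed
          finally have "\<bar>2 * D * q * ((?z + p) * (?z - p))\<bar> \<le> (?z - p)\<^sup>2 / 2 + 8 * R ^ 4 * D\<^sup>2"
            by (simp add: abs_mult mult_ac)
          moreover have sq: "(?z + p) * (?z - p) = ?z\<^sup>2 - p\<^sup>2" by (simp add: algebra_simps power2_eq_square)
          ultimately have "\<bar>2 * D * q * (?z\<^sup>2 - p\<^sup>2)\<bar> \<le> (?z - p)\<^sup>2 / 2 + 8 * R ^ 4 * D\<^sup>2" by (simp only: sq)
          from abs_le_D2[OF this] have "- ((?z - p)\<^sup>2 / 2 + 8 * R ^ 4 * D\<^sup>2) \<le> 2 * D * q * (?z\<^sup>2 - p\<^sup>2)"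
            by (simp only: minus_le_iff)
          then show ?thesis using True by simp
        qed simp
      qed
    qed
    also have "\<dots> = 2 * D * q * (expectation (QV t1 t2) - h * p\<^sup>2)"
      unfolding integral_mult_right_zero Bochner_Integration.integral_diff[OF iZ ind(1)] ind(2) QV_expectation(2) ..
    finally show ?thesis .
  qed
  \<comment> \<open>Coefficients of \<open>1\<close>, \<open>w\<^sup>2\<close> and
    \<open>w ^ 4\<close> in the pathwise lower bound for the squared error; under expectation the
    two powers become \<open>h\<close> and \<open>3 h\<^sup>2\<close>.\<close>
  define c0 where "c0 = D\<^sup>2 - 32 * R ^ 6 * h\<^sup>2 - D * aa * h - 2 * D * q * (h * p\<^sup>2) - R ^ 3 * D\<^sup>2 * h - R ^ 5 * h\<^sup>2 * (D\<^sup>2 + 1) - R * (h * D\<^sup>2 + h\<^sup>2)"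
  define c2 where "c2 = D * aa - R * D\<^sup>2 - R ^ 3 * h"
  define c4 where "c4 = - (2 * R\<^sup>2 + R)"
  have "AE \<omega> in M. c0 + ((1/2) * (K \<omega>)\<^sup>2 + ((- 2 * D) * K \<omega> + (c4 * w \<omega> ^ 4 + (c2 * (w \<omega>)\<^sup>2 + (2 * D * q) * QV t1 t2 \<omega>)))) \<le> e\<^sup>2"
    using J(2) Y_u[OF t1] Y_u[OF t2] X1_eq[OF t1] X1_eq[OF t2] X2_QV[OF t1] X2_QV[OF t2] QV_props[OF Z_bound L0]
  proof eventually_elim
    case (elim \<omega>)
    define I where "I = QV t1 t2 \<omega>"
    have "0 \<le> QV t1 t2 \<omega>" "QV t1 t2 \<omega> \<le> L\<^sup>2 * (t2 - t1)" using elim(8)[rule_format, of t1 t2] t12 by auto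
    moreover have "L\<^sup>2 * (t2 - t1) \<le> R\<^sup>2 * h" unfolding h_def using R L0 t12 by (intro mult_right_mono power_mono) auto
    ultimately have I: "0 \<le> I" "I \<le> R\<^sup>2 * h" unfolding I_def by linarith+
    define v where "v = w \<omega>"
    define S where "S = f (x1 + v, x2 + I) - nf - p * v"
    have "QV t1 t1 \<omega> = 0" by (simp add: QV_def)
    then have "Y t1 \<omega> = u t1 (x1, x2)" using elim(2,4,6) by simp
    moreover have "Y t2 \<omega> = u t2 (x1 + v, x2 + I)" using elim(3,5,7) unfolding v_def w_def I_def by simp
    ultimately have "f (x1 + v, x2 + I) - u t2 (x1 + v, x2 + I) = D - K \<omega> + S"
      using elim(1) unfolding D_def K_def S_def v_def by simp
    then have "\<bar>D - K \<omega> + S\<bar> \<le> \<bar>e\<bar>" using close[of "(x1 + v, x2 + I)"] by simp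
    then have 1: "(D - K \<omega> + S)\<^sup>2 \<le> e\<^sup>2" by (simp only: abs_le_square_iff)
    \<comment> \<open>Half of \<open>K\<^sup>2\<close> is spent on the cross term
      \<open>2 K S\<close>; the other half is what \<open>QD\<close> consumes.\<close>
    have 2: "D\<^sup>2 + (1/2) * (K \<omega>)\<^sup>2 - S\<^sup>2 - 2 * D * K \<omega> + 2 * D * S \<le> (D - K \<omega> + S)\<^sup>2"
    proof -
      have "0 \<le> (K \<omega> - 2 * S)\<^sup>2" by simp
      then show ?thesis by (simp add: power2_eq_square algebra_simps)
    qed
    have hs: "h * sqrt h \<le> h" using h mult_left_mono[of "sqrt h" 1 h] by simp
    have 3: "S\<^sup>2 \<le> 2 * R\<^sup>2 * v ^ 4 + 32 * R ^ 6 * h\<^sup>2"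
    proof -
      have p2: "p\<^sup>2 \<le> R\<^sup>2" using R(1) R0 by (simp add: abs_le_square_iff[symmetric])
      have "\<bar>q * p\<^sup>2\<bar> \<le> R * R\<^sup>2" unfolding abs_mult using p2 R R0 by (intro mult_mono) auto
      then have "\<bar>aa / 2 + q * p\<^sup>2\<bar> \<le> R + R ^ 3" using R(3) R0 by (simp add: power3_eq_cube power2_eq_square abs_le_iff)
      then have "\<bar>h * (aa / 2 + q * p\<^sup>2)\<bar> \<le> h * (R + R ^ 3)" using h by (simp add: abs_mult mult_left_mono)
      moreover have "R * (h * sqrt h) \<le> R * h" using hs R0 by (intro mult_left_mono)
      ultimately have "\<bar>nf - f (x1, x2)\<bar> \<le> h * (R + R ^ 3) + R * h" using cons by linarith
      moreover have "\<bar>f (x1 + v, x2 + I) - f (x1, x2) - p * v\<bar> \<le> R * (v\<^sup>2 + R\<^sup>2 * h)"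
        using T2[of v I] I R0 mult_left_mono[of "v\<^sup>2 + \<bar>I\<bar>" "v\<^sup>2 + R\<^sup>2 * h" R] by simp
      ultimately have "\<bar>S\<bar> \<le> R * (v\<^sup>2 + R\<^sup>2 * h) + (h * (R + R ^ 3) + R * h)" unfolding S_def by linarith
      also have "\<dots> = R * v\<^sup>2 + h * (2 * R ^ 3 + 2 * R)" by (simp add: algebra_simps power3_eq_cube power2_eq_square)
      also have "\<dots> \<le> R * v\<^sup>2 + h * (4 * R ^ 3)"
        using Rm[of 1 3] h by (intro add_left_mono mult_left_mono) auto
      finally have "\<bar>S\<bar> \<le> \<bar>R * v\<^sup>2 + 4 * R ^ 3 * h\<bar>" by (simp add: mult_ac)
      then have "S\<^sup>2 \<le> (R * v\<^sup>2 + 4 * R ^ 3 * h)\<^sup>2" by (simp only: abs_le_square_iff)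
      also have "\<dots> \<le> 2 * (R * v\<^sup>2)\<^sup>2 + 2 * (4 * R ^ 3 * h)\<^sup>2"
      proof -
        have "0 \<le> (R * v\<^sup>2 - 4 * R ^ 3 * h)\<^sup>2" by simp
        then show ?thesis unfolding power2_sum power2_diff by linarith
      qed
      also have "\<dots> = 2 * R\<^sup>2 * v ^ 4 + 32 * R ^ 6 * h\<^sup>2" by (simp add: power_mult_distrib)
      finally show ?thesis .
    qed
    \<comment> \<open>\<open>S\<close> is split into \<open>aa / 2 (v\<^sup>2 - h)\<close>, of mean
      zero, \<open>q (I - h p\<^sup>2)\<close>, left to \<open>QD\<close>, and a remainder
      \<open>T\<close>. Multiplied by \<open>2 D\<close>, the remainder costs in mean only multiples
      of \<open>h D\<^sup>2\<close> and \<open>h\<^sup>2\<close>.\<close>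
    have 4: "D * aa * (v\<^sup>2 - h) + 2 * D * q * (I - h * p\<^sup>2)
       - (R * (D\<^sup>2 * v\<^sup>2 + v ^ 4) + R ^ 3 * (D\<^sup>2 * h + h * v\<^sup>2) + R ^ 5 * h\<^sup>2 * (D\<^sup>2 + 1) + R * (h * D\<^sup>2 + h\<^sup>2)) \<le> 2 * D * S"
    proof -
      define T where "T = S - aa / 2 * (v\<^sup>2 - h) - q * (I - h * p\<^sup>2)"
      define y where "y = \<bar>v\<bar>"
      define x where "x = \<bar>D\<bar>"
      have xy: "0 \<le> x" "0 \<le> y" by (auto simp: x_def y_def)
      have "T = (f (x1 + v, x2 + I) - f (x1, x2) - p * v - aa / 2 * v\<^sup>2 - q * I) - (nf - (f (x1, x2) + h * (aa / 2 + q * p\<^sup>2)))"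
        unfolding T_def S_def by (simp add: algebra_simps)
      then have "\<bar>T\<bar> \<le> R * (y ^ 3 + y * I + I\<^sup>2) + R * (h * sqrt h)"
        using T1[of v I] cons I unfolding y_def by simp
      also have "R * (y ^ 3 + y * I + I\<^sup>2) \<le> R * (y ^ 3 + y * (R\<^sup>2 * h) + (R\<^sup>2 * h)\<^sup>2)"
        using I R0 xy by (intro mult_left_mono add_mono power_mono) auto
      finally have T: "\<bar>T\<bar> \<le> R * (y ^ 3 + y * (R\<^sup>2 * h) + (R\<^sup>2 * h)\<^sup>2) + R * (h * sqrt h)" by simp
      have a1: "2 * (x * y ^ 3) \<le> x\<^sup>2 * y\<^sup>2 + y ^ 4"
      proof -
        have "0 \<le> (x * y - y\<^sup>2)\<^sup>2" by simp
        also have "\<dots> = x\<^sup>2 * y\<^sup>2 + y ^ 4 - 2 * (x * y ^ 3)"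
          by (simp add: algebra_simps power2_eq_square power3_eq_cube power4_eq_xxxx)
        finally show ?thesis by linarith
      qed
      have a2: "2 * (x * y) * h \<le> x\<^sup>2 * h + h * y\<^sup>2"
      proof -
        have "0 \<le> h * (x - y)\<^sup>2" using h by simp
        also have "\<dots> = x\<^sup>2 * h + h * y\<^sup>2 - 2 * (x * y) * h" by (simp add: power2_diff algebra_simps)
        finally show ?thesis by linarith
      qed
      have a3: "2 * x \<le> x\<^sup>2 + 1" using zero_le_power2[of "x - 1"] by (simp add: power2_diff)
      have a4: "2 * x * (h * sqrt h) \<le> h * x\<^sup>2 + h\<^sup>2"
      proof -
        have "0 \<le> h * (x - sqrt h)\<^sup>2" using h by simp
        also have "\<dots> = h * x\<^sup>2 + h\<^sup>2 - 2 * x * (h * sqrt h)"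
          using h by (simp add: power2_diff algebra_simps power2_eq_square)
        finally show ?thesis by linarith
      qed
      have "\<bar>2 * D * T\<bar> = (2 * x) * \<bar>T\<bar>" by (simp add: abs_mult x_def)
      also have "\<dots> \<le> (2 * x) * (R * (y ^ 3 + y * (R\<^sup>2 * h) + (R\<^sup>2 * h)\<^sup>2) + R * (h * sqrt h))"
        using T xy by (intro mult_left_mono) auto
      also have "\<dots> = R * (2 * (x * y ^ 3)) + R ^ 3 * (2 * (x * y) * h) + R ^ 5 * h\<^sup>2 * (2 * x) + R * (2 * x * (h * sqrt h))"
        by (simp add: algebra_simps power2_eq_square eval_nat_numeral)
      also have "\<dots> \<le> R * (x\<^sup>2 * y\<^sup>2 + y ^ 4) + R ^ 3 * (x\<^sup>2 * h + h * y\<^sup>2) + R ^ 5 * h\<^sup>2 * (x\<^sup>2 + 1) + R * (h * x\<^sup>2 + h\<^sup>2)"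
        using R0 a1 a2 a3 a4 by (intro add_mono mult_left_mono) auto
      also have "\<dots> = R * (D\<^sup>2 * v\<^sup>2 + v ^ 4) + R ^ 3 * (D\<^sup>2 * h + h * v\<^sup>2) + R ^ 5 * h\<^sup>2 * (D\<^sup>2 + 1) + R * (h * D\<^sup>2 + h\<^sup>2)"
        by (simp add: x_def y_def power_even_abs_numeral)
      finally have "\<bar>2 * D * T\<bar> \<le> \<dots>" .
      moreover have "2 * D * S = D * aa * (v\<^sup>2 - h) + 2 * D * q * (I - h * p\<^sup>2) + 2 * D * T"
        unfolding T_def by (simp add: algebra_simps)
      ultimately show ?thesis by linarith
    qed
    have "c0 + ((1/2) * (K \<omega>)\<^sup>2 + ((- 2 * D) * K \<omega> + (c4 * v ^ 4 + (c2 * v\<^sup>2 + (2 * D * q) * I)))) =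
      D\<^sup>2 + (1/2) * (K \<omega>)\<^sup>2 - (2 * R\<^sup>2 * v ^ 4 + 32 * R ^ 6 * h\<^sup>2) - 2 * D * K \<omega> +
      (D * aa * (v\<^sup>2 - h) + 2 * D * q * (I - h * p\<^sup>2)
       - (R * (D\<^sup>2 * v\<^sup>2 + v ^ 4) + R ^ 3 * (D\<^sup>2 * h + h * v\<^sup>2) + R ^ 5 * h\<^sup>2 * (D\<^sup>2 + 1) + R * (h * D\<^sup>2 + h\<^sup>2)))"
      unfolding c0_def c2_def c4_def by (simp add: algebra_simps)
    also have "\<dots> \<le> e\<^sup>2" using 1 2 3 4 by linarith
    finally show ?case unfolding v_def I_def .
  qed
  moreover have "integrable M (\<lambda>\<omega>. c0 + ((1/2) * (K \<omega>)\<^sup>2 + ((- 2 * D) * K \<omega> + (c4 * w \<omega> ^ 4 + (c2 * (w \<omega>)\<^sup>2 + (2 * D * q) * QV t1 t2 \<omega>)))))"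
    using K1 K2 mom(1) QV_expectation(1) by simp
  ultimately have "expectation (\<lambda>\<omega>. c0 + ((1/2) * (K \<omega>)\<^sup>2 + ((- 2 * D) * K \<omega> + (c4 * w \<omega> ^ 4 + (c2 * (w \<omega>)\<^sup>2 + (2 * D * q) * QV t1 t2 \<omega>)))))
     \<le> expectation (\<lambda>\<omega>. e\<^sup>2)"
    by (intro integral_mono_AE) auto
  moreover have "expectation (\<lambda>\<omega>. c0 + ((1/2) * (K \<omega>)\<^sup>2 + ((- 2 * D) * K \<omega> + (c4 * w \<omega> ^ 4 + (c2 * (w \<omega>)\<^sup>2 + (2 * D * q) * QV t1 t2 \<omega>)))))
     = c0 + ((1/2) * Q + (c4 * (3 * h\<^sup>2) + (c2 * h + 2 * D * q * expectation (QV t1 t2))))"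
    using K1 K2 mom QV_expectation(1) EK EK2 by (simp add: prob_space)
  ultimately have "c0 + ((1/2) * Q + (c4 * (3 * h\<^sup>2) + (c2 * h + 2 * D * q * expectation (QV t1 t2)))) \<le> e\<^sup>2"
    by (simp add: prob_space)
  moreover have "2 * D * q * expectation (QV t1 t2) = 2 * D * q * (expectation (QV t1 t2) - h * p\<^sup>2) + 2 * D * q * (h * p\<^sup>2)"
    by (simp add: algebra_simps)
  ultimately have "c0 + (c4 * (3 * h\<^sup>2) + (c2 * h + 2 * D * q * (h * p\<^sup>2))) - 8 * R ^ 4 * D\<^sup>2 * h \<le> e\<^sup>2"
    using QD by linarith
  moreover have "c0 + (c4 * (3 * h\<^sup>2) + (c2 * h + 2 * D * q * (h * p\<^sup>2))) - 8 * R ^ 4 * D\<^sup>2 * h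
    = D\<^sup>2 - (D\<^sup>2 * h) * (8 * R ^ 4 + 2 * R + R ^ 3) - R ^ 5 * (h\<^sup>2 * D\<^sup>2) - h\<^sup>2 * (32 * R ^ 6 + R ^ 5 + R + R ^ 3 + 6 * R\<^sup>2 + 3 * R)"
    unfolding c0_def c2_def c4_def by (simp add: algebra_simps power2_eq_square)
  moreover have "(D\<^sup>2 * h) * (8 * R ^ 4 + 2 * R + R ^ 3) + R ^ 5 * (h\<^sup>2 * D\<^sup>2) \<le> (D\<^sup>2 * h) * (44 * R ^ 8)"
  proof -
    have "h\<^sup>2 * D\<^sup>2 \<le> h * D\<^sup>2" using h mult_left_mono[of h 1 h] by (intro mult_right_mono) (auto simp: power2_eq_square)
    then have "R ^ 5 * (h\<^sup>2 * D\<^sup>2) \<le> (D\<^sup>2 * h) * R ^ 5" using R0 mult_left_mono[of "h\<^sup>2 * D\<^sup>2" "h * D\<^sup>2" "R ^ 5"] by (simp add: mult_ac)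
    moreover have "(D\<^sup>2 * h) * (8 * R ^ 4 + 2 * R + R ^ 3 + R ^ 5) \<le> (D\<^sup>2 * h) * (44 * R ^ 8)"
    proof (rule mult_left_mono)
      have "R ^ 4 \<le> R ^ 8" "R ^ 1 \<le> R ^ 8" "R ^ 3 \<le> R ^ 8" "R ^ 5 \<le> R ^ 8" "0 \<le> R ^ 8" by (rule Rm, simp)+ (use R0 in simp)
      then show "8 * R ^ 4 + 2 * R + R ^ 3 + R ^ 5 \<le> 44 * R ^ 8" unfolding power_one_right by linarith
    qed (use h in simp)
    ultimately show ?thesis by (simp only: distrib_left)
  qed
  \<comment> \<open>\<open>44 = 32 + 1 + 1 + 1 + 6 + 3\<close> is the sum of the coefficients in
    this bracket; every power of \<open>R \<ge> 1\<close> is raised to the eighth.\<close>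
  moreover have "h\<^sup>2 * (32 * R ^ 6 + R ^ 5 + R + R ^ 3 + 6 * R\<^sup>2 + 3 * R) \<le> h\<^sup>2 * (44 * R ^ 8)"
  proof (rule mult_left_mono)
    have "R ^ 6 \<le> R ^ 8" "R ^ 2 \<le> R ^ 8" "R ^ 1 \<le> R ^ 8" "R ^ 3 \<le> R ^ 8" "R ^ 5 \<le> R ^ 8" by (rule Rm, simp)+
    then show "32 * R ^ 6 + R ^ 5 + R + R ^ 3 + 6 * R\<^sup>2 + 3 * R \<le> 44 * R ^ 8" unfolding power_one_right by linarith
  qed simp
  ultimately have "D\<^sup>2 - (D\<^sup>2 * h) * (44 * R ^ 8) - h\<^sup>2 * (44 * R ^ 8) \<le> e\<^sup>2" by linarith
  then show ?thesis unfolding D_def[symmetric] by (simp add: algebra_simps)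
qed

end

section \<open>Passage to the limit\<close>

text \<open>Derivatives with a common Lipschitz constant are uniformly close to difference
  quotients, so pointwise convergence of the functions alone forces the derivatives to
  converge.\<close>

lemma limit_deriv:
  fixes \<phi> \<phi>' :: "nat \<Rightarrow> real \<Rightarrow> real" and \<phi>0 :: "real \<Rightarrow> real"
  assumes d: "\<And>n t. n0 \<le> n \<Longrightarrow> (\<phi> n has_real_derivative \<phi>' n t) (at t)"
    and lip: "\<And>n s t. n0 \<le> n \<Longrightarrow> \<bar>\<phi>' n s - \<phi>' n t\<bar> \<le> B * \<bar>s - t\<bar>"
    and lim: "\<And>t. (\<lambda>n. \<phi> n t) \<longlonglongrightarrow> \<phi>0 t"
  shows "convergent (\<lambda>n. \<phi>' n t)" "(\<phi>0 has_real_derivative lim (\<lambda>n. \<phi>' n t)) (at t)"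
proof -
  have B0: "0 \<le> B" using lip[of n0 1 0] by simp
  have tay: "\<bar>\<phi> n (t + k) - \<phi> n t - k * \<phi>' n t\<bar> \<le> B * k\<^sup>2" if "n0 \<le> n" for n k
    by (rule taylor1[OF d[OF that] lip[OF that]])
  have "Cauchy (\<lambda>n. \<phi>' n t)"
  proof (rule CauchyI)
    fix e :: real assume e: "0 < e"
    define k where "k = e / (4 * (B + 1))"
    have k: "0 < k" "B * k < e / 4" using e B0 by (auto simp: k_def field_simps)
    have "(\<lambda>n. (\<phi> n (t + k) - \<phi> n t) / k) \<longlonglongrightarrow> (\<phi>0 (t + k) - \<phi>0 t) / k"
      by (intro tendsto_intros lim) (use k in simp)
    from CauchyD[OF LIMSEQ_imp_Cauchy[OF this], of "e / 2"] e
    obtain N where N: "\<And>m n. m \<ge> N \<Longrightarrow> n \<ge> N \<Longrightarrow> norm ((\<phi> m (t + k) - \<phi> m t) / k - (\<phi> n (t + k) - \<phi> n t) / k) < e / 2"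
      by auto
    have close: "\<bar>(\<phi> n (t + k) - \<phi> n t) / k - \<phi>' n t\<bar> < e / 4" if "n0 \<le> n" for n
    proof -
      have "(\<phi> n (t + k) - \<phi> n t) / k - \<phi>' n t = (\<phi> n (t + k) - \<phi> n t - k * \<phi>' n t) / k"
        using k by (simp add: diff_divide_distrib)
      then have "\<bar>(\<phi> n (t + k) - \<phi> n t) / k - \<phi>' n t\<bar> = \<bar>\<phi> n (t + k) - \<phi> n t - k * \<phi>' n t\<bar> / k"
        using k by simp
      also have "\<dots> \<le> B * k\<^sup>2 / k" using tay[OF that] k by (intro divide_right_mono) auto
      also have "\<dots> = B * k" using k by (simp add: power2_eq_square)
      finally show ?thesis using k by linarith
    qed
    have "norm (\<phi>' m t - \<phi>' n t) < e" if "m \<ge> max N n0" "n \<ge> max N n0" for m n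
      using N[of m n] close[of m] close[of n] that unfolding real_norm_def by linarith
    then show "\<exists>M. \<forall>m\<ge>M. \<forall>n\<ge>M. norm (\<phi>' m t - \<phi>' n t) < e" by blast
  qed
  then show conv: "convergent (\<lambda>n. \<phi>' n t)" by (rule Cauchy_convergent)
  then have l: "(\<lambda>n. \<phi>' n t) \<longlonglongrightarrow> lim (\<lambda>n. \<phi>' n t)" by (simp add: convergent_LIMSEQ_iff)
  have bound: "\<bar>\<phi>0 (t + k) - \<phi>0 t - k * lim (\<lambda>n. \<phi>' n t)\<bar> \<le> B * k\<^sup>2" for k :: real
  proof (rule LIMSEQ_le_const2)
    show "(\<lambda>n. \<bar>\<phi> n (t + k) - \<phi> n t - k * \<phi>' n t\<bar>) \<longlonglongrightarrow> \<bar>\<phi>0 (t + k) - \<phi>0 t - k * lim (\<lambda>n. \<phi>' n t)\<bar>"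
      by (intro tendsto_intros lim l)
    show "\<exists>N. \<forall>n\<ge>N. \<bar>\<phi> n (t + k) - \<phi> n t - k * \<phi>' n t\<bar> \<le> B * k\<^sup>2" using tay by blast
  qed
  show "(\<phi>0 has_real_derivative lim (\<lambda>n. \<phi>' n t)) (at t)"
    unfolding DERIV_def LIM_eq
  proof (intro allI impI)
    fix e :: real assume e: "0 < e"
    show "\<exists>s>0. \<forall>k. k \<noteq> 0 \<and> norm (k - 0) < s \<longrightarrow> norm ((\<phi>0 (t + k) - \<phi>0 t) / k - lim (\<lambda>n. \<phi>' n t)) < e"
    proof (intro exI[of _ "e / (B + 1)"] conjI allI impI)
      show "0 < e / (B + 1)" using e B0 by simp
      fix k :: real assume k: "k \<noteq> 0 \<and> norm (k - 0) < e / (B + 1)"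
      have "(\<phi>0 (t + k) - \<phi>0 t) / k - lim (\<lambda>n. \<phi>' n t) = (\<phi>0 (t + k) - \<phi>0 t - k * lim (\<lambda>n. \<phi>' n t)) / k"
        using k by (simp add: diff_divide_distrib)
      then have "norm ((\<phi>0 (t + k) - \<phi>0 t) / k - lim (\<lambda>n. \<phi>' n t)) = \<bar>\<phi>0 (t + k) - \<phi>0 t - k * lim (\<lambda>n. \<phi>' n t)\<bar> / \<bar>k\<bar>"
        by simp
      also have "\<dots> \<le> B * k\<^sup>2 / \<bar>k\<bar>" using bound by (intro divide_right_mono) auto
      also have "\<dots> = B * \<bar>k\<bar>" using k by (simp add: power2_eq_square abs_if)
      also have "\<dots> \<le> (B + 1) * \<bar>k\<bar>" by (intro mult_right_mono) auto
      also have "\<dots> < e" using k B0 by (simp add: pos_less_divide_eq mult.commute)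
      finally show "norm ((\<phi>0 (t + k) - \<phi>0 t) / k - lim (\<lambda>n. \<phi>' n t)) < e" .
    qed
  qed
qed

lemma compactly_supported_integrable:
  fixes f :: field2
  assumes "continuous_on UNIV f" "\<And>x. x \<notin> cbox (-c) c \<Longrightarrow> f x = 0"
  shows "integrable lborel f"
proof -
  have "integrable lborel (\<lambda>x. indicator (cbox (-c) c) x *\<^sub>R f x)"
    by (rule borel_integrable_compact) (auto intro: continuous_on_subset[OF assms(1)])
  moreover have "(\<lambda>x. indicator (cbox (-c) c) x *\<^sub>R f x) = f"
    using assms(2) by (intro ext) (auto simp: indicator_def)
  ultimately show ?thesis by simp
qed

text \<open>On each line parallel to the first axis \<open>f \<phi>\<close> vanishes far out, so its
  derivative integrates to 0 by the fundamental theorem of calculus; Fubini then gives integration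
  by parts on the plane.\<close>

lemma has_weak_partial_continuous:
  fixes f v :: field2
  assumes f: "continuous_on UNIV f" and v: "continuous_on UNIV v"
    and deriv: "\<And>t y. ((\<lambda>t. f (t, y)) has_real_derivative v (t, y)) (at t)"
  shows "has_weak_partial f (1, 0) v"
  unfolding has_weak_partial_def
proof (intro conjI allI impI)
  fix K :: "(real \<times> real) set" assume K: "compact K"
  have "g absolutely_integrable_on K" if "continuous_on UNIV g" for g :: field2
  proof -
    have "integrable lborel (\<lambda>x. indicator K x *\<^sub>R g x)"
      by (rule borel_integrable_compact[OF K continuous_on_subset[OF that]]) simp
    then show ?thesis unfolding set_integrable_def
      by (subst integrable_completion) (auto intro: borel_measurable_integrable)
  qed
  then show "f absolutely_integrable_on K" "v absolutely_integrable_on K" using f v by auto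
next
  fix \<phi> :: field2 assume \<phi>: "test_function \<phi>"
  define \<phi>1 where "\<phi>1 x = frechet_derivative \<phi> (at x) (1, 0)" for x
  have "C_k (Suc 0) \<phi>" using \<phi> unfolding test_function_def by blast
  then have diff: "\<phi> differentiable_on UNIV" and c1: "continuous_on UNIV \<phi>1"
    unfolding \<phi>1_def[abs_def] by (auto simp: Basis_prod_def)
  have hd: "(\<phi> has_derivative frechet_derivative \<phi> (at x)) (at x)" for x
  proof -
    have "\<phi> differentiable (at x)" using diff unfolding differentiable_on_def by blast
    then show ?thesis by (simp only: frechet_derivative_works)
  qed
  have c0: "continuous_on UNIV \<phi>" by (rule differentiable_imp_continuous_on[OF diff])
  have comp: "compact (closure {x. \<phi> x \<noteq> 0})" using \<phi> unfolding test_function_def by blast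
  obtain c where c: "closure {x. \<phi> x \<noteq> 0} \<subseteq> cbox (-c) c"
    using bounded_subset_cbox_symmetric[OF compact_imp_bounded[OF comp]] by blast
  have z0: "\<phi> x = 0" if "x \<notin> cbox (-c) c" for x
    using that c closure_subset[of "{x. \<phi> x \<noteq> 0}"] by blast
  have z1: "\<phi>1 x = 0" if "x \<notin> cbox (-c) c" for x
  proof -
    have "(\<phi> has_derivative (\<lambda>_. 0)) (at x)"
    proof (rule has_derivative_transform_within_open)
      show "((\<lambda>_. 0 :: real) has_derivative (\<lambda>_. 0)) (at x)" by simp
      show "open (- cbox (-c) c)" by (rule open_Compl[OF closed_cbox])
      show "x \<in> - cbox (-c) c" using that by simp
      show "0 = \<phi> y" if "y \<in> - cbox (-c) c" for y using z0[of y] that by simp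
    qed
    from has_derivative_unique[OF this hd[of x]] show ?thesis unfolding \<phi>1_def by (metis)
  qed
  have d1: "((\<lambda>t. \<phi> (t, y)) has_real_derivative \<phi>1 (t, y)) (at t)" for t y
  proof -
    have "((\<lambda>t. (t, y)) has_derivative (\<lambda>s. (s, 0))) (at t)" by (auto intro!: derivative_eq_intros)
    from has_derivative_compose[OF this hd[of "(t, y)"]]
    have 1: "((\<lambda>t. \<phi> (t, y)) has_derivative (\<lambda>s. frechet_derivative \<phi> (at (t, y)) (s, 0))) (at t)" .
    have "frechet_derivative \<phi> (at (t, y)) (s, 0) = \<phi>1 (t, y) * s" for s
    proof -
      have "frechet_derivative \<phi> (at (t, y)) (s *\<^sub>R (1, 0)) = s *\<^sub>R frechet_derivative \<phi> (at (t, y)) (1, 0)"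
        using linear_scale[OF has_derivative_linear[OF hd]] by blast
      then show ?thesis by (simp add: \<phi>1_def)
    qed
    then show ?thesis using 1 by (simp add: has_field_derivative_def)
  qed
  define G where "G x = v x * \<phi> x + f x * \<phi>1 x" for x
  have G: "continuous_on UNIV G" unfolding G_def[abs_def] using v c0 f c1 by (intro continuous_intros)
  have zG: "G x = 0" if "x \<notin> cbox (-c) c" for x using z0[OF that] z1[OF that] by (simp add: G_def)
  have iG: "integrable lborel G" by (rule compactly_supported_integrable[OF G zG])
  have i1: "integrable lborel (\<lambda>x. f x * \<phi>1 x)"
    by (rule compactly_supported_integrable[where c=c]) (use z1 f c1 in \<open>auto intro!: continuous_intros\<close>)
  have i2: "integrable lborel (\<lambda>x. v x * \<phi> x)"
    by (rule compactly_supported_integrable[where c=c]) (use z0 v c0 in \<open>auto intro!: continuous_intros\<close>)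
  have inner: "(\<integral>t. G (t, y) \<partial>lborel) = 0" for y
  proof -
    define r where "r = \<bar>fst c\<bar> + 1"
    have r: "0 < r" by (simp add: r_def)
    have out: "(t, y) \<notin> cbox (-c) c" if "r \<le> \<bar>t\<bar>" for t
      using that by (cases c) (auto simp: r_def)
    have "(\<integral>t. G (t, y) \<partial>lborel) = (\<integral>t. G (t, y) * indicator {-r..r} t \<partial>lborel)"
    proof (rule Bochner_Integration.integral_cong)
      show "G (t, y) = G (t, y) * indicator {-r..r} t" for t
      proof (cases "r \<le> \<bar>t\<bar>")
        case True
        then show ?thesis using zG[OF out] by simp
      next
        case False
        then have "t \<in> {-r..r}" by auto
        then show ?thesis by simp
      qed
    qed simp
    also have "\<dots> = f (r, y) * \<phi> (r, y) - f (-r, y) * \<phi> (-r, y)"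
    proof (rule integral_FTC_Icc_real)
      show "((\<lambda>t. f (t, y) * \<phi> (t, y)) has_real_derivative G (t, y)) (at t)" for t
        using DERIV_mult[OF deriv d1] by (simp add: G_def algebra_simps)
      have "continuous_on UNIV (\<lambda>t. G (t, y))"
        by (rule continuous_on_compose2[OF G]) (auto intro!: continuous_intros)
      then show "isCont (\<lambda>t. G (t, y)) t" for t by (simp add: continuous_on_eq_continuous_at)
    qed (use r in simp)
    also have "\<dots> = 0" using z0[OF out[of r]] z0[OF out[of "-r"]] r by simp
    finally show ?thesis .
  qed
  have "(\<integral>x. G x \<partial>lborel) = 0"
  proof -
    have "integrable (lborel \<Otimes>\<^sub>M lborel) G" using iG by (simp add: lborel_prod)
    then have iG': "integrable (lborel \<Otimes>\<^sub>M lborel) (case_prod (\<lambda>t y. G (t, y)))" by simp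
    have "(\<integral>y. (\<integral>t. G (t, y) \<partial>lborel) \<partial>lborel) = (\<integral>x. G x \<partial>(lborel \<Otimes>\<^sub>M lborel))"
      using lborel_pair.integral_snd[OF iG'] by simp
    then show ?thesis by (simp add: inner lborel_prod)
  qed
  then have "(\<integral>x. v x * \<phi> x \<partial>lborel) + (\<integral>x. f x * \<phi>1 x \<partial>lborel) = 0"
    unfolding G_def using i1 i2 by simp
  moreover have "(\<integral>x. f x * \<phi>1 x \<partial>lebesgue) = (\<integral>x. f x * \<phi>1 x \<partial>lborel)"
    "(\<integral>x. v x * \<phi> x \<partial>lebesgue) = (\<integral>x. v x * \<phi> x \<partial>lborel)"
    by (rule integral_completion; rule borel_measurable_integrable[OF i1] borel_measurable_integrable[OF i2])+
  ultimately show "(LINT x|lebesgue. f x * frechet_derivative \<phi> (at x) (1, 0)) = - (LINT x|lebesgue. v x * \<phi> x)"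
    unfolding \<phi>1_def by simp
qed

text \<open>Move first in the first coordinate, then in the second; evaluating \<open>q\<close> at
  the intermediate point produces the mixed error \<open>|k| |l|\<close>. The coarse expansion
  serves to bound \<open>S\<^sup>2\<close> in \<open>one_step\<close>, the fine one to bound
  \<open>D S\<close>.\<close>

lemma regular_taylor:
  assumes G: "regular L C C (f, p, q, a, b, c)" and C: "0 \<le> C" "C \<le> R" "C * (2 * L\<^sup>2 + 1) \<le> R" "L \<le> R"
  shows "\<bar>f (x1 + k, x2 + l) - f (x1, x2) - p (x1, x2) * k - a (x1, x2) / 2 * k\<^sup>2 - q (x1, x2) * l\<bar>
      \<le> R * (\<bar>k\<bar> ^ 3 + \<bar>k\<bar> * \<bar>l\<bar> + l\<^sup>2)"
    "\<bar>f (x1 + k, x2 + l) - f (x1, x2) - p (x1, x2) * k\<bar> \<le> R * (k\<^sup>2 + \<bar>l\<bar>)"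
proof -
  have g: "grad2 f p q" "grad2 p a b" "grad2 q b c" and qL: "\<And>x. \<bar>q x\<bar> \<le> L"
    and bar: "barrier L C p q a" "barrier L C p q b" "barrier L C p q c"
    and la: "lip2 C a"
    using G unfolding regular.simps by blast+
  have aM: "\<bar>a x\<bar> \<le> R" "\<bar>b x\<bar> \<le> R" "\<bar>c x\<bar> \<le> R" for x
    using bar[THEN barrier_bound, OF C(1), of x] C(3) by linarith+
  have lq: "lip2 R q" by (rule grad2_lip2[OF g(3) aM(2,3)])
  have lp: "lip2 R p" by (rule grad2_lip2[OF g(2) aM(1,2)])
  have R: "0 \<le> R" using C by linarith
  have l1: "\<bar>F (s, y) - F (t, y)\<bar> \<le> B * \<bar>s - t\<bar>" if "lip2 B F" for F B s t y
    using lip2D[OF that, of "(s, y)" "(t, y)"] by simp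
  have l2: "\<bar>F (y, s) - F (y, t)\<bar> \<le> B * \<bar>s - t\<bar>" if "lip2 B F" for F B s t y
    using lip2D[OF that, of "(y, s)" "(y, t)"] by simp
  have 1: "\<bar>f (x1 + k, x2 + l) - f (x1 + k, x2) - l * q (x1 + k, x2)\<bar> \<le> R * l\<^sup>2"
    by (rule taylor1[OF grad2_deriv2[OF g(1)] l2[OF lq]])
  have 2: "\<bar>l * (q (x1 + k, x2) - q (x1, x2))\<bar> \<le> \<bar>l\<bar> * (R * \<bar>k\<bar>)"
    unfolding abs_mult using l1[OF lq, of "x1 + k" x2 x1] by (intro mult_left_mono) auto
  have 3: "\<bar>f (x1 + k, x2) - f (x1, x2) - k * p (x1, x2) - k\<^sup>2 / 2 * a (x1, x2)\<bar> \<le> C * \<bar>k\<bar> ^ 3"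
    by (rule taylor2[OF grad2_deriv1[OF g(1)] grad2_deriv1[OF g(2)] l1[OF la]])
  have CR: "C * \<bar>k\<bar> ^ 3 \<le> R * \<bar>k\<bar> ^ 3" using C by (intro mult_right_mono) auto
  have e: "f (x1 + k, x2 + l) - f (x1, x2) - p (x1, x2) * k - a (x1, x2) / 2 * k\<^sup>2 - q (x1, x2) * l =
    (f (x1 + k, x2 + l) - f (x1 + k, x2) - l * q (x1 + k, x2)) + l * (q (x1 + k, x2) - q (x1, x2))
     + (f (x1 + k, x2) - f (x1, x2) - k * p (x1, x2) - k\<^sup>2 / 2 * a (x1, x2))"
    by (simp add: algebra_simps)
  have "R * (\<bar>k\<bar> ^ 3 + \<bar>k\<bar> * \<bar>l\<bar> + l\<^sup>2) = R * \<bar>k\<bar> ^ 3 + \<bar>l\<bar> * (R * \<bar>k\<bar>) + R * l\<^sup>2" by (simp add: algebra_simps)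
  then show "\<bar>f (x1 + k, x2 + l) - f (x1, x2) - p (x1, x2) * k - a (x1, x2) / 2 * k\<^sup>2 - q (x1, x2) * l\<bar>
      \<le> R * (\<bar>k\<bar> ^ 3 + \<bar>k\<bar> * \<bar>l\<bar> + l\<^sup>2)"
    unfolding e using 1 2 3 CR by linarith
  have 4: "\<bar>f (x1 + k, x2 + l) - f (x1 + k, x2)\<bar> \<le> R * \<bar>l\<bar>"
    using real_deriv_bound[OF grad2_deriv2[OF g(1)], of "x1 + k" R "x2 + l" x2] order_trans[OF qL C(4)] by simp
  have 5: "\<bar>f (x1 + k, x2) - f (x1, x2) - k * p (x1, x2)\<bar> \<le> R * k\<^sup>2"
    by (rule taylor1[OF grad2_deriv1[OF g(1)] l1[OF lp]])
  have "R * (k\<^sup>2 + \<bar>l\<bar>) = R * k\<^sup>2 + R * \<bar>l\<bar>" "p (x1, x2) * k = k * p (x1, x2)" by (simp_all add: algebra_simps)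
  then show "\<bar>f (x1 + k, x2 + l) - f (x1, x2) - p (x1, x2) * k\<bar> \<le> R * (k\<^sup>2 + \<bar>l\<bar>)"
    using 4 5 by linarith
qed

text \<open>For \<open>\<kappa> \<le> 1/2\<close>,
  \<open>(1 + 2 \<kappa>) (1 - \<kappa>) \<ge> 1\<close> inverts the factor on the left. The
  \<open>- 1\<close> in the ansatz absorbs the source \<open>\<kappa> h\<close> and makes the
  initial error zero.\<close>

lemma error_recursion:
  fixes E E' \<kappa> h :: real
  assumes "E' * (1 - \<kappa>) \<le> E + \<kappa> * h" "E \<le> ((1 + 2 * \<kappa>) ^ j - 1) * h" "0 \<le> \<kappa>" "\<kappa> \<le> 1/2" "0 \<le> h" "0 \<le> E'"
  shows "E' \<le> ((1 + 2 * \<kappa>) ^ Suc j - 1) * h"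
proof -
  have k: "1 \<le> (1 + 2 * \<kappa>) * (1 - \<kappa>)"
    using mult_left_mono[of \<kappa> "1/2" \<kappa>] assms by (simp add: algebra_simps)
  have "E' \<le> E' * ((1 + 2 * \<kappa>) * (1 - \<kappa>))" using mult_left_mono[OF k assms(6)] by simp
  also have "\<dots> = (1 + 2 * \<kappa>) * (E' * (1 - \<kappa>))" by simp
  also have "\<dots> \<le> (1 + 2 * \<kappa>) * (((1 + 2 * \<kappa>) ^ j - 1) * h + \<kappa> * h)"
    using assms by (intro mult_left_mono) auto
  also have "\<dots> = (1 + 2 * \<kappa>) ^ Suc j * h - ((1 + 2 * \<kappa>) * (1 - \<kappa>)) * h" by (simp add: algebra_simps)
  also have "\<dots> \<le> (1 + 2 * \<kappa>) ^ Suc j * h - 1 * h" using k assms(5) by (intro diff_left_mono mult_right_mono)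
  finally show ?thesis by (simp add: algebra_simps)
qed

text \<open>Level \<open>j\<close> stands for time \<open>1 - j / n\<close>. The error vanishes at
  the terminal level, and the source of order \<open>1 / n\<^sup>2\<close> that
  \<open>one_step\<close> adds in each of \<open>n\<close> steps accumulates to order
  \<open>1 / n\<close>. The lower bound on \<open>n\<close> is
  \<open>\<kappa> \<le> 1/2\<close>.\<close>

lemma scheme_error:
  assumes bb: "brownian_basis M F W"
    and mdf: "markovian_decoupling_field M F W g \<delta> (\<lambda>s \<omega> x. u s x)"
    and u_lip: "\<And>s. s \<in> {0..1} \<Longrightarrow> Lu-lipschitz_on UNIV (u s)"
    and n: "0 < n" "88 * R ^ 8 \<le> real n"
    and R: "1 \<le> R" "L \<le> R" "Lu \<le> R" "C \<le> R" "C * (2 * L\<^sup>2 + 1) \<le> R" "0 \<le> C"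
    and S0: "S 0 = (\<lambda>x. g (fst x) - \<delta> (snd x), p0, q0, a0, b0, c0)"
    and good: "\<And>j. j \<le> n \<Longrightarrow> regular L C C (S j)"
    and linked: "\<And>j. j < n \<Longrightarrow> linked L C (1 / sqrt (real n)) (S j) (S (Suc j))"
  shows "j \<le> n \<Longrightarrow> (fst (S j) x - u (1 - real j / real n) x)\<^sup>2 \<le> exp (88 * R ^ 8) / real n"
proof -
  interpret brownian_basis M F W by (rule bb)
  define \<kappa> where "\<kappa> = 44 * R ^ 8 * (1 / real n)"
  have \<kappa>: "0 \<le> \<kappa>" "\<kappa> \<le> 1/2" using n R(1) by (auto simp: \<kappa>_def pos_divide_le_eq)
  have u1: "u 1 x = g (fst x) - \<delta> (snd x)" for x
  proof -
    have "AE \<omega> in M. u 1 x = g (fst x) - \<delta> (snd x)"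
      using mdf unfolding markovian_decoupling_field_def by blast
    then show ?thesis by simp
  qed
  have step: "j \<le> n \<Longrightarrow> (fst (S j) x - u (1 - real j / real n) x)\<^sup>2 \<le> ((1 + 2 * \<kappa>) ^ j - 1) * (1 / real n)" for j x
  proof (induction j arbitrary: x)
    case 0
    then show ?case using u1 by (simp add: S0)
  next
    case (Suc j)
    have j: "j < n" "j \<le> n" using Suc.prems by auto
    define t1 where "t1 = 1 - real (Suc j) / real n"
    define t2 where "t2 = 1 - real j / real n"
    have h: "t2 - t1 = 1 / real n" using n by (simp add: t1_def t2_def field_simps)
    have t: "0 \<le> t1" "t1 \<le> t2" "t2 \<le> 1" using j n h by (auto simp: t1_def t2_def field_simps)
    obtain f p q a b c where Sj: "S j = (f, p, q, a, b, c)" by (metis prod_cases6)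
    obtain f' p' q' a' b' c' where Sj': "S (Suc j) = (f', p', q', a', b', c')" by (metis prod_cases6)
    obtain x1 x2 where x: "x = (x1, x2)" by (metis surj_pair)
    have "(\<lambda>_. x) \<in> borel_measurable (F t1)" by simp
    then obtain X1 X2 Y Z where
      P: "progressively_measurable F t1 t2 X1" "progressively_measurable F t1 t2 X2"
        "progressively_measurable F t1 t2 Y" "progressively_measurable F t1 t2 Z" "essentially_bounded M t1 t2 Z"
      and E: "\<forall>s\<in>{t1..t2}.
          (AE \<omega> in M. X1 s \<omega> = fst x + (W s \<omega> - W t1 \<omega>)) \<and>
          (AE \<omega> in M. X2 s \<omega> = snd x + (LINT r:{t1..s}|lborel. (Z r \<omega>)\<^sup>2)) \<and>
          (\<exists>J. has_ito_integral M F W s t2 Z J \<and> (AE \<omega> in M. Y s \<omega> = Y t2 \<omega> - J \<omega>)) \<and>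
          (AE \<omega> in M. Y s \<omega> = u s (X1 s \<omega>, X2 s \<omega>))"
      using mdf t unfolding markovian_decoupling_field_def by blast
    interpret D: decoupled M F W t1 t2 x1 x2 Lu u X1 X2 Y Z
      by unfold_locales (use t P E u_lip in \<open>auto simp: x\<close>)
    have G: "regular L C C (f, p, q, a, b, c)" using good[OF j(2)] Sj by simp
    have pq: "\<bar>p x\<bar> \<le> R" "\<bar>q x\<bar> \<le> R" "\<bar>a x\<bar> \<le> R"
    proof -
      have "\<bar>p x\<bar> \<le> L" "\<bar>q x\<bar> \<le> L" "barrier L C p q a" using G unfolding regular.simps by blast+
      then show "\<bar>p x\<bar> \<le> R" "\<bar>q x\<bar> \<le> R" "\<bar>a x\<bar> \<le> R"
        using R barrier_bound[of L C p q a x] by linarith+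
    qed
    have "\<bar>f' x - (f x + (1 / sqrt (real n))\<^sup>2 * (a x / 2 + q x * (p x)\<^sup>2))\<bar> \<le> C * (1 / sqrt (real n)) ^ 3"
      using linked[OF j(1)] unfolding Sj Sj' linked.simps by blast
    moreover have "C * (1 / sqrt (real n)) ^ 3 \<le> R * ((t2 - t1) * sqrt (t2 - t1))"
    proof -
      have "(1 / sqrt (real n)) ^ 3 = (t2 - t1) * sqrt (t2 - t1)"
        unfolding h using n by (simp add: power3_eq_cube real_sqrt_divide)
      moreover have "0 \<le> (t2 - t1) * sqrt (t2 - t1)" using t by simp
      ultimately show ?thesis using R(4) by (simp add: mult_right_mono)
    qed
    moreover have "(1 / sqrt (real n))\<^sup>2 = t2 - t1" unfolding h using n by (simp add: power_divide)
    ultimately have cons: "\<bar>f' x - (f x + (t2 - t1) * (a x / 2 + q x * (p x)\<^sup>2))\<bar> \<le> R * ((t2 - t1) * sqrt (t2 - t1))"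
      by simp
    define e where "e = sqrt (((1 + 2 * \<kappa>) ^ j - 1) * (1 / real n))"
    have pw: "1 \<le> (1 + 2 * \<kappa>) ^ j" using \<kappa> by (intro one_le_power) simp
    have e2: "e\<^sup>2 = ((1 + 2 * \<kappa>) ^ j - 1) * (1 / real n)" unfolding e_def using pw by simp
    have close: "\<bar>f y - u t2 y\<bar> \<le> e" for y
      using real_sqrt_le_mono[OF Suc.IH[OF j(2), of y]] unfolding e_def t2_def Sj by simp
    have "(f' x - u t1 (x1, x2))\<^sup>2 * (1 - 44 * R ^ 8 * (t2 - t1)) \<le> e\<^sup>2 + 44 * R ^ 8 * (t2 - t1)\<^sup>2"
      by (rule D.one_step[where f=f and p="p x" and aa="a x" and q="q x"])
         (use regular_taylor[OF G R(6,4,5,2)] pq R cons close in \<open>simp_all only: x\<close>)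
    then have "(f' x - u t1 x)\<^sup>2 * (1 - \<kappa>) \<le> ((1 + 2 * \<kappa>) ^ j - 1) * (1 / real n) + \<kappa> * (1 / real n)"
      unfolding h e2 x[symmetric] \<kappa>_def by (simp add: power2_eq_square mult.assoc)
    from error_recursion[OF this order_refl \<kappa>]
    show ?case unfolding Sj' t1_def by simp
  qed
  assume j: "j \<le> n"
  have "((1 + 2 * \<kappa>) ^ j - 1) * (1 / real n) \<le> exp (88 * R ^ 8) * (1 / real n)"
  proof (rule mult_right_mono)
    have "2 * \<kappa> = 88 * R ^ 8 * (1 / real n)" by (simp add: \<kappa>_def)
    moreover have "(1 + 88 * R ^ 8 * (1 / real n)) ^ j \<le> exp (88 * R ^ 8)"
      by (rule power_exp_bound) (use j n R in \<open>auto simp: field_simps\<close>)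
    ultimately show "(1 + 2 * \<kappa>) ^ j - 1 \<le> exp (88 * R ^ 8)" by simp
  qed (use n in simp)
  with step[OF j, of x] show "(fst (S j) x - u (1 - real j / real n) x)\<^sup>2 \<le> exp (88 * R ^ 8) / real n" by simp
qed

lemma grad2_fst: "(\<And>t. (G has_real_derivative G' t) (at t)) \<Longrightarrow> grad2 (\<lambda>x. G (fst x)) (\<lambda>x. G' (fst x)) (\<lambda>x. 0)"
  unfolding grad2_def
proof
  fix x :: "real \<times> real" assume "\<And>t. (G has_real_derivative G' t) (at t)"
  then have "(G has_derivative (\<lambda>s. G' (fst x) * s)) (at (fst x))" by (simp add: has_field_derivative_def)
  from has_derivative_compose[OF has_derivative_fst[OF has_derivative_ident] this]
  show "((\<lambda>x. G (fst x)) has_derivative (\<lambda>v. G' (fst x) * fst v + 0 * snd v)) (at x)" by simp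
qed

lemma grad2_snd: "(\<And>t. (G has_real_derivative G' t) (at t)) \<Longrightarrow> grad2 (\<lambda>x. G (snd x)) (\<lambda>x. 0) (\<lambda>x. G' (snd x))"
  unfolding grad2_def
proof
  fix x :: "real \<times> real" assume "\<And>t. (G has_real_derivative G' t) (at t)"
  then have "(G has_derivative (\<lambda>s. G' (snd x) * s)) (at (snd x))" by (simp add: has_field_derivative_def)
  from has_derivative_compose[OF has_derivative_snd[OF has_derivative_ident] this]
  show "((\<lambda>x. G (snd x)) has_derivative (\<lambda>v. 0 * fst v + G' (snd x) * snd v)) (at x)" by simp
qed

lemma lipschitz_deriv_bound:
  fixes f :: "real \<Rightarrow> real"
  assumes "(f has_real_derivative D) (at x)" "\<And>s t. \<bar>f s - f t\<bar> \<le> B * \<bar>s - t\<bar>"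
  shows "\<bar>D\<bar> \<le> B"
proof -
  have "((\<lambda>k. (f (x + k) - f x) / k) \<longlongrightarrow> D) (at 0)" using assms(1) by (simp add: DERIV_def)
  moreover have "\<forall>\<^sub>F k in at 0. norm ((f (x + k) - f x) / k) \<le> B"
    unfolding eventually_at
  proof (intro exI[of _ 1] conjI ballI impI)
    fix k :: real assume "k \<noteq> 0 \<and> dist k 0 < 1"
    then show "norm ((f (x + k) - f x) / k) \<le> B" using assms(2)[of "x + k" x] by (simp add: divide_le_eq)
  qed simp
  ultimately have "norm D \<le> B" by (rule Lim_norm_ubound[of "at 0", rotated]) simp
  then show ?thesis by simp
qed

lemma mono_deriv_nonneg:
  fixes f :: "real \<Rightarrow> real"
  assumes "mono f" "(f has_real_derivative D) (at x)"
  shows "0 \<le> D"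
proof -
  have "((\<lambda>k. (f (x + k) - f x) / k) \<longlongrightarrow> D) (at 0)" using assms(2) by (simp add: DERIV_def)
  moreover have "\<forall>\<^sub>F k in at 0. 0 \<le> (f (x + k) - f x) / k"
    unfolding eventually_at
  proof (intro exI[of _ 1] conjI ballI impI)
    fix k :: real assume k: "k \<noteq> 0 \<and> dist k 0 < 1"
    show "0 \<le> (f (x + k) - f x) / k"
    proof (cases "0 < k")
      case True
      then show ?thesis using monoD[OF assms(1), of x "x + k"] by simp
    next
      case False
      then show ?thesis using monoD[OF assms(1), of "x + k" x] k by (simp add: zero_le_divide_iff)
    qed
  qed simp
  ultimately show ?thesis by (rule tendsto_lowerbound) simp
qed

text \<open>The variables are separated, so the mixed derivative is \<open>0\<close>. Lipschitz
  constants of \<open>g\<close>, \<open>\<delta>\<close> bound the gradient, those of the first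
  derivatives bound the Hessian, and those of the second derivatives start the recursion for
  \<open>\<Lambda>\<close>.\<close>

lemma regular_terminal:
  fixes g g' g'' \<delta> \<delta>' \<delta>'' :: "real \<Rightarrow> real"
  assumes d: "\<And>x. (g has_real_derivative g' x) (at x)" "\<And>x. (g' has_real_derivative g'' x) (at x)"
      "\<And>x. (\<delta> has_real_derivative \<delta>' x) (at x)" "\<And>x. (\<delta>' has_real_derivative \<delta>'' x) (at x)"
    and lip: "\<And>f s t. f \<in> {g, \<delta>, g', \<delta>', g'', \<delta>''} \<Longrightarrow> \<bar>f s - f t\<bar> \<le> L * \<bar>s - t\<bar>"
    and L: "0 \<le> L" "L \<le> E"
  shows "regular L E L (\<lambda>x. g (fst x) - \<delta> (snd x), \<lambda>x. g' (fst x), \<lambda>x. - \<delta>' (snd x),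
    \<lambda>x. g'' (fst x), \<lambda>x. 0, \<lambda>x. - \<delta>'' (snd x))"
proof -
  have b: "\<bar>g' x\<bar> \<le> L" "\<bar>g'' x\<bar> \<le> L" "\<bar>\<delta>' x\<bar> \<le> L" "\<bar>\<delta>'' x\<bar> \<le> L" for x
    by (rule lipschitz_deriv_bound[OF d(1)] lipschitz_deriv_bound[OF d(2)] lipschitz_deriv_bound[OF d(3)]
        lipschitz_deriv_bound[OF d(4)]; rule lip; simp)+
  have "grad2 (\<lambda>x. g (fst x) - \<delta> (snd x)) (\<lambda>x. g' (fst x)) (\<lambda>x. - \<delta>' (snd x))"
    using grad2_diff[OF grad2_fst[OF d(1)] grad2_snd[OF d(3)]] by simp
  moreover have "grad2 (\<lambda>x. g' (fst x)) (\<lambda>x. g'' (fst x)) (\<lambda>x. 0)"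
    by (rule grad2_fst[OF d(2)])
  moreover have "grad2 (\<lambda>x. - \<delta>' (snd x)) (\<lambda>x. 0) (\<lambda>x. - \<delta>'' (snd x))"
    using grad2_diff[OF grad2_const[of 0] grad2_snd[OF d(4)]] by simp
  moreover have "barrier L E (\<lambda>x. g' (fst x)) (\<lambda>x. - \<delta>' (snd x)) G" if "\<And>x. \<bar>G x\<bar> \<le> L" for G
    unfolding barrier_def
  proof
    fix x
    have "(g' (fst x))\<^sup>2 \<le> L\<^sup>2" "(\<delta>' (snd x))\<^sup>2 \<le> L\<^sup>2"
      using b(1)[of "fst x"] b(3)[of "snd x"] L(1) by (auto intro!: abs_le_square_iff[THEN iffD1])
    then have "1 \<le> 2 * L\<^sup>2 + 1 - (g' (fst x))\<^sup>2 - (- \<delta>' (snd x))\<^sup>2" by simp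
    then have "E * 1 \<le> E * (2 * L\<^sup>2 + 1 - (g' (fst x))\<^sup>2 - (- \<delta>' (snd x))\<^sup>2)"
      using L by (intro mult_left_mono) auto
    then show "\<bar>G x\<bar> \<le> E * (2 * L\<^sup>2 + 1 - (g' (fst x))\<^sup>2 - (- \<delta>' (snd x))\<^sup>2)"
      using that[of x] L by linarith
  qed
  moreover have "lip2 L (\<lambda>x. g'' (fst x))" "lip2 L (\<lambda>x. 0)" "lip2 L (\<lambda>x. - \<delta>'' (snd x))"
    unfolding lip2_def
  proof (safe)
    fix x1 x2 y1 y2 :: real
    have "L * (\<bar>x1 - y1\<bar> + \<bar>x2 - y2\<bar>) = L * \<bar>x1 - y1\<bar> + L * \<bar>x2 - y2\<bar>" "0 \<le> L * \<bar>x1 - y1\<bar>" "0 \<le> L * \<bar>x2 - y2\<bar>"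
      using L by (simp_all add: distrib_left)
    then show "\<bar>g'' (fst (x1, x2)) - g'' (fst (y1, y2))\<bar> \<le> L * (\<bar>fst (x1, x2) - fst (y1, y2)\<bar> + \<bar>snd (x1, x2) - snd (y1, y2)\<bar>)"
      "\<bar>0 - 0 :: real\<bar> \<le> L * (\<bar>fst (x1, x2) - fst (y1, y2)\<bar> + \<bar>snd (x1, x2) - snd (y1, y2)\<bar>)"
      "\<bar>- \<delta>'' (snd (x1, x2)) - - \<delta>'' (snd (y1, y2))\<bar> \<le> L * (\<bar>fst (x1, x2) - fst (y1, y2)\<bar> + \<bar>snd (x1, x2) - snd (y1, y2)\<bar>)"
      using lip[of g'' x1 y1] lip[of \<delta>'' x2 y2] by (simp_all add: abs_minus_commute)
  qed
  ultimately show ?thesis using b L(1) by simp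
qed

lemma linked_time:
  assumes "\<And>j. j < n \<Longrightarrow> linked L C (1 / sqrt (real n)) (S j) (S (Suc j))" "0 < n" "i \<le> j" "j \<le> n"
  shows "\<bar>fst (snd (S j)) x - fst (snd (S i)) x\<bar> \<le> C * ((real j - real i) / real n)"
  using assms(3,4)
proof (induction j rule: dec_induct)
  case (step j)
  obtain f p q a b c where Sj: "S j = (f, p, q, a, b, c)" by (metis prod_cases6)
  obtain f' p' q' a' b' c' where Sj': "S (Suc j) = (f', p', q', a', b', c')" by (metis prod_cases6)
  have "\<bar>p' x - p x\<bar> \<le> C * (1 / sqrt (real n))\<^sup>2"
    using assms(1)[of j] step.hyps(2) step.prems unfolding Sj Sj' linked.simps by (metis less_eq_Suc_le)
  also have "(1 / sqrt (real n))\<^sup>2 = 1 / real n" using assms(2) by (simp add: power_divide)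
  finally have "\<bar>p' x - p x\<bar> \<le> C * (1 / real n)" .
  moreover have "\<bar>p x - fst (snd (S i)) x\<bar> \<le> C * ((real j - real i) / real n)" using step unfolding Sj by simp
  moreover have "C * ((real (Suc j) - real i) / real n) = C * ((real j - real i) / real n) + C * (1 / real n)"
    by (simp add: add_divide_distrib diff_divide_distrib algebra_simps)
  ultimately show ?case unfolding Sj' by simp
qed simp

text \<open>Iterates the positivity clause with \<open>k\<close> collecting the losses and
  \<open>N\<close> the walk average of \<open>\<phi>\<close>, whose square is the terminal lower
  bound.\<close>

lemma linked_positivity:
  assumes "\<And>j. j < n \<Longrightarrow> linked L C (1 / sqrt (real n)) (S j) (S (Suc j))" "0 < n" "4 * L ^ 4 \<le> real n"
    and "\<And>x. (\<phi> (fst x))\<^sup>2 \<le> fst (snd (S 0)) x"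
  shows "j \<le> n \<Longrightarrow> (1 - 4 * L ^ 4 / real n) ^ j * (walk (1 / sqrt (real n)) \<phi> j (fst x))\<^sup>2 \<le> fst (snd (S j)) x"
proof (induction j arbitrary: x)
  case 0
  then show ?case using assms(4) by simp
next
  case (Suc j)
  obtain f p q a b c where Sj: "S j = (f, p, q, a, b, c)" by (metis prod_cases6)
  obtain f' p' q' a' b' c' where Sj': "S (Suc j) = (f', p', q', a', b', c')" by (metis prod_cases6)
  let ?k = "(1 - 4 * L ^ 4 / real n) ^ j"
  have e: "4 * L ^ 4 * (1 / sqrt (real n))\<^sup>2 = 4 * L ^ 4 / real n" using assms(2) by (simp add: power_divide)
  have "0 \<le> 1 - 4 * L ^ 4 / real n" using assms(2,3) by (simp add: pos_divide_le_eq)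
  then have "0 \<le> ?k" by (rule zero_le_power)
  moreover have "\<forall>x. ?k * (walk (1 / sqrt (real n)) \<phi> j (fst x))\<^sup>2 \<le> p x"
    using Suc unfolding Sj by simp
  ultimately have "?k * (1 - 4 * L ^ 4 * (1 / sqrt (real n))\<^sup>2) *
     ((walk (1 / sqrt (real n)) \<phi> j (fst x + 1 / sqrt (real n)) + walk (1 / sqrt (real n)) \<phi> j (fst x - 1 / sqrt (real n))) / 2)\<^sup>2 \<le> p' x"
    using assms(1)[of j] Suc.prems unfolding Sj Sj' linked.simps Suc_le_eq by blast
  then show ?case unfolding Sj' e by (simp add: mult.commute)
qed

text \<open>Backward steps from time 1, rounded so that the grid time lies at or just below
  \<open>s\<close>; at least the time \<open>1 - s\<close> has then been run through, which
  positivity relies on.\<close>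

definition grid_step :: "nat \<Rightarrow> real \<Rightarrow> nat" where
  "grid_step n s = n - nat \<lfloor>s * real n\<rfloor>"

lemma grid_step_le: "grid_step n s \<le> n"
  by (simp add: grid_step_def)

lemma grid_step_antimono: "s \<le> t \<Longrightarrow> grid_step n t \<le> grid_step n s"
  unfolding grid_step_def by (intro diff_le_mono2 nat_mono floor_mono mult_right_mono) auto

lemma grid_step_time:
  assumes "s \<in> {0..1}" "0 < n"
  shows "1 - real (grid_step n s) / real n \<in> {0..1}" "1 - real (grid_step n s) / real n \<le> s"
    "s - 1 / real n \<le> 1 - real (grid_step n s) / real n"
proof -
  have f: "0 \<le> \<lfloor>s * real n\<rfloor>" using assms by simp
  have "s * real n \<le> 1 * real n" using assms by (intro mult_right_mono) auto
  then have "\<lfloor>s * real n\<rfloor> \<le> int n" by linarith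
  then have "nat \<lfloor>s * real n\<rfloor> \<le> n" by linarith
  then have e: "1 - real (grid_step n s) / real n = of_int \<lfloor>s * real n\<rfloor> / real n"
    using f assms(2) by (simp add: grid_step_def of_nat_diff field_simps)
  have "of_int \<lfloor>s * real n\<rfloor> \<le> s * real n" "s * real n - 1 \<le> of_int \<lfloor>s * real n\<rfloor>" by linarith+
  then show "1 - real (grid_step n s) / real n \<le> s" "s - 1 / real n \<le> 1 - real (grid_step n s) / real n"
    unfolding e using assms(2) by (simp_all add: pos_divide_le_eq pos_le_divide_eq left_diff_distrib)
  then show "1 - real (grid_step n s) / real n \<in> {0..1}" using assms(1) e f by (auto simp: grid_step_le)
qed

lemma grid_step_tendsto:
  assumes "s \<in> {0..1}"
  shows "(\<lambda>n. 1 - real (grid_step n s) / real n) \<longlonglongrightarrow> s"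
proof (rule tendsto_sandwich)
  show "\<forall>\<^sub>F n in sequentially. s - 1 / real n \<le> 1 - real (grid_step n s) / real n"
    "\<forall>\<^sub>F n in sequentially. 1 - real (grid_step n s) / real n \<le> s"
    using grid_step_time(2,3)[OF assms] by (auto intro!: eventually_sequentiallyI[of 1])
  show "(\<lambda>n. s - 1 / real n) \<longlonglongrightarrow> s" by real_asymp
qed simp

lemma scheme_derivative_limit:
  fixes S :: "nat \<Rightarrow> nat \<Rightarrow> level"
  assumes good: "\<And>n j. n1 \<le> n \<Longrightarrow> j \<le> n \<Longrightarrow> regular L C C (S n j)"
    and C: "0 \<le> C" "C * (2 * L\<^sup>2 + 1) \<le> R"
    and lim: "\<And>x. (\<lambda>n. fst (S n (grid_step n s)) x) \<longlonglongrightarrow> u x"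
  defines "v \<equiv> \<lambda>x. lim (\<lambda>n. fst (snd (S n (grid_step n s))) x)"
  shows "(\<lambda>n. fst (snd (S n (grid_step n s))) x) \<longlonglongrightarrow> v x"
    and "((\<lambda>t. u (t, y)) has_real_derivative v (t, y)) (at t)"
    and "lip2 R v"
proof -
  have f: "((\<lambda>t. fst (S n (grid_step n s)) (t, y)) has_real_derivative fst (snd (S n (grid_step n s))) (t, y)) (at t)"
    and p: "lip2 R (fst (snd (S n (grid_step n s))))" if "n1 \<le> n" for n t y
  proof -
    obtain f p q a b c where Sj: "S n (grid_step n s) = (f, p, q, a, b, c)" by (metis prod_cases6)
    have G: "grad2 f p q" "grad2 p a b" "barrier L C p q a" "barrier L C p q b"
      using good[OF that grid_step_le[of n s]] unfolding Sj regular.simps by blast+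
    show "((\<lambda>t. fst (S n (grid_step n s)) (t, y)) has_real_derivative fst (snd (S n (grid_step n s))) (t, y)) (at t)"
      unfolding Sj by (simp add: grad2_deriv1[OF G(1)])
    have "lip2 R p"
      by (rule grad2_lip2[OF G(2)])
        (rule order_trans[OF barrier_bound[OF G(3) C(1)] C(2)] order_trans[OF barrier_bound[OF G(4) C(1)] C(2)])+
    then show "lip2 R (fst (snd (S n (grid_step n s))))" unfolding Sj by simp
  qed
  have x1: "\<bar>fst (snd (S n (grid_step n s))) (r, y) - fst (snd (S n (grid_step n s))) (t, y)\<bar> \<le> R * \<bar>r - t\<bar>"
    if "n1 \<le> n" for n r t y
    using lip2D[OF p[OF that], of "(r, y)" "(t, y)"] by simp
  note D = limit_deriv[of n1 "\<lambda>n t. fst (S n (grid_step n s)) (t, y)"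
      "\<lambda>n t. fst (snd (S n (grid_step n s))) (t, y)" R "\<lambda>t. u (t, y)" for y, OF f x1 lim]
  show conv: "(\<lambda>n. fst (snd (S n (grid_step n s))) x) \<longlonglongrightarrow> v x" for x
    using D(1)[of "fst x" "snd x"] unfolding v_def by (simp add: convergent_LIMSEQ_iff)
  show "((\<lambda>t. u (t, y)) has_real_derivative v (t, y)) (at t)" using D(2) unfolding v_def .
  show "lip2 R v" unfolding lip2_def
  proof (intro allI)
    fix x y
    show "\<bar>v x - v y\<bar> \<le> R * (\<bar>fst x - fst y\<bar> + \<bar>snd x - snd y\<bar>)"
    proof (rule tendsto_upperbound[OF tendsto_rabs[OF tendsto_diff[OF conv conv]]])
      show "\<forall>\<^sub>F n in sequentially. \<bar>fst (snd (S n (grid_step n s))) x - fst (snd (S n (grid_step n s))) y\<bar>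
          \<le> R * (\<bar>fst x - fst y\<bar> + \<bar>snd x - snd y\<bar>)"
        using lip2D[OF p] by (intro eventually_sequentiallyI[of n1]) blast
    qed simp
  qed
qed

lemma lip2_continuous:
  assumes "lip2 R v"
  shows "continuous_on UNIV v"
proof -
  have R: "0 \<le> R" using lip2D[OF assms, of "(1, 0)" "(0, 0)"] by simp
  have "dist (v x) (v y) \<le> (2 * R) * dist x y" for x y
  proof -
    have "\<bar>fst x - fst y\<bar> + \<bar>snd x - snd y\<bar> \<le> 2 * dist x y"
      using dist_fst_le[of x y] dist_snd_le[of x y] by (simp add: dist_real_def)
    then have "R * (\<bar>fst x - fst y\<bar> + \<bar>snd x - snd y\<bar>) \<le> R * (2 * dist x y)" using R by (rule mult_left_mono)
    then show ?thesis using lip2D[OF assms, of x y] by (simp add: dist_real_def)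
  qed
  then have "(2 * R)-lipschitz_on UNIV v" using R by (intro lipschitz_onI) auto
  then show ?thesis by (rule lipschitz_on_continuous_on)
qed

text \<open>By Lipschitz continuity \<open>\<phi> = sqrt h\<close> stays above
  \<open>sqrt (h x0 / 2)\<close> near \<open>x0\<close>. The walk bound with run time
  \<open>1 - s > 0\<close>, together with the loss factor \<open>exp (- 8 L ^ 4)\<close>, gives a
  lower bound that does not depend on \<open>n\<close>, so strict positivity survives the
  limit.\<close>

lemma scheme_limit_positive:
  fixes S :: "nat \<Rightarrow> nat \<Rightarrow> level"
  assumes linked: "\<And>n j. n1 \<le> n \<Longrightarrow> j < n \<Longrightarrow> linked L C (1 / sqrt (real n)) (S n j) (S n (Suc j))"
    and S0: "\<And>n x. n1 \<le> n \<Longrightarrow> fst (snd (S n 0)) x = h (fst x)"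
    and h: "\<And>t. 0 \<le> h t" "0 < h x0" "\<And>s t. \<bar>h s - h t\<bar> \<le> L * \<bar>s - t\<bar>" and L: "0 < L"
    and s: "s \<in> {0..<1}"
    and lim: "(\<lambda>n. fst (snd (S n (grid_step n s))) x) \<longlonglongrightarrow> v"
  shows "0 < v"
proof -
  define \<phi> where "\<phi> = (\<lambda>t. sqrt (h t))"
  have \<phi>: "0 \<le> \<phi> t" "(\<phi> t)\<^sup>2 = h t" for t unfolding \<phi>_def by (simp_all add: h)
  have m: "sqrt (h x0 / 2) \<le> \<phi> t" if "\<bar>t - x0\<bar> \<le> h x0 / (2 * L)" for t
  proof -
    have "L * \<bar>t - x0\<bar> \<le> L * (h x0 / (2 * L))" using that L by (intro mult_left_mono) auto
    then have "\<bar>h t - h x0\<bar> \<le> h x0 / 2" using h(3)[of t x0] L by simp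
    then have "h x0 / 2 \<le> h t" by linarith
    then show ?thesis unfolding \<phi>_def by (rule real_sqrt_le_mono)
  qed
  have pos: "0 < h x0 / (2 * L)" "0 < sqrt (h x0 / 2)" "0 < 1 - s" using h(2) L s by auto
  from walk_lower_bound[where \<phi>=\<phi> and ?x0.0=x0 and R="h x0 / (2 * L)" and m="sqrt (h x0 / 2)" and x="fst x"
      and \<sigma>="1 - s", OF \<phi>(1) m pos]
  obtain c n0 where c: "0 < c" and w: "\<And>n j. n0 \<le> n \<Longrightarrow> j \<le> n \<Longrightarrow> 1 - s \<le> real j / real n \<Longrightarrow>
      c \<le> walk (1 / sqrt (real n)) \<phi> j (fst x)" by metis
  obtain n2 :: nat where n2: "8 * L ^ 4 \<le> real n2" by (meson real_arch_simple)
  have "exp (- 2 * (4 * L ^ 4)) * c\<^sup>2 \<le> fst (snd (S n (grid_step n s))) x" if n: "n0 + n1 + n2 + 1 \<le> n" for n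
  proof -
    have n': "n0 \<le> n" "n1 \<le> n" "0 < n" "real n2 \<le> real n" using n by auto
    then have l: "4 * L ^ 4 / real n \<le> 1/2" "4 * L ^ 4 \<le> real n" using n2 L
      by (auto simp: field_simps intro: order_trans[of _ "8 * L ^ 4"])
    have j: "1 - s \<le> real (grid_step n s) / real n"
      using grid_step_time(2)[of s n] s n'(3) by auto
    have "exp (- 2 * (4 * L ^ 4)) * c\<^sup>2
        \<le> (1 - 4 * L ^ 4 / real n) ^ grid_step n s * (walk (1 / sqrt (real n)) \<phi> (grid_step n s) (fst x))\<^sup>2"
    proof (rule mult_mono)
      show "exp (- 2 * (4 * L ^ 4)) \<le> (1 - 4 * L ^ 4 / real n) ^ grid_step n s"
        by (rule one_minus_power_ge) (use L l n' grid_step_le in auto)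
      show "c\<^sup>2 \<le> (walk (1 / sqrt (real n)) \<phi> (grid_step n s) (fst x))\<^sup>2"
        by (rule power_mono[OF w[OF n'(1) grid_step_le j]]) (use c in simp)
      show "0 \<le> (1 - 4 * L ^ 4 / real n) ^ grid_step n s" by (rule zero_le_power) (use l in simp)
    qed simp
    also have "\<dots> \<le> fst (snd (S n (grid_step n s))) x"
      by (rule linked_positivity[where S="S n" and \<phi>=\<phi>, OF linked[OF n'(2)] n'(3) l(2) _ grid_step_le]) (simp_all add: \<phi>(2) S0[OF n'(2)])
    finally show ?thesis .
  qed
  then have "\<forall>\<^sub>F n in sequentially. exp (- 2 * (4 * L ^ 4)) * c\<^sup>2 \<le> fst (snd (S n (grid_step n s))) x"
    by (rule eventually_sequentiallyI)
  then have "exp (- 2 * (4 * L ^ 4)) * c\<^sup>2 \<le> v" by (rule tendsto_lowerbound[OF lim]) simp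
  moreover have "0 < exp (- 2 * (4 * L ^ 4)) * c\<^sup>2" using c by simp
  ultimately show ?thesis by linarith
qed

lemma scheme_limit_time:
  fixes S :: "nat \<Rightarrow> nat \<Rightarrow> level"
  assumes linked: "\<And>n j. n1 \<le> n \<Longrightarrow> j < n \<Longrightarrow> linked L C (1 / sqrt (real n)) (S n j) (S n (Suc j))"
    and v: "\<And>s. s \<in> {0..1} \<Longrightarrow> (\<lambda>n. fst (snd (S n (grid_step n s))) x) \<longlonglongrightarrow> v s"
    and s: "s \<in> {0..1}" "t \<in> {0..1}"
  shows "\<bar>v s - v t\<bar> \<le> C * \<bar>s - t\<bar>"
proof -
  have le: "\<bar>v s - v t\<bar> \<le> C * (t - s)" if s: "s \<in> {0..1}" "t \<in> {0..1}" "s \<le> t" for s t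
  proof (rule tendsto_le[OF _ _ tendsto_rabs[OF tendsto_diff[OF v[OF s(1)] v[OF s(2)]]]])
    show "\<forall>\<^sub>F n in sequentially. \<bar>fst (snd (S n (grid_step n s))) x - fst (snd (S n (grid_step n t))) x\<bar> \<le>
        C * ((1 - real (grid_step n t) / real n) - (1 - real (grid_step n s) / real n))"
    proof (rule eventually_sequentiallyI[of "n1 + 1"])
      fix n assume n: "n1 + 1 \<le> n"
      have "\<bar>fst (snd (S n (grid_step n s))) x - fst (snd (S n (grid_step n t))) x\<bar> \<le>
          C * ((real (grid_step n s) - real (grid_step n t)) / real n)"
        by (rule linked_time[where S="S n", OF linked]) (use n grid_step_antimono[OF s(3)] grid_step_le in auto)
      then show "\<bar>fst (snd (S n (grid_step n s))) x - fst (snd (S n (grid_step n t))) x\<bar> \<le>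
        C * ((1 - real (grid_step n t) / real n) - (1 - real (grid_step n s) / real n))"
        by (simp add: diff_divide_distrib)
    qed
  qed (simp, rule tendsto_mult[OF tendsto_const tendsto_diff[OF grid_step_tendsto[OF s(2)] grid_step_tendsto[OF s(1)]]])
  show ?thesis using le[of s t] le[of t s] s by (cases "s \<le> t") (auto simp: abs_minus_commute)
qed

lemma decoupling_field_derivative:
  fixes g g' g'' \<delta> \<delta>' \<delta>'' :: "real \<Rightarrow> real" and u :: "real \<Rightarrow> real \<times> real \<Rightarrow> real"
  assumes bb: "brownian_basis M F W"
    and d: "\<And>x. (g has_real_derivative g' x) (at x)" "\<And>x. (g' has_real_derivative g'' x) (at x)"
      "\<And>x. (\<delta> has_real_derivative \<delta>' x) (at x)" "\<And>x. (\<delta>' has_real_derivative \<delta>'' x) (at x)"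
    and lip: "\<And>f s t. f \<in> {g, \<delta>, g', \<delta>', g'', \<delta>''} \<Longrightarrow> \<bar>f s - f t\<bar> \<le> L * \<bar>s - t\<bar>"
    and L: "1 \<le> L"
    and mono: "mono g" and nonconst: "\<not> g constant_on UNIV"
    and mdf: "markovian_decoupling_field M F W g \<delta> (\<lambda>s \<omega> x. u s x)"
    and u_lip: "\<And>s. s \<in> {0..1} \<Longrightarrow> Lu-lipschitz_on UNIV (u s)"
    and u_cont: "continuous_on ({0..1} \<times> UNIV) (\<lambda>(s, x). u s x)"
  obtains v B where "0 \<le> B"
    "\<And>s y t. s \<in> {0..1} \<Longrightarrow> ((\<lambda>t. u s (t, y)) has_real_derivative v s (t, y)) (at t)"
    "\<And>s. s \<in> {0..1} \<Longrightarrow> lip2 B (v s)"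
    "\<And>s t x. s \<in> {0..1} \<Longrightarrow> t \<in> {0..1} \<Longrightarrow> \<bar>v s x - v t x\<bar> \<le> B * \<bar>s - t\<bar>"
    "\<And>s x. s \<in> {0..<1} \<Longrightarrow> 0 < v s x"
proof -
  let ?D0 = "(\<lambda>x. g (fst x) - \<delta> (snd x), \<lambda>x. g' (fst x), \<lambda>x. - \<delta>' (snd x),
    \<lambda>x. g'' (fst x), \<lambda>x. 0, \<lambda>x. - \<delta>'' (snd x))"
  have L3: "L \<le> 32 * L ^ 3" using L power_increasing[of 1 3 L] by simp
  have "regular L (32 * L ^ 3) L ?D0" by (rule regular_terminal[OF d lip]) (use L L3 in auto)
  then obtain C n0 where C: "0 < C" and sch: "\<And>n. n0 \<le> n \<Longrightarrow> \<exists>S. S 0 = ?D0 \<and>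
       (\<forall>j\<le>n. regular L C C (S j)) \<and> (\<forall>j<n. linked L C (1 / sqrt (real n)) (S j) (S (Suc j)))"
    by (rule binomial_scheme[OF _ L order_refl]) (use L in auto)
  define R where "R = 1 + L + \<bar>Lu\<bar> + C + C * (2 * L\<^sup>2 + 1)"
  have "0 \<le> C * (2 * L\<^sup>2 + 1)" using C by simp
  then have R: "1 \<le> R" "L \<le> R" "Lu \<le> R" "C \<le> R" "C * (2 * L\<^sup>2 + 1) \<le> R" "0 \<le> C"
    using L C unfolding R_def by linarith+
  obtain n2 :: nat where n2: "88 * R ^ 8 \<le> real n2" by (meson real_arch_simple)
  define n1 where "n1 = n0 + n2 + 1"
  define T where "T n S \<longleftrightarrow> S 0 = ?D0 \<and>
       (\<forall>j\<le>n. regular L C C (S j)) \<and> (\<forall>j<n. linked L C (1 / sqrt (real n)) (S j) (S (Suc j)))" for n S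
  define S where "S n = (SOME S. T n S)" for n
  have S: "T n (S n)" if "n1 \<le> n" for n
  proof -
    have "n0 \<le> n" using that unfolding n1_def by simp
    from sch[OF this] show ?thesis unfolding S_def T_def by (rule someI_ex)
  qed
  have S0: "S n 0 = ?D0" and good: "\<And>j. j \<le> n \<Longrightarrow> regular L C C (S n j)"
    and linked: "\<And>j. j < n \<Longrightarrow> linked L C (1 / sqrt (real n)) (S n j) (S n (Suc j))" if "n1 \<le> n" for n
    using S[OF that] unfolding T_def by blast+
  have u_lim: "(\<lambda>n. fst (S n (grid_step n s)) x) \<longlonglongrightarrow> u s x" if s: "s \<in> {0..1}" for s x
  proof -
    let ?\<tau> = "\<lambda>n. 1 - real (grid_step n s) / real n"
    have err: "(fst (S n (grid_step n s)) x - u (?\<tau> n) x)\<^sup>2 \<le> exp (88 * R ^ 8) / real n" if "n1 \<le> n" for n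
    proof (rule scheme_error[OF bb mdf u_lip _ _ R S0[OF that] good[OF that] linked[OF that] grid_step_le])
      show "0 < n" "88 * R ^ 8 \<le> real n" using that n2 unfolding n1_def by linarith+
    qed
    have "(\<lambda>n. (fst (S n (grid_step n s)) x - u (?\<tau> n) x)\<^sup>2) \<longlonglongrightarrow> 0"
    proof (rule tendsto_sandwich[where f="\<lambda>_. 0" and h="\<lambda>n. exp (88 * R ^ 8) / real n"])
      show "\<forall>\<^sub>F n in sequentially. (fst (S n (grid_step n s)) x - u (?\<tau> n) x)\<^sup>2 \<le> exp (88 * R ^ 8) / real n"
        using err by (rule eventually_sequentiallyI)
      show "(\<lambda>n. exp (88 * R ^ 8) / real n) \<longlonglongrightarrow> 0"
        by (rule tendsto_divide_0[OF tendsto_const]) (rule filterlim_at_top_imp_at_infinity[OF filterlim_real_sequentially])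
    qed auto
    from tendsto_real_sqrt[OF this]
    have 1: "(\<lambda>n. fst (S n (grid_step n s)) x - u (?\<tau> n) x) \<longlonglongrightarrow> 0"
      by (simp add: tendsto_rabs_zero_iff)
    \<comment> \<open>The error estimate holds at the grid time below \<open>s\<close>; joint
      continuity of \<open>u\<close> carries it to \<open>s\<close> itself.\<close>
    have "(\<lambda>n. (\<lambda>(s, x). u s x) (?\<tau> n, x)) \<longlonglongrightarrow> (\<lambda>(s, x). u s x) (s, x)"
    proof (rule continuous_on_tendsto_compose[OF u_cont tendsto_Pair[OF grid_step_tendsto[OF s] tendsto_const]])
      show "\<forall>\<^sub>F n in sequentially. (?\<tau> n, x) \<in> {0..1} \<times> UNIV"
        using grid_step_time(1)[OF s] by (intro eventually_sequentiallyI[of 1]) simp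
    qed (use s in simp)
    then have "(\<lambda>n. u (?\<tau> n) x) \<longlonglongrightarrow> u s x" by simp
    from tendsto_add[OF 1 this] show ?thesis by simp
  qed
  define v where "v = (\<lambda>s x. lim (\<lambda>n. fst (snd (S n (grid_step n s))) x))"
  have v_lim: "(\<lambda>n. fst (snd (S n (grid_step n s))) x) \<longlonglongrightarrow> v s x"
    and v_deriv: "((\<lambda>t. u s (t, y)) has_real_derivative v s (t, y)) (at t)"
    and v_lip: "lip2 R (v s)" if "s \<in> {0..1}" for s x y t
    unfolding v_def
    by (rule scheme_derivative_limit[where S=S and s=s and u="u s", OF good R(6,5) u_lim[OF that]]; assumption)+
  have "\<exists>x0. g' x0 \<noteq> 0"
  proof (rule ccontr)
    assume "\<nexists>x0. g' x0 \<noteq> 0"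
    then have "g x = g 0" for x using DERIV_isconst_all[of g x 0] d(1) by simp
    then show False using nonconst unfolding constant_on_def by blast
  qed
  moreover have g'0: "0 \<le> g' t" for t by (rule mono_deriv_nonneg[OF mono d(1)])
  ultimately obtain x0 where x0: "0 < g' x0" by (metis less_eq_real_def)
  show ?thesis
  proof (rule that[of R v])
    show "\<bar>v s x - v t x\<bar> \<le> R * \<bar>s - t\<bar>" if "s \<in> {0..1}" "t \<in> {0..1}" for s t x
      by (rule order_trans[OF scheme_limit_time[where S=S and v="\<lambda>s. v s x", OF linked v_lim that]])
        (use R in \<open>auto intro: mult_right_mono\<close>)
    show "0 < v s x" if "s \<in> {0..<1}" for s x
    proof (rule scheme_limit_positive[where S=S and h=g' and ?x0.0=x0, OF linked _ g'0 x0 lip _ that v_lim])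
      show "fst (snd (S n 0)) x = g' (fst x)" if "n1 \<le> n" for n x using S0[OF that] by simp
    qed (use L that in auto)
  qed (use R v_deriv v_lip in simp_all)
qed

theorem theorem4p10:
  fixes M :: "'a measure" and F :: "real \<Rightarrow> 'a measure" and W :: "real \<Rightarrow> 'a \<Rightarrow> real"
    and g g' g'' \<delta> \<delta>' \<delta>'' :: "real \<Rightarrow> real"
    and u :: "real \<Rightarrow> real \<times> real \<Rightarrow> real"
  assumes "brownian_basis M F W"
    and "\<And>x. (g has_real_derivative g' x) (at x)"
    and "\<And>x. (g' has_real_derivative g'' x) (at x)"
    and "\<And>x. (\<delta> has_real_derivative \<delta>' x) (at x)"
    and "\<And>x. (\<delta>' has_real_derivative \<delta>'' x) (at x)"
    and "\<And>f. f \<in> {g, \<delta>, g', \<delta>', g'', \<delta>''} \<Longrightarrow> \<exists>L. L-lipschitz_on UNIV f"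
    and "mono g"
    and "\<not> g constant_on UNIV"
    and "markovian_decoupling_field M F W g \<delta> (\<lambda>s \<omega> x. u s x)"
    and "weakly_regular M (\<lambda>s \<omega> x. u s x)"
    and "continuous_on ({0..1} \<times> UNIV) (\<lambda>(s, x). u s x)"
  shows "\<exists>v :: real \<Rightarrow> real \<times> real \<Rightarrow> real.
    (\<forall>s\<in>{0..<1}. has_weak_partial (u s) (1, 0) (v s)) \<and>
    (\<forall>s\<in>{0..<1}. \<forall>x. v s x \<noteq> 0) \<and>
    (\<forall>K. compact K \<and> K \<subseteq> {0..<1} \<times> (UNIV :: (real \<times> real) set) \<longrightarrow>
      (\<exists>L. \<forall>x2. L-lipschitz_on {(s, x1). (s, x1, x2) \<in> K} (\<lambda>(s, x1). v s (x1, x2))))"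
proof -
  interpret brownian_basis M F W by fact
  define I where "I = {g, \<delta>, g', \<delta>', g'', \<delta>''}"
  have "\<forall>f\<in>I. \<exists>K. K-lipschitz_on UNIV f" using assms(6) unfolding I_def by blast
  then obtain \<Lambda> where \<Lambda>: "\<forall>f\<in>I. (\<Lambda> f)-lipschitz_on UNIV f" using bchoice by meson
  \<comment> \<open>One constant for all six functions; the summand \<open>1\<close> provides
    \<open>1 \<le> L\<close>, which the scheme requires.\<close>
  define L where "L = 1 + (\<Sum>f\<in>I. \<Lambda> f)"
  have nn: "0 \<le> \<Lambda> f" if "f \<in> I" for f
    using \<Lambda> that by (auto dest: lipschitz_on_nonneg)
  have finI: "finite I" unfolding I_def by simp
  have L: "1 \<le> L" unfolding L_def using nn by (simp add: sum_nonneg)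
  have lip: "\<bar>f s - f t\<bar> \<le> L * \<bar>s - t\<bar>" if "f \<in> {g, \<delta>, g', \<delta>', g'', \<delta>''}" for f s t
  proof -
    have f: "f \<in> I" using that unfolding I_def .
    have "\<Lambda> f \<le> L" using member_le_sum[OF f _ finI, of \<Lambda>] nn unfolding L_def by fastforce
    then have "\<Lambda> f * \<bar>s - t\<bar> \<le> L * \<bar>s - t\<bar>" by (rule mult_right_mono) simp
    moreover have "\<bar>f s - f t\<bar> \<le> \<Lambda> f * \<bar>s - t\<bar>"
      using lipschitz_onD[of "\<Lambda> f" UNIV f s t] \<Lambda> f by (simp add: dist_real_def)
    ultimately show ?thesis by linarith
  qed
  from assms(10) obtain Lu where "\<forall>s\<in>{0..1}. AE \<omega> in M. Lu-lipschitz_on UNIV (u s)"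
    unfolding weakly_regular_def by blast
  \<comment> \<open>The field is deterministic, so the almost sure statement is about a fixed
    proposition and holds outright on a probability space.\<close>
  then have u_lip: "\<And>s. s \<in> {0..1} \<Longrightarrow> Lu-lipschitz_on UNIV (u s)" by simp
  from decoupling_field_derivative[OF assms(1-5) lip L assms(7-9) u_lip assms(11)]
  obtain v B where B: "0 \<le> B"
    and dv: "\<And>s y t. s \<in> {0..1} \<Longrightarrow> ((\<lambda>t. u s (t, y)) has_real_derivative v s (t, y)) (at t)"
    and vx: "\<And>s. s \<in> {0..1} \<Longrightarrow> lip2 B (v s)"
    and vt: "\<And>s t x. s \<in> {0..1} \<Longrightarrow> t \<in> {0..1} \<Longrightarrow> \<bar>v s x - v t x\<bar> \<le> B * \<bar>s - t\<bar>"
    and pos: "\<And>s x. s \<in> {0..<1} \<Longrightarrow> 0 < v s x"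
    by metis
  show ?thesis
  proof (intro exI[of _ v] conjI ballI allI impI)
    fix s :: real assume s: "s \<in> {0..<1}"
    then have s': "s \<in> {0..1}" by simp
    show "has_weak_partial (u s) (1, 0) (v s)"
      by (rule has_weak_partial_continuous[OF lipschitz_on_continuous_on[OF u_lip[OF s']]
          lip2_continuous[OF vx[OF s']] dv[OF s']])
    show "v s x \<noteq> 0" for x using pos[OF s, of x] by simp
  next
    fix K :: "(real \<times> real \<times> real) set"
    assume K: "compact K \<and> K \<subseteq> {0..<1} \<times> (UNIV :: (real \<times> real) set)"
    \<comment> \<open>\<open>2 B\<close> arises from moving first in time and then in
      \<open>x1\<close>, each at cost \<open>B\<close> times the Euclidean distance; it serves all
      \<open>K\<close> and all \<open>x2\<close> at once.\<close>
    show "\<exists>L. \<forall>x2. L-lipschitz_on {(s, x1). (s, x1, x2) \<in> K} (\<lambda>(s, x1). v s (x1, x2))"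
    proof (intro exI[of _ "2 * B"] allI lipschitz_onI)
      fix x2 :: real and a b :: "real \<times> real"
      assume a: "a \<in> {(s, x1). (s, x1, x2) \<in> K}" and b: "b \<in> {(s, x1). (s, x1, x2) \<in> K}"
      have s: "fst a \<in> {0..1}" "fst b \<in> {0..1}" using a b K by force+
      have "\<bar>v (fst a) (snd a, x2) - v (fst b) (snd a, x2)\<bar> \<le> B * \<bar>fst a - fst b\<bar>" by (rule vt[OF s])
      moreover have "B * \<bar>fst a - fst b\<bar> \<le> B * dist a b"
        using dist_fst_le[of a b] B by (intro mult_left_mono) (simp_all add: dist_real_def)
      moreover have "\<bar>v (fst b) (snd a, x2) - v (fst b) (snd b, x2)\<bar> \<le> B * \<bar>snd a - snd b\<bar>"
        using lip2D[OF vx[OF s(2)], of "(snd a, x2)" "(snd b, x2)"] by simp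
      moreover have "B * \<bar>snd a - snd b\<bar> \<le> B * dist a b"
        using dist_snd_le[of a b] B by (intro mult_left_mono) (simp_all add: dist_real_def)
      ultimately have "\<bar>v (fst a) (snd a, x2) - v (fst b) (snd b, x2)\<bar> \<le> 2 * B * dist a b" by linarith
      then show "dist ((\<lambda>(s, x1). v s (x1, x2)) a) ((\<lambda>(s, x1). v s (x1, x2)) b) \<le> 2 * B * dist a b"
        by (simp add: dist_real_def case_prod_beta')
    qed (use B in simp)
  qed
qed

end
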